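(* Let $R$ be a hereditary Noetherian integral domain and $R[\varepsilon]=R[T]/(T^2)$. There is an equivalence of categories between the orbit category $D^b(\operatorname{mod}R)/[1]$ and the stable category $\underline{\operatorname{sub}}(R[\varepsilon])$.
   Context: All modules are finitely generated right modules. $D^b(\operatorname{mod}R)$ is the bounded derived category of finitely generated $R$-modules, with shift $[1]$. The orbit category $\mathcal T/[1]$ of a category $\mathcal T$ with shift $[1]$ has the same objects as $\mathcal T$ and $\operatorname{Hom}_{\mathcal T/[1]}(X,Y)=\bigoplus_{i\in\mathbb Z}\operatorname{Hom}_{\mathcal T}(X,Y[i])$, with composition of $f:X\to Y[i]$ and $g:Y\to Z[k]$ given by $g[i]\circ f$. $\operatorname{sub}(R[\varepsilon])$ is the full subcategory of $\operatorname{mod}R[\varepsilon]$ of torsionless modules, i.e. modules (isomorphic to) submodules of $R[\varepsilon]^n$ for some $n$. $\underline{\operatorname{sub}}(R[\varepsilon])$ has the same objects, and morphism groups the quotients by the morphisms factoring through a finitely generated projective $R[\varepsilon]$-module. *)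

theory Defs
  imports "HOL-Algebra.UnivPoly" "HOL-Algebra.QuotRing" "HOL-Library.Equipollence"
begin

section \<open>Categories\<close>

text \<open>
  Hom sets are indexed by source and target and need not be disjoint; composition therefore takes
  the three objects as arguments: for \<open>f : X \<rightarrow> Y\<close> and \<open>g : Y \<rightarrow> Z\<close>, \<open>cmp C X Y Z g f\<close> is
  \<open>g \<circ> f : X \<rightarrow> Z\<close>.
\<close>

record ('o, 'm) cat =
  Obj :: "'o set"
  Hom :: "'o \<Rightarrow> 'o \<Rightarrow> 'm set"
  idn :: "'o \<Rightarrow> 'm"
  cmp :: "'o \<Rightarrow> 'o \<Rightarrow> 'o \<Rightarrow> 'm \<Rightarrow> 'm \<Rightarrow> 'm"

record ('o, 'm) preadd_cat = "('o, 'm) cat" +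
  hadd :: "'o \<Rightarrow> 'o \<Rightarrow> 'm \<Rightarrow> 'm \<Rightarrow> 'm"
  hzero :: "'o \<Rightarrow> 'o \<Rightarrow> 'm"

definition is_category :: "('o, 'm, 'x) cat_scheme \<Rightarrow> bool" where
  "is_category C \<longleftrightarrow>
     (\<forall>X\<in>Obj C. idn C X \<in> Hom C X X) \<and>
     (\<forall>X\<in>Obj C. \<forall>Y\<in>Obj C. \<forall>Z\<in>Obj C. \<forall>f\<in>Hom C X Y. \<forall>g\<in>Hom C Y Z.
        cmp C X Y Z g f \<in> Hom C X Z) \<and>
     (\<forall>X\<in>Obj C. \<forall>Y\<in>Obj C. \<forall>f\<in>Hom C X Y.
        cmp C X X Y f (idn C X) = f \<and> cmp C X Y Y (idn C Y) f = f) \<and>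
     (\<forall>W\<in>Obj C. \<forall>X\<in>Obj C. \<forall>Y\<in>Obj C. \<forall>Z\<in>Obj C.
        \<forall>f\<in>Hom C W X. \<forall>g\<in>Hom C X Y. \<forall>h\<in>Hom C Y Z.
        cmp C W X Z (cmp C X Y Z h g) f = cmp C W Y Z h (cmp C W X Y g f))"

definition is_functor ::
  "('o, 'm, 'x) cat_scheme \<Rightarrow> ('p, 'n, 'y) cat_scheme \<Rightarrow> ('o \<Rightarrow> 'p) \<Rightarrow> ('o \<Rightarrow> 'o \<Rightarrow> 'm \<Rightarrow> 'n) \<Rightarrow> bool"
where
  "is_functor C D F0 F1 \<longleftrightarrow>
     (\<forall>X\<in>Obj C. F0 X \<in> Obj D) \<and>
     (\<forall>X\<in>Obj C. \<forall>Y\<in>Obj C. \<forall>f\<in>Hom C X Y. F1 X Y f \<in> Hom D (F0 X) (F0 Y)) \<and>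
     (\<forall>X\<in>Obj C. F1 X X (idn C X) = idn D (F0 X)) \<and>
     (\<forall>X\<in>Obj C. \<forall>Y\<in>Obj C. \<forall>Z\<in>Obj C. \<forall>f\<in>Hom C X Y. \<forall>g\<in>Hom C Y Z.
        F1 X Z (cmp C X Y Z g f) = cmp D (F0 X) (F0 Y) (F0 Z) (F1 Y Z g) (F1 X Y f))"

definition is_isomorphism :: "('o, 'm, 'x) cat_scheme \<Rightarrow> 'o \<Rightarrow> 'o \<Rightarrow> 'm \<Rightarrow> bool" where
  "is_isomorphism C X Y f \<longleftrightarrow> f \<in> Hom C X Y \<and>
     (\<exists>g\<in>Hom C Y X. cmp C X Y X g f = idn C X \<and> cmp C Y X Y f g = idn C Y)"

definition is_natural_iso ::
  "('o, 'm, 'x) cat_scheme \<Rightarrow> ('p, 'n, 'y) cat_scheme \<Rightarrow>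
   ('o \<Rightarrow> 'p) \<Rightarrow> ('o \<Rightarrow> 'o \<Rightarrow> 'm \<Rightarrow> 'n) \<Rightarrow> ('o \<Rightarrow> 'p) \<Rightarrow> ('o \<Rightarrow> 'o \<Rightarrow> 'm \<Rightarrow> 'n) \<Rightarrow> ('o \<Rightarrow> 'n) \<Rightarrow> bool"
where
  "is_natural_iso C D F0 F1 G0 G1 \<eta> \<longleftrightarrow>
     (\<forall>X\<in>Obj C. is_isomorphism D (F0 X) (G0 X) (\<eta> X)) \<and>
     (\<forall>X\<in>Obj C. \<forall>Y\<in>Obj C. \<forall>f\<in>Hom C X Y.
        cmp D (F0 X) (F0 Y) (G0 Y) (\<eta> Y) (F1 X Y f) =
        cmp D (F0 X) (G0 X) (G0 Y) (G1 X Y f) (\<eta> X))"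

definition equivalent_categories ::
  "('o, 'm, 'x) cat_scheme \<Rightarrow> ('p, 'n, 'y) cat_scheme \<Rightarrow> bool"
where
  "equivalent_categories C D \<longleftrightarrow> is_category C \<and> is_category D \<and>
     (\<exists>F0 F1 G0 G1 \<eta> \<theta>. is_functor C D F0 F1 \<and> is_functor D C G0 G1 \<and>
        is_natural_iso C C (\<lambda>X. X) (\<lambda>X Y f. f)
          (\<lambda>X. G0 (F0 X)) (\<lambda>X Y f. G1 (F0 X) (F0 Y) (F1 X Y f)) \<eta> \<and>
        is_natural_iso D D (\<lambda>X. F0 (G0 X)) (\<lambda>X Y f. F1 (G0 X) (G0 Y) (G1 X Y f))
          (\<lambda>X. X) (\<lambda>X Y f. f) \<theta>)"

definition hom_group :: "('o, 'm, 'x) preadd_cat_scheme \<Rightarrow> 'o \<Rightarrow> 'o \<Rightarrow> 'm monoid" where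
  "hom_group C X Y = \<lparr>carrier = Hom C X Y, monoid.mult = hadd C X Y, one = hzero C X Y\<rparr>"


subsection \<open>Quotient by an ideal of morphisms\<close>

definition ideal_rel ::
  "('o, 'm, 'x) preadd_cat_scheme \<Rightarrow> ('o \<Rightarrow> 'o \<Rightarrow> 'm set) \<Rightarrow> 'o \<Rightarrow> 'o \<Rightarrow> ('m \<times> 'm) set"
where
  "ideal_rel C J X Y =
     {(f, g). f \<in> Hom C X Y \<and> g \<in> Hom C X Y \<and> (\<exists>j\<in>J X Y. f = hadd C X Y g j)}"

definition quotient_cat ::
  "('o, 'm, 'x) preadd_cat_scheme \<Rightarrow> ('o \<Rightarrow> 'o \<Rightarrow> 'm set) \<Rightarrow> ('o, 'm set) preadd_cat"
where
  "quotient_cat C J = \<lparr>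
     Obj = Obj C,
     Hom = (\<lambda>X Y. Hom C X Y // ideal_rel C J X Y),
     idn = (\<lambda>X. ideal_rel C J X X `` {idn C X}),
     cmp = (\<lambda>X Y Z \<psi> \<phi>. \<Union>g\<in>\<psi>. \<Union>f\<in>\<phi>. ideal_rel C J X Z `` {cmp C X Y Z g f}),
     hadd = (\<lambda>X Y \<phi> \<psi>. \<Union>f\<in>\<phi>. \<Union>g\<in>\<psi>. ideal_rel C J X Y `` {hadd C X Y f g}),
     hzero = (\<lambda>X Y. ideal_rel C J X Y `` {hzero C X Y})\<rparr>"

definition factoring_through ::
  "('o, 'm, 'x) cat_scheme \<Rightarrow> 'o set \<Rightarrow> 'o \<Rightarrow> 'o \<Rightarrow> 'm set"
where
  "factoring_through C \<P> X Y =
     {cmp C X P Y k h | P h k. P \<in> \<P> \<and> h \<in> Hom C X P \<and> k \<in> Hom C P Y}"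


subsection \<open>Localisation by fractions\<close>

text \<open>
  A roof \<open>(A, s, f)\<close> from \<open>X\<close> to \<open>Y\<close> is a diagram \<open>X \<leftarrow> A \<rightarrow> Y\<close> with \<open>s : A \<rightarrow> X\<close> in \<open>W\<close> and
  \<open>f : A \<rightarrow> Y\<close>; it stands for \<open>f \<circ> s\<^sup>-\<^sup>1\<close>.
\<close>

definition roofs ::
  "('o, 'm, 'x) cat_scheme \<Rightarrow> ('o \<Rightarrow> 'o \<Rightarrow> 'm set) \<Rightarrow> 'o \<Rightarrow> 'o \<Rightarrow> ('o \<times> 'm \<times> 'm) set"
where
  "roofs C W X Y = {(A, s, f). A \<in> Obj C \<and> s \<in> W A X \<and> f \<in> Hom C A Y}"

definition roof_rel ::
  "('o, 'm, 'x) cat_scheme \<Rightarrow> ('o \<Rightarrow> 'o \<Rightarrow> 'm set) \<Rightarrow> 'o \<Rightarrow> 'o \<Rightarrow>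
   (('o \<times> 'm \<times> 'm) \<times> ('o \<times> 'm \<times> 'm)) set"
where
  "roof_rel C W X Y =
     {((A, s, f), (B, t, g)). (A, s, f) \<in> roofs C W X Y \<and> (B, t, g) \<in> roofs C W X Y \<and>
        (\<exists>E\<in>Obj C. \<exists>u\<in>Hom C E A. \<exists>v\<in>Hom C E B.
           cmp C E A X s u = cmp C E B X t v \<and> cmp C E A X s u \<in> W E X \<and>
           cmp C E A Y f u = cmp C E B Y g v)}"

text \<open>
  Composition completes \<open>A \<rightarrow> Y \<leftarrow> B\<close> to a commutative square with \<open>t' : E \<rightarrow> A\<close> in \<open>W\<close>, and addition
  uses representatives with a common denominator; the unions are over all possible choices, which
  all give the same class when \<open>W\<close> admits a calculus of fractions.
\<close>

definition localisation ::
  "('o, 'm, 'x) preadd_cat_scheme \<Rightarrow> ('o \<Rightarrow> 'o \<Rightarrow> 'm set) \<Rightarrow>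
   ('o, ('o \<times> 'm \<times> 'm) set) preadd_cat"
where
  "localisation C W = \<lparr>
     Obj = Obj C,
     Hom = (\<lambda>X Y. roofs C W X Y // roof_rel C W X Y),
     idn = (\<lambda>X. roof_rel C W X X `` {(X, idn C X, idn C X)}),
     cmp = (\<lambda>X Y Z \<psi> \<phi>.
       \<Union>{roof_rel C W X Z `` {(E, cmp C E A X s t', cmp C E B Z g f')} | A s f B t g E t' f'.
           (A, s, f) \<in> \<phi> \<and> (B, t, g) \<in> \<psi> \<and> E \<in> Obj C \<and> t' \<in> W E A \<and> f' \<in> Hom C E B \<and>
           cmp C E A Y f t' = cmp C E B Y t f'}),
     hadd = (\<lambda>X Y \<phi> \<psi>.
       \<Union>{roof_rel C W X Y `` {(A, s, hadd C A Y f g)} | A s f g.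
           (A, s, f) \<in> \<phi> \<and> (A, s, g) \<in> \<psi>}),
     hzero = (\<lambda>X Y. roof_rel C W X Y `` {(X, idn C X, hzero C X Y)})\<rparr>"


subsection \<open>Orbit categories\<close>

text \<open>
  \<open>S0 i X\<close> is \<open>X[i]\<close> and \<open>S1 i f\<close> is \<open>f[i]\<close>. An element of the direct sum of the groups
  \<open>Hom(X, Y[i])\<close> is a finitely supported family indexed by \<open>i\<close>; the component in degree \<open>n\<close> of the
  composite of \<open>\<phi>\<close> and \<open>\<psi>\<close> is the sum of all \<open>\<psi>\<^sub>k[i] \<circ> \<phi>\<^sub>i\<close> with \<open>i + k = n\<close>.
\<close>

definition orbit_support ::
  "('o, 'm, 'x) preadd_cat_scheme \<Rightarrow> (int \<Rightarrow> 'o \<Rightarrow> 'o) \<Rightarrow> 'o \<Rightarrow> 'o \<Rightarrow> (int \<Rightarrow> 'm) \<Rightarrow> int set"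
where
  "orbit_support C S0 X Y \<phi> = {i. \<phi> i \<noteq> hzero C X (S0 i Y)}"

definition orbit_cat ::
  "('o, 'm, 'x) preadd_cat_scheme \<Rightarrow> (int \<Rightarrow> 'o \<Rightarrow> 'o) \<Rightarrow> (int \<Rightarrow> 'm \<Rightarrow> 'm) \<Rightarrow> ('o, int \<Rightarrow> 'm) cat"
where
  "orbit_cat C S0 S1 = \<lparr>
     Obj = Obj C,
     Hom = (\<lambda>X Y. {\<phi>. (\<forall>i. \<phi> i \<in> Hom C X (S0 i Y)) \<and> finite (orbit_support C S0 X Y \<phi>)}),
     idn = (\<lambda>X i. if i = 0 then idn C X else hzero C X (S0 i X)),
     cmp = (\<lambda>X Y Z \<psi> \<phi> n.
       finprod (hom_group C X (S0 n Z))
         (\<lambda>i. cmp C X (S0 i Y) (S0 n Z) (S1 i (\<psi> (n - i))) (\<phi> i))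
         (orbit_support C S0 X Y \<phi>))\<rparr>"


section \<open>Right modules\<close>

text \<open>
  The record of the library is reused with \<open>smult M a x\<close> read as the right action \<open>x a\<close>. The fields
  \<open>mult\<close> and \<open>one\<close> inherited from the ring record play no role.
\<close>

locale right_module = R?: ring R + M?: abelian_group M
  for R (structure) and M :: "('a, 'b, 'c) module_scheme" (structure) +
  assumes smult_closed:
      "\<lbrakk>a \<in> carrier R; x \<in> carrier M\<rbrakk> \<Longrightarrow> a \<odot>\<^bsub>M\<^esub> x \<in> carrier M"
    and smult_scalar_distr:
      "\<lbrakk>a \<in> carrier R; b \<in> carrier R; x \<in> carrier M\<rbrakk> \<Longrightarrow>
         (a \<oplus> b) \<odot>\<^bsub>M\<^esub> x = a \<odot>\<^bsub>M\<^esub> x \<oplus>\<^bsub>M\<^esub> b \<odot>\<^bsub>M\<^esub> x"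
    and smult_vector_distr:
      "\<lbrakk>a \<in> carrier R; x \<in> carrier M; y \<in> carrier M\<rbrakk> \<Longrightarrow>
         a \<odot>\<^bsub>M\<^esub> (x \<oplus>\<^bsub>M\<^esub> y) = a \<odot>\<^bsub>M\<^esub> x \<oplus>\<^bsub>M\<^esub> a \<odot>\<^bsub>M\<^esub> y"
    and smult_assoc:
      "\<lbrakk>a \<in> carrier R; b \<in> carrier R; x \<in> carrier M\<rbrakk> \<Longrightarrow>
         (a \<otimes> b) \<odot>\<^bsub>M\<^esub> x = b \<odot>\<^bsub>M\<^esub> (a \<odot>\<^bsub>M\<^esub> x)"
    and smult_one: "x \<in> carrier M \<Longrightarrow> \<one> \<odot>\<^bsub>M\<^esub> x = x"

text \<open>Homomorphisms are extensional, so that equality of morphisms is equality of functions.\<close>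

definition mod_hom ::
  "('a, 'r) ring_scheme \<Rightarrow> ('a, 'b, 'c) module_scheme \<Rightarrow> ('a, 'd, 'e) module_scheme \<Rightarrow> ('b \<Rightarrow> 'd) set"
where
  "mod_hom R M N = {f \<in> carrier M \<rightarrow>\<^sub>E carrier N.
     (\<forall>x\<in>carrier M. \<forall>y\<in>carrier M. f (x \<oplus>\<^bsub>M\<^esub> y) = f x \<oplus>\<^bsub>N\<^esub> f y) \<and>
     (\<forall>a\<in>carrier R. \<forall>x\<in>carrier M. f (a \<odot>\<^bsub>M\<^esub> x) = a \<odot>\<^bsub>N\<^esub> f x)}"

definition fin_gen :: "('a, 'r) ring_scheme \<Rightarrow> ('a, 'b, 'c) module_scheme \<Rightarrow> bool" where
  "fin_gen R M \<longleftrightarrow> (\<exists>A. finite A \<and> A \<subseteq> carrier M \<and>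
     (\<forall>x\<in>carrier M. \<exists>c\<in>A \<rightarrow> carrier R. x = (\<Oplus>\<^bsub>M\<^esub>a\<in>A. c a \<odot>\<^bsub>M\<^esub> a)))"

text \<open>The free right module of finitely supported families indexed by \<open>I\<close>.\<close>

definition free_module :: "('a, 'r) ring_scheme \<Rightarrow> 'i set \<Rightarrow> ('a, 'i \<Rightarrow> 'a) module" where
  "free_module R I = \<lparr>
     carrier = {v \<in> I \<rightarrow>\<^sub>E carrier R. finite {i \<in> I. v i \<noteq> \<zero>\<^bsub>R\<^esub>}},
     mult = undefined,
     one = undefined,
     zero = (\<lambda>i\<in>I. \<zero>\<^bsub>R\<^esub>),
     add = (\<lambda>v w. \<lambda>i\<in>I. v i \<oplus>\<^bsub>R\<^esub> w i),
     smult = (\<lambda>a v. \<lambda>i\<in>I. v i \<otimes>\<^bsub>R\<^esub> a)\<rparr>"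

text \<open>
  A module is projective if it is a direct summand (a retract) of a free module. Restricting the
  basis to a subset of the element type of \<open>P\<close> loses nothing: \<open>P\<close> is a quotient of the free module
  on \<open>carrier P\<close>.
\<close>

definition projective :: "('a, 'r) ring_scheme \<Rightarrow> ('a, 'b, 'c) module_scheme \<Rightarrow> bool" where
  "projective R P \<longleftrightarrow> right_module R P \<and>
     (\<exists>I :: 'b set. \<exists>i\<in>mod_hom R P (free_module R I). \<exists>p\<in>mod_hom R (free_module R I) P.
        \<forall>x\<in>carrier P. p (i x) = x)"

definition torsionless :: "('a, 'r) ring_scheme \<Rightarrow> ('a, 'b, 'c) module_scheme \<Rightarrow> bool" where
  "torsionless R M \<longleftrightarrow>
     (\<exists>n::nat. \<exists>f\<in>mod_hom R M (free_module R {..<n}). inj_on f (carrier M))"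


subsection \<open>Hereditary Noetherian domains\<close>

text \<open>Rings are not assumed commutative; being hereditary or Noetherian is two-sided.\<close>

definition opposite_ring :: "('a, 'r) ring_scheme \<Rightarrow> ('a, 'r) ring_scheme" where
  "opposite_ring R = R\<lparr>mult := (\<lambda>x y. y \<otimes>\<^bsub>R\<^esub> x)\<rparr>"

definition right_ideal :: "'a set \<Rightarrow> ('a, 'r) ring_scheme \<Rightarrow> bool" where
  "right_ideal I R \<longleftrightarrow> additive_subgroup I R \<and> (\<forall>x\<in>I. \<forall>a\<in>carrier R. x \<otimes>\<^bsub>R\<^esub> a \<in> I)"

definition right_ideal_module :: "('a, 'r) ring_scheme \<Rightarrow> 'a set \<Rightarrow> ('a, 'a) module" where
  "right_ideal_module R I = \<lparr>carrier = I, mult = mult R, one = \<one>\<^bsub>R\<^esub>, zero = \<zero>\<^bsub>R\<^esub>, add = add R,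
     smult = (\<lambda>a x. x \<otimes>\<^bsub>R\<^esub> a)\<rparr>"

definition right_noetherian :: "('a, 'r) ring_scheme \<Rightarrow> bool" where
  "right_noetherian R \<longleftrightarrow> (\<forall>I. right_ideal I R \<longrightarrow> fin_gen R (right_ideal_module R I))"

definition right_hereditary :: "('a, 'r) ring_scheme \<Rightarrow> bool" where
  "right_hereditary R \<longleftrightarrow> (\<forall>I. right_ideal I R \<longrightarrow> projective R (right_ideal_module R I))"

definition hereditary_noetherian_domain :: "('a, 'r) ring_scheme \<Rightarrow> bool" where
  "hereditary_noetherian_domain R \<longleftrightarrow>
     ring R \<and> \<one>\<^bsub>R\<^esub> \<noteq> \<zero>\<^bsub>R\<^esub> \<and>
     (\<forall>a\<in>carrier R. \<forall>b\<in>carrier R. a \<otimes>\<^bsub>R\<^esub> b = \<zero>\<^bsub>R\<^esub> \<longrightarrow> a = \<zero>\<^bsub>R\<^esub> \<or> b = \<zero>\<^bsub>R\<^esub>) \<and>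
     right_noetherian R \<and> right_noetherian (opposite_ring R) \<and>
     right_hereditary R \<and> right_hereditary (opposite_ring R)"

definition dual_numbers :: "('a, 'r) ring_scheme \<Rightarrow> (nat \<Rightarrow> 'a) set ring" where
  "dual_numbers R = UP R Quot (Idl\<^bsub>UP R\<^esub> {monom (UP R) \<one>\<^bsub>R\<^esub> 2})"


subsection \<open>Categories of finitely generated modules\<close>

text \<open>
  A category of modules consists of modules whose carrier is a subset of a fixed type \<open>'u\<close>. If \<open>'u\<close>
  is infinite and at least as large as \<open>R\<close>, every finitely generated module, with elements of
  any type, over \<open>R\<close> (or over the dual numbers of \<open>R\<close>) is isomorphic to one of these.
\<close>

definition large_universe :: "('a, 'r) ring_scheme \<Rightarrow> 'u itself \<Rightarrow> bool" where
  "large_universe R U \<longleftrightarrow> infinite (UNIV :: 'u set) \<and> (\<exists>\<iota> :: 'a \<Rightarrow> 'u. inj_on \<iota> (carrier R))"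

definition fg_modules :: "('a, 'r) ring_scheme \<Rightarrow> ('a, 'u) module set" where
  "fg_modules R = {M. right_module R M \<and> fin_gen R M}"

lemma PiE_lepoll_universe:
  assumes "large_universe R TYPE('u)" "finite A"
  shows "(A \<rightarrow>\<^sub>E carrier R) \<lesssim> (UNIV :: 'u set)"
proof -
  have inf: "infinite (UNIV :: 'u set)" and R: "carrier R \<lesssim> (UNIV :: 'u set)"
    using assms(1) by (auto simp: large_universe_def lepoll_def)
  show ?thesis
    using assms(2)
  proof induction
    case empty
    show ?case using inf by (auto simp: lepoll_def)
  next
    case (insert a A)
    have "(insert a A \<rightarrow>\<^sub>E carrier R) \<lesssim> carrier R \<times> (A \<rightarrow>\<^sub>E carrier R)"
      unfolding PiE_insert_eq by (rule image_lepoll)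
    also have "\<dots> \<lesssim> (UNIV :: 'u set) \<times> (UNIV :: 'u set)"
      by (rule times_lepoll_mono[OF R insert.IH])
    also have "\<dots> \<lesssim> (UNIV :: 'u set)"
      using card_of_Times_same_infinite[OF inf, THEN ordIso_imp_ordLeq]
      by (auto simp: lepoll_def simp flip: card_of_ordLeq)
    finally show ?case .
  qed
qed

lemma fin_gen_in_large_universe:
  fixes R :: "('a, 'r) ring_scheme" and M :: "('a, 'b, 'c) module_scheme"
  assumes "right_module R M" "fin_gen R M" "large_universe R TYPE('u)"
  shows "\<exists>N \<in> (fg_modules R :: ('a, 'u) module set). \<exists>f\<in>mod_hom R M N.
    bij_betw f (carrier M) (carrier N)"
proof -
  interpret right_module R M by fact
  obtain A where A: "finite A" "A \<subseteq> carrier M"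
    and gen: "\<And>x. x \<in> carrier M \<Longrightarrow> \<exists>c\<in>A \<rightarrow> carrier R. x = (\<Oplus>\<^bsub>M\<^esub>a\<in>A. c a \<odot>\<^bsub>M\<^esub> a)"
    using assms(2) unfolding fin_gen_def by blast
  let ?s = "\<lambda>c. \<Oplus>\<^bsub>M\<^esub>a\<in>A. c a \<odot>\<^bsub>M\<^esub> a"
  have "carrier M \<subseteq> ?s ` (A \<rightarrow>\<^sub>E carrier R)"
  proof
    fix x assume "x \<in> carrier M"
    then obtain c where c: "c \<in> A \<rightarrow> carrier R" "x = ?s c" using gen by blast
    have "?s c = ?s (restrict c A)"
      using c(1) A by (intro M.finsum_cong') (auto intro!: smult_closed)
    moreover have "restrict c A \<in> A \<rightarrow>\<^sub>E carrier R" using c(1) by auto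
    ultimately show "x \<in> ?s ` (A \<rightarrow>\<^sub>E carrier R)" using c(2) by blast
  qed
  then have "carrier M \<lesssim> (A \<rightarrow>\<^sub>E carrier R)"
    by (meson image_lepoll lepoll_trans subset_imp_lepoll)
  also have "(A \<rightarrow>\<^sub>E carrier R) \<lesssim> (UNIV :: 'u set)"
    by (rule PiE_lepoll_universe[OF assms(3) A(1)])
  finally obtain g :: "'b \<Rightarrow> 'u" where g: "inj_on g (carrier M)"
    by (auto simp: lepoll_def)
  define h where "h = inv_into (carrier M) g"
  have hg: "h (g x) = x" if "x \<in> carrier M" for x
    using that g by (simp add: h_def)
  define N :: "('a, 'u) module" where "N = \<lparr>carrier = g ` carrier M, mult = undefined,
    one = undefined, zero = g \<zero>\<^bsub>M\<^esub>, add = (\<lambda>u v. g (h u \<oplus>\<^bsub>M\<^esub> h v)),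
    smult = (\<lambda>a u. g (a \<odot>\<^bsub>M\<^esub> h u))\<rparr>"
  have "abelian_group N"
  proof (rule abelian_groupI)
    fix u assume "u \<in> carrier N"
    then obtain x where x: "x \<in> carrier M" "u = g x" by (auto simp: N_def)
    then show "\<exists>v\<in>carrier N. v \<oplus>\<^bsub>N\<^esub> u = \<zero>\<^bsub>N\<^esub>"
      by (intro bexI[of _ "g (\<ominus>\<^bsub>M\<^esub> x)"]) (auto simp: N_def hg M.l_neg)
  qed (auto simp: N_def hg M.a_ac)
  then interpret N: abelian_group N .
  have N: "right_module R N"
    by unfold_locales
      (auto simp: N_def hg smult_closed smult_scalar_distr smult_vector_distr smult_assoc smult_one)
  interpret N: right_module R N by fact
  have gN: "g x \<in> carrier N" if "x \<in> carrier M" for x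
    using that by (simp add: N_def)
  have gadd: "g (x \<oplus>\<^bsub>M\<^esub> y) = g x \<oplus>\<^bsub>N\<^esub> g y" if "x \<in> carrier M" "y \<in> carrier M" for x y
    using that by (simp add: N_def hg)
  have gsmult: "g (a \<odot>\<^bsub>M\<^esub> x) = a \<odot>\<^bsub>N\<^esub> g x" if "x \<in> carrier M" for a x
    using that by (simp add: N_def hg)
  have gzero: "g \<zero>\<^bsub>M\<^esub> = \<zero>\<^bsub>N\<^esub>" by (simp add: N_def)
  have gsum: "g (\<Oplus>\<^bsub>M\<^esub>a\<in>B. k a) = (\<Oplus>\<^bsub>N\<^esub>a\<in>B. g (k a))"
    if "finite B" "k \<in> B \<rightarrow> carrier M" for B and k :: "'b \<Rightarrow> 'b"
    using that
  proof induction
    case (insert a B)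
    then have "k \<in> B \<rightarrow> carrier M" "k a \<in> carrier M" "(\<lambda>a. g (k a)) \<in> B \<rightarrow> carrier N"
      by (auto intro: gN)
    with insert show ?case
      by (simp add: gadd gN)
  qed (simp add: gzero)
  have "fin_gen R N"
    unfolding fin_gen_def
  proof (intro exI[of _ "g ` A"] conjI ballI)
    fix u assume "u \<in> carrier N"
    then obtain x where x: "x \<in> carrier M" "u = g x" by (auto simp: N_def)
    then obtain c where c: "c \<in> A \<rightarrow> carrier R" "x = ?s c" using gen by blast
    have gA: "inj_on g A" using g A(2) by (rule inj_on_subset)
    have cl: "a \<in> A \<Longrightarrow> a \<in> carrier M \<and> c a \<in> carrier R" for a using A c(1) by auto
    have "u = (\<Oplus>\<^bsub>N\<^esub>a\<in>A. g (c a \<odot>\<^bsub>M\<^esub> a))"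
      unfolding x(2) c(2) by (rule gsum) (use A cl in \<open>auto intro!: smult_closed\<close>)
    also have "\<dots> = (\<Oplus>\<^bsub>N\<^esub>a\<in>A. c (h (g a)) \<odot>\<^bsub>N\<^esub> g a)"
      by (intro N.finsum_cong') (use cl in \<open>auto simp: gsmult hg gN intro!: N.smult_closed\<close>)
    also have "\<dots> = (\<Oplus>\<^bsub>N\<^esub>b\<in>g ` A. c (h b) \<odot>\<^bsub>N\<^esub> b)"
      by (rule N.finsum_reindex[symmetric, OF _ gA])
        (use cl in \<open>auto simp: hg gN intro!: N.smult_closed\<close>)
    finally show "\<exists>c\<in>g ` A \<rightarrow> carrier R. u = (\<Oplus>\<^bsub>N\<^esub>b\<in>g ` A. c b \<odot>\<^bsub>N\<^esub> b)"
      using cl by (intro bexI[of _ "\<lambda>b. c (h b)"]) (auto simp: hg)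
  qed (use A in \<open>auto simp: N_def\<close>)
  then have "N \<in> fg_modules R" using N by (simp add: fg_modules_def)
  moreover have "restrict g (carrier M) \<in> mod_hom R M N"
    by (auto simp: mod_hom_def gN gadd gsmult smult_closed)
  moreover have "bij_betw (restrict g (carrier M)) (carrier M) (carrier N)"
    using g by (simp add: bij_betw_def N_def)
  ultimately show ?thesis by blast
qed

lemma large_universe_dual_numbers:
  fixes R :: "('a, 'r) ring_scheme"
  assumes "large_universe R TYPE('u)"
  shows "large_universe (dual_numbers R) TYPE('u)"
proof -
  have inf: "infinite (UNIV :: 'u set)" and R: "carrier R \<lesssim> (UNIV :: 'u set)"
    using assms by (auto simp: large_universe_def lepoll_def)
  have square: "(UNIV :: 'u set) \<times> (UNIV :: 'u set) \<lesssim> (UNIV :: 'u set)"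
    using card_of_Times_same_infinite[OF inf, THEN ordIso_imp_ordLeq]
    by (auto simp: lepoll_def simp flip: card_of_ordLeq)
  define B where "B n = {p \<in> up R. bound \<zero>\<^bsub>R\<^esub> n p}" for n
  have B: "B n \<lesssim> (UNIV :: 'u set)" for n
  proof -
    have "inj_on (\<lambda>p. restrict p {..n}) (B n)"
    proof (rule inj_onI, rule ext)
      fix p q m assume "p \<in> B n" "q \<in> B n" and eq: "restrict p {..n} = restrict q {..n}"
      then show "p m = q m"
        using fun_cong[OF eq, unfolded restrict_apply, of m]
        by (cases "m \<le> n") (simp_all add: B_def bound_def)
    qed
    moreover have "(\<lambda>p. restrict p {..n}) ` B n \<subseteq> ({..n} \<rightarrow>\<^sub>E carrier R)"
      by (auto simp: B_def up_def split: if_splits)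
    ultimately have "B n \<lesssim> ({..n} \<rightarrow>\<^sub>E carrier R)" unfolding lepoll_def by blast
    also have "({..n} \<rightarrow>\<^sub>E carrier R) \<lesssim> (UNIV :: 'u set)"
      by (rule PiE_lepoll_universe[OF assms]) simp
    finally show ?thesis .
  qed
  then obtain g :: "nat \<Rightarrow> (nat \<Rightarrow> 'a) \<Rightarrow> 'u" where g: "\<And>n. inj_on (g n) (B n)"
    unfolding lepoll_def by metis
  obtain e :: "nat \<Rightarrow> 'u" where e: "inj e"
    using inf by (auto simp: infinite_iff_countable_subset)
  define d where "d p = (LEAST n. bound \<zero>\<^bsub>R\<^esub> n p)" for p :: "nat \<Rightarrow> 'a"
  have d: "p \<in> B (d p)" if "p \<in> up R" for p
    using that LeastI_ex[of "\<lambda>n. bound \<zero>\<^bsub>R\<^esub> n p"] by (auto simp: d_def B_def up_def)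
  have "inj_on (\<lambda>p. (e (d p), g (d p) p)) (up R)"
    by (rule inj_onI) (metis Pair_inject d e g inj_eq inj_onD)
  then have "up R \<lesssim> (UNIV :: 'u set) \<times> (UNIV :: 'u set)"
    unfolding lepoll_def by auto
  then have "carrier (UP R) \<lesssim> (UNIV :: 'u set)"
    using lepoll_trans[OF _ square] by (simp add: UP_def)
  moreover have "carrier (dual_numbers R) \<subseteq>
      (\<lambda>p. Idl\<^bsub>UP R\<^esub> {monom (UP R) \<one>\<^bsub>R\<^esub> 2} +>\<^bsub>UP R\<^esub> p) ` carrier (UP R)"
    by (auto simp: dual_numbers_def FactRing_def A_RCOSETS_def')
  ultimately have "carrier (dual_numbers R) \<lesssim> (UNIV :: 'u set)"
    by (meson image_lepoll lepoll_trans subset_imp_lepoll)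
  then show ?thesis using inf by (auto simp: large_universe_def lepoll_def)
qed

definition module_cat ::
  "('a, 'r) ring_scheme \<Rightarrow> ('a, 'u) module set \<Rightarrow> (('a, 'u) module, 'u \<Rightarrow> 'u) preadd_cat"
where
  "module_cat R \<M> = \<lparr>
     Obj = \<M>,
     Hom = (\<lambda>M N. mod_hom R M N),
     idn = (\<lambda>M. \<lambda>x\<in>carrier M. x),
     cmp = (\<lambda>L M N g f. compose (carrier L) g f),
     hadd = (\<lambda>M N f g. \<lambda>x\<in>carrier M. f x \<oplus>\<^bsub>N\<^esub> g x),
     hzero = (\<lambda>M N. \<lambda>x\<in>carrier M. \<zero>\<^bsub>N\<^esub>)\<rparr>"

definition torsionless_cat ::
  "('a, 'r) ring_scheme \<Rightarrow> (('a, 'u) module, 'u \<Rightarrow> 'u) preadd_cat"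
where
  "torsionless_cat R = module_cat R {M \<in> fg_modules R. torsionless R M}"

definition stable_torsionless_cat ::
  "('a, 'r) ring_scheme \<Rightarrow> (('a, 'u) module, ('u \<Rightarrow> 'u) set) preadd_cat"
where
  "stable_torsionless_cat R = quotient_cat (torsionless_cat R)
     (factoring_through (module_cat R (fg_modules R)) {P \<in> fg_modules R. projective R P})"


section \<open>The bounded derived category\<close>

text \<open>Complexes are graded cohomologically: \<open>diff X n : X\<^sup>n \<rightarrow> X\<^sup>n\<^sup>+\<^sup>1\<close>.\<close>

record ('a, 'u) cpx =
  part :: "int \<Rightarrow> ('a, 'u) module"
  diff :: "int \<Rightarrow> 'u \<Rightarrow> 'u"

definition bounded_complexes :: "('a, 'r) ring_scheme \<Rightarrow> ('a, 'u) cpx set" where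
  "bounded_complexes R = {X.
     (\<forall>n. part X n \<in> fg_modules R) \<and>
     (\<forall>n. diff X n \<in> mod_hom R (part X n) (part X (n + 1))) \<and>
     (\<forall>n. \<forall>x\<in>carrier (part X n). diff X (n + 1) (diff X n x) = \<zero>\<^bsub>part X (n + 2)\<^esub>) \<and>
     (\<exists>N. \<forall>n. \<bar>n\<bar> > N \<longrightarrow> carrier (part X n) = {\<zero>\<^bsub>part X n\<^esub>})}"

definition chain_maps ::
  "('a, 'r) ring_scheme \<Rightarrow> ('a, 'u) cpx \<Rightarrow> ('a, 'u) cpx \<Rightarrow> (int \<Rightarrow> 'u \<Rightarrow> 'u) set"
where
  "chain_maps R X Y = {f.
     (\<forall>n. f n \<in> mod_hom R (part X n) (part Y n)) \<and>
     (\<forall>n. \<forall>x\<in>carrier (part X n). f (n + 1) (diff X n x) = diff Y n (f n x))}"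

definition complex_cat ::
  "('a, 'r) ring_scheme \<Rightarrow> (('a, 'u) cpx, int \<Rightarrow> 'u \<Rightarrow> 'u) preadd_cat"
where
  "complex_cat R = \<lparr>
     Obj = bounded_complexes R,
     Hom = chain_maps R,
     idn = (\<lambda>X n. \<lambda>x\<in>carrier (part X n). x),
     cmp = (\<lambda>X Y Z g f n. compose (carrier (part X n)) (g n) (f n)),
     hadd = (\<lambda>X Y f g n. \<lambda>x\<in>carrier (part X n). f n x \<oplus>\<^bsub>part Y n\<^esub> g n x),
     hzero = (\<lambda>X Y n. \<lambda>x\<in>carrier (part X n). \<zero>\<^bsub>part Y n\<^esub>)\<rparr>"

definition null_homotopic ::
  "('a, 'r) ring_scheme \<Rightarrow> ('a, 'u) cpx \<Rightarrow> ('a, 'u) cpx \<Rightarrow> (int \<Rightarrow> 'u \<Rightarrow> 'u) set"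
where
  "null_homotopic R X Y = {f \<in> chain_maps R X Y.
     \<exists>h. (\<forall>n. h n \<in> mod_hom R (part X n) (part Y (n - 1))) \<and>
       (\<forall>n. \<forall>x\<in>carrier (part X n).
          f n x = diff Y (n - 1) (h n x) \<oplus>\<^bsub>part Y n\<^esub> h (n + 1) (diff X n x))}"

definition homotopy_cat ::
  "('a, 'r) ring_scheme \<Rightarrow> (('a, 'u) cpx, (int \<Rightarrow> 'u \<Rightarrow> 'u) set) preadd_cat"
where
  "homotopy_cat R = quotient_cat (complex_cat R) (null_homotopic R)"

definition cocycles :: "('a, 'u) cpx \<Rightarrow> int \<Rightarrow> 'u set" where
  "cocycles X n = {x \<in> carrier (part X n). diff X n x = \<zero>\<^bsub>part X (n + 1)\<^esub>}"

definition coboundaries :: "('a, 'u) cpx \<Rightarrow> int \<Rightarrow> 'u set" where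
  "coboundaries X n = diff X (n - 1) ` carrier (part X (n - 1))"

definition cohomology :: "('a, 'u) cpx \<Rightarrow> int \<Rightarrow> 'u set set" where
  "cohomology X n = a_rcosets\<^bsub>(part X n)\<lparr>carrier := cocycles X n\<rparr>\<^esub> (coboundaries X n)"

definition cohomology_map ::
  "('a, 'u) cpx \<Rightarrow> (int \<Rightarrow> 'u \<Rightarrow> 'u) \<Rightarrow> int \<Rightarrow> 'u set \<Rightarrow> 'u set"
where
  "cohomology_map Y f n c = (\<Union>x\<in>c. coboundaries Y n +>\<^bsub>part Y n\<^esub> f n x)"

definition quasi_isomorphisms ::
  "('a, 'r) ring_scheme \<Rightarrow> ('a, 'u) cpx \<Rightarrow> ('a, 'u) cpx \<Rightarrow> (int \<Rightarrow> 'u \<Rightarrow> 'u) set"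
where
  "quasi_isomorphisms R X Y = {f \<in> chain_maps R X Y.
     \<forall>n. bij_betw (cohomology_map Y f n) (cohomology X n) (cohomology Y n)}"

definition derived_cat ::
  "('a, 'r) ring_scheme \<Rightarrow>
   (('a, 'u) cpx,
    (('a, 'u) cpx \<times> (int \<Rightarrow> 'u \<Rightarrow> 'u) set \<times> (int \<Rightarrow> 'u \<Rightarrow> 'u) set) set) preadd_cat"
where
  "derived_cat R = localisation (homotopy_cat R)
     (\<lambda>X Y. {\<phi> \<in> Hom (homotopy_cat R) X Y. \<exists>f\<in>\<phi>. f \<in> quasi_isomorphisms R X Y})"

text \<open>\<open>X[k]\<^sup>n = X\<^sup>n\<^sup>+\<^sup>k\<close>, the differential being multiplied by \<open>(-1)\<^sup>k\<close>.\<close>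

definition shift :: "int \<Rightarrow> ('a, 'u) cpx \<Rightarrow> ('a, 'u) cpx" where
  "shift k X = \<lparr>
     part = (\<lambda>n. part X (n + k)),
     diff = (\<lambda>n. if even k then diff X (n + k)
       else (\<lambda>x\<in>carrier (part X (n + k)). \<ominus>\<^bsub>part X (n + k + 1)\<^esub> diff X (n + k) x))\<rparr>"

definition shift_map :: "int \<Rightarrow> (int \<Rightarrow> 'u \<Rightarrow> 'u) \<Rightarrow> (int \<Rightarrow> 'u \<Rightarrow> 'u)" where
  "shift_map k f = (\<lambda>n. f (n + k))"

text \<open>
  Since the shift is a bijection on complexes, on chain maps and on homotopies, the image of a class
  under the shift of representatives is again a full class.
\<close>

definition derived_shift_map ::
  "int \<Rightarrow> (('a, 'u) cpx \<times> (int \<Rightarrow> 'u \<Rightarrow> 'u) set \<times> (int \<Rightarrow> 'u \<Rightarrow> 'u) set) set \<Rightarrow>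
   (('a, 'u) cpx \<times> (int \<Rightarrow> 'u \<Rightarrow> 'u) set \<times> (int \<Rightarrow> 'u \<Rightarrow> 'u) set) set"
where
  "derived_shift_map k \<phi> = (\<lambda>(A, s, f). (shift k A, shift_map k ` s, shift_map k ` f)) ` \<phi>"

definition derived_orbit_cat ::
  "('a, 'r) ring_scheme \<Rightarrow>
   (('a, 'u) cpx,
    int \<Rightarrow> (('a, 'u) cpx \<times> (int \<Rightarrow> 'u \<Rightarrow> 'u) set \<times> (int \<Rightarrow> 'u \<Rightarrow> 'u) set) set) cat"
where
  "derived_orbit_cat R = orbit_cat (derived_cat R) shift derived_shift_map"

end

theory Submission
  imports Defs
begin

text \<open>
  Over a hereditary ring every torsionless module is projective, so bounded complexes of torsionless modules
  serve as resolutions: a morphism \<open>X \<rightarrow> Y[i]\<close> of the derived category is a chain map \<open>P \<rightarrow> Q[i]\<close> between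
  resolutions, up to homotopy. A module over \<open>R[\<epsilon>]\<close> is an \<open>R\<close>-module with an endomorphism \<open>\<epsilon>\<close> of square zero,
  and it is torsionless iff its underlying \<open>R\<close>-module is. Send a complex \<open>P\<close> to \<open>N = \<Oplus>\<^sub>n P\<^sup>n\<close> with
  \<open>\<epsilon> = (-1)\<^sup>n d\<close> on \<open>P\<^sup>n\<close>. The components of degree \<open>i\<close> of an \<open>R[\<epsilon>]\<close>-linear map \<open>N \<rightarrow> N'\<close> form a chain map
  \<open>P \<rightarrow> Q[i]\<close>, and every finite family of chain maps arises in this way. A map factors through a projective
  iff it has the form \<open>h \<epsilon> + \<epsilon> h\<close> with \<open>h\<close> linear over \<open>R\<close>, that is, iff all its components are null-homotopic.
  Finally every torsionless \<open>M\<close> is the total module of \<open>im \<epsilon> \<rightarrow> ker \<epsilon>\<close>.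
\<close>

section \<open>Equivalences, quotients and localisations of categories\<close>

text \<open>The comparison maps run backwards, from linear maps of total modules onto the Hom sets
  of the orbit category, whose category laws are read off from them. The obstacle is the
  localisation, whose operations are unions over all choices of roofs. Over a resolution
  \<open>P\<close> of \<open>X\<close> every roof out of \<open>X\<close> becomes one with left leg
  \<open>P -> X\<close>. This rests on a splitting: \<open>im d\<close> is torsionless along with
  its ambient module, so \<open>ker d\<close> is a direct summand, and lifts and homotopies are
  chosen on \<open>ker d\<close> and on a complement, in all degrees at once. The sign in the total
  module is forced by the shift: (-1)^n and (-1)^(n+i) differ by (-1)^i, the sign of the
  differential of \<open>Q[i]\<close>. The formula for maps through projectives has two sources. On
  a free module over R[\<epsilon>] the identity is t \<epsilon> + \<epsilon> t, where t takes the
  coefficient of \<epsilon>. And an R-linear functional f yields the R[\<epsilon>]-linear functional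
  x -> f(x \<epsilon>) + f(x) \<epsilon>; those of a dual basis embed a torsionless module into a
  free one.\<close>

locale category =
  fixes C :: "('o, 'm, 'x) cat_scheme"
  assumes is_cat: "is_category C"
begin

lemma id_in [intro, simp]: "X \<in> Obj C \<Longrightarrow> idn C X \<in> Hom C X X"
  using is_cat unfolding is_category_def by blast

lemma cmp_in [intro, simp]:
  "\<lbrakk>f \<in> Hom C X Y; g \<in> Hom C Y Z; X \<in> Obj C; Y \<in> Obj C; Z \<in> Obj C\<rbrakk> \<Longrightarrow> cmp C X Y Z g f \<in> Hom C X Z"
  using is_cat unfolding is_category_def by blast

lemma cmp_idr [simp]:
  "\<lbrakk>f \<in> Hom C X Y; X \<in> Obj C; Y \<in> Obj C\<rbrakk> \<Longrightarrow> cmp C X X Y f (idn C X) = f"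
  using is_cat unfolding is_category_def by blast

lemma cmp_idl [simp]:
  "\<lbrakk>f \<in> Hom C X Y; X \<in> Obj C; Y \<in> Obj C\<rbrakk> \<Longrightarrow> cmp C X Y Y (idn C Y) f = f"
  using is_cat unfolding is_category_def by blast

lemma cmp_assoc:
  "\<lbrakk>f \<in> Hom C W X; g \<in> Hom C X Y; h \<in> Hom C Y Z; W \<in> Obj C; X \<in> Obj C; Y \<in> Obj C; Z \<in> Obj C\<rbrakk>
   \<Longrightarrow> cmp C W X Z (cmp C X Y Z h g) f = cmp C W Y Z h (cmp C W X Y g f)"
  using is_cat unfolding is_category_def by blast

end

text \<open>\<open>K\<close> points from \<open>D\<close> to \<open>C\<close>, against the functor
  \<open>F1\<close>, which is its inverse on Hom sets. In this direction every morphism of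
  \<open>C\<close> is a value of \<open>K\<close>, so identities, associativity and closure in
  \<open>C\<close> are inherited from \<open>D\<close>. The quasi-inverse is obtained by choosing
  for each \<open>M\<close> an isomorphism \<open>a M\<close> from some \<open>F0 (G0 M)\<close> to
  \<open>M\<close>.\<close>

lemma equivalent_categoriesI:
  fixes C :: "('o, 'm, 'x) cat_scheme" and D :: "('p, 'n, 'y) cat_scheme"
  assumes D: "is_category D"
    and F0: "\<And>X. X \<in> Obj C \<Longrightarrow> F0 X \<in> Obj D"
    and bij: "\<And>X Y. \<lbrakk>X \<in> Obj C; Y \<in> Obj C\<rbrakk> \<Longrightarrow> bij_betw (K X Y) (Hom D (F0 X) (F0 Y)) (Hom C X Y)"
    and Kid: "\<And>X. X \<in> Obj C \<Longrightarrow> K X X (idn D (F0 X)) = idn C X"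
    and Kcmp: "\<And>X Y Z f g. \<lbrakk>X \<in> Obj C; Y \<in> Obj C; Z \<in> Obj C; f \<in> Hom D (F0 X) (F0 Y);
        g \<in> Hom D (F0 Y) (F0 Z)\<rbrakk> \<Longrightarrow>
        K X Z (cmp D (F0 X) (F0 Y) (F0 Z) g f) = cmp C X Y Z (K Y Z g) (K X Y f)"
    and ess: "\<And>M. M \<in> Obj D \<Longrightarrow> \<exists>X\<in>Obj C. \<exists>f. is_isomorphism D (F0 X) M f"
  shows "equivalent_categories C D"
proof -
  interpret D: category D by (rule category.intro[OF D])
  define F1 where "F1 X Y = inv_into (Hom D (F0 X) (F0 Y)) (K X Y)" for X Y
  have KF: "K X Y (F1 X Y f) = f" if "X \<in> Obj C" "Y \<in> Obj C" "f \<in> Hom C X Y" for X Y f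
    unfolding F1_def using bij[OF that(1,2)] that(3) by (simp add: bij_betw_def f_inv_into_f)
  have FK: "F1 X Y (K X Y f) = f" if "X \<in> Obj C" "Y \<in> Obj C" "f \<in> Hom D (F0 X) (F0 Y)" for X Y f
    unfolding F1_def using bij[OF that(1,2)] that(3) by (simp add: bij_betw_def)
  have F1_in: "F1 X Y f \<in> Hom D (F0 X) (F0 Y)"
    if "X \<in> Obj C" "Y \<in> Obj C" "f \<in> Hom C X Y" for X Y f
    unfolding F1_def using bij[OF that(1,2)] that(3) by (simp add: bij_betw_def inv_into_into)
  have K_in: "K X Y f \<in> Hom C X Y"
    if "X \<in> Obj C" "Y \<in> Obj C" "f \<in> Hom D (F0 X) (F0 Y)" for X Y f
    using bij_betwE[OF bij[OF that(1,2)]] that(3) by blast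
  have C: "is_category C"
    unfolding is_category_def
  proof (intro conjI ballI)
    fix X assume X: "X \<in> Obj C"
    show id: "idn C X \<in> Hom C X X" unfolding Kid[OF X, symmetric] by (intro K_in X D.id_in F0)
  next
    fix X Y Z f g assume h: "X \<in> Obj C" "Y \<in> Obj C" "Z \<in> Obj C" "f \<in> Hom C X Y" "g \<in> Hom C Y Z"
    have "cmp C X Y Z g f = K X Z (cmp D (F0 X) (F0 Y) (F0 Z) (F1 Y Z g) (F1 X Y f))"
      using h by (simp add: Kcmp F1_in KF)
    then show "cmp C X Y Z g f \<in> Hom C X Z" using h by (auto intro!: K_in D.cmp_in F0 F1_in)
  next
    fix X Y f assume h: "X \<in> Obj C" "Y \<in> Obj C" "f \<in> Hom C X Y"
    have "cmp C X X Y (K X Y (F1 X Y f)) (K X X (idn D (F0 X))) = K X Y (F1 X Y f)"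
      using h by (subst Kcmp[symmetric]) (auto simp: F1_in F0)
    then show "cmp C X X Y f (idn C X) = f" using h by (simp add: KF Kid)
    have "cmp C X Y Y (K Y Y (idn D (F0 Y))) (K X Y (F1 X Y f)) = K X Y (F1 X Y f)"
      using h by (subst Kcmp[symmetric]) (auto simp: F1_in F0)
    then show "cmp C X Y Y (idn C Y) f = f" using h by (simp add: KF Kid)
  next
    fix W X Y Z f g h
    assume a: "W \<in> Obj C" "X \<in> Obj C" "Y \<in> Obj C" "Z \<in> Obj C"
      "f \<in> Hom C W X" "g \<in> Hom C X Y" "h \<in> Hom C Y Z"
    have "cmp C W X Z (cmp C X Y Z (K Y Z (F1 Y Z h)) (K X Y (F1 X Y g))) (K W X (F1 W X f))
      = cmp C W Y Z (K Y Z (F1 Y Z h)) (cmp C W X Y (K X Y (F1 X Y g)) (K W X (F1 W X f)))"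
      using a by (simp add: Kcmp[symmetric] F1_in F0 D.cmp_assoc)
    then show "cmp C W X Z (cmp C X Y Z h g) f = cmp C W Y Z h (cmp C W X Y g f)"
      using a by (simp add: KF)
  qed
  interpret C: category C by (rule category.intro[OF C])
  have Fid: "F1 X X (idn C X) = idn D (F0 X)" if "X \<in> Obj C" for X
    using that FK[of X X "idn D (F0 X)"] by (simp add: Kid F0)
  have Fcmp: "F1 X Z (cmp C X Y Z g f) = cmp D (F0 X) (F0 Y) (F0 Z) (F1 Y Z g) (F1 X Y f)"
    if "X \<in> Obj C" "Y \<in> Obj C" "Z \<in> Obj C" "f \<in> Hom C X Y" "g \<in> Hom C Y Z" for X Y Z f g
    using that FK[of X Z "cmp D (F0 X) (F0 Y) (F0 Z) (F1 Y Z g) (F1 X Y f)"]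
    by (simp add: Kcmp F1_in KF F0)
  have "\<forall>M. \<exists>X f g. M \<in> Obj D \<longrightarrow> X \<in> Obj C \<and> f \<in> Hom D (F0 X) M \<and> g \<in> Hom D M (F0 X) \<and>
      cmp D (F0 X) M (F0 X) g f = idn D (F0 X) \<and> cmp D M (F0 X) M f g = idn D M"
    using ess unfolding is_isomorphism_def by meson
  then obtain G0 a b where G: "\<And>M. M \<in> Obj D \<Longrightarrow> G0 M \<in> Obj C \<and> a M \<in> Hom D (F0 (G0 M)) M \<and>
      b M \<in> Hom D M (F0 (G0 M)) \<and>
      cmp D (F0 (G0 M)) M (F0 (G0 M)) (b M) (a M) = idn D (F0 (G0 M)) \<and>
      cmp D M (F0 (G0 M)) M (a M) (b M) = idn D M"
    by metis
  \<comment> \<open>Conjugation by the chosen isomorphisms: \<open>g1 M N g\<close> is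
    \<open>b N\<close> after \<open>g\<close> after \<open>a M\<close>, a morphism between objects
    in the image of \<open>F0\<close>. Full faithfulness then moves it to \<open>C\<close>, which
    gives \<open>G1\<close>.\<close>
  define g1 where "g1 M N g = cmp D (F0 (G0 M)) M (F0 (G0 N)) (cmp D M N (F0 (G0 N)) (b N) g) (a M)"
    for M N g
  have g1_in: "g1 M N g \<in> Hom D (F0 (G0 M)) (F0 (G0 N))"
    if "M \<in> Obj D" "N \<in> Obj D" "g \<in> Hom D M N" for M N g
    unfolding g1_def using that G[OF that(1)] G[OF that(2)] by (auto intro!: D.cmp_in F0)
  define G1 where "G1 M N g = K (G0 M) (G0 N) (g1 M N g)" for M N g
  have ab: "cmp D W (F0 (G0 M)) M (a M) (cmp D W M (F0 (G0 M)) (b M) f) = f"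
    if "M \<in> Obj D" "W \<in> Obj D" "f \<in> Hom D W M" for M W f
    using that G[OF that(1)] by (simp add: D.cmp_assoc[symmetric] F0)
  have ag1: "cmp D (F0 (G0 M)) (F0 (G0 N)) N (a N) (g1 M N g) = cmp D (F0 (G0 M)) M N g (a M)"
    if "M \<in> Obj D" "N \<in> Obj D" "g \<in> Hom D M N" for M N g
    unfolding g1_def using that G[OF that(1)] G[OF that(2)]
    by (simp add: D.cmp_assoc F0 ab)
  have g1b: "cmp D M (F0 (G0 M)) (F0 (G0 N)) (g1 M N g) (b M) = cmp D M N (F0 (G0 N)) (b N) g"
    if "M \<in> Obj D" "N \<in> Obj D" "g \<in> Hom D M N" for M N g
    unfolding g1_def using that G[OF that(1)] G[OF that(2)]
    by (simp add: D.cmp_assoc F0)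
  have Gid: "G1 M M (idn D M) = idn C (G0 M)" if "M \<in> Obj D" for M
    using that G[OF that] by (simp add: G1_def g1_def F0 Kid)
  have Gcmp: "G1 M L (cmp D M N L h g) = cmp C (G0 M) (G0 N) (G0 L) (G1 N L h) (G1 M N g)"
    if "M \<in> Obj D" "N \<in> Obj D" "L \<in> Obj D" "g \<in> Hom D M N" "h \<in> Hom D N L" for M N L g h
  proof -
    have "cmp D (F0 (G0 M)) (F0 (G0 N)) (F0 (G0 L)) (g1 N L h) (g1 M N g) = g1 M L (cmp D M N L h g)"
      using that G[OF that(1)] G[OF that(2)] G[OF that(3)]
      by (simp add: g1_def[of N] g1_def[of M L] D.cmp_assoc F0 ag1 g1_in)
    then show ?thesis
      using G[OF that(1)] G[OF that(2)] G[OF that(3)] g1_in that unfolding G1_def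
      by (simp add: Kcmp[symmetric])
  qed
  \<comment> \<open>The unit at \<open>X\<close> is the preimage under \<open>F1\<close> of the
    inverse \<open>b (F0 X)\<close> of the chosen isomorphism; the counit is \<open>a\<close>
    itself.\<close>
  define \<eta> where "\<eta> X = K X (G0 (F0 X)) (b (F0 X))" for X
  show ?thesis
    unfolding equivalent_categories_def
  proof (intro conjI C D exI)
    show "is_functor C D F0 F1" unfolding is_functor_def using F0 F1_in Fid Fcmp by blast
    show "is_functor D C G0 G1"
    proof -
      have "G0 M \<in> Obj C" if "M \<in> Obj D" for M using G[OF that] by blast
      moreover have "G1 M N g \<in> Hom C (G0 M) (G0 N)"
        if "M \<in> Obj D" "N \<in> Obj D" "g \<in> Hom D M N" for M N g
        unfolding G1_def using G[OF that(1)] G[OF that(2)] K_in g1_in[OF that] by blast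
      ultimately show ?thesis unfolding is_functor_def by (intro conjI ballI) (simp_all add: Gid Gcmp)
    qed
    show "is_natural_iso C C (\<lambda>X. X) (\<lambda>X Y f. f)
          (\<lambda>X. G0 (F0 X)) (\<lambda>X Y f. G1 (F0 X) (F0 Y) (F1 X Y f)) \<eta>"
      unfolding is_natural_iso_def
    proof (intro conjI ballI)
      fix X assume X: "X \<in> Obj C"
      note FX = F0[OF X]
      note GX = G[OF FX]
      show "is_isomorphism C X (G0 (F0 X)) (\<eta> X)"
        unfolding is_isomorphism_def
      proof (intro conjI bexI)
        show "\<eta> X \<in> Hom C X (G0 (F0 X))" unfolding \<eta>_def using X GX by (auto intro!: K_in)
        show "K (G0 (F0 X)) X (a (F0 X)) \<in> Hom C (G0 (F0 X)) X" using X GX by (auto intro!: K_in)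
        show "cmp C X (G0 (F0 X)) X (K (G0 (F0 X)) X (a (F0 X))) (\<eta> X) = idn C X"
          unfolding \<eta>_def using X GX by (simp add: Kcmp[symmetric] Kid)
        show "cmp C (G0 (F0 X)) X (G0 (F0 X)) (\<eta> X) (K (G0 (F0 X)) X (a (F0 X))) = idn C (G0 (F0 X))"
          unfolding \<eta>_def using X GX by (simp add: Kcmp[symmetric] Kid)
      qed
    next
      fix X Y f assume h: "X \<in> Obj C" "Y \<in> Obj C" "f \<in> Hom C X Y"
      have "cmp C X Y (G0 (F0 Y)) (\<eta> Y) (K X Y (F1 X Y f)) =
            cmp C X (G0 (F0 X)) (G0 (F0 Y)) (G1 (F0 X) (F0 Y) (F1 X Y f)) (\<eta> X)"
        using h G[OF F0[OF h(1)]] G[OF F0[OF h(2)]]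
        by (simp add: \<eta>_def G1_def Kcmp[symmetric] F1_in g1_in F0 g1b)
      then show "cmp C X Y (G0 (F0 Y)) (\<eta> Y) f =
            cmp C X (G0 (F0 X)) (G0 (F0 Y)) (G1 (F0 X) (F0 Y) (F1 X Y f)) (\<eta> X)"
        using h by (simp add: KF)
    qed
    show "is_natural_iso D D (\<lambda>X. F0 (G0 X)) (\<lambda>X Y f. F1 (G0 X) (G0 Y) (G1 X Y f))
          (\<lambda>X. X) (\<lambda>X Y f. f) a"
      unfolding is_natural_iso_def
    proof (intro conjI ballI)
      fix M assume "M \<in> Obj D"
      then show "is_isomorphism D (F0 (G0 M)) M (a M)"
        unfolding is_isomorphism_def using G by blast
    next
      fix M N g assume h: "M \<in> Obj D" "N \<in> Obj D" "g \<in> Hom D M N"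
      then show "cmp D (F0 (G0 M)) (F0 (G0 N)) N (a N) (F1 (G0 M) (G0 N) (G1 M N g)) =
          cmp D (F0 (G0 M)) M N g (a M)"
        using G[OF h(1)] G[OF h(2)] by (simp add: G1_def FK g1_in ag1)
    qed
  qed
qed


subsection \<open>Preadditive categories and ideals\<close>

text \<open>Each axiom holds in \<open>H\<close> because every element of \<open>H\<close> is a
  value of \<open>f\<close>. This supplies the Hom groups of quotients and localisations, whose
  operations are defined as unions over representatives and would be awkward to check
  directly.\<close>

lemma comm_group_surj_hom:
  assumes "comm_group G" and "f ` carrier G = carrier H"
    and "\<And>x y. \<lbrakk>x \<in> carrier G; y \<in> carrier G\<rbrakk> \<Longrightarrow> f (x \<otimes>\<^bsub>G\<^esub> y) = f x \<otimes>\<^bsub>H\<^esub> f y"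
    and "f \<one>\<^bsub>G\<^esub> = \<one>\<^bsub>H\<^esub>"
  shows "comm_group H"
proof -
  interpret G: comm_group G by fact
  have *: "\<And>u. u \<in> carrier H \<Longrightarrow> \<exists>x\<in>carrier G. u = f x" using assms(2) by blast
  have f: "\<And>x. x \<in> carrier G \<Longrightarrow> f x \<in> carrier H" using assms(2) by blast
  show ?thesis
  proof (rule comm_groupI)
    show "\<one>\<^bsub>H\<^esub> \<in> carrier H" unfolding assms(4)[symmetric] by (simp add: f)
  next
    fix u assume "u \<in> carrier H"
    then obtain x where x: "x \<in> carrier G" "u = f x" using * by blast
    then have "f (inv\<^bsub>G\<^esub> x) \<otimes>\<^bsub>H\<^esub> u = \<one>\<^bsub>H\<^esub>" by (simp add: assms(3)[symmetric] assms(4))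
    then show "\<exists>v\<in>carrier H. v \<otimes>\<^bsub>H\<^esub> u = \<one>\<^bsub>H\<^esub>" using x f by blast
  qed (auto dest!: * simp: assms(3)[symmetric] assms(4)[symmetric] f G.m_ac)
qed

locale preadditive = category C
  for C :: "('o, 'm, 'x) preadd_cat_scheme" +
  assumes hom_comm_group: "\<lbrakk>X \<in> Obj C; Y \<in> Obj C\<rbrakk> \<Longrightarrow> comm_group (hom_group C X Y)"
    and cmp_hadd_right:
      "\<lbrakk>f \<in> Hom C X Y; g \<in> Hom C X Y; h \<in> Hom C Y Z; X \<in> Obj C; Y \<in> Obj C; Z \<in> Obj C\<rbrakk> \<Longrightarrow>
        cmp C X Y Z h (hadd C X Y f g) = hadd C X Z (cmp C X Y Z h f) (cmp C X Y Z h g)"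
    and cmp_hadd_left:
      "\<lbrakk>f \<in> Hom C X Y; g \<in> Hom C Y Z; h \<in> Hom C Y Z; X \<in> Obj C; Y \<in> Obj C; Z \<in> Obj C\<rbrakk> \<Longrightarrow>
        cmp C X Y Z (hadd C Y Z g h) f = hadd C X Z (cmp C X Y Z g f) (cmp C X Y Z h f)"
begin

lemma hadd_in [intro, simp]:
  "\<lbrakk>f \<in> Hom C X Y; g \<in> Hom C X Y; X \<in> Obj C; Y \<in> Obj C\<rbrakk> \<Longrightarrow> hadd C X Y f g \<in> Hom C X Y"
  using monoid.m_closed[of "hom_group C X Y" f g] hom_comm_group[of X Y]
  by (simp add: hom_group_def comm_group_def comm_monoid_def)

lemma hzero_in [intro, simp]: "\<lbrakk>X \<in> Obj C; Y \<in> Obj C\<rbrakk> \<Longrightarrow> hzero C X Y \<in> Hom C X Y"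
  using monoid.one_closed[of "hom_group C X Y"] hom_comm_group[of X Y]
  by (simp add: hom_group_def comm_group_def comm_monoid_def)

lemma hadd_hzero [simp]:
  assumes "f \<in> Hom C X Y" "X \<in> Obj C" "Y \<in> Obj C"
  shows "hadd C X Y f (hzero C X Y) = f" "hadd C X Y (hzero C X Y) f = f"
proof -
  interpret G: comm_group "hom_group C X Y" by (rule hom_comm_group[OF assms(2,3)])
  show "hadd C X Y f (hzero C X Y) = f" "hadd C X Y (hzero C X Y) f = f"
    using G.r_one[of f] G.l_one[of f] assms(1) by (simp_all add: hom_group_def)
qed

lemma hadd_idem:
  assumes "f \<in> Hom C X Y" "X \<in> Obj C" "Y \<in> Obj C" "hadd C X Y f f = f"
  shows "f = hzero C X Y"
proof -
  interpret G: comm_group "hom_group C X Y" by (rule hom_comm_group[OF assms(2,3)])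
  show ?thesis using G.l_cancel_one[of f f] assms by (simp add: hom_group_def)
qed

lemma cmp_hzero_right [simp]:
  assumes "h \<in> Hom C Y Z" "X \<in> Obj C" "Y \<in> Obj C" "Z \<in> Obj C"
  shows "cmp C X Y Z h (hzero C X Y) = hzero C X Z"
  by (rule hadd_idem) (use assms in \<open>auto simp: cmp_hadd_right[symmetric]\<close>)

lemma cmp_hzero_left [simp]:
  assumes "f \<in> Hom C X Y" "X \<in> Obj C" "Y \<in> Obj C" "Z \<in> Obj C"
  shows "cmp C X Y Z (hzero C Y Z) f = hzero C X Z"
  by (rule hadd_idem) (use assms in \<open>auto simp: cmp_hadd_left[symmetric]\<close>)

end

locale hom_ideal = preadditive C
  for C :: "('o, 'm, 'x) preadd_cat_scheme" +
  fixes J :: "'o \<Rightarrow> 'o \<Rightarrow> 'm set"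
  assumes J_sub: "\<lbrakk>X \<in> Obj C; Y \<in> Obj C; j \<in> J X Y\<rbrakk> \<Longrightarrow> j \<in> Hom C X Y"
    and J_zero: "\<lbrakk>X \<in> Obj C; Y \<in> Obj C\<rbrakk> \<Longrightarrow> hzero C X Y \<in> J X Y"
    and J_add: "\<lbrakk>X \<in> Obj C; Y \<in> Obj C; j \<in> J X Y; k \<in> J X Y\<rbrakk> \<Longrightarrow> hadd C X Y j k \<in> J X Y"
    and J_left: "\<lbrakk>X \<in> Obj C; Y \<in> Obj C; Z \<in> Obj C; j \<in> J X Y; g \<in> Hom C Y Z\<rbrakk> \<Longrightarrow> cmp C X Y Z g j \<in> J X Z"
    and J_right: "\<lbrakk>X \<in> Obj C; Y \<in> Obj C; Z \<in> Obj C; j \<in> J Y Z; f \<in> Hom C X Y\<rbrakk> \<Longrightarrow> cmp C X Y Z j f \<in> J X Z"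
begin

abbreviation "rel \<equiv> ideal_rel C J"
abbreviation "Q \<equiv> quotient_cat C J"

definition cls :: "'o \<Rightarrow> 'o \<Rightarrow> 'm \<Rightarrow> 'm set" where "cls X Y f = rel X Y `` {f}"

text \<open>The ideal axioms contain no closure under negation; it follows from composition, since
  -j is j followed by the additive inverse of the identity of \<open>Y\<close>.\<close>

lemma J_neg:
  assumes "X \<in> Obj C" "Y \<in> Obj C" "j \<in> J X Y"
  shows "inv\<^bsub>hom_group C X Y\<^esub> j \<in> J X Y"
proof -
  interpret G: comm_group "hom_group C X Y" by (rule hom_comm_group[OF assms(1,2)])
  interpret E: comm_group "hom_group C Y Y" by (rule hom_comm_group[OF assms(2,2)])
  let ?n = "inv\<^bsub>hom_group C Y Y\<^esub> idn C Y"
  have n: "?n \<in> Hom C Y Y" "hadd C Y Y ?n (idn C Y) = hzero C Y Y"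
    using E.inv_closed[of "idn C Y"] E.l_inv[of "idn C Y"] assms by (auto simp: hom_group_def)
  have j: "j \<in> Hom C X Y" using J_sub assms by blast
  have "hadd C X Y (cmp C X Y Y ?n j) j = hadd C X Y (cmp C X Y Y ?n j) (cmp C X Y Y (idn C Y) j)"
    using assms j by simp
  also have "\<dots> = cmp C X Y Y (hadd C Y Y ?n (idn C Y)) j"
    using assms n(1) j by (subst cmp_hadd_left) auto
  also have "\<dots> = hzero C X Y" using assms j n by simp
  finally have "inv\<^bsub>hom_group C X Y\<^esub> j = cmp C X Y Y ?n j"
    by (intro G.inv_equality) (use assms n(1) j in \<open>auto simp: hom_group_def\<close>)
  then show ?thesis using J_left[OF assms(1,2,2,3) n(1)] by simp
qed

lemma rel_equiv:
  assumes "X \<in> Obj C" "Y \<in> Obj C"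
  shows "equiv (Hom C X Y) (rel X Y)"
proof -
  interpret G: comm_group "hom_group C X Y" by (rule hom_comm_group[OF assms])
  have simps: "carrier (hom_group C X Y) = Hom C X Y" "mult (hom_group C X Y) = hadd C X Y"
    "one (hom_group C X Y) = hzero C X Y" by (simp_all add: hom_group_def)
  note [simp] = simps
  note Gs = G.m_assoc[unfolded simps] G.r_inv[unfolded simps]
  show ?thesis
  proof (rule equivI)
    show "rel X Y \<subseteq> Hom C X Y \<times> Hom C X Y" by (auto simp: ideal_rel_def)
    show "refl_on (Hom C X Y) (rel X Y)"
      unfolding refl_on_def ideal_rel_def using J_zero[OF assms] hadd_hzero(1)[OF _ assms] by (auto intro!: bexI[of _ "hzero C X Y"])
    show "sym (rel X Y)"
    proof (rule symI)
      fix f g assume "(f, g) \<in> rel X Y"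
      then obtain j where j: "f \<in> Hom C X Y" "g \<in> Hom C X Y" "j \<in> J X Y" "f = hadd C X Y g j"
        by (auto simp: ideal_rel_def)
      have "j \<in> Hom C X Y" using J_sub assms j by blast
      then have "g = hadd C X Y f (inv\<^bsub>hom_group C X Y\<^esub> j)"
        using j assms G.inv_closed[of j] by (simp add: Gs)
      then show "(g, f) \<in> rel X Y" using j J_neg[OF assms j(3)] by (auto simp: ideal_rel_def)
    qed
    show "trans (rel X Y)"
    proof (rule transI)
      fix f g h assume "(f, g) \<in> rel X Y" "(g, h) \<in> rel X Y"
      then obtain j k where j: "f \<in> Hom C X Y" "g \<in> Hom C X Y" "h \<in> Hom C X Y" "j \<in> J X Y" "k \<in> J X Y"
        "f = hadd C X Y g j" "g = hadd C X Y h k"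
        by (auto simp: ideal_rel_def)
      then have "f = hadd C X Y h (hadd C X Y k j)"
        using J_sub[OF assms] by (simp add: Gs)
      then show "(f, h) \<in> rel X Y" using j J_add[OF assms j(5,4)] by (auto simp: ideal_rel_def)
    qed
  qed
qed

lemma cls_eq_iff:
  assumes "X \<in> Obj C" "Y \<in> Obj C" "f \<in> Hom C X Y" "g \<in> Hom C X Y"
  shows "cls X Y f = cls X Y g \<longleftrightarrow> (f, g) \<in> rel X Y"
  unfolding cls_def using eq_equiv_class_iff[OF rel_equiv[OF assms(1,2)] assms(3,4)] .

lemma mem_cls_self: "\<lbrakk>X \<in> Obj C; Y \<in> Obj C; f \<in> Hom C X Y\<rbrakk> \<Longrightarrow> f \<in> cls X Y f"
  unfolding cls_def using equiv_class_self[OF rel_equiv] .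

lemma mem_cls:
  assumes "X \<in> Obj C" "Y \<in> Obj C" "f \<in> Hom C X Y" "g \<in> cls X Y f"
  shows "g \<in> Hom C X Y" "cls X Y g = cls X Y f" "(f, g) \<in> rel X Y"
proof -
  show "(f, g) \<in> rel X Y" using assms(4) by (simp add: cls_def)
  then show "g \<in> Hom C X Y" by (simp add: ideal_rel_def)
  then show "cls X Y g = cls X Y f" using cls_eq_iff assms \<open>(f, g) \<in> rel X Y\<close> by metis
qed

lemma Obj_Q [simp]: "Obj Q = Obj C" by (simp add: quotient_cat_def)

lemma Hom_Q: "Hom Q X Y = cls X Y ` Hom C X Y"
  by (auto simp: quotient_cat_def quotient_def cls_def)

lemma cls_in [intro, simp]: "f \<in> Hom C X Y \<Longrightarrow> cls X Y f \<in> Hom Q X Y"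
  by (simp add: Hom_Q)

lemma idn_Q: "idn Q X = cls X X (idn C X)" by (simp add: quotient_cat_def cls_def)

lemma hzero_Q: "hzero Q X Y = cls X Y (hzero C X Y)" by (simp add: quotient_cat_def cls_def)

lemma relI: "\<lbrakk>f \<in> Hom C X Y; g \<in> Hom C X Y; j \<in> J X Y; f = hadd C X Y g j\<rbrakk> \<Longrightarrow> (f, g) \<in> rel X Y"
  by (auto simp: ideal_rel_def)

lemma rel_cmp:
  assumes "X \<in> Obj C" "Y \<in> Obj C" "Z \<in> Obj C" "(f, f') \<in> rel X Y" "(g, g') \<in> rel Y Z"
  shows "(cmp C X Y Z g f, cmp C X Y Z g' f') \<in> rel X Z"
proof -
  obtain j k where h: "f \<in> Hom C X Y" "f' \<in> Hom C X Y" "j \<in> J X Y" "f = hadd C X Y f' j"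
    "g \<in> Hom C Y Z" "g' \<in> Hom C Y Z" "k \<in> J Y Z" "g = hadd C Y Z g' k"
    using assms(4,5) by (auto simp: ideal_rel_def)
  have j: "j \<in> Hom C X Y" and k: "k \<in> Hom C Y Z" using J_sub assms h by blast+
  have 1: "(cmp C X Y Z g f, cmp C X Y Z g f') \<in> rel X Z"
  proof (rule relI)
    show "cmp C X Y Z g j \<in> J X Z" by (rule J_left[OF assms(1-3) h(3,5)])
    show "cmp C X Y Z g f = hadd C X Z (cmp C X Y Z g f') (cmp C X Y Z g j)"
      using cmp_hadd_right[OF h(2) j h(5) assms(1-3)] h(4) by simp
  qed (rule cmp_in h assms)+
  have 2: "(cmp C X Y Z g f', cmp C X Y Z g' f') \<in> rel X Z"
  proof (rule relI)
    show "cmp C X Y Z k f' \<in> J X Z" by (rule J_right[OF assms(1-3) h(7,2)])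
    show "cmp C X Y Z g f' = hadd C X Z (cmp C X Y Z g' f') (cmp C X Y Z k f')"
      using cmp_hadd_left[OF h(2,6) k assms(1-3)] h(8) by simp
  qed (rule cmp_in h assms)+
  show ?thesis using rel_equiv[OF assms(1,3)] 1 2 by (meson equivE transD)
qed

lemma rel_hadd:
  assumes "X \<in> Obj C" "Y \<in> Obj C" "(f, f') \<in> rel X Y" "(g, g') \<in> rel X Y"
  shows "(hadd C X Y f g, hadd C X Y f' g') \<in> rel X Y"
proof -
  interpret G: comm_group "hom_group C X Y" by (rule hom_comm_group[OF assms(1,2)])
  obtain j k where h: "f \<in> Hom C X Y" "f' \<in> Hom C X Y" "j \<in> J X Y" "f = hadd C X Y f' j"
    "g \<in> Hom C X Y" "g' \<in> Hom C X Y" "k \<in> J X Y" "g = hadd C X Y g' k"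
    using assms(3,4) by (auto simp: ideal_rel_def)
  have jk: "j \<in> Hom C X Y" "k \<in> Hom C X Y" using J_sub assms h by blast+
  have "f' \<otimes>\<^bsub>hom_group C X Y\<^esub> j \<otimes>\<^bsub>hom_group C X Y\<^esub> (g' \<otimes>\<^bsub>hom_group C X Y\<^esub> k) =
      f' \<otimes>\<^bsub>hom_group C X Y\<^esub> g' \<otimes>\<^bsub>hom_group C X Y\<^esub> (j \<otimes>\<^bsub>hom_group C X Y\<^esub> k)"
  proof -
    have "f' \<in> carrier (hom_group C X Y)" "g' \<in> carrier (hom_group C X Y)"
      "j \<in> carrier (hom_group C X Y)" "k \<in> carrier (hom_group C X Y)"
      using h(2,6) jk by (simp_all add: hom_group_def)
    then show ?thesis by (simp add: G.m_ac)
  qed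
  then have "hadd C X Y (hadd C X Y f' j) (hadd C X Y g' k) = hadd C X Y (hadd C X Y f' g') (hadd C X Y j k)"
    by (simp add: hom_group_def)
  then have "hadd C X Y f g = hadd C X Y (hadd C X Y f' g') (hadd C X Y j k)"
    using h(4,8) by simp
  then show ?thesis
    by (rule relI[OF hadd_in[OF h(1,5) assms(1,2)] hadd_in[OF h(2,6) assms(1,2)]
          J_add[OF assms(1,2) h(3,7)]])
qed

text \<open>All representatives give the same class by \<open>rel_cmp\<close>, and there is at least
  one pair of them, so the union in the definition of the quotient collapses to a single
  class.\<close>

lemma cmp_Q:
  assumes "X \<in> Obj C" "Y \<in> Obj C" "Z \<in> Obj C" "f \<in> Hom C X Y" "g \<in> Hom C Y Z"
  shows "cmp Q X Y Z (cls Y Z g) (cls X Y f) = cls X Z (cmp C X Y Z g f)"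
proof -
  have "cls X Z (cmp C X Y Z g' f') = cls X Z (cmp C X Y Z g f)"
    if "g' \<in> cls Y Z g" "f' \<in> cls X Y f" for f' g'
  proof -
    note f' = mem_cls[OF assms(1,2,4) that(2)] and g' = mem_cls[OF assms(2,3,5) that(1)]
    have "cls X Z (cmp C X Y Z g f) = cls X Z (cmp C X Y Z g' f')"
      using rel_cmp[OF assms(1-3) f'(3) g'(3)] assms f'(1) g'(1) by (simp add: cls_eq_iff)
    then show ?thesis by simp
  qed
  then have "(\<Union>g'\<in>cls Y Z g. \<Union>f'\<in>cls X Y f. cls X Z (cmp C X Y Z g' f')) = cls X Z (cmp C X Y Z g f)"
    using mem_cls_self[OF assms(1,2,4)] mem_cls_self[OF assms(2,3,5)] by blast
  then show ?thesis by (simp add: quotient_cat_def cls_def[symmetric])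
qed

lemma hadd_Q:
  assumes "X \<in> Obj C" "Y \<in> Obj C" "f \<in> Hom C X Y" "g \<in> Hom C X Y"
  shows "hadd Q X Y (cls X Y f) (cls X Y g) = cls X Y (hadd C X Y f g)"
proof -
  have "cls X Y (hadd C X Y f' g') = cls X Y (hadd C X Y f g)"
    if "g' \<in> cls X Y g" "f' \<in> cls X Y f" for f' g'
  proof -
    note f' = mem_cls[OF assms(1,2,3) that(2)] and g' = mem_cls[OF assms(1,2,4) that(1)]
    have "cls X Y (hadd C X Y f g) = cls X Y (hadd C X Y f' g')"
      using rel_hadd[OF assms(1,2) f'(3) g'(3)] assms f'(1) g'(1) by (simp add: cls_eq_iff)
    then show ?thesis by simp
  qed
  then have "(\<Union>f'\<in>cls X Y f. \<Union>g'\<in>cls X Y g. cls X Y (hadd C X Y f' g')) = cls X Y (hadd C X Y f g)"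
    using mem_cls_self[OF assms(1-3)] mem_cls_self[OF assms(1,2,4)] by blast
  then show ?thesis by (simp add: quotient_cat_def cls_def[symmetric])
qed

lemma preadditive_Q: "preadditive Q"
proof (intro preadditive.intro category.intro preadditive_axioms.intro,
    unfold is_category_def, intro conjI ballI)
  fix X assume "X \<in> Obj Q"
  then show "idn Q X \<in> Hom Q X X" by (auto simp: idn_Q)
next
  fix X Y Z f g assume "X \<in> Obj Q" "Y \<in> Obj Q" "Z \<in> Obj Q" "f \<in> Hom Q X Y" "g \<in> Hom Q Y Z"
  then show "cmp Q X Y Z g f \<in> Hom Q X Z" by (auto simp: Hom_Q cmp_Q)
next
  fix X Y f assume "X \<in> Obj Q" "Y \<in> Obj Q" "f \<in> Hom Q X Y"
  then show "cmp Q X X Y f (idn Q X) = f" "cmp Q X Y Y (idn Q Y) f = f"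
    by (auto simp: Hom_Q idn_Q cmp_Q)
next
  fix W X Y Z f g h
  assume "W \<in> Obj Q" "X \<in> Obj Q" "Y \<in> Obj Q" "Z \<in> Obj Q"
    "f \<in> Hom Q W X" "g \<in> Hom Q X Y" "h \<in> Hom Q Y Z"
  then show "cmp Q W X Z (cmp Q X Y Z h g) f = cmp Q W Y Z h (cmp Q W X Y g f)"
    by (auto simp: Hom_Q cmp_Q cmp_assoc)
next
  fix X Y assume h: "X \<in> Obj Q" "Y \<in> Obj Q"
  show "comm_group (hom_group Q X Y)"
    by (rule comm_group_surj_hom[OF hom_comm_group[of X Y], of "cls X Y"])
      (use h in \<open>auto simp: hom_group_def Hom_Q hadd_Q hzero_Q\<close>)
next
  fix X Y Z f g h assume "X \<in> Obj Q" "Y \<in> Obj Q" "Z \<in> Obj Q"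
    "f \<in> Hom Q X Y" "g \<in> Hom Q X Y" "h \<in> Hom Q Y Z"
  then show "cmp Q X Y Z h (hadd Q X Y f g) = hadd Q X Z (cmp Q X Y Z h f) (cmp Q X Y Z h g)"
    by (auto simp: Hom_Q cmp_Q hadd_Q cmp_hadd_right)
next
  fix X Y Z f g h assume "X \<in> Obj Q" "Y \<in> Obj Q" "Z \<in> Obj Q"
    "f \<in> Hom Q X Y" "g \<in> Hom Q Y Z" "h \<in> Hom Q Y Z"
  then show "cmp Q X Y Z (hadd Q Y Z g h) f = hadd Q X Z (cmp Q X Y Z g f) (cmp Q X Y Z h f)"
    by (auto simp: Hom_Q cmp_Q hadd_Q cmp_hadd_left)
qed

text \<open>\<open>H\<close> is given on morphisms of \<open>C\<close> before any class is formed.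
  The condition \<open>ker\<close> says at once that \<open>H\<close> is constant on classes and
  that it separates them. Essential surjectivity may be checked in \<open>C\<close>, because the
  class of an isomorphism is an isomorphism.\<close>

lemma equivalent_to_quotientI:
  fixes D :: "('p, 'n, 'y) cat_scheme"
  assumes F0: "\<And>X. X \<in> Obj D \<Longrightarrow> F0 X \<in> Obj C"
    and surj: "\<And>X Y. \<lbrakk>X \<in> Obj D; Y \<in> Obj D\<rbrakk> \<Longrightarrow> H X Y ` Hom C (F0 X) (F0 Y) = Hom D X Y"
    and ker: "\<And>X Y f g. \<lbrakk>X \<in> Obj D; Y \<in> Obj D; f \<in> Hom C (F0 X) (F0 Y); g \<in> Hom C (F0 X) (F0 Y)\<rbrakk> \<Longrightarrow>
      H X Y f = H X Y g \<longleftrightarrow> (f, g) \<in> ideal_rel C J (F0 X) (F0 Y)"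
    and Hid: "\<And>X. X \<in> Obj D \<Longrightarrow> H X X (idn C (F0 X)) = idn D X"
    and Hcmp: "\<And>X Y Z f g. \<lbrakk>X \<in> Obj D; Y \<in> Obj D; Z \<in> Obj D; f \<in> Hom C (F0 X) (F0 Y);
        g \<in> Hom C (F0 Y) (F0 Z)\<rbrakk> \<Longrightarrow>
        H X Z (cmp C (F0 X) (F0 Y) (F0 Z) g f) = cmp D X Y Z (H Y Z g) (H X Y f)"
    and ess: "\<And>M. M \<in> Obj C \<Longrightarrow> \<exists>X\<in>Obj D. \<exists>f. is_isomorphism C (F0 X) M f"
  shows "equivalent_categories D (quotient_cat C J)"
proof -
  interpret Q: preadditive Q by (rule preadditive_Q)
  \<comment> \<open>\<open>H\<close> is constant on the class \<open>c\<close>, so its image of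
    \<open>c\<close> is a singleton.\<close>
  define K where "K X Y c = the_elem (H X Y ` c)" for X Y c
  have K: "K X Y (cls (F0 X) (F0 Y) f) = H X Y f"
    if "X \<in> Obj D" "Y \<in> Obj D" "f \<in> Hom C (F0 X) (F0 Y)" for X Y f
  proof -
    note FX = F0[OF that(1)] and FY = F0[OF that(2)]
    have "H X Y g = H X Y f" if g: "g \<in> cls (F0 X) (F0 Y) f" for g
      using mem_cls[OF FX FY \<open>f \<in> Hom C (F0 X) (F0 Y)\<close> g]
        ker[OF \<open>X \<in> Obj D\<close> \<open>Y \<in> Obj D\<close> \<open>f \<in> Hom C (F0 X) (F0 Y)\<close>, of g] by simp
    then have "H X Y ` cls (F0 X) (F0 Y) f = {H X Y f}"
      using mem_cls_self[OF FX FY that(3)] by blast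
    then show ?thesis by (simp add: K_def)
  qed
  show ?thesis
  proof (rule equivalent_categoriesI[where K = K and ?F0.0 = F0])
    show "is_category Q" by (rule Q.is_cat)
  next
    fix X assume h: "X \<in> Obj D"
    then show "F0 X \<in> Obj Q" by (simp add: F0)
    show "K X X (idn Q (F0 X)) = idn D X" using h by (simp add: idn_Q K F0 Hid)
  next
    fix X Y Z f g
    assume h: "X \<in> Obj D" "Y \<in> Obj D" "Z \<in> Obj D"
      and "f \<in> Hom Q (F0 X) (F0 Y)" "g \<in> Hom Q (F0 Y) (F0 Z)"
    then obtain f' g' where "f' \<in> Hom C (F0 X) (F0 Y)" "g' \<in> Hom C (F0 Y) (F0 Z)"
      "f = cls (F0 X) (F0 Y) f'" "g = cls (F0 Y) (F0 Z) g'" by (auto simp: Hom_Q)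
    then show "K X Z (cmp Q (F0 X) (F0 Y) (F0 Z) g f) = cmp D X Y Z (K Y Z g) (K X Y f)"
      using h by (simp add: cmp_Q F0 K Hcmp)
  next
    fix X Y assume h: "X \<in> Obj D" "Y \<in> Obj D"
    show "bij_betw (K X Y) (Hom Q (F0 X) (F0 Y)) (Hom D X Y)"
      unfolding bij_betw_def
    proof
      show "inj_on (K X Y) (Hom Q (F0 X) (F0 Y))"
      proof (rule inj_onI)
        fix c d assume "c \<in> Hom Q (F0 X) (F0 Y)" "d \<in> Hom Q (F0 X) (F0 Y)" and eq: "K X Y c = K X Y d"
        then obtain f g where fg: "f \<in> Hom C (F0 X) (F0 Y)" "g \<in> Hom C (F0 X) (F0 Y)"
          "c = cls (F0 X) (F0 Y) f" "d = cls (F0 X) (F0 Y) g" by (auto simp: Hom_Q)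
        then show "c = d" using eq K[OF h] ker[OF h fg(1,2)] cls_eq_iff[OF F0 F0 fg(1,2)] h by simp
      qed
      show "K X Y ` Hom Q (F0 X) (F0 Y) = Hom D X Y"
      proof -
        have "K X Y ` cls (F0 X) (F0 Y) ` Hom C (F0 X) (F0 Y) = H X Y ` Hom C (F0 X) (F0 Y)"
          unfolding image_image by (rule image_cong[OF refl K[OF h]])
        then show ?thesis unfolding Hom_Q surj[OF h] .
      qed
    qed
  next
    fix M assume "M \<in> Obj Q"
    then have M: "M \<in> Obj C" by simp
    obtain X f where X: "X \<in> Obj D" and "is_isomorphism C (F0 X) M f"
      using ess[OF M] by blast
    then obtain g where h: "f \<in> Hom C (F0 X) M" "g \<in> Hom C M (F0 X)"
      "cmp C (F0 X) M (F0 X) g f = idn C (F0 X)" "cmp C M (F0 X) M f g = idn C M"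
      unfolding is_isomorphism_def by auto
    note FX = F0[OF X]
    have "is_isomorphism Q (F0 X) M (cls (F0 X) M f)"
      unfolding is_isomorphism_def
    proof (intro conjI bexI)
      show "cmp Q (F0 X) M (F0 X) (cls M (F0 X) g) (cls (F0 X) M f) = idn Q (F0 X)"
        using cmp_Q[OF FX M FX h(1,2)] h(3) by (simp add: idn_Q)
      show "cmp Q M (F0 X) M (cls (F0 X) M f) (cls M (F0 X) g) = idn Q M"
        using cmp_Q[OF M FX M h(2,1)] h(4) by (simp add: idn_Q)
    qed (rule cls_in h)+
    with X show "\<exists>X\<in>Obj D. \<exists>f. is_isomorphism Q (F0 X) M f" by (intro bexI exI)
  qed
qed

end

subsection \<open>Localisation at morphisms with enough local objects\<close>

locale resolved_localisation = preadditive K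
  for K :: "('o, 'm, 'x) preadd_cat_scheme" +
  fixes W :: "'o \<Rightarrow> 'o \<Rightarrow> 'm set"
  assumes W_sub: "\<lbrakk>X \<in> Obj K; Y \<in> Obj K; s \<in> W X Y\<rbrakk> \<Longrightarrow> s \<in> Hom K X Y"
    and W_id: "X \<in> Obj K \<Longrightarrow> idn K X \<in> W X X"
    and W_cmp: "\<lbrakk>X \<in> Obj K; Y \<in> Obj K; Z \<in> Obj K; s \<in> W X Y; t \<in> W Y Z\<rbrakk> \<Longrightarrow> cmp K X Y Z t s \<in> W X Z"
begin

text \<open>The second half says that \<open>Hom(P, -)\<close> turns the morphisms of
  \<open>W\<close> into bijections, as a K-projective complex does with quasi-isomorphisms. Together
  with \<open>p\<close> in \<open>W\<close> this makes \<open>P\<close> a resolution of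
  \<open>X\<close>. The behaviour of fractions out of \<open>X\<close> is drawn from such a
  \<open>P\<close>, not from square-completion axioms on \<open>W\<close>.\<close>

definition res :: "'o \<Rightarrow> 'm \<Rightarrow> 'o \<Rightarrow> bool" where
  "res P p X \<longleftrightarrow> P \<in> Obj K \<and> X \<in> Obj K \<and> p \<in> W P X \<and>
     (\<forall>A\<in>Obj K. \<forall>Z\<in>Obj K. \<forall>s\<in>W A Z. bij_betw (cmp K P A Z s) (Hom K P A) (Hom K P Z))"

abbreviation "L \<equiv> localisation K W"

text \<open>The fraction \<open>\<gamma>\<close> after the inverse of \<open>p\<close>. For a
  resolution \<open>p\<close> this is a bijection from \<open>Hom K P Y\<close> onto the morphisms
  from \<open>X\<close> to \<open>Y\<close> in the localisation, as \<open>Hom_L\<close> and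
  \<open>lam_inject\<close> show.\<close>

definition lam :: "'o \<Rightarrow> 'o \<Rightarrow> 'o \<Rightarrow> 'm \<Rightarrow> 'm \<Rightarrow> ('o \<times> 'm \<times> 'm) set" where
  "lam X Y P p \<gamma> = roof_rel K W X Y `` {(P, p, \<gamma>)}"

lemma resD:
  assumes "res P p X"
  shows "P \<in> Obj K" "X \<in> Obj K" "p \<in> W P X" "p \<in> Hom K P X"
  using assms W_sub by (auto simp: res_def)

lemma res_lift:
  assumes "res P p X" "A \<in> Obj K" "Z \<in> Obj K" "s \<in> W A Z" "g \<in> Hom K P Z"
  obtains e where "e \<in> Hom K P A" "cmp K P A Z s e = g"
proof -
  have "bij_betw (cmp K P A Z s) (Hom K P A) (Hom K P Z)" using assms by (auto simp: res_def)
  then have "g \<in> cmp K P A Z s ` Hom K P A" using assms(5) by (simp add: bij_betw_def)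
  then show thesis using that by auto
qed

lemma res_unique:
  assumes "res P p X" "A \<in> Obj K" "Z \<in> Obj K" "s \<in> W A Z" "e \<in> Hom K P A" "e' \<in> Hom K P A"
    "cmp K P A Z s e = cmp K P A Z s e'"
  shows "e = e'"
proof -
  have "bij_betw (cmp K P A Z s) (Hom K P A) (Hom K P Z)" using assms by (auto simp: res_def)
  then show ?thesis using assms(5-7) by (simp add: bij_betw_def inj_on_def)
qed

text \<open>Here \<open>e\<close> and \<open>e'\<close> are the unique lifts of \<open>p\<close>
  along \<open>s\<close> and \<open>t\<close>. A common refinement \<open>E\<close> of the two roofs
  also receives a lift \<open>d\<close> of \<open>p\<close>, and uniqueness identifies its
  composites with \<open>e\<close> and \<open>e'\<close>. Conversely \<open>P\<close>, with
  \<open>e\<close> and \<open>e'\<close>, is itself a common refinement. Equivalence of roofs thus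
  becomes an equality in \<open>Hom K P Y\<close>.\<close>

lemma roof_rel_iff:
  assumes r: "res P p X" and Y: "Y \<in> Obj K"
    and A: "A \<in> Obj K" "s \<in> W A X" "f \<in> Hom K A Y" "e \<in> Hom K P A" "cmp K P A X s e = p"
    and B: "B \<in> Obj K" "t \<in> W B X" "g \<in> Hom K B Y" "e' \<in> Hom K P B" "cmp K P B X t e' = p"
  shows "((A, s, f), (B, t, g)) \<in> roof_rel K W X Y \<longleftrightarrow> cmp K P A Y f e = cmp K P B Y g e'"
proof
  note P = resD[OF r]
  have s: "s \<in> Hom K A X" by (rule W_sub[OF A(1) P(2) A(2)])
  have t: "t \<in> Hom K B X" by (rule W_sub[OF B(1) P(2) B(2)])
  assume "((A, s, f), (B, t, g)) \<in> roof_rel K W X Y"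
  then obtain E u v where E: "E \<in> Obj K" "u \<in> Hom K E A" "v \<in> Hom K E B"
    "cmp K E A X s u = cmp K E B X t v" "cmp K E A X s u \<in> W E X"
    "cmp K E A Y f u = cmp K E B Y g v"
    unfolding roof_rel_def by auto
  obtain d where d: "d \<in> Hom K P E" "cmp K P E X (cmp K E A X s u) d = p"
    using res_lift[OF r E(1) P(2) E(5) P(4)] .
  have "cmp K P A X s (cmp K P E A u d) = cmp K P A X s e"
    using cmp_assoc[OF d(1) E(2) s P(1) E(1) A(1) P(2)] d(2) A(5) by simp
  then have e: "cmp K P E A u d = e"
    by (rule res_unique[OF r A(1) P(2) A(2) cmp_in[OF d(1) E(2) P(1) E(1) A(1)] A(4)])
  have "cmp K P B X t (cmp K P E B v d) = cmp K P B X t e'"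
    using cmp_assoc[OF d(1) E(3) t P(1) E(1) B(1) P(2)] d(2) B(5) E(4) by simp
  then have e': "cmp K P E B v d = e'"
    by (rule res_unique[OF r B(1) P(2) B(2) cmp_in[OF d(1) E(3) P(1) E(1) B(1)] B(4)])
  show "cmp K P A Y f e = cmp K P B Y g e'"
    using cmp_assoc[OF d(1) E(2) A(3) P(1) E(1) A(1) Y] cmp_assoc[OF d(1) E(3) B(3) P(1) E(1) B(1) Y]
      e e' E(6) by simp
next
  note P = resD[OF r]
  assume "cmp K P A Y f e = cmp K P B Y g e'"
  then show "((A, s, f), (B, t, g)) \<in> roof_rel K W X Y"
    unfolding roof_rel_def roofs_def using A B P
    by (auto intro!: bexI[OF _ P(1)] bexI[OF _ A(4)] bexI[OF _ B(4)])
qed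

lemma roof_lift:
  assumes "res P p X" "A \<in> Obj K" "s \<in> W A X"
  obtains e where "e \<in> Hom K P A" "cmp K P A X s e = p"
  using res_lift[OF assms(1,2) resD(2)[OF assms(1)] assms(3) resD(4)[OF assms(1)]] by blast

text \<open>The lift \<open>e\<close> exhibits \<open>P\<close> as a refinement of \<open>A\<close>,
  so any roof out of \<open>X\<close> can be rewritten with left leg \<open>p\<close>.\<close>

lemma roof_class:
  assumes r: "res P p X" and Y: "Y \<in> Obj K"
    and A: "A \<in> Obj K" "s \<in> W A X" "f \<in> Hom K A Y" "e \<in> Hom K P A" "cmp K P A X s e = p"
  shows "roof_rel K W X Y `` {(A, s, f)} = lam X Y P p (cmp K P A Y f e)"
proof -
  note P = resD[OF r]
  let ?\<gamma> = "cmp K P A Y f e"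
  have \<gamma>: "?\<gamma> \<in> Hom K P Y" using P(1) A Y by blast
  have id: "idn K P \<in> Hom K P P" "cmp K P P X p (idn K P) = p" using P by simp_all
  have "((A, s, f), z) \<in> roof_rel K W X Y \<longleftrightarrow> ((P, p, ?\<gamma>), z) \<in> roof_rel K W X Y" for z
  proof (cases "z \<in> roofs K W X Y")
    case True
    obtain B t g where z: "z = (B, t, g)" by (metis prod_cases3)
    have B: "B \<in> Obj K" "t \<in> W B X" "g \<in> Hom K B Y" using True by (auto simp: z roofs_def)
    obtain e' where e': "e' \<in> Hom K P B" "cmp K P B X t e' = p" using roof_lift[OF r B(1,2)] .
    show ?thesis
      using roof_rel_iff[OF r Y A B e'] roof_rel_iff[OF r Y P(1,3) \<gamma> id B e'] \<gamma> P Y by (simp add: z)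
  next
    case False
    then show ?thesis by (cases z) (auto simp: roof_rel_def)
  qed
  then show ?thesis unfolding lam_def by blast
qed

lemma lam_eq:
  assumes r: "res P p X" and Y: "Y \<in> Obj K" and \<gamma>: "\<gamma> \<in> Hom K P Y"
  shows "lam X Y P p \<gamma> = {(A, s, f). A \<in> Obj K \<and> s \<in> W A X \<and> f \<in> Hom K A Y \<and>
    (\<exists>e\<in>Hom K P A. cmp K P A X s e = p \<and> cmp K P A Y f e = \<gamma>)}"
proof -
  note P = resD[OF r]
  have id: "idn K P \<in> Hom K P P" "cmp K P P X p (idn K P) = p" using P by simp_all
  have "((P, p, \<gamma>), (A, s, f)) \<in> roof_rel K W X Y \<longleftrightarrow> A \<in> Obj K \<and> s \<in> W A X \<and> f \<in> Hom K A Y \<and>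
    (\<exists>e\<in>Hom K P A. cmp K P A X s e = p \<and> cmp K P A Y f e = \<gamma>)" for A s f
  proof (cases "A \<in> Obj K \<and> s \<in> W A X \<and> f \<in> Hom K A Y")
    case True
    then have A: "A \<in> Obj K" "s \<in> W A X" "f \<in> Hom K A Y" by blast+
    obtain e where e: "e \<in> Hom K P A" "cmp K P A X s e = p" using roof_lift[OF r A(1,2)] .
    have uniq: "e' = e" if "e' \<in> Hom K P A" "cmp K P A X s e' = p" for e'
      using res_unique[OF r A(1) P(2) A(2) that(1) e(1)] that(2) e(2) by simp
    have "((P, p, \<gamma>), (A, s, f)) \<in> roof_rel K W X Y \<longleftrightarrow> cmp K P A Y f e = \<gamma>"
      using roof_rel_iff[OF r Y P(1,3) \<gamma> id A e] \<gamma> P(1) Y by auto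
    then show ?thesis using A e uniq by blast
  next
    case False
    then show ?thesis by (auto simp: roof_rel_def roofs_def)
  qed
  then show ?thesis unfolding lam_def by auto
qed

text \<open>The only endomorphism \<open>e\<close> of \<open>P\<close> with \<open>p e = p\<close>
  is the identity, because \<open>p\<close> itself lies in \<open>W\<close> and lifts along it are
  unique.\<close>

lemma lam_inject:
  assumes r: "res P p X" and Y: "Y \<in> Obj K" and \<gamma>: "\<gamma> \<in> Hom K P Y" "\<gamma>' \<in> Hom K P Y"
  shows "lam X Y P p \<gamma> = lam X Y P p \<gamma>' \<longleftrightarrow> \<gamma> = \<gamma>'"
proof
  assume "lam X Y P p \<gamma> = lam X Y P p \<gamma>'"
  moreover have "(P, p, \<gamma>) \<in> lam X Y P p \<gamma>"
    unfolding lam_eq[OF r Y \<gamma>(1)] using resD[OF r] \<gamma> Y by (auto intro!: bexI[of _ "idn K P"])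
  ultimately have "(P, p, \<gamma>) \<in> lam X Y P p \<gamma>'" by simp
  then obtain e where e: "e \<in> Hom K P P" "cmp K P P X p e = p" "cmp K P P Y \<gamma> e = \<gamma>'"
    unfolding lam_eq[OF r Y \<gamma>(2)] by auto
  have "e = idn K P"
    by (rule res_unique[OF r resD(1,2,3)[OF r] e(1)]) (use e resD[OF r] in auto)
  then show "\<gamma> = \<gamma>'" using e(3) \<gamma> resD(1)[OF r] Y by simp
qed simp

section \<open>Morphisms, composition and sums in the localisation\<close>

lemma Obj_L [simp]: "Obj L = Obj K" by (simp add: localisation_def)

lemma Hom_L:
  assumes r: "res P p X" and Y: "Y \<in> Obj K"
  shows "Hom L X Y = lam X Y P p ` Hom K P Y"
proof
  show "Hom L X Y \<subseteq> lam X Y P p ` Hom K P Y"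
  proof
    fix \<phi> assume "\<phi> \<in> Hom L X Y"
    then obtain A s f where A: "A \<in> Obj K" "s \<in> W A X" "f \<in> Hom K A Y"
      and \<phi>: "\<phi> = roof_rel K W X Y `` {(A, s, f)}"
      by (auto simp: localisation_def quotient_def roofs_def)
    obtain e where e: "e \<in> Hom K P A" "cmp K P A X s e = p" using roof_lift[OF r A(1,2)] .
    show "\<phi> \<in> lam X Y P p ` Hom K P Y"
      unfolding \<phi> roof_class[OF r Y A e] using A e Y resD[OF r] by blast
  qed
  show "lam X Y P p ` Hom K P Y \<subseteq> Hom L X Y"
    using resD[OF r] by (auto simp: localisation_def quotient_def roofs_def lam_def)
qed

text \<open>Any choice of roofs and of a completed square leads to the same class. Let
  \<open>c\<close> lift to \<open>E\<close> the map from \<open>P\<close> to \<open>A\<close> that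
  belongs to the first roof, and let \<open>d\<close> be the map from \<open>Q\<close> to
  \<open>B\<close> that belongs to the second. Then \<open>f' c\<close> and
  \<open>d \<gamma>\<close> agree after the morphism \<open>t\<close> of \<open>W\<close>, hence
  agree, and the right leg pulled back to \<open>P\<close> is
  \<open>\<delta> \<gamma>\<close>.\<close>

lemma lam_cmp:
  assumes r: "res P p X" "res Q q Y" and Z: "Z \<in> Obj K" and g: "\<gamma> \<in> Hom K P Q" "\<delta> \<in> Hom K Q Z"
  shows "cmp L X Y Z (lam Y Z Q q \<delta>) (lam X Y P p (cmp K P Q Y q \<gamma>)) = lam X Z P p (cmp K P Q Z \<delta> \<gamma>)"
proof -
  note P = resD[OF r(1)] and Q = resD[OF r(2)]
  let ?\<gamma> = "cmp K P Q Y q \<gamma>"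
  have \<gamma>: "?\<gamma> \<in> Hom K P Y" using P Q g by blast
  let ?S = "{roof_rel K W X Z `` {(E, cmp K E A X s t', cmp K E B Z g f')} | A s f B t g E t' f'.
           (A, s, f) \<in> lam X Y P p ?\<gamma> \<and> (B, t, g) \<in> lam Y Z Q q \<delta> \<and> E \<in> Obj K \<and> t' \<in> W E A \<and>
           f' \<in> Hom K E B \<and> cmp K E A Y f t' = cmp K E B Y t f'}"
  have cl: "roof_rel K W X Z `` {(E, cmp K E A X s t', cmp K E B Z g f')} = lam X Z P p (cmp K P Q Z \<delta> \<gamma>)"
    if h: "(A, s, f) \<in> lam X Y P p ?\<gamma>" "(B, t, g) \<in> lam Y Z Q q \<delta>" "E \<in> Obj K" "t' \<in> W E A"
      "f' \<in> Hom K E B" "cmp K E A Y f t' = cmp K E B Y t f'" for A s f B t g E t' f'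
  proof -
    obtain e where A: "A \<in> Obj K" "s \<in> W A X" "f \<in> Hom K A Y" "e \<in> Hom K P A"
      "cmp K P A X s e = p" "cmp K P A Y f e = ?\<gamma>"
      using h(1) unfolding lam_eq[OF r(1) Q(2) \<gamma>] by auto
    obtain d where B: "B \<in> Obj K" "t \<in> W B Y" "g \<in> Hom K B Z" "d \<in> Hom K Q B"
      "cmp K Q B Y t d = q" "cmp K Q B Z g d = \<delta>"
      using h(2) unfolding lam_eq[OF r(2) Z g(2)] by auto
    have s: "s \<in> Hom K A X" by (rule W_sub[OF A(1) P(2) A(2)])
    have t: "t \<in> Hom K B Y" by (rule W_sub[OF B(1) Q(2) B(2)])
    have t': "t' \<in> Hom K E A" by (rule W_sub[OF h(3) A(1) h(4)])
    obtain c where c: "c \<in> Hom K P E" "cmp K P E A t' c = e"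
      using res_lift[OF r(1) h(3) A(1) h(4) A(4)] .
    have "cmp K P E X (cmp K E A X s t') c = p"
      using cmp_assoc[OF c(1) t' s P(1) h(3) A(1) P(2)] c(2) A(5) by simp
    then have 1: "roof_rel K W X Z `` {(E, cmp K E A X s t', cmp K E B Z g f')} =
        lam X Z P p (cmp K P E Z (cmp K E B Z g f') c)"
      by (rule roof_class[OF r(1) Z h(3) W_cmp[OF h(3) A(1) P(2) h(4) A(2)]
          cmp_in[OF h(5) B(3) h(3) B(1) Z] c(1)])
    have "cmp K P B Y t (cmp K P E B f' c) = cmp K P B Y t (cmp K P Q B d \<gamma>)"
      using cmp_assoc[OF c(1) h(5) t P(1) h(3) B(1) Q(2)] cmp_assoc[OF c(1) t' A(3) P(1) h(3) A(1) Q(2)]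
        cmp_assoc[OF g(1) B(4) t P(1) Q(1) B(1) Q(2)] h(6) c(2) A(6) B(5) by simp
    then have "cmp K P E B f' c = cmp K P Q B d \<gamma>"
      by (rule res_unique[OF r(1) B(1) Q(2) B(2) cmp_in[OF c(1) h(5) P(1) h(3) B(1)]
            cmp_in[OF g(1) B(4) P(1) Q(1) B(1)]])
    then have "cmp K P E Z (cmp K E B Z g f') c = cmp K P Q Z \<delta> \<gamma>"
      using cmp_assoc[OF c(1) h(5) B(3) P(1) h(3) B(1) Z] cmp_assoc[OF g(1) B(4) B(3) P(1) Q(1) B(1) Z]
        B(6) by simp
    with 1 show ?thesis by simp
  qed
  have "z = lam X Z P p (cmp K P Q Z \<delta> \<gamma>)" if "z \<in> ?S" for z
    using that by (elim CollectE exE conjE) (simp only: cl)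
  then have "?S \<subseteq> {lam X Z P p (cmp K P Q Z \<delta> \<gamma>)}" by blast
  \<comment> \<open>The union runs over a non-empty set: \<open>E = P\<close>, with the identity as
    \<open>t'\<close> and \<open>\<gamma>\<close> as \<open>f'\<close>, completes the
    square.\<close>
  moreover have "roof_rel K W X Z `` {(P, cmp K P P X p (idn K P), cmp K P Q Z \<delta> \<gamma>)} \<in> ?S"
  proof -
    have "(P, p, ?\<gamma>) \<in> lam X Y P p ?\<gamma>"
      unfolding lam_eq[OF r(1) Q(2) \<gamma>] using P Q \<gamma> by (auto intro!: bexI[of _ "idn K P"])
    moreover have "(Q, q, \<delta>) \<in> lam Y Z Q q \<delta>"
      unfolding lam_eq[OF r(2) Z g(2)] using Q Z g by (auto intro!: bexI[of _ "idn K Q"])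
    moreover have "cmp K P P Y ?\<gamma> (idn K P) = cmp K P Q Y q \<gamma>" using \<gamma> P Q by simp
    ultimately show ?thesis using P(1) W_id[OF P(1)] g(1) by blast
  qed
  ultimately have "?S = {lam X Z P p (cmp K P Q Z \<delta> \<gamma>)}" by blast
  then show ?thesis unfolding localisation_def by simp
qed

lemma lam_hadd:
  assumes r: "res P p X" and Y: "Y \<in> Obj K" and g: "\<gamma> \<in> Hom K P Y" "\<delta> \<in> Hom K P Y"
  shows "hadd L X Y (lam X Y P p \<gamma>) (lam X Y P p \<delta>) = lam X Y P p (hadd K P Y \<gamma> \<delta>)"
proof -
  note P = resD[OF r]
  let ?S = "{roof_rel K W X Y `` {(A, s, hadd K A Y f g)} | A s f g.
           (A, s, f) \<in> lam X Y P p \<gamma> \<and> (A, s, g) \<in> lam X Y P p \<delta>}"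
  have cl: "roof_rel K W X Y `` {(A, s, hadd K A Y f g)} = lam X Y P p (hadd K P Y \<gamma> \<delta>)"
    if h: "(A, s, f) \<in> lam X Y P p \<gamma>" "(A, s, g) \<in> lam X Y P p \<delta>" for A s f g
  proof -
    obtain e where A: "A \<in> Obj K" "s \<in> W A X" "f \<in> Hom K A Y" "e \<in> Hom K P A"
      "cmp K P A X s e = p" "cmp K P A Y f e = \<gamma>"
      using h(1) unfolding lam_eq[OF r Y g(1)] by auto
    obtain d where B: "g \<in> Hom K A Y" "d \<in> Hom K P A" "cmp K P A X s d = p" "cmp K P A Y g d = \<delta>"
      using h(2) unfolding lam_eq[OF r Y g(2)] by auto
    \<comment> \<open>Both right legs sit over the same left leg \<open>s\<close>, and the lift of
      \<open>p\<close> along \<open>s\<close> is unique; so the two numerators are pulled back along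
      the same map and can be added.\<close>
    have "d = e" using res_unique[OF r A(1) P(2) A(2) B(2) A(4)] A(5) B(3) by simp
    then show ?thesis
      using roof_class[OF r Y A(1,2) hadd_in[OF A(3) B(1) A(1) Y] A(4,5)]
        cmp_hadd_left[OF A(4,3) B(1) P(1) A(1) Y] A(6) B(4) by simp
  qed
  have "z = lam X Y P p (hadd K P Y \<gamma> \<delta>)" if "z \<in> ?S" for z
    using that by (elim CollectE exE conjE) (simp only: cl)
  then have "?S \<subseteq> {lam X Y P p (hadd K P Y \<gamma> \<delta>)}" by blast
  moreover have "roof_rel K W X Y `` {(P, p, hadd K P Y \<gamma> \<delta>)} \<in> ?S"
  proof -
    have "(P, p, \<gamma>) \<in> lam X Y P p \<gamma>" if "\<gamma> \<in> Hom K P Y" for \<gamma>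
      unfolding lam_eq[OF r Y that] using P Y that by (auto intro!: bexI[of _ "idn K P"])
    from this[OF g(1)] this[OF g(2)] show ?thesis by blast
  qed
  ultimately have "?S = {lam X Y P p (hadd K P Y \<gamma> \<delta>)}" by blast
  then show ?thesis unfolding localisation_def by simp
qed

lemma lam_hzero:
  assumes r: "res P p X" and Y: "Y \<in> Obj K"
  shows "hzero L X Y = lam X Y P p (hzero K P Y)"
  using roof_class[OF r Y resD(2)[OF r] W_id[OF resD(2)[OF r]] hzero_in[OF resD(2)[OF r] Y] resD(4)[OF r]]
    resD[OF r] Y by (simp add: localisation_def)

lemma lam_idn:
  assumes r: "res P p X"
  shows "idn L X = lam X X P p p"
  using roof_class[OF r resD(2)[OF r] resD(2)[OF r] W_id[OF resD(2)[OF r]] id_in[OF resD(2)[OF r]] resD(4)[OF r]]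
    resD[OF r] by (simp add: localisation_def)

lemma L_comm_group:
  assumes r: "res P p X" and Y: "Y \<in> Obj K"
  shows "comm_group (hom_group L X Y)"
  by (rule comm_group_surj_hom[OF hom_comm_group[OF resD(1)[OF r] Y], of "lam X Y P p"])
    (use Hom_L[OF r Y] lam_hadd[OF r Y] lam_hzero[OF r Y] in \<open>simp_all add: hom_group_def\<close>)

lemma lam_finprod:
  assumes r: "res P p X" and Y: "Y \<in> Obj K" and "finite S" and "\<And>i. i \<in> S \<Longrightarrow> g i \<in> Hom K P Y"
  shows "finprod (hom_group L X Y) (\<lambda>i. lam X Y P p (g i)) S =
    lam X Y P p (finprod (hom_group K P Y) g S)"
proof -
  interpret G: comm_group "hom_group K P Y" by (rule hom_comm_group[OF resD(1)[OF r] Y])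
  interpret H: comm_group "hom_group L X Y" by (rule L_comm_group[OF r Y])
  note hs = Hom_L[OF r Y] hom_group_def
  show ?thesis
    using assms(3,4)
  proof induction
    case empty
    show ?case unfolding G.finprod_empty H.finprod_empty using lam_hzero[OF r Y] by (simp add: hom_group_def)
  next
    case (insert i S)
    have 1: "g \<in> S \<rightarrow> carrier (hom_group K P Y)" "g i \<in> carrier (hom_group K P Y)"
      using insert.prems by (auto simp: hom_group_def)
    then have 2: "(\<lambda>i. lam X Y P p (g i)) \<in> S \<rightarrow> carrier (hom_group L X Y)"
      "lam X Y P p (g i) \<in> carrier (hom_group L X Y)" by (auto simp: hs)
    have 3: "finprod (hom_group K P Y) g S \<in> Hom K P Y"
      using G.finprod_closed[OF 1(1)] by (simp add: hom_group_def)
    have "finprod (hom_group L X Y) (\<lambda>i. lam X Y P p (g i)) (insert i S) =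
      hadd L X Y (lam X Y P p (g i)) (lam X Y P p (finprod (hom_group K P Y) g S))"
      using H.finprod_insert[OF insert.hyps(1,2) 2] insert.IH insert.prems by (simp add: hom_group_def)
    also have "\<dots> = lam X Y P p (finprod (hom_group K P Y) g (insert i S))"
      using lam_hadd[OF r Y _ 3, of "g i"] G.finprod_insert[OF insert.hyps(1,2) 1] insert.prems
      by (simp add: hom_group_def)
    finally show ?case .
  qed
qed

text \<open>A functor with a strict inverse, both preserving \<open>W\<close>, carries a full class
  of roofs onto a full class: the witness \<open>e\<close> of membership is transported by
  \<open>S1\<close> in one direction and by \<open>T1\<close> in the other. It is meant for the
  shift by i and the shift by -i.\<close>

lemma lam_image:
  assumes r: "res P p X" "res (S0 P) (S1 p) (S0 X)" and Y: "Y \<in> Obj K" "S0 Y \<in> Obj K"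
    and \<gamma>: "\<gamma> \<in> Hom K P Y"
    and S: "\<And>A. A \<in> Obj K \<Longrightarrow> S0 A \<in> Obj K"
      "\<And>A B f. \<lbrakk>A \<in> Obj K; B \<in> Obj K; f \<in> Hom K A B\<rbrakk> \<Longrightarrow> S1 f \<in> Hom K (S0 A) (S0 B)"
      "\<And>A B f. \<lbrakk>A \<in> Obj K; B \<in> Obj K; f \<in> W A B\<rbrakk> \<Longrightarrow> S1 f \<in> W (S0 A) (S0 B)"
      "\<And>A B C f g. \<lbrakk>A \<in> Obj K; B \<in> Obj K; C \<in> Obj K; f \<in> Hom K A B; g \<in> Hom K B C\<rbrakk> \<Longrightarrow>
        S1 (cmp K A B C g f) = cmp K (S0 A) (S0 B) (S0 C) (S1 g) (S1 f)"
    and T: "\<And>A. A \<in> Obj K \<Longrightarrow> T0 A \<in> Obj K"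
      "\<And>A B f. \<lbrakk>A \<in> Obj K; B \<in> Obj K; f \<in> Hom K A B\<rbrakk> \<Longrightarrow> T1 f \<in> Hom K (T0 A) (T0 B)"
      "\<And>A B f. \<lbrakk>A \<in> Obj K; B \<in> Obj K; f \<in> W A B\<rbrakk> \<Longrightarrow> T1 f \<in> W (T0 A) (T0 B)"
      "\<And>A B C f g. \<lbrakk>A \<in> Obj K; B \<in> Obj K; C \<in> Obj K; f \<in> Hom K A B; g \<in> Hom K B C\<rbrakk> \<Longrightarrow>
        T1 (cmp K A B C g f) = cmp K (T0 A) (T0 B) (T0 C) (T1 g) (T1 f)"
    and ST: "\<And>A. A \<in> Obj K \<Longrightarrow> S0 (T0 A) = A" "\<And>A. A \<in> Obj K \<Longrightarrow> T0 (S0 A) = A"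
      "\<And>f. S1 (T1 f) = f" "\<And>f. T1 (S1 f) = f"
  shows "(\<lambda>(A, s, f). (S0 A, S1 s, S1 f)) ` lam X Y P p \<gamma> = lam (S0 X) (S0 Y) (S0 P) (S1 p) (S1 \<gamma>)"
proof -
  note P = resD[OF r(1)] and SP = resD[OF r(2)]
  have S\<gamma>: "S1 \<gamma> \<in> Hom K (S0 P) (S0 Y)" by (rule S(2)[OF P(1) Y(1) \<gamma>])
  show ?thesis
  proof (rule Set.equalityI; rule subsetI)
    fix z assume "z \<in> (\<lambda>(A, s, f). (S0 A, S1 s, S1 f)) ` lam X Y P p \<gamma>"
    then obtain A s f where z: "z = (S0 A, S1 s, S1 f)" and "(A, s, f) \<in> lam X Y P p \<gamma>" by auto
    then obtain e where A: "A \<in> Obj K" "s \<in> W A X" "f \<in> Hom K A Y" "e \<in> Hom K P A"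
      "cmp K P A X s e = p" "cmp K P A Y f e = \<gamma>"
      unfolding lam_eq[OF r(1) Y(1) \<gamma>] by auto
    have "S1 e \<in> Hom K (S0 P) (S0 A)" by (rule S(2)[OF P(1) A(1,4)])
    moreover have "cmp K (S0 P) (S0 A) (S0 X) (S1 s) (S1 e) = S1 p"
      using S(4)[OF P(1) A(1) P(2) A(4) W_sub[OF A(1) P(2) A(2)]] unfolding A(5) by (rule sym)
    moreover have "cmp K (S0 P) (S0 A) (S0 Y) (S1 f) (S1 e) = S1 \<gamma>"
      using S(4)[OF P(1) A(1) Y(1) A(4,3)] unfolding A(6) by (rule sym)
    ultimately have "\<exists>e\<in>Hom K (S0 P) (S0 A). cmp K (S0 P) (S0 A) (S0 X) (S1 s) e = S1 p \<and>
        cmp K (S0 P) (S0 A) (S0 Y) (S1 f) e = S1 \<gamma>" by blast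
    then have "(S0 A, S1 s, S1 f) \<in> lam (S0 X) (S0 Y) (S0 P) (S1 p) (S1 \<gamma>)"
      using S(1)[OF A(1)] S(3)[OF A(1) P(2) A(2)] S(2)[OF A(1) Y(1) A(3)]
      by (subst lam_eq[OF r(2) Y(2) S\<gamma>]) (simp only: mem_Collect_eq prod.case)
    then show "z \<in> lam (S0 X) (S0 Y) (S0 P) (S1 p) (S1 \<gamma>)" by (simp only: z)
  next
    fix z assume "z \<in> lam (S0 X) (S0 Y) (S0 P) (S1 p) (S1 \<gamma>)"
    moreover obtain A s f where z: "z = (A, s, f)" by (rule prod_cases3)
    ultimately have "(A, s, f) \<in> lam (S0 X) (S0 Y) (S0 P) (S1 p) (S1 \<gamma>)" by (simp only:)
    then obtain e where A: "A \<in> Obj K" "s \<in> W A (S0 X)" "f \<in> Hom K A (S0 Y)" "e \<in> Hom K (S0 P) A"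
      "cmp K (S0 P) A (S0 X) s e = S1 p" "cmp K (S0 P) A (S0 Y) f e = S1 \<gamma>"
      unfolding lam_eq[OF r(2) Y(2) S\<gamma>] by auto
    have "T1 e \<in> Hom K P (T0 A)" using T(2)[OF SP(1) A(1,4)] unfolding ST(2)[OF P(1)] .
    moreover have "cmp K P (T0 A) X (T1 s) (T1 e) = p"
      using T(4)[OF SP(1) A(1) SP(2) A(4) W_sub[OF A(1) SP(2) A(2)]]
      unfolding A(5) ST(2)[OF P(1)] ST(2)[OF P(2)] ST(4) by (rule sym)
    moreover have "cmp K P (T0 A) Y (T1 f) (T1 e) = \<gamma>"
      using T(4)[OF SP(1) A(1) Y(2) A(4,3)] unfolding A(6) ST(2)[OF P(1)] ST(2)[OF Y(1)] ST(4) by (rule sym)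
    ultimately have "\<exists>e\<in>Hom K P (T0 A). cmp K P (T0 A) X (T1 s) e = p \<and>
        cmp K P (T0 A) Y (T1 f) e = \<gamma>" by blast
    then have "(T0 A, T1 s, T1 f) \<in> lam X Y P p \<gamma>"
      unfolding lam_eq[OF r(1) Y(1) \<gamma>] mem_Collect_eq prod.case
      using T(1)[OF A(1)] T(3)[OF A(1) SP(2) A(2)] T(2)[OF A(1) Y(2) A(3)]
      unfolding ST(2)[OF P(2)] ST(2)[OF Y(1)] by blast
    moreover have "z = (\<lambda>(A, s, f). (S0 A, S1 s, S1 f)) (T0 A, T1 s, T1 f)"
      by (simp add: z ST(1)[OF A(1)] ST(3))
    ultimately show "z \<in> (\<lambda>(A, s, f). (S0 A, S1 s, S1 f)) ` lam X Y P p \<gamma>" by (rule rev_image_eqI)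
  qed
qed

end

section \<open>Finitely generated projective modules\<close>

lemma (in abelian_group) add_eq_self_zero: "\<lbrakk>x \<in> carrier G; y \<in> carrier G; x \<oplus> y = x\<rbrakk> \<Longrightarrow> y = \<zero>"
  by (simp add: add.l_cancel_one)

lemma (in abelian_group) eq_add_minus: "\<lbrakk>x \<in> carrier G; y \<in> carrier G\<rbrakk> \<Longrightarrow> x = y \<oplus> (x \<ominus> y)"
  by (simp add: minus_eq a_lcomm r_neg)

lemma (in abelian_group) minus_eq_if_eq_add:
  "\<lbrakk>x = y \<oplus> z; y \<in> carrier G; z \<in> carrier G\<rbrakk> \<Longrightarrow> x \<ominus> z = y"
  by (simp add: minus_eq a_assoc r_neg)

lemma (in abelian_group) eq_add_if_minus_eq:
  "\<lbrakk>x \<ominus> z = y; x \<in> carrier G; z \<in> carrier G\<rbrakk> \<Longrightarrow> x = y \<oplus> z"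
  by (auto simp add: minus_eq a_assoc l_neg)

lemma (in abelian_group) minus_self: "x \<in> carrier G \<Longrightarrow> x \<ominus> x = \<zero>"
  by (simp add: minus_eq r_neg)

lemma (in abelian_group) minus_zero_right: "x \<in> carrier G \<Longrightarrow> x \<ominus> \<zero> = x"
  by (simp add: minus_eq)

context right_module
begin

lemma smult_l_null:
  assumes "x \<in> carrier M"
  shows "\<zero> \<odot>\<^bsub>M\<^esub> x = \<zero>\<^bsub>M\<^esub>"
proof (rule M.add_eq_self_zero)
  show "\<zero> \<odot>\<^bsub>M\<^esub> x \<oplus>\<^bsub>M\<^esub> \<zero> \<odot>\<^bsub>M\<^esub> x = \<zero> \<odot>\<^bsub>M\<^esub> x"
    by (subst smult_scalar_distr[symmetric]) (simp_all add: assms)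
qed (simp_all add: smult_closed assms)

lemma smult_r_null:
  assumes "a \<in> carrier R"
  shows "a \<odot>\<^bsub>M\<^esub> \<zero>\<^bsub>M\<^esub> = \<zero>\<^bsub>M\<^esub>"
proof (rule M.add_eq_self_zero)
  show "a \<odot>\<^bsub>M\<^esub> \<zero>\<^bsub>M\<^esub> \<oplus>\<^bsub>M\<^esub> a \<odot>\<^bsub>M\<^esub> \<zero>\<^bsub>M\<^esub> = a \<odot>\<^bsub>M\<^esub> \<zero>\<^bsub>M\<^esub>"
    by (subst smult_vector_distr[symmetric]) (simp_all add: assms)
qed (simp_all add: smult_closed assms)

lemma smult_minus: "\<lbrakk>a \<in> carrier R; x \<in> carrier M\<rbrakk> \<Longrightarrow> a \<odot>\<^bsub>M\<^esub> (\<ominus>\<^bsub>M\<^esub> x) = \<ominus>\<^bsub>M\<^esub> (a \<odot>\<^bsub>M\<^esub> x)"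
  by (rule M.minus_equality[symmetric], subst smult_vector_distr[symmetric])
    (simp_all add: smult_closed M.l_neg smult_r_null)

lemma smult_neg_one: "x \<in> carrier M \<Longrightarrow> (\<ominus> \<one>) \<odot>\<^bsub>M\<^esub> x = \<ominus>\<^bsub>M\<^esub> x"
  using smult_scalar_distr[of "\<ominus> \<one>" \<one> x]
  by (intro M.minus_equality[symmetric]) (simp_all add: smult_closed R.l_neg smult_l_null smult_one)

lemma smult_finsum:
  assumes "a \<in> carrier R" "finite S" "\<And>k. k \<in> S \<Longrightarrow> g k \<in> carrier M"
  shows "a \<odot>\<^bsub>M\<^esub> (\<Oplus>\<^bsub>M\<^esub>k\<in>S. g k) = (\<Oplus>\<^bsub>M\<^esub>k\<in>S. a \<odot>\<^bsub>M\<^esub> g k)"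
  using assms(2,3)
proof induction
  case empty
  then show ?case by (simp add: smult_r_null assms(1))
next
  case (insert i S)
  then have "g \<in> S \<rightarrow> carrier M" "g i \<in> carrier M" "(\<lambda>k. a \<odot>\<^bsub>M\<^esub> g k) \<in> S \<rightarrow> carrier M"
    using assms(1) by (auto intro: smult_closed)
  then show ?case using insert assms(1) by (simp add: smult_vector_distr smult_closed)
qed

end

lemma rm_group: "right_module R M \<Longrightarrow> abelian_group M"
  by (rule right_module.axioms(2))

lemma rm_ring: "right_module R M \<Longrightarrow> ring R"
  by (rule right_module.axioms(1))

text \<open>\<open>mod_hom\<close> without extensionality. Composites, sums and restrictions to
  submodules can then be written as plain functions; \<open>lin_restrict\<close> returns to
  \<open>mod_hom\<close> where equality of morphisms matters.\<close>

definition lin ::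
  "('a, 'r) ring_scheme \<Rightarrow> ('a, 'b, 'c) module_scheme \<Rightarrow> ('a, 'd, 'e) module_scheme \<Rightarrow> ('b \<Rightarrow> 'd) \<Rightarrow> bool"
where
  "lin R M N f \<longleftrightarrow> (\<forall>x\<in>carrier M. f x \<in> carrier N) \<and>
     (\<forall>x\<in>carrier M. \<forall>y\<in>carrier M. f (x \<oplus>\<^bsub>M\<^esub> y) = f x \<oplus>\<^bsub>N\<^esub> f y) \<and>
     (\<forall>a\<in>carrier R. \<forall>x\<in>carrier M. f (a \<odot>\<^bsub>M\<^esub> x) = a \<odot>\<^bsub>N\<^esub> f x)"

lemma linI:
  assumes "\<And>x. x \<in> carrier M \<Longrightarrow> f x \<in> carrier N"
    and "\<And>x y. \<lbrakk>x \<in> carrier M; y \<in> carrier M\<rbrakk> \<Longrightarrow> f (x \<oplus>\<^bsub>M\<^esub> y) = f x \<oplus>\<^bsub>N\<^esub> f y"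
    and "\<And>a x. \<lbrakk>a \<in> carrier R; x \<in> carrier M\<rbrakk> \<Longrightarrow> f (a \<odot>\<^bsub>M\<^esub> x) = a \<odot>\<^bsub>N\<^esub> f x"
  shows "lin R M N f"
  using assms by (simp add: lin_def)

lemma lin_closed: "lin R M N f \<Longrightarrow> x \<in> carrier M \<Longrightarrow> f x \<in> carrier N"
  and lin_add: "lin R M N f \<Longrightarrow> x \<in> carrier M \<Longrightarrow> y \<in> carrier M \<Longrightarrow> f (x \<oplus>\<^bsub>M\<^esub> y) = f x \<oplus>\<^bsub>N\<^esub> f y"
  and lin_smult: "lin R M N f \<Longrightarrow> a \<in> carrier R \<Longrightarrow> x \<in> carrier M \<Longrightarrow> f (a \<odot>\<^bsub>M\<^esub> x) = a \<odot>\<^bsub>N\<^esub> f x"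
  by (simp_all add: lin_def)

lemma mod_hom_iff: "f \<in> mod_hom R M N \<longleftrightarrow> lin R M N f \<and> f \<in> extensional (carrier M)"
  by (auto simp: mod_hom_def lin_def PiE_def)

lemma mod_hom_lin: "f \<in> mod_hom R M N \<Longrightarrow> lin R M N f"
  by (simp add: mod_hom_iff)

lemma mod_hom_eqI:
  "\<lbrakk>f \<in> mod_hom R M N; g \<in> mod_hom R M N; \<And>x. x \<in> carrier M \<Longrightarrow> f x = g x\<rbrakk> \<Longrightarrow> f = g"
  by (auto simp: mod_hom_iff intro: extensionalityI)

lemma lin_zero:
  assumes "lin R M N f" "right_module R M" "right_module R N"
  shows "f \<zero>\<^bsub>M\<^esub> = \<zero>\<^bsub>N\<^esub>"
proof -
  interpret M: abelian_group M by (rule rm_group[OF assms(2)])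
  interpret N: abelian_group N by (rule rm_group[OF assms(3)])
  have "f \<zero>\<^bsub>M\<^esub> \<oplus>\<^bsub>N\<^esub> f \<zero>\<^bsub>M\<^esub> = f \<zero>\<^bsub>M\<^esub>"
    using lin_add[OF assms(1), of "\<zero>\<^bsub>M\<^esub>" "\<zero>\<^bsub>M\<^esub>"] by simp
  then show ?thesis using N.add_eq_self_zero lin_closed[OF assms(1)] by simp
qed

lemma lin_neg:
  assumes "lin R M N f" "right_module R M" "right_module R N" "x \<in> carrier M"
  shows "f (\<ominus>\<^bsub>M\<^esub> x) = \<ominus>\<^bsub>N\<^esub> f x"
proof -
  interpret M: abelian_group M by (rule rm_group[OF assms(2)])
  interpret N: abelian_group N by (rule rm_group[OF assms(3)])
  have "f (\<ominus>\<^bsub>M\<^esub> x) \<oplus>\<^bsub>N\<^esub> f x = \<zero>\<^bsub>N\<^esub>"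
    using lin_add[OF assms(1), of "\<ominus>\<^bsub>M\<^esub> x" x] lin_zero[OF assms(1-3)] assms(4) by (simp add: M.l_neg)
  then show ?thesis using N.minus_equality lin_closed[OF assms(1)] assms(4) by simp
qed

lemma lin_minus:
  assumes "lin R M N f" "right_module R M" "right_module R N" "x \<in> carrier M" "y \<in> carrier M"
  shows "f (x \<ominus>\<^bsub>M\<^esub> y) = f x \<ominus>\<^bsub>N\<^esub> f y"
proof -
  interpret M: abelian_group M by (rule rm_group[OF assms(2)])
  show ?thesis using assms by (simp add: a_minus_def lin_add[OF assms(1)] lin_neg[OF assms(1-3)])
qed

lemma lin_cong:
  assumes "lin R M N f" "right_module R M" "\<And>x. x \<in> carrier M \<Longrightarrow> g x = f x"
  shows "lin R M N g"
proof -
  interpret M: right_module R M by fact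
  show ?thesis
    by (rule linI) (simp_all add: assms(3) M.smult_closed lin_closed[OF assms(1)] lin_add[OF assms(1)]
        lin_smult[OF assms(1)])
qed

lemma lin_restrict:
  assumes "lin R M N f" "right_module R M"
  shows "restrict f (carrier M) \<in> mod_hom R M N"
  using lin_cong[OF assms, of "restrict f (carrier M)"] by (simp add: mod_hom_iff)

lemma lin_comp: "\<lbrakk>lin R M N f; lin R N L g\<rbrakk> \<Longrightarrow> lin R M L (\<lambda>x. g (f x))"
  by (simp add: lin_def)

lemma lin_id: "lin R M M (\<lambda>x. x)"
  by (simp add: lin_def)

lemma lin_const_zero:
  assumes "right_module R N"
  shows "lin R M N (\<lambda>x. \<zero>\<^bsub>N\<^esub>)"
proof -
  interpret N: right_module R N by fact
  show ?thesis by (rule linI) (simp_all add: N.smult_r_null)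
qed

lemma lin_sum:
  assumes "right_module R M" "right_module R N" "lin R M N f" "lin R M N g"
  shows "lin R M N (\<lambda>x. f x \<oplus>\<^bsub>N\<^esub> g x)"
proof -
  interpret M: right_module R M by fact
  interpret N: right_module R N by fact
  show ?thesis
    by (rule linI) (simp_all add: lin_closed[OF assms(3)] lin_closed[OF assms(4)] lin_add[OF assms(3)]
        lin_add[OF assms(4)] lin_smult[OF assms(3)] lin_smult[OF assms(4)] N.M.a_ac N.smult_vector_distr)
qed

lemma lin_uminus:
  assumes "right_module R M" "right_module R N" "lin R M N f"
  shows "lin R M N (\<lambda>x. \<ominus>\<^bsub>N\<^esub> f x)"
proof -
  interpret M: right_module R M by fact
  interpret N: right_module R N by fact
  show ?thesis
    by (rule linI) (simp_all add: lin_closed[OF assms(3)] lin_add[OF assms(3)]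
        lin_smult[OF assms(3)] N.smult_minus N.M.minus_add)
qed

lemma lin_diff:
  assumes "right_module R M" "right_module R N" "lin R M N f" "lin R M N g"
  shows "lin R M N (\<lambda>x. f x \<ominus>\<^bsub>N\<^esub> g x)"
  unfolding a_minus_def by (intro lin_sum lin_uminus assms)

lemma lin_finsum:
  assumes "right_module R M" "right_module R N" "lin R M N f" "finite S"
    "\<And>k. k \<in> S \<Longrightarrow> g k \<in> carrier M"
  shows "f (\<Oplus>\<^bsub>M\<^esub>k\<in>S. g k) = (\<Oplus>\<^bsub>N\<^esub>k\<in>S. f (g k))"
proof -
  interpret M: abelian_group M by (rule rm_group[OF assms(1)])
  interpret N: abelian_group N by (rule rm_group[OF assms(2)])
  show ?thesis
    using assms(4,5)
  proof induction
    case empty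
    then show ?case by (simp add: lin_zero[OF assms(3,1,2)])
  next
    case (insert i S)
    then have "g \<in> S \<rightarrow> carrier M" "g i \<in> carrier M" "(\<lambda>k. f (g k)) \<in> S \<rightarrow> carrier N"
      using lin_closed[OF assms(3)] by auto
    then show ?case using insert lin_closed[OF assms(3)] by (simp add: lin_add[OF assms(3)])
  qed
qed

lemma lin_family_sum:
  assumes "right_module R M" "right_module R N" "finite S" "\<And>k. k \<in> S \<Longrightarrow> lin R M N (f k)"
  shows "lin R M N (\<lambda>x. \<Oplus>\<^bsub>N\<^esub>k\<in>S. f k x)"
proof -
  interpret M: right_module R M by fact
  interpret N: right_module R N by fact
  have cl: "(\<lambda>k. f k x) \<in> S \<rightarrow> carrier N" if "x \<in> carrier M" for x
    using lin_closed[OF assms(4)] that by auto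
  show ?thesis
  proof (rule linI)
    fix x assume x: "x \<in> carrier M"
    show "(\<Oplus>\<^bsub>N\<^esub>k\<in>S. f k x) \<in> carrier N" by (rule N.M.finsum_closed[OF cl[OF x]])
    fix y assume y: "y \<in> carrier M"
    show "(\<Oplus>\<^bsub>N\<^esub>k\<in>S. f k (x \<oplus>\<^bsub>M\<^esub> y)) = (\<Oplus>\<^bsub>N\<^esub>k\<in>S. f k x) \<oplus>\<^bsub>N\<^esub> (\<Oplus>\<^bsub>N\<^esub>k\<in>S. f k y)"
      unfolding N.M.finsum_addf[OF cl[OF x] cl[OF y], symmetric]
      using lin_closed[OF assms(4)] lin_add[OF assms(4)] x y
      by (intro N.M.finsum_cong') auto
  next
    fix a x assume x: "a \<in> carrier R" "x \<in> carrier M"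
    show "(\<Oplus>\<^bsub>N\<^esub>k\<in>S. f k (a \<odot>\<^bsub>M\<^esub> x)) = a \<odot>\<^bsub>N\<^esub> (\<Oplus>\<^bsub>N\<^esub>k\<in>S. f k x)"
      using lin_closed[OF assms(4)] lin_smult[OF assms(4)] x N.smult_closed
      by (subst N.smult_finsum[OF x(1) assms(3)]) (auto intro!: N.M.finsum_cong')
  qed
qed

lemma lin_inverse:
  assumes "right_module R M" "lin R M N f" "bij_betw f (carrier M) (carrier N)"
  obtains g where "lin R N M g" "\<And>x. x \<in> carrier M \<Longrightarrow> g (f x) = x" "\<And>y. y \<in> carrier N \<Longrightarrow> f (g y) = y"
proof
  interpret M: right_module R M by fact
  let ?g = "inv_into (carrier M) f"
  have g: "?g y \<in> carrier M" if "y \<in> carrier N" for y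
    using that assms(3) by (auto simp: bij_betw_def inv_into_into)
  show fg: "f (?g y) = y" if "y \<in> carrier N" for y
    using that assms(3) by (simp add: bij_betw_def f_inv_into_f)
  show gf: "?g (f x) = x" if "x \<in> carrier M" for x
    using that assms(3) by (simp add: bij_betw_def)
  show "lin R N M ?g"
  proof (rule linI)
    fix x y assume x: "x \<in> carrier N" and y: "y \<in> carrier N"
    have "x \<oplus>\<^bsub>N\<^esub> y = f (?g x \<oplus>\<^bsub>M\<^esub> ?g y)" by (simp add: lin_add[OF assms(2)] g fg x y)
    then show "?g (x \<oplus>\<^bsub>N\<^esub> y) = ?g x \<oplus>\<^bsub>M\<^esub> ?g y" by (simp add: gf g x y)
  next
    fix a x assume x: "a \<in> carrier R" "x \<in> carrier N"
    have "a \<odot>\<^bsub>N\<^esub> x = f (a \<odot>\<^bsub>M\<^esub> ?g x)" by (simp add: lin_smult[OF assms(2)] g fg x)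
    then show "?g (a \<odot>\<^bsub>N\<^esub> x) = a \<odot>\<^bsub>M\<^esub> ?g x" by (simp add: gf g x M.smult_closed)
  qed (rule g)
qed


subsection \<open>Submodules and generation\<close>

definition submod :: "('a, 'r) ring_scheme \<Rightarrow> ('a, 'b, 'c) module_scheme \<Rightarrow> 'b set \<Rightarrow> bool" where
  "submod R M S \<longleftrightarrow> S \<subseteq> carrier M \<and> \<zero>\<^bsub>M\<^esub> \<in> S \<and> (\<forall>x\<in>S. \<forall>y\<in>S. x \<oplus>\<^bsub>M\<^esub> y \<in> S) \<and>
     (\<forall>a\<in>carrier R. \<forall>x\<in>S. a \<odot>\<^bsub>M\<^esub> x \<in> S)"

lemma submodI:
  "\<lbrakk>S \<subseteq> carrier M; \<zero>\<^bsub>M\<^esub> \<in> S; \<And>x y. \<lbrakk>x \<in> S; y \<in> S\<rbrakk> \<Longrightarrow> x \<oplus>\<^bsub>M\<^esub> y \<in> S;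
    \<And>a x. \<lbrakk>a \<in> carrier R; x \<in> S\<rbrakk> \<Longrightarrow> a \<odot>\<^bsub>M\<^esub> x \<in> S\<rbrakk> \<Longrightarrow> submod R M S"
  by (simp add: submod_def)

lemma submod_neg:
  assumes "right_module R M" "submod R M S" "x \<in> S"
  shows "\<ominus>\<^bsub>M\<^esub> x \<in> S"
proof -
  interpret M: right_module R M by fact
  have "(\<ominus>\<^bsub>R\<^esub> \<one>\<^bsub>R\<^esub>) \<odot>\<^bsub>M\<^esub> x \<in> S" using assms by (auto simp: submod_def)
  then show ?thesis using M.smult_neg_one assms by (auto simp: submod_def subset_iff)
qed

lemma submod_finsum:
  assumes "right_module R M" "submod R M S" "finite I" "\<And>k. k \<in> I \<Longrightarrow> g k \<in> S"
  shows "(\<Oplus>\<^bsub>M\<^esub>k\<in>I. g k) \<in> S"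
proof -
  interpret M: right_module R M by fact
  show ?thesis
    using assms(3,4)
  proof induction
    case empty
    then show ?case using assms(2) by (simp add: submod_def)
  next
    case (insert i I)
    then have "g \<in> I \<rightarrow> carrier M" "g i \<in> carrier M" using assms(2) by (auto simp: submod_def)
    then show ?case using insert assms(2) by (simp add: submod_def)
  qed
qed

lemma submod_module:
  assumes M: "right_module R M" and S: "submod R M S"
  shows "right_module R (M\<lparr>carrier := S\<rparr>)"
proof -
  interpret M: right_module R M by fact
  have sub: "\<And>x. x \<in> S \<Longrightarrow> x \<in> carrier M" using S by (auto simp: submod_def)
  have "abelian_group (M\<lparr>carrier := S\<rparr>)"
  proof (rule abelian_groupI)
    fix x assume "x \<in> carrier (M\<lparr>carrier := S\<rparr>)"
    then show "\<exists>y\<in>carrier (M\<lparr>carrier := S\<rparr>). y \<oplus>\<^bsub>M\<lparr>carrier := S\<rparr>\<^esub> x = \<zero>\<^bsub>M\<lparr>carrier := S\<rparr>\<^esub>"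
      using submod_neg[OF M S] by (auto simp: sub M.M.l_neg intro!: bexI[of _ "\<ominus>\<^bsub>M\<^esub> x"])
  qed (use S in \<open>auto simp: submod_def sub M.M.a_ac\<close>)
  then show ?thesis
    by (intro right_module.intro right_module_axioms.intro)
      (use S in \<open>auto simp: submod_def sub M.R.ring_axioms M.smult_scalar_distr M.smult_vector_distr
         M.smult_assoc M.smult_one\<close>)
qed

lemma submod_incl: "submod R M S \<Longrightarrow> lin R (M\<lparr>carrier := S\<rparr>) M (\<lambda>x. x)"
  by (auto simp: submod_def lin_def)

lemma lin_corestrict: "\<lbrakk>lin R M N f; \<And>x. x \<in> carrier M \<Longrightarrow> f x \<in> S\<rbrakk> \<Longrightarrow> lin R M (N\<lparr>carrier := S\<rparr>) f"
  by (simp add: lin_def)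

lemma lin_sub: "\<lbrakk>lin R M N f; submod R M S\<rbrakk> \<Longrightarrow> lin R (M\<lparr>carrier := S\<rparr>) N f"
  by (auto simp: lin_def submod_def subset_iff)

lemma submod_vimage:
  assumes "right_module R M" "right_module R N" "lin R M N f" "submod R N S"
  shows "submod R M {x \<in> carrier M. f x \<in> S}"
proof -
  interpret M: right_module R M by fact
  show ?thesis
    using assms(4) lin_zero[OF assms(3,1,2)]
    by (intro submodI) (auto simp: submod_def lin_add[OF assms(3)] lin_smult[OF assms(3)] M.smult_closed)
qed

lemma submod_image:
  assumes "right_module R M" "right_module R N" "lin R M N f"
  shows "submod R N (f ` carrier M)"
proof (rule submodI)
  interpret M: right_module R M by fact
  show "f ` carrier M \<subseteq> carrier N" using lin_closed[OF assms(3)] by auto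
  show "\<zero>\<^bsub>N\<^esub> \<in> f ` carrier M" using lin_zero[OF assms(3,1,2)] M.M.zero_closed by (metis imageI)
  show "\<And>x y. \<lbrakk>x \<in> f ` carrier M; y \<in> f ` carrier M\<rbrakk> \<Longrightarrow> x \<oplus>\<^bsub>N\<^esub> y \<in> f ` carrier M"
    by (auto simp: lin_add[OF assms(3), symmetric])
  show "\<And>a x. \<lbrakk>a \<in> carrier R; x \<in> f ` carrier M\<rbrakk> \<Longrightarrow> a \<odot>\<^bsub>N\<^esub> x \<in> f ` carrier M"
    by (auto simp: lin_smult[OF assms(3), symmetric] M.smult_closed)
qed

lemma submod_zero:
  assumes "right_module R M"
  shows "submod R M {\<zero>\<^bsub>M\<^esub>}"
proof -
  interpret M: right_module R M by fact
  show ?thesis by (rule submodI) (auto simp: M.smult_r_null)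
qed

text \<open>The linear combinations of \<open>A\<close> form the smallest submodule containing
  \<open>A\<close>. In this form, generation can be transferred to another scalar ring or tested on
  a submodule without handling coefficient families.\<close>

lemma fin_gen_iff:
  assumes M: "right_module R M"
  shows "fin_gen R M \<longleftrightarrow>
    (\<exists>A. finite A \<and> A \<subseteq> carrier M \<and> (\<forall>S. submod R M S \<longrightarrow> A \<subseteq> S \<longrightarrow> carrier M \<subseteq> S))"
proof -
  interpret M: right_module R M by fact
  have "(\<forall>S. submod R M S \<longrightarrow> A \<subseteq> S \<longrightarrow> carrier M \<subseteq> S) \<longleftrightarrow>
      (\<forall>x\<in>carrier M. \<exists>c\<in>A \<rightarrow> carrier R. x = (\<Oplus>\<^bsub>M\<^esub>a\<in>A. c a \<odot>\<^bsub>M\<^esub> a))"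
    if A: "finite A" "A \<subseteq> carrier M" for A
  proof
    assume *: "\<forall>x\<in>carrier M. \<exists>c\<in>A \<rightarrow> carrier R. x = (\<Oplus>\<^bsub>M\<^esub>a\<in>A. c a \<odot>\<^bsub>M\<^esub> a)"
    show "\<forall>S. submod R M S \<longrightarrow> A \<subseteq> S \<longrightarrow> carrier M \<subseteq> S"
    proof (intro allI impI subsetI)
      fix S x assume S: "submod R M S" "A \<subseteq> S" and "x \<in> carrier M"
      then obtain c where c: "c \<in> A \<rightarrow> carrier R" "x = (\<Oplus>\<^bsub>M\<^esub>a\<in>A. c a \<odot>\<^bsub>M\<^esub> a)" using * by blast
      show "x \<in> S"
        unfolding c(2)
      proof (rule submod_finsum[OF M S(1) A(1)])
        fix a assume "a \<in> A"
        then have "c a \<in> carrier R" "a \<in> S" using c(1) S(2) by blast+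
        then show "c a \<odot>\<^bsub>M\<^esub> a \<in> S" using S(1) by (simp add: submod_def)
      qed
    qed
  next
    assume *: "\<forall>S. submod R M S \<longrightarrow> A \<subseteq> S \<longrightarrow> carrier M \<subseteq> S"
    define S where "S = {x. \<exists>c\<in>A \<rightarrow> carrier R. x = (\<Oplus>\<^bsub>M\<^esub>a\<in>A. c a \<odot>\<^bsub>M\<^esub> a)}"
    have cl: "(\<lambda>a. c a \<odot>\<^bsub>M\<^esub> a) \<in> A \<rightarrow> carrier M" if "c \<in> A \<rightarrow> carrier R" for c
      using that A by (auto intro!: M.smult_closed)
    have "submod R M S"
    proof (rule submodI)
      show "S \<subseteq> carrier M" using cl by (auto simp: S_def)
      have "(\<Oplus>\<^bsub>M\<^esub>a\<in>A. \<zero>\<^bsub>R\<^esub> \<odot>\<^bsub>M\<^esub> a) = (\<Oplus>\<^bsub>M\<^esub>a\<in>A. \<zero>\<^bsub>M\<^esub>)"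
        using A by (intro M.M.finsum_cong') (auto simp: M.smult_l_null)
      then have "\<zero>\<^bsub>M\<^esub> = (\<Oplus>\<^bsub>M\<^esub>a\<in>A. \<zero>\<^bsub>R\<^esub> \<odot>\<^bsub>M\<^esub> a)" by (simp add: M.M.finsum_zero)
      then show "\<zero>\<^bsub>M\<^esub> \<in> S" unfolding S_def by (intro CollectI bexI[of _ "\<lambda>_. \<zero>\<^bsub>R\<^esub>"]) auto
    next
      fix x y assume "x \<in> S" "y \<in> S"
      then obtain c d where c: "c \<in> A \<rightarrow> carrier R" "x = (\<Oplus>\<^bsub>M\<^esub>a\<in>A. c a \<odot>\<^bsub>M\<^esub> a)"
        and d: "d \<in> A \<rightarrow> carrier R" "y = (\<Oplus>\<^bsub>M\<^esub>a\<in>A. d a \<odot>\<^bsub>M\<^esub> a)" by (auto simp: S_def)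
      have "x \<oplus>\<^bsub>M\<^esub> y = (\<Oplus>\<^bsub>M\<^esub>a\<in>A. c a \<odot>\<^bsub>M\<^esub> a \<oplus>\<^bsub>M\<^esub> d a \<odot>\<^bsub>M\<^esub> a)"
        unfolding c d by (rule M.M.finsum_addf[symmetric, OF cl[OF c(1)] cl[OF d(1)]])
      also have "\<dots> = (\<Oplus>\<^bsub>M\<^esub>a\<in>A. (c a \<oplus>\<^bsub>R\<^esub> d a) \<odot>\<^bsub>M\<^esub> a)"
        using c d A by (intro M.M.finsum_cong') (auto simp: M.smult_scalar_distr subset_iff Pi_iff intro!: M.smult_closed)
      finally show "x \<oplus>\<^bsub>M\<^esub> y \<in> S"
        unfolding S_def using c d by (auto intro!: bexI[of _ "\<lambda>a. c a \<oplus>\<^bsub>R\<^esub> d a"])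
    next
      fix r x assume r: "r \<in> carrier R" and "x \<in> S"
      then obtain c where c: "c \<in> A \<rightarrow> carrier R" "x = (\<Oplus>\<^bsub>M\<^esub>a\<in>A. c a \<odot>\<^bsub>M\<^esub> a)" by (auto simp: S_def)
      have "r \<odot>\<^bsub>M\<^esub> x = (\<Oplus>\<^bsub>M\<^esub>a\<in>A. r \<odot>\<^bsub>M\<^esub> (c a \<odot>\<^bsub>M\<^esub> a))"
        unfolding c using cl[OF c(1)] by (intro M.smult_finsum[OF r A(1)]) auto
      also have "\<dots> = (\<Oplus>\<^bsub>M\<^esub>a\<in>A. (c a \<otimes>\<^bsub>R\<^esub> r) \<odot>\<^bsub>M\<^esub> a)"
        using c A r by (intro M.M.finsum_cong') (auto simp: M.smult_assoc subset_iff Pi_iff intro!: M.smult_closed)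
      finally show "r \<odot>\<^bsub>M\<^esub> x \<in> S"
        unfolding S_def using c r by (auto intro!: bexI[of _ "\<lambda>a. c a \<otimes>\<^bsub>R\<^esub> r"])
    qed
    moreover have "A \<subseteq> S"
    proof
      fix b assume b: "b \<in> A"
      have "(\<Oplus>\<^bsub>M\<^esub>a\<in>A. (if a = b then \<one>\<^bsub>R\<^esub> else \<zero>\<^bsub>R\<^esub>) \<odot>\<^bsub>M\<^esub> a) = (\<Oplus>\<^bsub>M\<^esub>a\<in>A. if b = a then a else \<zero>\<^bsub>M\<^esub>)"
        using A by (intro M.M.finsum_cong') (auto simp: M.smult_one M.smult_l_null subset_iff)
      also have "\<dots> = b" using M.M.finsum_singleton[OF b A(1), of "\<lambda>a. a"] A by auto
      finally show "b \<in> S" unfolding S_def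
        by (auto intro!: bexI[of _ "\<lambda>a. if a = b then \<one>\<^bsub>R\<^esub> else \<zero>\<^bsub>R\<^esub>"])
    qed
    ultimately have "carrier M \<subseteq> S" using * by blast
    then show "\<forall>x\<in>carrier M. \<exists>c\<in>A \<rightarrow> carrier R. x = (\<Oplus>\<^bsub>M\<^esub>a\<in>A. c a \<odot>\<^bsub>M\<^esub> a)"
      by (auto simp: S_def)
  qed
  then show ?thesis unfolding fin_gen_def by blast
qed

subsection \<open>Free modules and dual bases\<close>

definition reg :: "('a, 'r) ring_scheme \<Rightarrow> ('a, 'a) module" where
  "reg R = right_ideal_module R (carrier R)"

lemma reg_simps [simp]:
  "carrier (reg R) = carrier R" "x \<oplus>\<^bsub>reg R\<^esub> y = x \<oplus>\<^bsub>R\<^esub> y" "\<zero>\<^bsub>reg R\<^esub> = \<zero>\<^bsub>R\<^esub>"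
  "a \<odot>\<^bsub>reg R\<^esub> x = x \<otimes>\<^bsub>R\<^esub> a"
  by (simp_all add: reg_def right_ideal_module_def)

lemma reg_module:
  assumes "ring R"
  shows "right_module R (reg R)"
proof -
  interpret R: ring R by fact
  have "abelian_group (reg R)"
  proof (rule abelian_groupI)
    fix x assume "x \<in> carrier (reg R)"
    then show "\<exists>y\<in>carrier (reg R). y \<oplus>\<^bsub>reg R\<^esub> x = \<zero>\<^bsub>reg R\<^esub>"
      by (intro bexI[of _ "\<ominus>\<^bsub>R\<^esub> x"]) (simp_all add: R.l_neg)
  qed (simp_all add: R.a_ac)
  then show ?thesis
    by (intro right_module.intro right_module_axioms.intro assms)
      (simp_all add: R.r_distr R.l_distr R.m_assoc)
qed

lemma finsum_reg: "finsum (reg R) f S = finsum R f S"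
  by (simp add: finsum_def finprod_def reg_def right_ideal_module_def)

lemma right_ideal_module_eq: "right_ideal_module R I = reg R\<lparr>carrier := I\<rparr>"
  by (simp add: reg_def right_ideal_module_def)

lemma submod_reg_ideal:
  assumes R: "ring R" and I: "submod R (reg R) I"
  shows "right_ideal I R"
proof -
  interpret R: ring R by fact
  have sub: "\<And>x. x \<in> I \<Longrightarrow> x \<in> carrier R" using I by (auto simp: submod_def)
  have neg: "\<ominus>\<^bsub>R\<^esub> x \<in> I" if "x \<in> I" for x
  proof -
    have "(\<ominus>\<^bsub>R\<^esub> \<one>\<^bsub>R\<^esub>) \<odot>\<^bsub>reg R\<^esub> x \<in> I" using I that by (simp add: submod_def)
    then show ?thesis using sub[OF that] by (simp add: R.r_minus)
  qed
  have "additive_subgroup I R"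
    by (intro additive_subgroup.intro R.add.subgroupI)
      (use I neg in \<open>auto simp: submod_def a_inv_def[symmetric]\<close>)
  then show ?thesis using I by (auto simp: right_ideal_def submod_def)
qed

lemma free_module_simps [simp]:
  "carrier (free_module R I) = {v \<in> I \<rightarrow>\<^sub>E carrier R. finite {i \<in> I. v i \<noteq> \<zero>\<^bsub>R\<^esub>}}"
  "v \<oplus>\<^bsub>free_module R I\<^esub> w = (\<lambda>i\<in>I. v i \<oplus>\<^bsub>R\<^esub> w i)"
  "\<zero>\<^bsub>free_module R I\<^esub> = (\<lambda>i\<in>I. \<zero>\<^bsub>R\<^esub>)"
  "a \<odot>\<^bsub>free_module R I\<^esub> v = (\<lambda>i\<in>I. v i \<otimes>\<^bsub>R\<^esub> a)"
  by (simp_all add: free_module_def)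

lemma free_module_module:
  assumes "ring R"
  shows "right_module R (free_module R I)"
proof -
  interpret R: ring R by fact
  let ?F = "free_module R I"
  have fin: "finite {i \<in> I. f i \<noteq> \<zero>\<^bsub>R\<^esub>}"
    if "\<And>i. i \<in> I \<Longrightarrow> v i = \<zero>\<^bsub>R\<^esub> \<Longrightarrow> w i = \<zero>\<^bsub>R\<^esub> \<Longrightarrow> f i = \<zero>\<^bsub>R\<^esub>" "v \<in> carrier ?F" "w \<in> carrier ?F"
    for f v w
    by (rule finite_subset[of _ "{i \<in> I. v i \<noteq> \<zero>\<^bsub>R\<^esub>} \<union> {i \<in> I. w i \<noteq> \<zero>\<^bsub>R\<^esub>}"]) (use that in auto)
  have mem: "v i \<in> carrier R" if "v \<in> carrier ?F" "i \<in> I" for v i using that by auto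
  have ext: "v = w" if "v \<in> extensional I" "w \<in> extensional I" "\<And>i. i \<in> I \<Longrightarrow> v i = w i"
    for v w :: "'c \<Rightarrow> 'a"
    using that by (rule extensionalityI)
  have exc: "v \<in> extensional I" if "v \<in> carrier ?F" for v using that by (simp add: PiE_def)
  have "abelian_group ?F"
  proof (rule abelian_groupI)
    fix v w assume v: "v \<in> carrier ?F" and w: "w \<in> carrier ?F"
    have "finite {i \<in> I. (\<lambda>i\<in>I. v i \<oplus>\<^bsub>R\<^esub> w i) i \<noteq> \<zero>\<^bsub>R\<^esub>}" by (rule fin[OF _ v w]) simp
    then show "v \<oplus>\<^bsub>?F\<^esub> w \<in> carrier ?F" using mem[OF v] mem[OF w] by simp
    show "v \<oplus>\<^bsub>?F\<^esub> w = w \<oplus>\<^bsub>?F\<^esub> v"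
      by (rule ext) (simp_all add: mem[OF v] mem[OF w] R.a_comm)
    fix u assume u: "u \<in> carrier ?F"
    show "v \<oplus>\<^bsub>?F\<^esub> w \<oplus>\<^bsub>?F\<^esub> u = v \<oplus>\<^bsub>?F\<^esub> (w \<oplus>\<^bsub>?F\<^esub> u)"
      by (rule ext) (simp_all add: mem[OF v] mem[OF w] mem[OF u] R.a_assoc)
  next
    show "\<zero>\<^bsub>?F\<^esub> \<in> carrier ?F" by simp
  next
    fix v assume v: "v \<in> carrier ?F"
    show "\<zero>\<^bsub>?F\<^esub> \<oplus>\<^bsub>?F\<^esub> v = v" by (rule ext[OF _ exc[OF v]]) (simp_all add: mem[OF v])
    have "finite {i \<in> I. (\<lambda>i\<in>I. \<ominus>\<^bsub>R\<^esub> v i) i \<noteq> \<zero>\<^bsub>R\<^esub>}" by (rule fin[OF _ v v]) simp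
    then have "(\<lambda>i\<in>I. \<ominus>\<^bsub>R\<^esub> v i) \<in> carrier ?F" using mem[OF v] by simp
    moreover have "(\<lambda>i\<in>I. \<ominus>\<^bsub>R\<^esub> v i) \<oplus>\<^bsub>?F\<^esub> v = \<zero>\<^bsub>?F\<^esub>"
      by (rule ext) (simp_all add: mem[OF v] R.l_neg)
    ultimately show "\<exists>w\<in>carrier ?F. w \<oplus>\<^bsub>?F\<^esub> v = \<zero>\<^bsub>?F\<^esub>" by blast
  qed
  then show ?thesis
  proof (intro right_module.intro right_module_axioms.intro assms)
    fix a b v w assume a: "a \<in> carrier R"
    {
      assume v: "v \<in> carrier ?F"
      have "finite {i \<in> I. (\<lambda>i\<in>I. v i \<otimes>\<^bsub>R\<^esub> a) i \<noteq> \<zero>\<^bsub>R\<^esub>}" by (rule fin[OF _ v v]) (simp add: a)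
      then show "a \<odot>\<^bsub>?F\<^esub> v \<in> carrier ?F" using mem[OF v] a by simp
    }
    {
      assume b: "b \<in> carrier R" and v: "v \<in> carrier ?F"
      show "(a \<oplus>\<^bsub>R\<^esub> b) \<odot>\<^bsub>?F\<^esub> v = a \<odot>\<^bsub>?F\<^esub> v \<oplus>\<^bsub>?F\<^esub> b \<odot>\<^bsub>?F\<^esub> v"
        by (rule ext) (simp_all add: a b mem[OF v] R.r_distr)
      show "(a \<otimes>\<^bsub>R\<^esub> b) \<odot>\<^bsub>?F\<^esub> v = b \<odot>\<^bsub>?F\<^esub> (a \<odot>\<^bsub>?F\<^esub> v)"
        by (rule ext) (simp_all add: a b mem[OF v] R.m_assoc)
    }
    {
      assume v: "v \<in> carrier ?F" and w: "w \<in> carrier ?F"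
      show "a \<odot>\<^bsub>?F\<^esub> (v \<oplus>\<^bsub>?F\<^esub> w) = a \<odot>\<^bsub>?F\<^esub> v \<oplus>\<^bsub>?F\<^esub> a \<odot>\<^bsub>?F\<^esub> w"
        by (rule ext) (simp_all add: a mem[OF v] mem[OF w] R.l_distr)
    }
  next
    fix v assume v: "v \<in> carrier ?F"
    show "\<one>\<^bsub>R\<^esub> \<odot>\<^bsub>?F\<^esub> v = v" by (rule ext[OF _ exc[OF v]]) (simp_all add: mem[OF v])
  qed
qed

lemma free_coord_lin: "i \<in> I \<Longrightarrow> lin R (free_module R I) (reg R) (\<lambda>v. v i)"
  by (auto simp: lin_def)

definition free_unit :: "('a, 'r) ring_scheme \<Rightarrow> 'i set \<Rightarrow> 'i \<Rightarrow> 'i \<Rightarrow> 'a" where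
  "free_unit R I j = (\<lambda>i\<in>I. if i = j then \<one>\<^bsub>R\<^esub> else \<zero>\<^bsub>R\<^esub>)"

lemma free_unit_closed:
  assumes "ring R" "j \<in> I"
  shows "free_unit R I j \<in> carrier (free_module R I)"
proof -
  interpret R: ring R by fact
  have "finite {i \<in> I. free_unit R I j i \<noteq> \<zero>\<^bsub>R\<^esub>}"
    by (rule finite_subset[of _ "{j}"]) (auto simp: free_unit_def)
  then show ?thesis by (auto simp: free_unit_def)
qed

text \<open>The sum runs over a finite set \<open>J\<close> containing the support rather than over
  \<open>I\<close>, since the basis \<open>I\<close> of a free module covering a projective one may
  be infinite.\<close>

lemma free_expand:
  assumes R: "ring R" and v: "v \<in> carrier (free_module R I)"
    and J: "finite J" "J \<subseteq> I" "\<And>i. i \<in> I - J \<Longrightarrow> v i = \<zero>\<^bsub>R\<^esub>"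
  shows "(\<Oplus>\<^bsub>free_module R I\<^esub>j\<in>J. v j \<odot>\<^bsub>free_module R I\<^esub> free_unit R I j) = v"
proof -
  interpret R: ring R by fact
  let ?F = "free_module R I"
  note F = free_module_module[OF R, of I]
  interpret F: right_module R ?F by (rule F)
  have vR: "v j \<in> carrier R" if "j \<in> I" for j using v that by auto
  have cl: "v j \<odot>\<^bsub>?F\<^esub> free_unit R I j \<in> carrier ?F" if "j \<in> J" for j
  proof -
    have j: "j \<in> I" using that J(2) by blast
    show ?thesis by (rule F.smult_closed[OF vR[OF j] free_unit_closed[OF R j]])
  qed
  have "(\<Oplus>\<^bsub>?F\<^esub>j\<in>J. v j \<odot>\<^bsub>?F\<^esub> free_unit R I j) \<in> carrier ?F"
    by (rule F.M.finsum_closed, rule Pi_I, rule cl)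
  moreover have "(\<Oplus>\<^bsub>?F\<^esub>j\<in>J. v j \<odot>\<^bsub>?F\<^esub> free_unit R I j) i = v i" if i: "i \<in> I" for i
  proof -
    have "(\<Oplus>\<^bsub>?F\<^esub>j\<in>J. v j \<odot>\<^bsub>?F\<^esub> free_unit R I j) i = (\<Oplus>\<^bsub>R\<^esub>j\<in>J. (v j \<odot>\<^bsub>?F\<^esub> free_unit R I j) i)"
      by (rule lin_finsum[OF F reg_module[OF R] free_coord_lin[OF i] J(1), unfolded finsum_reg]) (rule cl)
    also have "\<dots> = (\<Oplus>\<^bsub>R\<^esub>j\<in>J. if i = j then v j else \<zero>\<^bsub>R\<^esub>)"
      using i J(2) vR by (intro R.finsum_cong') (auto simp: free_unit_def)
    also have "\<dots> = v i"
    proof (cases "i \<in> J")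
      case True
      then show ?thesis using R.finsum_singleton[OF True J(1), of v] J(2) vR by auto
    next
      case False
      then have "(\<Oplus>\<^bsub>R\<^esub>j\<in>J. if i = j then v j else \<zero>\<^bsub>R\<^esub>) = (\<Oplus>\<^bsub>R\<^esub>j\<in>J. \<zero>\<^bsub>R\<^esub>)"
        by (intro R.finsum_cong') auto
      then show ?thesis using J(3) i False by (simp add: R.finsum_zero)
    qed
    finally show ?thesis .
  qed
  ultimately show ?thesis using v by (intro extensionalityI[of _ I]) (simp_all add: PiE_def)
qed

text \<open>The dual basis criterion for finitely generated projective modules, used as the working
  notion of projectivity. The functionals \<open>f k\<close> are coordinates with respect to
  generators \<open>b k\<close> that need not be independent.\<close>

definition dual_basis ::
  "('a, 'r) ring_scheme \<Rightarrow> ('a, 'b, 'c) module_scheme \<Rightarrow> 'k set \<Rightarrow> ('k \<Rightarrow> 'b) \<Rightarrow> ('k \<Rightarrow> 'b \<Rightarrow> 'a) \<Rightarrow> bool"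
where
  "dual_basis R M J b f \<longleftrightarrow> right_module R M \<and> finite J \<and> (\<forall>k\<in>J. b k \<in> carrier M) \<and>
     (\<forall>k\<in>J. lin R M (reg R) (f k)) \<and>
     (\<forall>x\<in>carrier M. (\<Oplus>\<^bsub>M\<^esub>k\<in>J. f k x \<odot>\<^bsub>M\<^esub> b k) = x)"

lemma dual_basisD:
  assumes "dual_basis R M J b f"
  shows "right_module R M" "k \<in> J \<Longrightarrow> b k \<in> carrier M" "k \<in> J \<Longrightarrow> lin R M (reg R) (f k)"
    "\<lbrakk>k \<in> J; x \<in> carrier M\<rbrakk> \<Longrightarrow> f k x \<in> carrier R"
    "x \<in> carrier M \<Longrightarrow> (\<Oplus>\<^bsub>M\<^esub>k\<in>J. f k x \<odot>\<^bsub>M\<^esub> b k) = x"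
  using assms lin_closed[of R M "reg R" "f k" x] by (simp_all add: dual_basis_def)

text \<open>The index set is an initial segment of the naturals so that the existential ranges over
  a single type; \<open>fgpI\<close> reindexes any other finite set.\<close>

definition fgp :: "('a, 'r) ring_scheme \<Rightarrow> ('a, 'b, 'c) module_scheme \<Rightarrow> bool" where
  "fgp R M \<longleftrightarrow> (\<exists>n b f. dual_basis R M {..<n::nat} b f)"

lemma fgpI:
  assumes "dual_basis R M J b f"
  shows "fgp R M"
proof -
  have M: "right_module R M" and J: "finite J" "\<And>k. k \<in> J \<Longrightarrow> b k \<in> carrier M"
    "\<And>k. k \<in> J \<Longrightarrow> lin R M (reg R) (f k)"
    and eq: "\<And>x. x \<in> carrier M \<Longrightarrow> (\<Oplus>\<^bsub>M\<^esub>k\<in>J. f k x \<odot>\<^bsub>M\<^esub> b k) = x"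
    using assms by (auto simp: dual_basis_def)
  interpret M: right_module R M by (rule M)
  obtain h where h: "bij_betw h {0..<card J} J" using ex_bij_betw_nat_finite[OF J(1)] by blast
  then have hJ: "inj_on h {..<card J}" "h ` {..<card J} = J"
    by (simp_all add: bij_betw_def atLeast0LessThan)
  then have hk: "h k \<in> J" if "k < card J" for k using that by auto
  have "(\<Oplus>\<^bsub>M\<^esub>k\<in>{..<card J}. f (h k) x \<odot>\<^bsub>M\<^esub> b (h k)) = x" if x: "x \<in> carrier M" for x
  proof -
    have "(\<lambda>k. f k x \<odot>\<^bsub>M\<^esub> b k) \<in> h ` {..<card J} \<rightarrow> carrier M"
      unfolding hJ(2) using J(2) lin_closed[OF J(3) x] by (auto intro!: M.smult_closed)
    from M.M.finsum_reindex[OF this hJ(1)] show ?thesis using eq[OF x] by (simp add: hJ(2))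
  qed
  then have "dual_basis R M {..<card J} (\<lambda>k. b (h k)) (\<lambda>k. f (h k))"
    unfolding dual_basis_def using M J hk by simp
  then show ?thesis unfolding fgp_def by blast
qed

lemma fgp_module: "fgp R M \<Longrightarrow> right_module R M"
  by (auto simp: fgp_def dual_basis_def)

text \<open>The \<open>b k\<close> may satisfy relations, so \<open>E (b k) = y k\<close> can fail.
  What survives is that, if \<open>\<phi>\<close> sends each \<open>y k\<close> to
  \<open>\<alpha> (b k)\<close>, then expanding x in the dual basis gives
  \<open>\<phi> (E x) = \<alpha> x\<close>. This is exactly what a lifting problem needs.\<close>

lemma dual_basis_extend:
  assumes db: "dual_basis R M J b f" and N: "right_module R N" and y: "\<And>k. k \<in> J \<Longrightarrow> y k \<in> carrier N"
  defines "E \<equiv> \<lambda>x. \<Oplus>\<^bsub>N\<^esub>k\<in>J. f k x \<odot>\<^bsub>N\<^esub> y k"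
  shows "lin R M N E"
    and "\<And>x L \<phi> \<alpha>. \<lbrakk>x \<in> carrier M; right_module R L; lin R N L \<phi>; lin R M L \<alpha>;
      \<And>k. k \<in> J \<Longrightarrow> \<phi> (y k) = \<alpha> (b k)\<rbrakk> \<Longrightarrow> \<phi> (E x) = \<alpha> x"
proof -
  have M: "right_module R M" and J: "finite J" "\<And>k. k \<in> J \<Longrightarrow> b k \<in> carrier M"
    "\<And>k. k \<in> J \<Longrightarrow> lin R M (reg R) (f k)"
    and eq: "\<And>x. x \<in> carrier M \<Longrightarrow> (\<Oplus>\<^bsub>M\<^esub>k\<in>J. f k x \<odot>\<^bsub>M\<^esub> b k) = x"
    using db by (auto simp: dual_basis_def)
  interpret M: right_module R M by (rule M)
  interpret N: right_module R N by (rule N)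
  have fR: "f k x \<in> carrier R" if "k \<in> J" "x \<in> carrier M" for k x
    using lin_closed[OF J(3)] that by simp
  show "lin R M N E"
    unfolding E_def
  proof (rule lin_family_sum[OF M N J(1)])
    fix k assume k: "k \<in> J"
    show "lin R M N (\<lambda>x. f k x \<odot>\<^bsub>N\<^esub> y k)"
      using y[OF k] fR[OF k] lin_add[OF J(3)[OF k]] lin_smult[OF J(3)[OF k]]
      by (intro linI) (simp_all add: N.smult_closed N.smult_scalar_distr N.smult_assoc)
  qed
  fix x L \<phi> \<alpha>
  assume x: "x \<in> carrier M" and L: "right_module R L" and \<phi>: "lin R N L \<phi>" and \<alpha>: "lin R M L \<alpha>"
    and eq2: "\<And>k. k \<in> J \<Longrightarrow> \<phi> (y k) = \<alpha> (b k)"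
  interpret L: right_module R L by (rule L)
  have "\<phi> (E x) = (\<Oplus>\<^bsub>L\<^esub>k\<in>J. \<phi> (f k x \<odot>\<^bsub>N\<^esub> y k))"
    unfolding E_def by (rule lin_finsum[OF N L \<phi> J(1)]) (simp add: N.smult_closed fR x y)
  also have "\<dots> = (\<Oplus>\<^bsub>L\<^esub>k\<in>J. \<alpha> (f k x \<odot>\<^bsub>M\<^esub> b k))"
    using fR x y J(2) eq2 lin_closed[OF \<alpha>]
    by (intro L.M.finsum_cong') (simp_all add: lin_smult[OF \<phi>] lin_smult[OF \<alpha>] L.smult_closed)
  also have "\<dots> = \<alpha> (\<Oplus>\<^bsub>M\<^esub>k\<in>J. f k x \<odot>\<^bsub>M\<^esub> b k)"
    by (rule lin_finsum[OF M L \<alpha> J(1), symmetric]) (simp add: M.smult_closed fR x J(2))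
  finally show "\<phi> (E x) = \<alpha> x" by (simp add: eq[OF x])
qed

section \<open>Lifting and splitting with finitely generated projective modules\<close>

lemma fgp_lift:
  assumes M: "fgp R M" and N: "right_module R N" "right_module R L" and \<phi>: "lin R N L \<phi>" and \<alpha>: "lin R M L \<alpha>"
    and ex: "\<And>x. x \<in> carrier M \<Longrightarrow> \<exists>y\<in>carrier N. \<phi> y = \<alpha> x"
  obtains y where "lin R M N y" "\<And>x. x \<in> carrier M \<Longrightarrow> \<phi> (y x) = \<alpha> x"
proof -
  obtain n b f where db: "dual_basis R M {..<n::nat} b f" using M by (auto simp: fgp_def)
  have "\<exists>y\<in>carrier N. \<phi> y = \<alpha> (b k)" if "k \<in> {..<n}" for k
    using db that by (intro ex) (simp add: dual_basis_def)
  then obtain y where y: "\<And>k. k \<in> {..<n} \<Longrightarrow> y k \<in> carrier N" "\<And>k. k \<in> {..<n} \<Longrightarrow> \<phi> (y k) = \<alpha> (b k)"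
    by metis
  show thesis
    by (rule that[OF dual_basis_extend(1)[OF db N(1) y(1)] dual_basis_extend(2)[OF db N(1) y(1) _ N(2) \<phi> \<alpha> y(2)]])
qed

text \<open>This is lifting along (a, c) -> (u a, v a + w c) from the sum of \<open>A\<close> and
  \<open>W\<close> to the sum of \<open>U\<close> and \<open>V\<close>, written out without forming
  the sums. The shape is that of the differential of a mapping cone, up to signs.\<close>

lemma fgp_lift_pair:
  assumes M: "fgp R M"
    and mods: "right_module R A" "right_module R W" "right_module R U" "right_module R V"
    and u: "lin R A U u" and v: "lin R A V v" and w: "lin R W V w"
    and \<alpha>: "lin R M U \<alpha>" and \<beta>: "lin R M V \<beta>"
    and ex: "\<And>x. x \<in> carrier M \<Longrightarrow> \<exists>a\<in>carrier A. \<exists>c\<in>carrier W. u a = \<alpha> x \<and> v a \<oplus>\<^bsub>V\<^esub> w c = \<beta> x"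
  obtains y z where "lin R M A y" "lin R M W z" "\<And>x. x \<in> carrier M \<Longrightarrow> u (y x) = \<alpha> x"
    "\<And>x. x \<in> carrier M \<Longrightarrow> v (y x) \<oplus>\<^bsub>V\<^esub> w (z x) = \<beta> x"
proof -
  obtain n b f where db: "dual_basis R M {..<n::nat} b f" using M by (auto simp: fgp_def)
  have fR: "f k x \<in> carrier R" if "k < n" "x \<in> carrier M" for k x
    using dual_basisD(4)[OF db _ that(2)] that(1) by simp
  interpret V: right_module R V by fact
  interpret A: right_module R A by fact
  interpret W: right_module R W by fact
  have "\<exists>a c. a \<in> carrier A \<and> c \<in> carrier W \<and> u a = \<alpha> (b k) \<and> v a \<oplus>\<^bsub>V\<^esub> w c = \<beta> (b k)"
    if "k \<in> {..<n}" for k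
    using ex[OF dual_basisD(2)[OF db that]] by blast
  then obtain a c where a: "\<And>k. k \<in> {..<n} \<Longrightarrow> a k \<in> carrier A" and c: "\<And>k. k \<in> {..<n} \<Longrightarrow> c k \<in> carrier W"
    and ac: "\<And>k. k \<in> {..<n} \<Longrightarrow> u (a k) = \<alpha> (b k)" "\<And>k. k \<in> {..<n} \<Longrightarrow> v (a k) \<oplus>\<^bsub>V\<^esub> w (c k) = \<beta> (b k)"
    by metis
  define y where "y x = (\<Oplus>\<^bsub>A\<^esub>k\<in>{..<n}. f k x \<odot>\<^bsub>A\<^esub> a k)" for x
  define z where "z x = (\<Oplus>\<^bsub>W\<^esub>k\<in>{..<n}. f k x \<odot>\<^bsub>W\<^esub> c k)" for x
  have y: "lin R M A y" unfolding y_def by (rule dual_basis_extend(1)[OF db mods(1) a])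
  have z: "lin R M W z" unfolding z_def by (rule dual_basis_extend(1)[OF db mods(2) c])
  have uy: "u (y x) = \<alpha> x" if "x \<in> carrier M" for x
    unfolding y_def by (rule dual_basis_extend(2)[OF db mods(1) a that mods(3) u \<alpha> ac(1)])
  have va: "v (a k) \<in> carrier V" "w (c k) \<in> carrier V" if "k \<in> {..<n}" for k
    using a[OF that] c[OF that] lin_closed[OF v] lin_closed[OF w] by blast+
  have "v (y x) \<oplus>\<^bsub>V\<^esub> w (z x) = \<beta> x" if x: "x \<in> carrier M" for x
  proof -
    have "v (y x) = (\<Oplus>\<^bsub>V\<^esub>k\<in>{..<n}. f k x \<odot>\<^bsub>V\<^esub> v (a k))"
      unfolding y_def using a fR x va
      by (subst lin_finsum[OF mods(1,4) v]) (auto simp: A.smult_closed lin_smult[OF v] V.smult_closed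
          intro!: V.M.finsum_cong')
    moreover have "w (z x) = (\<Oplus>\<^bsub>V\<^esub>k\<in>{..<n}. f k x \<odot>\<^bsub>V\<^esub> w (c k))"
      unfolding z_def using c fR x va
      by (subst lin_finsum[OF mods(2,4) w]) (auto simp: W.smult_closed lin_smult[OF w] V.smult_closed
          intro!: V.M.finsum_cong')
    ultimately have "v (y x) \<oplus>\<^bsub>V\<^esub> w (z x) =
        (\<Oplus>\<^bsub>V\<^esub>k\<in>{..<n}. f k x \<odot>\<^bsub>V\<^esub> v (a k) \<oplus>\<^bsub>V\<^esub> f k x \<odot>\<^bsub>V\<^esub> w (c k))"
      using fR x va by (simp add: V.M.finsum_addf V.smult_closed)
    also have "\<dots> = (\<Oplus>\<^bsub>V\<^esub>k\<in>{..<n}. f k x \<odot>\<^bsub>V\<^esub> \<beta> (b k))"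
      using fR x va by (intro V.M.finsum_cong')
        (auto simp: ac(2)[symmetric] V.smult_vector_distr V.smult_closed)
    also have "\<dots> = \<beta> x"
    proof (rule dual_basis_extend(2)[OF db mods(4) _ x mods(4) lin_id \<beta>])
      show "\<beta> (b k) \<in> carrier V" if "k \<in> {..<n}" for k
        using va[OF that] unfolding ac(2)[OF that, symmetric] by simp
    qed simp
    finally show ?thesis .
  qed
  with y z uy show thesis by (rule that)
qed

text \<open>The hypothesis factors the identity of \<open>M\<close> through the sum of
  \<open>M1\<close> and \<open>M2\<close>. The dual bases of both, carried to \<open>M\<close>,
  therefore combine to a dual basis indexed by the disjoint union.\<close>

lemma fgp_split:
  assumes M: "right_module R M" and M1: "fgp R M1" and M2: "fgp R M2"
    and l: "lin R M M1 \<rho>" "lin R M1 M \<sigma>" "lin R M M2 \<pi>" "lin R M2 M \<tau>"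
    and eq: "\<And>x. x \<in> carrier M \<Longrightarrow> \<sigma> (\<rho> x) \<oplus>\<^bsub>M\<^esub> \<tau> (\<pi> x) = x"
  shows "fgp R M"
proof -
  obtain n b f where db: "dual_basis R M1 {..<n::nat} b f" using M1 by (auto simp: fgp_def)
  obtain m c g where dc: "dual_basis R M2 {..<m::nat} c g" using M2 by (auto simp: fgp_def)
  interpret M: right_module R M by fact
  interpret M1: right_module R M1 by (rule fgp_module[OF M1])
  interpret M2: right_module R M2 by (rule fgp_module[OF M2])
  have fl: "k < n \<Longrightarrow> lin R M1 (reg R) (f k)" and b: "k < n \<Longrightarrow> b k \<in> carrier M1" for k
    using db by (simp_all add: dual_basis_def)
  have gl: "k < m \<Longrightarrow> lin R M2 (reg R) (g k)" and c: "k < m \<Longrightarrow> c k \<in> carrier M2" for k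
    using dc by (simp_all add: dual_basis_def)
  have fR: "f k x \<in> carrier R" if "k < n" "x \<in> carrier M1" for k x
    using lin_closed[OF fl[OF that(1)] that(2)] by simp
  have gR: "g k x \<in> carrier R" if "k < m" "x \<in> carrier M2" for k x
    using lin_closed[OF gl[OF that(1)] that(2)] by simp
  let ?J = "{..<n} <+> {..<m}"
  define B where "B = case_sum (\<lambda>k. \<sigma> (b k)) (\<lambda>k. \<tau> (c k))"
  define G where "G = case_sum (\<lambda>k x. f k (\<rho> x)) (\<lambda>k x. g k (\<pi> x))"
  have "dual_basis R M ?J B G"
    unfolding dual_basis_def
  proof (intro conjI ballI M)
    show "finite ?J" by simp
    fix k assume "k \<in> ?J"
    then show "B k \<in> carrier M" "lin R M (reg R) (G k)"
      using lin_closed[OF l(2)] lin_closed[OF l(4)] b c lin_comp[OF l(1) fl] lin_comp[OF l(3) gl]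
      by (auto simp: B_def G_def)
  next
    fix x assume x: "x \<in> carrier M"
    let ?t = "\<lambda>k. G k x \<odot>\<^bsub>M\<^esub> B k"
    have t1: "?t (Inl k) = \<sigma> (f k (\<rho> x) \<odot>\<^bsub>M1\<^esub> b k)" "f k (\<rho> x) \<odot>\<^bsub>M1\<^esub> b k \<in> carrier M1" if "k < n" for k
      using fR b that lin_closed[OF l(1) x] by (simp_all add: G_def B_def lin_smult[OF l(2)] M1.smult_closed)
    have t2: "?t (Inr k) = \<tau> (g k (\<pi> x) \<odot>\<^bsub>M2\<^esub> c k)" "g k (\<pi> x) \<odot>\<^bsub>M2\<^esub> c k \<in> carrier M2" if "k < m" for k
      using gR c that lin_closed[OF l(3) x] by (simp_all add: G_def B_def lin_smult[OF l(4)] M2.smult_closed)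
    have p1: "?t \<in> Inl ` {..<n} \<rightarrow> carrier M" using t1 lin_closed[OF l(2)] by auto
    have p2: "?t \<in> Inr ` {..<m} \<rightarrow> carrier M" using t2 lin_closed[OF l(4)] by auto
    have "(\<Oplus>\<^bsub>M\<^esub>k\<in>?J. ?t k) = (\<Oplus>\<^bsub>M\<^esub>k\<in>Inl ` {..<n}. ?t k) \<oplus>\<^bsub>M\<^esub> (\<Oplus>\<^bsub>M\<^esub>k\<in>Inr ` {..<m}. ?t k)"
      unfolding Plus_def by (rule M.M.finsum_Un_disjoint) (use p1 p2 in auto)
    also have "(\<Oplus>\<^bsub>M\<^esub>k\<in>Inl ` {..<n}. ?t k) = (\<Oplus>\<^bsub>M\<^esub>k\<in>{..<n}. \<sigma> (f k (\<rho> x) \<odot>\<^bsub>M1\<^esub> b k))"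
      by (subst M.M.finsum_reindex[OF p1]) (use t1 lin_closed[OF l(2)] in \<open>auto intro!: M.M.finsum_cong'\<close>)
    also have "\<dots> = \<sigma> (\<Oplus>\<^bsub>M1\<^esub>k\<in>{..<n}. f k (\<rho> x) \<odot>\<^bsub>M1\<^esub> b k)"
      by (rule lin_finsum[OF fgp_module[OF M1] M l(2), symmetric]) (use t1 in auto)
    also have "(\<Oplus>\<^bsub>M1\<^esub>k\<in>{..<n}. f k (\<rho> x) \<odot>\<^bsub>M1\<^esub> b k) = \<rho> x"
      using db lin_closed[OF l(1) x] by (simp add: dual_basis_def)
    also have "(\<Oplus>\<^bsub>M\<^esub>k\<in>Inr ` {..<m}. ?t k) = (\<Oplus>\<^bsub>M\<^esub>k\<in>{..<m}. \<tau> (g k (\<pi> x) \<odot>\<^bsub>M2\<^esub> c k))"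
      by (subst M.M.finsum_reindex[OF p2]) (use t2 lin_closed[OF l(4)] in \<open>auto intro!: M.M.finsum_cong'\<close>)
    also have "\<dots> = \<tau> (\<Oplus>\<^bsub>M2\<^esub>k\<in>{..<m}. g k (\<pi> x) \<odot>\<^bsub>M2\<^esub> c k)"
      by (rule lin_finsum[OF fgp_module[OF M2] M l(4), symmetric]) (use t2 in auto)
    also have "(\<Oplus>\<^bsub>M2\<^esub>k\<in>{..<m}. g k (\<pi> x) \<odot>\<^bsub>M2\<^esub> c k) = \<pi> x"
      using dc lin_closed[OF l(3) x] by (simp add: dual_basis_def)
    finally show "(\<Oplus>\<^bsub>M\<^esub>k\<in>?J. ?t k) = x" by (simp add: eq[OF x])
  qed
  then show ?thesis by (rule fgpI)
qed

text \<open>\<open>M\<close> is a retract of a free module whose basis may be infinite. Finitely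
  many generators involve only a finite set \<open>J\<close> of coordinates, and the elements
  supported on \<open>J\<close> form a submodule that contains the generators, hence is everything.
  The coordinates in \<open>J\<close> and the images of the unit vectors are then a dual
  basis.\<close>

lemma projective_fgp:
  fixes M :: "('a, 'b, 'c) module_scheme"
  assumes P: "projective R M" and fg: "fin_gen R M"
  shows "fgp R M"
proof -
  obtain I :: "'b set" and i p where M: "right_module R M" and i: "i \<in> mod_hom R M (free_module R I)"
    and p: "p \<in> mod_hom R (free_module R I) M" and pi: "\<And>x. x \<in> carrier M \<Longrightarrow> p (i x) = x"
    using P by (auto simp: projective_def)
  note il = mod_hom_lin[OF i] and pl = mod_hom_lin[OF p]
  have R: "ring R" by (rule rm_ring[OF M])
  let ?F = "free_module R I"
  note F = free_module_module[OF R, of I]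
  interpret F: right_module R ?F by (rule F)
  obtain A where A: "finite A" "A \<subseteq> carrier M" "\<And>S. submod R M S \<Longrightarrow> A \<subseteq> S \<Longrightarrow> carrier M \<subseteq> S"
    using fg unfolding fin_gen_iff[OF M] by blast
  define J where "J = (\<Union>a\<in>A. {j \<in> I. i a j \<noteq> \<zero>\<^bsub>R\<^esub>})"
  have iF: "i x \<in> carrier ?F" if "x \<in> carrier M" for x by (rule lin_closed[OF il that])
  have "finite {j \<in> I. i a j \<noteq> \<zero>\<^bsub>R\<^esub>}" if "a \<in> A" for a
  proof -
    have "a \<in> carrier M" using that A(2) by blast
    from iF[OF this] show ?thesis by (simp only: free_module_simps mem_Collect_eq)
  qed
  then have J: "finite J" "J \<subseteq> I" using A(1) by (auto simp: J_def)
  let ?S = "{v \<in> carrier ?F. \<forall>j\<in>I - J. v j = \<zero>\<^bsub>R\<^esub>}"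
  have "submod R M {x \<in> carrier M. \<forall>j\<in>I - J. i x j \<in> {\<zero>\<^bsub>R\<^esub>}}"
  proof -
    interpret M: right_module R M by (rule M)
    have l: "lin R M (reg R) (\<lambda>x. i x j)" if "j \<in> I" for j by (rule lin_comp[OF il free_coord_lin[OF that]])
    have "submod R M {x \<in> carrier M. i x j \<in> {\<zero>\<^bsub>reg R\<^esub>}}" if "j \<in> I" for j
      by (rule submod_vimage[OF M reg_module[OF R] l[OF that] submod_zero[OF reg_module[OF R]]])
    then show ?thesis by (simp add: submod_def M.M.a_closed M.smult_closed)
  qed
  then have "carrier M \<subseteq> {x \<in> carrier M. \<forall>j\<in>I - J. i x j \<in> {\<zero>\<^bsub>R\<^esub>}}"
    by (rule A(3)) (use A(2) in \<open>auto simp: J_def\<close>)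
  then have supp: "i x j = \<zero>\<^bsub>R\<^esub>" if "x \<in> carrier M" "j \<in> I - J" for x j using that by blast
  have "dual_basis R M J (\<lambda>j. p (free_unit R I j)) (\<lambda>j x. i x j)"
    unfolding dual_basis_def
  proof (intro conjI ballI M J(1))
    fix j assume "j \<in> J"
    then have j: "j \<in> I" using J(2) by blast
    show "p (free_unit R I j) \<in> carrier M" by (rule lin_closed[OF pl free_unit_closed[OF R j]])
    show "lin R M (reg R) (\<lambda>x. i x j)" by (rule lin_comp[OF il free_coord_lin[OF j]])
  next
    fix x assume x: "x \<in> carrier M"
    have ix: "i x j \<in> carrier R" if "j \<in> I" for j
      using lin_closed[OF free_coord_lin[OF that] iF[OF x]] by simp
    have JI: "j \<in> I" if "j \<in> J" for j using J(2) that by blast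
    have cl: "free_unit R I j \<in> carrier ?F" if "j \<in> J" for j
      by (rule free_unit_closed[OF R JI[OF that]])
    have "(\<Oplus>\<^bsub>M\<^esub>j\<in>J. i x j \<odot>\<^bsub>M\<^esub> p (free_unit R I j)) = (\<Oplus>\<^bsub>M\<^esub>j\<in>J. p (i x j \<odot>\<^bsub>?F\<^esub> free_unit R I j))"
    proof (rule abelian_monoid.finsum_cong')
      show "abelian_monoid M" using rm_group[OF M] by (rule abelian_group.axioms)
      show "(\<lambda>j. p (i x j \<odot>\<^bsub>?F\<^esub> free_unit R I j)) \<in> J \<rightarrow> carrier M"
        by (rule Pi_I, rule lin_closed[OF pl F.smult_closed[OF ix[OF JI] cl]])
      fix j assume j: "j \<in> J"
      from lin_smult[OF pl ix[OF JI[OF j]] cl[OF j]]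
      show "i x j \<odot>\<^bsub>M\<^esub> p (free_unit R I j) = p (i x j \<odot>\<^bsub>?F\<^esub> free_unit R I j)" by (rule sym)
    qed simp
    also have "\<dots> = p (\<Oplus>\<^bsub>?F\<^esub>j\<in>J. i x j \<odot>\<^bsub>?F\<^esub> free_unit R I j)"
    proof (rule lin_finsum[OF F M pl J(1), symmetric])
      fix j assume j: "j \<in> J"
      show "i x j \<odot>\<^bsub>?F\<^esub> free_unit R I j \<in> carrier ?F" by (rule F.smult_closed[OF ix[OF JI[OF j]] cl[OF j]])
    qed
    also have "\<dots> = p (i x)" using free_expand[OF R iF[OF x] J] supp[OF x] by simp
    finally show "(\<Oplus>\<^bsub>M\<^esub>j\<in>J. i x j \<odot>\<^bsub>M\<^esub> p (free_unit R I j)) = x" by (simp add: pi[OF x])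
  qed
  then show ?thesis by (rule fgpI)
qed

lemma fgp_fin_gen:
  assumes "fgp R M"
  shows "fin_gen R M"
proof -
  note M = fgp_module[OF assms]
  obtain n b f where db: "dual_basis R M {..<n::nat} b f" using assms by (auto simp: fgp_def)
  have "carrier M \<subseteq> S" if S: "submod R M S" "b ` {..<n} \<subseteq> S" for S
  proof
    fix x assume x: "x \<in> carrier M"
    have "(\<Oplus>\<^bsub>M\<^esub>k\<in>{..<n}. f k x \<odot>\<^bsub>M\<^esub> b k) \<in> S"
    proof (rule submod_finsum[OF M S(1)])
      fix k assume k: "k \<in> {..<n}"
      have "f k x \<in> carrier R" "b k \<in> S" using dual_basisD(4)[OF db k x] S(2) k by auto
      then show "f k x \<odot>\<^bsub>M\<^esub> b k \<in> S" using S(1) by (simp add: submod_def)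
    qed simp
    then show "x \<in> S" unfolding dual_basisD(5)[OF db x] .
  qed
  moreover have "b ` {..<n} \<subseteq> carrier M" using dual_basisD(2)[OF db] by (simp add: image_subset_iff)
  ultimately have "finite (b ` {..<n}) \<and> b ` {..<n} \<subseteq> carrier M \<and>
      (\<forall>S. submod R M S \<longrightarrow> b ` {..<n} \<subseteq> S \<longrightarrow> carrier M \<subseteq> S)" by simp
  then show ?thesis unfolding fin_gen_iff[OF M] by (rule exI)
qed

subsection \<open>Torsionless modules over a hereditary Noetherian ring\<close>

lemma sub_carrier: "carrier (M\<lparr>carrier := S\<rparr>) = S"
  by simp

text \<open>A finite family of functionals with trivial common kernel is an embedding into
  \<open>R^n\<close> given by its coordinates. It avoids extensional families and makes the
  induction on the number of functionals possible.\<close>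

definition tls :: "('a, 'r) ring_scheme \<Rightarrow> ('a, 'b, 'c) module_scheme \<Rightarrow> bool" where
  "tls R M \<longleftrightarrow> right_module R M \<and>
     (\<exists>n::nat. \<exists>g. (\<forall>k<n. lin R M (reg R) (g k)) \<and>
       (\<forall>x\<in>carrier M. (\<forall>k<n. g k x = \<zero>\<^bsub>R\<^esub>) \<longrightarrow> x = \<zero>\<^bsub>M\<^esub>))"

lemma tl_module: "tls R M \<Longrightarrow> right_module R M"
  by (simp add: tls_def)

lemma tlI:
  assumes M: "right_module R M" and J: "finite J" and g: "\<And>k. k \<in> J \<Longrightarrow> lin R M (reg R) (g k)"
    and inj: "\<And>x. \<lbrakk>x \<in> carrier M; \<And>k. k \<in> J \<Longrightarrow> g k x = \<zero>\<^bsub>R\<^esub>\<rbrakk> \<Longrightarrow> x = \<zero>\<^bsub>M\<^esub>"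
  shows "tls R M"
proof -
  obtain h where h: "bij_betw h {0..<card J} J" using ex_bij_betw_nat_finite[OF J] by blast
  have hJ: "h k \<in> J" if "k < card J" for k using bij_betwE[OF h] that by simp
  have surj: "\<exists>k<card J. h k = j" if "j \<in> J" for j
  proof -
    have "j \<in> h ` {0..<card J}" using h that by (simp add: bij_betw_def)
    then show ?thesis by auto
  qed
  have "x = \<zero>\<^bsub>M\<^esub>" if "x \<in> carrier M" "\<forall>k<card J. g (h k) x = \<zero>\<^bsub>R\<^esub>" for x
  proof (rule inj[OF that(1)])
    fix j assume "j \<in> J"
    then obtain k where "k < card J" "h k = j" using surj by blast
    then show "g j x = \<zero>\<^bsub>R\<^esub>" using that(2) by auto
  qed
  then show ?thesis
    unfolding tls_def using M g[OF hJ] by (intro conjI exI[of _ "card J"] exI[of _ "\<lambda>k. g (h k)"]) blast+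
qed

lemma tlE:
  assumes "tls R M"
  obtains n :: nat and g where "\<And>k. k < n \<Longrightarrow> lin R M (reg R) (g k)"
    "\<And>x. \<lbrakk>x \<in> carrier M; \<And>k. k < n \<Longrightarrow> g k x = \<zero>\<^bsub>R\<^esub>\<rbrakk> \<Longrightarrow> x = \<zero>\<^bsub>M\<^esub>"
proof -
  obtain n :: nat and g where "\<forall>k<n. lin R M (reg R) (g k)"
    "\<forall>x\<in>carrier M. (\<forall>k<n. g k x = \<zero>\<^bsub>R\<^esub>) \<longrightarrow> x = \<zero>\<^bsub>M\<^esub>"
    using assms unfolding tls_def by blast
  then show thesis by (intro that[of n g]) simp_all
qed

lemma tl_inj:
  assumes N: "right_module R N" and f: "lin R N M f" and M: "tls R M"
    and inj: "\<And>x. \<lbrakk>x \<in> carrier N; f x = \<zero>\<^bsub>M\<^esub>\<rbrakk> \<Longrightarrow> x = \<zero>\<^bsub>N\<^esub>"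
  shows "tls R N"
proof -
  obtain n :: nat and g where g: "\<And>k. k < n \<Longrightarrow> lin R M (reg R) (g k)"
    "\<And>x. \<lbrakk>x \<in> carrier M; \<And>k. k < n \<Longrightarrow> g k x = \<zero>\<^bsub>R\<^esub>\<rbrakk> \<Longrightarrow> x = \<zero>\<^bsub>M\<^esub>"
    by (rule tlE[OF M]) blast
  show ?thesis
  proof (rule tlI[OF N, of "{..<n}" "\<lambda>k x. g k (f x)"])
    fix x assume x: "x \<in> carrier N" and z: "\<And>k. k \<in> {..<n} \<Longrightarrow> g k (f x) = \<zero>\<^bsub>R\<^esub>"
    have "f x = \<zero>\<^bsub>M\<^esub>" by (rule g(2)[OF lin_closed[OF f x]]) (simp add: z)
    then show "x = \<zero>\<^bsub>N\<^esub>" by (rule inj[OF x])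
  next
    fix k assume "k \<in> {..<n}"
    then show "lin R N (reg R) (\<lambda>x. g k (f x))" using lin_comp[OF f g(1)] by simp
  qed simp
qed

lemma tl_sub: "tls R M \<Longrightarrow> submod R M S \<Longrightarrow> tls R (M\<lparr>carrier := S\<rparr>)"
  by (rule tl_inj[OF submod_module[OF tl_module] submod_incl]) simp_all

lemma tl_free:
  assumes R: "ring R" and A: "finite A"
  shows "tls R (free_module R A)"
proof (rule tlI[OF free_module_module[OF R] A, where g = "\<lambda>a v. v a"])
  fix x assume x: "x \<in> carrier (free_module R A)" "\<And>a. a \<in> A \<Longrightarrow> x a = \<zero>\<^bsub>R\<^esub>"
  have "x \<in> extensional A" using x(1) by (simp add: PiE_def)
  then show "x = \<zero>\<^bsub>free_module R A\<^esub>" by (rule extensionalityI) (simp_all add: x(2))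
qed (rule free_coord_lin)

section \<open>Direct sums of two modules\<close>

definition prod_module :: "('a, 'b) module \<Rightarrow> ('a, 'd) module \<Rightarrow> ('a, 'b \<times> 'd) module" where
  "prod_module M N = \<lparr>carrier = carrier M \<times> carrier N, mult = undefined, one = undefined,
     zero = (\<zero>\<^bsub>M\<^esub>, \<zero>\<^bsub>N\<^esub>), add = (\<lambda>x y. (fst x \<oplus>\<^bsub>M\<^esub> fst y, snd x \<oplus>\<^bsub>N\<^esub> snd y)),
     smult = (\<lambda>a x. (a \<odot>\<^bsub>M\<^esub> fst x, a \<odot>\<^bsub>N\<^esub> snd x))\<rparr>"

lemma prod_module_simps:
  "carrier (prod_module M N) = carrier M \<times> carrier N"
  "\<zero>\<^bsub>prod_module M N\<^esub> = (\<zero>\<^bsub>M\<^esub>, \<zero>\<^bsub>N\<^esub>)"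
  "x \<oplus>\<^bsub>prod_module M N\<^esub> y = (fst x \<oplus>\<^bsub>M\<^esub> fst y, snd x \<oplus>\<^bsub>N\<^esub> snd y)"
  "a \<odot>\<^bsub>prod_module M N\<^esub> x = (a \<odot>\<^bsub>M\<^esub> fst x, a \<odot>\<^bsub>N\<^esub> snd x)"
  by (simp_all add: prod_module_def)

lemma prod_module_module:
  assumes "right_module R M" "right_module R N"
  shows "right_module R (prod_module M N)"
proof -
  interpret M: right_module R M by fact
  interpret N: right_module R N by fact
  have "abelian_group (prod_module M N)"
  proof (rule abelian_groupI)
    fix x assume x: "x \<in> carrier (prod_module M N)"
    then have "(\<ominus>\<^bsub>M\<^esub> fst x, \<ominus>\<^bsub>N\<^esub> snd x) \<oplus>\<^bsub>prod_module M N\<^esub> x = \<zero>\<^bsub>prod_module M N\<^esub>"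
      by (auto simp: prod_module_simps M.M.l_neg N.M.l_neg)
    moreover have "(\<ominus>\<^bsub>M\<^esub> fst x, \<ominus>\<^bsub>N\<^esub> snd x) \<in> carrier (prod_module M N)"
      using x by (auto simp: prod_module_simps)
    ultimately show "\<exists>y\<in>carrier (prod_module M N). y \<oplus>\<^bsub>prod_module M N\<^esub> x = \<zero>\<^bsub>prod_module M N\<^esub>" by blast
  qed (auto simp: prod_module_simps M.M.a_ac N.M.a_ac)
  then show ?thesis
    by (intro right_module.intro right_module_axioms.intro)
      (auto simp: prod_module_simps M.R.ring_axioms M.smult_closed M.smult_scalar_distr M.smult_vector_distr
        M.smult_assoc M.smult_one N.smult_closed N.smult_scalar_distr N.smult_vector_distr
        N.smult_assoc N.smult_one)
qed

lemma lin_fst: "lin R (prod_module M N) M fst"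
  and lin_snd: "lin R (prod_module M N) N snd"
  by (auto simp: lin_def prod_module_simps)

lemma lin_pair: "\<lbrakk>lin R L M f; lin R L N g\<rbrakk> \<Longrightarrow> lin R L (prod_module M N) (\<lambda>x. (f x, g x))"
  by (simp add: lin_def prod_module_simps)

lemma tl_prod:
  assumes M: "tls R M" and N: "tls R N"
  shows "tls R (prod_module M N)"
proof -
  obtain n :: nat and g where g: "\<And>k. k < n \<Longrightarrow> lin R M (reg R) (g k)"
    "\<And>x. \<lbrakk>x \<in> carrier M; \<And>k. k < n \<Longrightarrow> g k x = \<zero>\<^bsub>R\<^esub>\<rbrakk> \<Longrightarrow> x = \<zero>\<^bsub>M\<^esub>"
    by (rule tlE[OF M]) blast
  obtain m :: nat and h where h: "\<And>k. k < m \<Longrightarrow> lin R N (reg R) (h k)"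
    "\<And>x. \<lbrakk>x \<in> carrier N; \<And>k. k < m \<Longrightarrow> h k x = \<zero>\<^bsub>R\<^esub>\<rbrakk> \<Longrightarrow> x = \<zero>\<^bsub>N\<^esub>"
    by (rule tlE[OF N]) blast
  let ?J = "{..<n} <+> {..<m}"
  define G where "G = case_sum (\<lambda>k x. g k (fst x)) (\<lambda>k x. h k (snd x))"
  show ?thesis
  proof (rule tlI[OF prod_module_module[OF tl_module[OF M] tl_module[OF N]], of ?J G])
    fix k assume "k \<in> ?J"
    then show "lin R (prod_module M N) (reg R) (G k)"
      using lin_comp[OF lin_fst g(1)] lin_comp[OF lin_snd h(1)] by (auto simp: G_def)
  next
    fix x assume x: "x \<in> carrier (prod_module M N)" and z: "\<And>k. k \<in> ?J \<Longrightarrow> G k x = \<zero>\<^bsub>R\<^esub>"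
    have "g k (fst x) = \<zero>\<^bsub>R\<^esub>" if "k < n" for k using z[OF InlI] that by (simp add: G_def)
    moreover have "h k (snd x) = \<zero>\<^bsub>R\<^esub>" if "k < m" for k using z[OF InrI] that by (simp add: G_def)
    moreover have "fst x \<in> carrier M" "snd x \<in> carrier N" using x by (auto simp: prod_module_simps)
    ultimately have "fst x = \<zero>\<^bsub>M\<^esub>" "snd x = \<zero>\<^bsub>N\<^esub>" using g(2) h(2) by blast+
    then show "x = \<zero>\<^bsub>prod_module M N\<^esub>" by (simp add: prod_module_simps prod_eq_iff)
  qed simp
qed

lemma fgp_trivial:
  assumes "right_module R M" "\<And>x. x \<in> carrier M \<Longrightarrow> x = \<zero>\<^bsub>M\<^esub>"
  shows "fgp R M"
proof -
  interpret M: right_module R M by fact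
  have "dual_basis R M {} undefined undefined"
    using assms by (auto simp: dual_basis_def)
  then show ?thesis by (rule fgpI)
qed

section \<open>Torsionless modules are projective\<close>

locale hereditary_noetherian =
  fixes R :: "('a, 'r) ring_scheme"
  assumes hnd: "hereditary_noetherian_domain R"
begin

lemma ring_R: "ring R"
  using hnd by (simp add: hereditary_noetherian_domain_def)

lemma ideal_fgp:
  assumes "submod R (reg R) I"
  shows "fgp R (reg R\<lparr>carrier := I\<rparr>)"
proof -
  have "right_ideal I R" by (rule submod_reg_ideal[OF ring_R assms])
  then have "projective R (right_ideal_module R I)" "fin_gen R (right_ideal_module R I)"
    using hnd by (simp_all add: hereditary_noetherian_domain_def right_hereditary_def right_noetherian_def)
  then show ?thesis unfolding right_ideal_module_eq by (rule projective_fgp)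
qed

text \<open>The classical argument that a submodule of a free module over a hereditary ring is built
  from right ideals. The image of the last functional is a right ideal, projective and finitely
  generated, so it splits off; on the kernel of that functional the remaining ones still separate
  points. \<open>M\<close> is arbitrary in the induction because the induction hypothesis is applied
  to that kernel.\<close>

lemma functionals_fgp:
  fixes n :: nat
  assumes "right_module R M" "\<And>k. k < n \<Longrightarrow> lin R M (reg R) (g k)"
    "\<And>x. \<lbrakk>x \<in> carrier M; \<And>k. k < n \<Longrightarrow> g k x = \<zero>\<^bsub>R\<^esub>\<rbrakk> \<Longrightarrow> x = \<zero>\<^bsub>M\<^esub>"
  shows "fgp R M"
  using assms
proof (induction n arbitrary: M)
  case 0
  then show ?case by (intro fgp_trivial) simp_all
next
  case (Suc n)
  note M = Suc.prems(1)
  interpret M: right_module R M by (rule M)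
  note gn = Suc.prems(2)[OF lessI]
  note reg = reg_module[OF ring_R]
  let ?I = "g n ` carrier M"
  let ?RI = "reg R\<lparr>carrier := ?I\<rparr>"
  have I: "submod R (reg R) ?I" by (rule submod_image[OF M reg gn])
  have fI: "fgp R ?RI" by (rule ideal_fgp[OF I])
  obtain \<sigma> where \<sigma>: "lin R ?RI M \<sigma>" and g\<sigma>: "\<And>y. y \<in> carrier ?RI \<Longrightarrow> g n (\<sigma> y) = y"
  proof -
    have ex: "\<exists>x\<in>carrier M. g n x = y" if "y \<in> carrier ?RI" for y using that by auto
    show thesis by (rule fgp_lift[OF fI M reg gn submod_incl[OF I]], erule ex, rule that)
  qed
  let ?K = "{x \<in> carrier M. g n x \<in> {\<zero>\<^bsub>reg R\<^esub>}}"
  let ?MK = "M\<lparr>carrier := ?K\<rparr>"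
  have K: "submod R M ?K" by (rule submod_vimage[OF M reg gn submod_zero[OF reg]])
  have MK: "right_module R ?MK" by (rule submod_module[OF M K])
  have "fgp R ?MK"
  proof (rule Suc.IH[OF MK])
    fix k assume "k < n"
    then have "lin R M (reg R) (g k)" by (intro Suc.prems(2)) simp
    then show "lin R ?MK (reg R) (g k)" by (rule lin_sub[OF _ K])
  next
    fix x assume x: "x \<in> carrier ?MK" "\<And>k. k < n \<Longrightarrow> g k x = \<zero>\<^bsub>R\<^esub>"
    have "x = \<zero>\<^bsub>M\<^esub>" by (rule Suc.prems(3)) (use x in \<open>auto simp: less_Suc_eq\<close>)
    then show "x = \<zero>\<^bsub>?MK\<^esub>" by simp
  qed
  have gI: "lin R M ?RI (g n)" by (rule lin_corestrict[OF gn]) simp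
  have \<sigma>g: "lin R M M (\<lambda>x. \<sigma> (g n x))" by (rule lin_comp[OF gI \<sigma>])
  \<comment> \<open>Subtracting the section applied to \<open>g n x\<close> projects
    \<open>M\<close> onto the kernel of \<open>g n\<close>, the complement of the copy of the right
    ideal.\<close>
  have \<rho>: "lin R M M (\<lambda>x. x \<ominus>\<^bsub>M\<^esub> \<sigma> (g n x))" by (rule lin_diff[OF M M lin_id \<sigma>g])
  have \<rho>K: "x \<ominus>\<^bsub>M\<^esub> \<sigma> (g n x) \<in> ?K" if x: "x \<in> carrier M" for x
  proof -
    interpret N: abelian_group "reg R" by (rule rm_group[OF reg])
    have "g n (x \<ominus>\<^bsub>M\<^esub> \<sigma> (g n x)) = g n x \<ominus>\<^bsub>reg R\<^esub> g n x"
      using lin_minus[OF gn M reg x lin_closed[OF \<sigma>g x]] g\<sigma>[OF lin_closed[OF gI x]] by (simp only:)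
    also have "\<dots> = \<zero>\<^bsub>reg R\<^esub>" by (rule N.minus_self[OF lin_closed[OF gn x]])
    finally show ?thesis using lin_closed[OF \<rho> x] by (simp only: mem_Collect_eq singleton_iff)
  qed
  show ?case
  proof (rule fgp_split[OF M \<open>fgp R ?MK\<close> fI lin_corestrict[OF \<rho> \<rho>K] submod_incl[OF K] gI \<sigma>])
    fix x assume x: "x \<in> carrier M"
    show "x \<ominus>\<^bsub>M\<^esub> \<sigma> (g n x) \<oplus>\<^bsub>M\<^esub> \<sigma> (g n x) = x"
      using x lin_closed[OF \<sigma>g x] by (simp add: a_minus_def M.M.a_assoc M.M.l_neg)
  qed
qed

lemma tl_fgp:
  assumes t: "tls R M"
  shows "fgp R M"
proof (rule tlE[OF t])
  fix n :: nat and g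
  assume g: "\<And>k. k < n \<Longrightarrow> lin R M (reg R) (g k)"
    and inj: "\<And>x. \<lbrakk>x \<in> carrier M; \<And>k. k < n \<Longrightarrow> g k x = \<zero>\<^bsub>R\<^esub>\<rbrakk> \<Longrightarrow> x = \<zero>\<^bsub>M\<^esub>"
  show "fgp R M" by (rule functionals_fgp[where g = g and n = n, OF tl_module[OF t] g inj])
qed

lemma tl_fin_gen: "tls R M \<Longrightarrow> fin_gen R M"
  by (rule fgp_fin_gen[OF tl_fgp])

text \<open>The image is a submodule of a torsionless module, hence torsionless and projective, so
  the surjection of \<open>M\<close> onto it has a linear section.\<close>

lemma image_section:
  assumes M: "right_module R M" and N: "tls R N" and f: "lin R M N f"
  obtains \<tau> where "lin R (N\<lparr>carrier := f ` carrier M\<rparr>) M \<tau>"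
    "\<And>y. y \<in> f ` carrier M \<Longrightarrow> f (\<tau> y) = y"
proof -
  note I = submod_image[OF M tl_module[OF N] f]
  let ?NI = "N\<lparr>carrier := f ` carrier M\<rparr>"
  have ex: "\<exists>x\<in>carrier M. f x = y" if "y \<in> carrier ?NI" for y using that by auto
  obtain \<tau> where "lin R ?NI M \<tau>" "\<And>y. y \<in> carrier ?NI \<Longrightarrow> f (\<tau> y) = y"
    by (rule fgp_lift[OF tl_fgp[OF tl_sub[OF N I]] M tl_module[OF N] f submod_incl[OF I]], erule ex, rule that)
  then show thesis by (intro that) simp_all
qed

text \<open>With a section \<open>\<tau>\<close> of \<open>f\<close> over its image, x -
  \<open>\<tau> (f x)\<close> lies in the kernel of \<open>f\<close> and fixes its elements. So
  kernels of maps into torsionless modules are direct summands.\<close>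

lemma kernel_retraction:
  assumes M: "right_module R M" and N: "tls R N" and f: "lin R M N f"
  obtains r where "lin R M M r" "\<And>x. x \<in> carrier M \<Longrightarrow> f (r x) = \<zero>\<^bsub>N\<^esub>"
    "\<And>x. \<lbrakk>x \<in> carrier M; f x = \<zero>\<^bsub>N\<^esub>\<rbrakk> \<Longrightarrow> r x = x"
proof -
  interpret M: right_module R M by fact
  interpret N: right_module R N by (rule tl_module[OF N])
  let ?NI = "N\<lparr>carrier := f ` carrier M\<rparr>"
  note I = submod_image[OF M tl_module[OF N] f]
  obtain \<tau> where \<tau>: "lin R ?NI M \<tau>" "\<And>y. y \<in> f ` carrier M \<Longrightarrow> f (\<tau> y) = y"
    by (rule image_section[OF M N f]) blast
  have fI: "lin R M ?NI f" by (rule lin_corestrict[OF f]) simp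
  have \<tau>f: "lin R M M (\<lambda>x. \<tau> (f x))" by (rule lin_comp[OF fI \<tau>(1)])
  show thesis
  proof (rule that[of "\<lambda>x. x \<ominus>\<^bsub>M\<^esub> \<tau> (f x)"])
    show "lin R M M (\<lambda>x. x \<ominus>\<^bsub>M\<^esub> \<tau> (f x))" by (rule lin_diff[OF M M lin_id \<tau>f])
    fix x assume x: "x \<in> carrier M"
    show "f (x \<ominus>\<^bsub>M\<^esub> \<tau> (f x)) = \<zero>\<^bsub>N\<^esub>"
      unfolding lin_minus[OF f M tl_module[OF N] x lin_closed[OF \<tau>f x]] \<tau>(2)[OF imageI[OF x]]
      by (rule N.M.minus_self[OF lin_closed[OF f x]])
    assume "f x = \<zero>\<^bsub>N\<^esub>"
    moreover have "\<tau> \<zero>\<^bsub>N\<^esub> = \<zero>\<^bsub>M\<^esub>" using lin_zero[OF \<tau>(1) submod_module[OF tl_module[OF N] I] M] by simp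
    ultimately show "x \<ominus>\<^bsub>M\<^esub> \<tau> (f x) = x" using x by (simp add: M.M.minus_zero_right)
  qed
qed

text \<open>The zero module is given the empty generating set on purpose: a resolution assembled
  from these covers has to vanish wherever the complex does, or it would not be bounded.\<close>

lemma free_cover:
  assumes M: "right_module R M" and fg: "fin_gen R M"
  obtains A q where "finite A" "A \<subseteq> carrier M" "carrier M = {\<zero>\<^bsub>M\<^esub>} \<Longrightarrow> A = {}"
    "lin R (free_module R A) M q" "q ` carrier (free_module R A) = carrier M"
proof -
  interpret M: right_module R M by fact
  obtain A where A: "finite A" "A \<subseteq> carrier M" and triv: "carrier M = {\<zero>\<^bsub>M\<^esub>} \<Longrightarrow> A = {}"
    and gen: "\<And>x. x \<in> carrier M \<Longrightarrow> \<exists>c\<in>A \<rightarrow> carrier R. x = (\<Oplus>\<^bsub>M\<^esub>a\<in>A. c a \<odot>\<^bsub>M\<^esub> a)"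
  proof (cases "carrier M = {\<zero>\<^bsub>M\<^esub>}")
    case True
    show thesis by (rule that[of "{}"]) (use True in auto)
  next
    case False
    obtain A where "finite A" "A \<subseteq> carrier M"
      "\<forall>x\<in>carrier M. \<exists>c\<in>A \<rightarrow> carrier R. x = (\<Oplus>\<^bsub>M\<^esub>a\<in>A. c a \<odot>\<^bsub>M\<^esub> a)"
      using fg unfolding fin_gen_def by blast
    then show thesis using False by (intro that[of A]) simp_all
  qed
  let ?F = "free_module R A"
  note F = free_module_module[OF ring_R, of A]
  define q where "q v = (\<Oplus>\<^bsub>M\<^esub>a\<in>A. v a \<odot>\<^bsub>M\<^esub> a)" for v
  have q: "lin R ?F M q"
    unfolding q_def
  proof (rule lin_family_sum[OF F M A(1)])
    fix a assume a: "a \<in> A"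
    note c = free_coord_lin[OF a, of R]
    have aM: "a \<in> carrier M" using a A(2) by blast
    show "lin R ?F M (\<lambda>v. v a \<odot>\<^bsub>M\<^esub> a)"
      using lin_closed[OF c] lin_add[OF c] lin_smult[OF c] aM
      by (intro linI) (simp_all only: reg_simps M.smult_closed M.smult_scalar_distr M.smult_assoc)
  qed
  have "x \<in> q ` carrier ?F" if x: "x \<in> carrier M" for x
  proof -
    obtain c where c: "c \<in> A \<rightarrow> carrier R" "x = (\<Oplus>\<^bsub>M\<^esub>a\<in>A. c a \<odot>\<^bsub>M\<^esub> a)" using gen[OF x] by blast
    have ca: "c a \<in> carrier R" "a \<in> carrier M" if "a \<in> A" for a using c(1) A(2) that by auto
    have "q (restrict c A) = x"
      unfolding q_def c(2) by (rule M.M.finsum_cong') (use ca in \<open>auto intro!: M.smult_closed\<close>)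
    moreover have "restrict c A \<in> carrier ?F" using ca(1) A(1) by simp
    ultimately show ?thesis by blast
  qed
  then have surj: "q ` carrier ?F = carrier M" using lin_closed[OF q] by blast
  show thesis by (rule that[OF A _ q surj]) (rule triv)
qed

text \<open>\<open>S\<close> itself need not be torsionless, but its preimage in a finite free
  module is; that preimage is a projective module mapping onto \<open>S\<close>.\<close>

lemma submod_cover:
  assumes M: "right_module R M" and fg: "fin_gen R M" and S: "submod R M S"
  obtains A q where "finite A" "A \<subseteq> carrier M" "carrier M = {\<zero>\<^bsub>M\<^esub>} \<Longrightarrow> A = {}"
    "tls R (free_module R A\<lparr>carrier := {v \<in> carrier (free_module R A). q v \<in> S}\<rparr>)"
    "lin R (free_module R A) M q"
    "q ` {v \<in> carrier (free_module R A). q v \<in> S} = S"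
proof -
  obtain A q where A: "finite A" "A \<subseteq> carrier M" "carrier M = {\<zero>\<^bsub>M\<^esub>} \<Longrightarrow> A = {}"
    and q: "lin R (free_module R A) M q" and surj: "q ` carrier (free_module R A) = carrier M"
    by (rule free_cover[OF M fg], rule that)
  have "S \<subseteq> carrier M" using S by (simp add: submod_def)
  then have "q ` {v \<in> carrier (free_module R A). q v \<in> S} = S" unfolding surj[symmetric] by blast
  with A tl_sub[OF tl_free[OF ring_R A(1)] submod_vimage[OF free_module_module[OF ring_R] M q S]] q
  show thesis by (rule that)
qed

end

section \<open>Complexes\<close>

lemma bcD:
  assumes "X \<in> bounded_complexes R"
  shows "right_module R (part X n)" "fin_gen R (part X n)"
    "diff X n \<in> mod_hom R (part X n) (part X (n + 1))"
    "lin R (part X n) (part X (n + 1)) (diff X n)"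
    "lin R (part X (n - 1)) (part X n) (diff X (n - 1))"
    "x \<in> carrier (part X n) \<Longrightarrow> diff X (n + 1) (diff X n x) = \<zero>\<^bsub>part X (n + 2)\<^esub>"
    "x \<in> carrier (part X (n - 1)) \<Longrightarrow> diff X n (diff X (n - 1) x) = \<zero>\<^bsub>part X (n + 1)\<^esub>"
proof -
  have mods: "\<And>n. part X n \<in> fg_modules R"
    and d: "\<And>n. diff X n \<in> mod_hom R (part X n) (part X (n + 1))"
    and dd: "\<And>n x. x \<in> carrier (part X n) \<Longrightarrow> diff X (n + 1) (diff X n x) = \<zero>\<^bsub>part X (n + 2)\<^esub>"
    using assms by (simp_all add: bounded_complexes_def)
  show "right_module R (part X n)" "fin_gen R (part X n)" using mods[of n] by (simp_all add: fg_modules_def)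
  show "diff X n \<in> mod_hom R (part X n) (part X (n + 1))" by (rule d)
  show "lin R (part X n) (part X (n + 1)) (diff X n)" by (rule mod_hom_lin[OF d])
  show "lin R (part X (n - 1)) (part X n) (diff X (n - 1))" using mod_hom_lin[OF d[of "n - 1"]] by simp
  show "x \<in> carrier (part X n) \<Longrightarrow> diff X (n + 1) (diff X n x) = \<zero>\<^bsub>part X (n + 2)\<^esub>" by (rule dd)
  show "x \<in> carrier (part X (n - 1)) \<Longrightarrow> diff X n (diff X (n - 1) x) = \<zero>\<^bsub>part X (n + 1)\<^esub>"
    using dd[of x "n - 1"] by (simp add: add.commute)
qed

lemma bc_bound:
  assumes "X \<in> bounded_complexes R"
  obtains N where "\<And>n. \<bar>n\<bar> > N \<Longrightarrow> carrier (part X n) = {\<zero>\<^bsub>part X n\<^esub>}"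
  using assms unfolding bounded_complexes_def by blast

lemma cmD:
  assumes "f \<in> chain_maps R X Y"
  shows "f n \<in> mod_hom R (part X n) (part Y n)" "lin R (part X n) (part Y n) (f n)"
    "x \<in> carrier (part X n) \<Longrightarrow> f (n + 1) (diff X n x) = diff Y n (f n x)"
    "x \<in> carrier (part X (n - 1)) \<Longrightarrow> f n (diff X (n - 1) x) = diff Y (n - 1) (f (n - 1) x)"
proof -
  have 1: "\<And>n. f n \<in> mod_hom R (part X n) (part Y n)"
    and 2: "\<And>n x. x \<in> carrier (part X n) \<Longrightarrow> f (n + 1) (diff X n x) = diff Y n (f n x)"
    using assms by (simp_all add: chain_maps_def)
  show "f n \<in> mod_hom R (part X n) (part Y n)" by (rule 1)
  show "lin R (part X n) (part Y n) (f n)" by (rule mod_hom_lin[OF 1])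
  show "x \<in> carrier (part X n) \<Longrightarrow> f (n + 1) (diff X n x) = diff Y n (f n x)" by (rule 2)
  show "x \<in> carrier (part X (n - 1)) \<Longrightarrow> f n (diff X (n - 1) x) = diff Y (n - 1) (f (n - 1) x)"
    using 2[of x "n - 1"] by simp
qed

lemma cm_eqI:
  assumes "f \<in> chain_maps R X Y" "g \<in> chain_maps R X Y"
    "\<And>n x. x \<in> carrier (part X n) \<Longrightarrow> f n x = g n x"
  shows "f = g"
  by (rule ext, rule mod_hom_eqI[OF cmD(1)[OF assms(1)] cmD(1)[OF assms(2)] assms(3)])

text \<open>Chain maps are extensional in each degree, hence the restriction.\<close>

definition rst :: "('a, 'u) cpx \<Rightarrow> (int \<Rightarrow> 'u \<Rightarrow> 'u) \<Rightarrow> int \<Rightarrow> 'u \<Rightarrow> 'u" where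
  "rst X f n = restrict (f n) (carrier (part X n))"

lemma rst_apply: "x \<in> carrier (part X n) \<Longrightarrow> rst X f n x = f n x"
  by (simp add: rst_def)

lemma rst_eqI: "(\<And>n x. x \<in> carrier (part X n) \<Longrightarrow> f n x = g n x) \<Longrightarrow> rst X f = rst X g"
  unfolding rst_def by (rule ext, rule restrict_ext)

lemma rst_cm:
  assumes X: "X \<in> bounded_complexes R" and l: "\<And>n. lin R (part X n) (part Y n) (f n)"
    and c: "\<And>n x. x \<in> carrier (part X n) \<Longrightarrow> f (n + 1) (diff X n x) = diff Y n (f n x)"
  shows "rst X f \<in> chain_maps R X Y"
  unfolding chain_maps_def
proof (intro CollectI conjI allI ballI)
  fix n show "rst X f n \<in> mod_hom R (part X n) (part Y n)"
    unfolding rst_def by (rule lin_restrict[OF l bcD(1)[OF X]])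
  fix x assume x: "x \<in> carrier (part X n)"
  show "rst X f (n + 1) (diff X n x) = diff Y n (rst X f n x)"
    by (simp only: rst_apply[OF x] rst_apply[OF lin_closed[OF bcD(4)[OF X] x]] c[OF x])
qed

lemma cm_rst: "f \<in> chain_maps R X Y \<Longrightarrow> rst X f = f"
  by (rule ext) (simp add: rst_def extensional_restrict cmD(1)[unfolded mod_hom_iff])

lemma complex_cat_simps [simp]:
  "Obj (complex_cat R) = bounded_complexes R"
  "Hom (complex_cat R) = chain_maps R"
  "idn (complex_cat R) X = rst X (\<lambda>n x. x)"
  "cmp (complex_cat R) X Y Z g f = rst X (\<lambda>n x. g n (f n x))"
  "hadd (complex_cat R) X Y f g = rst X (\<lambda>n x. f n x \<oplus>\<^bsub>part Y n\<^esub> g n x)"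
  "hzero (complex_cat R) X Y = rst X (\<lambda>n x. \<zero>\<^bsub>part Y n\<^esub>)"
  by (simp_all add: complex_cat_def rst_def compose_def fun_eq_iff)

lemma cm_id: "X \<in> bounded_complexes R \<Longrightarrow> rst X (\<lambda>n x. x) \<in> chain_maps R X X"
  by (rule rst_cm) (simp_all add: lin_id)

lemma cm_comp:
  assumes "X \<in> bounded_complexes R" "f \<in> chain_maps R X Y" "g \<in> chain_maps R Y Z"
  shows "rst X (\<lambda>n x. g n (f n x)) \<in> chain_maps R X Z"
  by (rule rst_cm[OF assms(1) lin_comp[OF cmD(2)[OF assms(2)] cmD(2)[OF assms(3)]]])
    (simp only: cmD(3)[OF assms(2)] cmD(3)[OF assms(3) lin_closed[OF cmD(2)[OF assms(2)]]])

lemma cm_zero: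
  assumes "X \<in> bounded_complexes R" "Y \<in> bounded_complexes R"
  shows "rst X (\<lambda>n x. \<zero>\<^bsub>part Y n\<^esub>) \<in> chain_maps R X Y"
  by (rule rst_cm[OF assms(1) lin_const_zero[OF bcD(1)[OF assms(2)]]])
    (simp only: lin_zero[OF bcD(4)[OF assms(2)] bcD(1)[OF assms(2)] bcD(1)[OF assms(2)]])

lemma cm_add:
  assumes X: "X \<in> bounded_complexes R" and Y: "Y \<in> bounded_complexes R"
    and f: "f \<in> chain_maps R X Y" and g: "g \<in> chain_maps R X Y"
  shows "rst X (\<lambda>n x. f n x \<oplus>\<^bsub>part Y n\<^esub> g n x) \<in> chain_maps R X Y"
  by (rule rst_cm[OF X lin_sum[OF bcD(1)[OF X] bcD(1)[OF Y] cmD(2)[OF f] cmD(2)[OF g]]])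
    (simp only: cmD(3)[OF f] cmD(3)[OF g] lin_add[OF bcD(4)[OF Y] lin_closed[OF cmD(2)[OF f]]
        lin_closed[OF cmD(2)[OF g]]])

lemma cm_neg:
  assumes X: "X \<in> bounded_complexes R" and Y: "Y \<in> bounded_complexes R"
    and f: "f \<in> chain_maps R X Y"
  shows "rst X (\<lambda>n x. \<ominus>\<^bsub>part Y n\<^esub> f n x) \<in> chain_maps R X Y"
  by (rule rst_cm[OF X lin_uminus[OF bcD(1)[OF X] bcD(1)[OF Y] cmD(2)[OF f]]])
    (simp only: cmD(3)[OF f] lin_neg[OF bcD(4)[OF Y] bcD(1)[OF Y] bcD(1)[OF Y] lin_closed[OF cmD(2)[OF f]]])

lemma complex_preadditive:
  fixes R :: "('a, 'r) ring_scheme"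
  shows "preadditive (complex_cat R :: (('a, 'u) cpx, int \<Rightarrow> 'u \<Rightarrow> 'u) preadd_cat)"
proof (intro preadditive.intro category.intro preadditive_axioms.intro,
    unfold is_category_def complex_cat_simps, intro conjI ballI)
  fix X :: "('a, 'u) cpx" assume "X \<in> bounded_complexes R"
  then show "rst X (\<lambda>n x. x) \<in> chain_maps R X X" by (rule cm_id)
next
  fix X Y Z :: "('a, 'u) cpx" and f g assume "X \<in> bounded_complexes R" "f \<in> chain_maps R X Y" "g \<in> chain_maps R Y Z"
  then show "rst X (\<lambda>n x. g n (f n x)) \<in> chain_maps R X Z" by (rule cm_comp)
next
  fix X Y :: "('a, 'u) cpx" and f assume X: "X \<in> bounded_complexes R" "Y \<in> bounded_complexes R" and f: "f \<in> chain_maps R X Y"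
  show "rst X (\<lambda>n x. f n (rst X (\<lambda>n x. x) n x)) = f"
    by (rule cm_eqI[OF cm_comp[OF X(1) cm_id[OF X(1)] f] f]) (simp only: rst_apply)
  show "rst X (\<lambda>n x. rst Y (\<lambda>n x. x) n (f n x)) = f"
    by (rule cm_eqI[OF cm_comp[OF X(1) f cm_id[OF X(2)]] f]) (simp only: rst_apply lin_closed[OF cmD(2)[OF f]])
next
  fix W X Y Z :: "('a, 'u) cpx" and f g h
  assume W: "W \<in> bounded_complexes R" "X \<in> bounded_complexes R" "Y \<in> bounded_complexes R"
    and f: "f \<in> chain_maps R W X" and g: "g \<in> chain_maps R X Y" and h: "h \<in> chain_maps R Y Z"
  show "rst W (\<lambda>n x. rst X (\<lambda>n x. h n (g n x)) n (f n x)) = rst W (\<lambda>n x. h n (rst W (\<lambda>n x. g n (f n x)) n x))"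
    by (rule rst_eqI) (simp only: rst_apply lin_closed[OF cmD(2)[OF f]])
next
  fix X Y :: "('a, 'u) cpx" assume X: "X \<in> bounded_complexes R" and Y: "Y \<in> bounded_complexes R"
  have grp: "abelian_group (part Y n)" for n by (rule rm_group[OF bcD(1)[OF Y]])
  show "comm_group (hom_group (complex_cat R) X Y)"
  proof (rule comm_groupI, unfold hom_group_def complex_cat_simps partial_object.simps monoid.simps)
    fix f g assume f: "f \<in> chain_maps R X Y" and g: "g \<in> chain_maps R X Y"
    note fc = lin_closed[OF cmD(2)[OF f]] and gc = lin_closed[OF cmD(2)[OF g]]
    show "rst X (\<lambda>n x. f n x \<oplus>\<^bsub>part Y n\<^esub> g n x) \<in> chain_maps R X Y" by (rule cm_add[OF X Y f g])
    show "rst X (\<lambda>n x. f n x \<oplus>\<^bsub>part Y n\<^esub> g n x) = rst X (\<lambda>n x. g n x \<oplus>\<^bsub>part Y n\<^esub> f n x)"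
      by (rule rst_eqI) (simp only: rst_apply abelian_monoid.a_comm[OF abelian_group.axioms(1)[OF grp] fc gc])
    fix h assume h: "h \<in> chain_maps R X Y"
    note hc = lin_closed[OF cmD(2)[OF h]]
    show "rst X (\<lambda>n x. rst X (\<lambda>n x. f n x \<oplus>\<^bsub>part Y n\<^esub> g n x) n x \<oplus>\<^bsub>part Y n\<^esub> h n x) =
        rst X (\<lambda>n x. f n x \<oplus>\<^bsub>part Y n\<^esub> rst X (\<lambda>n x. g n x \<oplus>\<^bsub>part Y n\<^esub> h n x) n x)"
      by (rule rst_eqI) (simp only: rst_apply abelian_monoid.a_assoc[OF abelian_group.axioms(1)[OF grp] fc gc hc])
  next
    show "rst X (\<lambda>n x. \<zero>\<^bsub>part Y n\<^esub>) \<in> chain_maps R X Y" by (rule cm_zero[OF X Y])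
  next
    fix f assume f: "f \<in> chain_maps R X Y"
    note fc = lin_closed[OF cmD(2)[OF f]]
    show "rst X (\<lambda>n x. rst X (\<lambda>n x. \<zero>\<^bsub>part Y n\<^esub>) n x \<oplus>\<^bsub>part Y n\<^esub> f n x) = f"
      by (rule cm_eqI[OF cm_add[OF X Y cm_zero[OF X Y] f] f])
        (simp only: rst_apply abelian_monoid.l_zero[OF abelian_group.axioms(1)[OF grp] fc])
    have "rst X (\<lambda>n x. rst X (\<lambda>n x. \<ominus>\<^bsub>part Y n\<^esub> f n x) n x \<oplus>\<^bsub>part Y n\<^esub> f n x) = rst X (\<lambda>n x. \<zero>\<^bsub>part Y n\<^esub>)"
      by (rule rst_eqI) (simp only: rst_apply abelian_group.l_neg[OF grp fc])
    then show "\<exists>g\<in>chain_maps R X Y. rst X (\<lambda>n x. g n x \<oplus>\<^bsub>part Y n\<^esub> f n x) = rst X (\<lambda>n x. \<zero>\<^bsub>part Y n\<^esub>)"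
      using cm_neg[OF X Y f] by blast
  qed
next
  fix X Y Z :: "('a, 'u) cpx" and f g h
  assume X: "X \<in> bounded_complexes R" and Y: "Y \<in> bounded_complexes R" and Z: "Z \<in> bounded_complexes R"
    and f: "f \<in> chain_maps R X Y" and g: "g \<in> chain_maps R X Y" and h: "h \<in> chain_maps R Y Z"
  note fc = lin_closed[OF cmD(2)[OF f]] and gc = lin_closed[OF cmD(2)[OF g]]
  show "rst X (\<lambda>n x. h n (rst X (\<lambda>n x. f n x \<oplus>\<^bsub>part Y n\<^esub> g n x) n x)) =
      rst X (\<lambda>n x. rst X (\<lambda>n x. h n (f n x)) n x \<oplus>\<^bsub>part Z n\<^esub> rst X (\<lambda>n x. h n (g n x)) n x)"
    by (rule rst_eqI) (simp only: rst_apply lin_add[OF cmD(2)[OF h] fc gc])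
next
  fix X Y Z :: "('a, 'u) cpx" and f g h
  assume X: "X \<in> bounded_complexes R" and Y: "Y \<in> bounded_complexes R" and Z: "Z \<in> bounded_complexes R"
    and f: "f \<in> chain_maps R X Y" and g: "g \<in> chain_maps R Y Z" and h: "h \<in> chain_maps R Y Z"
  note fc = lin_closed[OF cmD(2)[OF f]]
  show "rst X (\<lambda>n x. rst Y (\<lambda>n x. g n x \<oplus>\<^bsub>part Z n\<^esub> h n x) n (f n x)) =
      rst X (\<lambda>n x. rst X (\<lambda>n x. g n (f n x)) n x \<oplus>\<^bsub>part Z n\<^esub> rst X (\<lambda>n x. h n (f n x)) n x)"
    by (rule rst_eqI) (simp only: rst_apply fc)
qed

section \<open>Null-homotopic chain maps form an ideal\<close>

lemma nullI:
  assumes X: "X \<in> bounded_complexes R" and f: "f \<in> chain_maps R X Y"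
    and h: "\<And>n. lin R (part X n) (part Y (n - 1)) (h n)"
    and eq: "\<And>n x. x \<in> carrier (part X n) \<Longrightarrow>
      f n x = diff Y (n - 1) (h n x) \<oplus>\<^bsub>part Y n\<^esub> h (n + 1) (diff X n x)"
  shows "f \<in> null_homotopic R X Y"
  unfolding null_homotopic_def
proof (intro CollectI conjI f exI[of _ "rst X h"] allI ballI)
  fix n show "rst X h n \<in> mod_hom R (part X n) (part Y (n - 1))"
    unfolding rst_def by (rule lin_restrict[OF h bcD(1)[OF X]])
  fix x assume x: "x \<in> carrier (part X n)"
  show "f n x = diff Y (n - 1) (rst X h n x) \<oplus>\<^bsub>part Y n\<^esub> rst X h (n + 1) (diff X n x)"
    by (simp only: rst_apply[OF x] rst_apply[OF lin_closed[OF bcD(4)[OF X] x]] eq[OF x])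
qed

lemma nullE:
  assumes "f \<in> null_homotopic R X Y"
  obtains h where "f \<in> chain_maps R X Y" "\<And>n. lin R (part X n) (part Y (n - 1)) (h n)"
    "\<And>n. lin R (part X (n + 1)) (part Y n) (h (n + 1))"
    "\<And>n x. x \<in> carrier (part X n) \<Longrightarrow>
      f n x = diff Y (n - 1) (h n x) \<oplus>\<^bsub>part Y n\<^esub> h (n + 1) (diff X n x)"
proof -
  obtain h where f: "f \<in> chain_maps R X Y" and h: "\<And>n. h n \<in> mod_hom R (part X n) (part Y (n - 1))"
    and eq: "\<And>n x. x \<in> carrier (part X n) \<Longrightarrow>
      f n x = diff Y (n - 1) (h n x) \<oplus>\<^bsub>part Y n\<^esub> h (n + 1) (diff X n x)"
    using assms unfolding null_homotopic_def by blast
  have "lin R (part X (n + 1)) (part Y n) (h (n + 1))" for n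
    using mod_hom_lin[OF h[of "n + 1"]] by simp
  then show thesis using that[OF f mod_hom_lin[OF h] _ eq] by blast
qed

lemma null_ideal:
  fixes R :: "('a, 'r) ring_scheme"
  shows "hom_ideal (complex_cat R :: (('a, 'u) cpx, int \<Rightarrow> 'u \<Rightarrow> 'u) preadd_cat) (null_homotopic R)"
proof (intro hom_ideal.intro hom_ideal_axioms.intro complex_preadditive, unfold complex_cat_simps)
  fix X Y :: "('a, 'u) cpx" and j assume "j \<in> null_homotopic R X Y"
  then show "j \<in> chain_maps R X Y" by (simp add: null_homotopic_def)
next
  fix X Y :: "('a, 'u) cpx" assume X: "X \<in> bounded_complexes R" and Y: "Y \<in> bounded_complexes R"
  interpret Y: abelian_group "part Y n" for n by (rule rm_group[OF bcD(1)[OF Y]])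
  show "rst X (\<lambda>n x. \<zero>\<^bsub>part Y n\<^esub>) \<in> null_homotopic R X Y"
  proof (rule nullI[OF X cm_zero[OF X Y], of "\<lambda>n x. \<zero>\<^bsub>part Y (n - 1)\<^esub>"])
    show "lin R (part X n) (part Y (n - 1)) (\<lambda>x. \<zero>\<^bsub>part Y (n - 1)\<^esub>)" for n
      by (rule lin_const_zero[OF bcD(1)[OF Y]])
    fix n x assume "x \<in> carrier (part X n)"
    then show "rst X (\<lambda>n x. \<zero>\<^bsub>part Y n\<^esub>) n x =
        diff Y (n - 1) \<zero>\<^bsub>part Y (n - 1)\<^esub> \<oplus>\<^bsub>part Y n\<^esub> \<zero>\<^bsub>part Y (n + 1 - 1)\<^esub>"
      using lin_zero[OF bcD(5)[OF Y] bcD(1)[OF Y] bcD(1)[OF Y], of n] by (simp add: rst_apply)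
  qed
next
  fix X Y :: "('a, 'u) cpx" and j k assume X: "X \<in> bounded_complexes R" and Y: "Y \<in> bounded_complexes R"
    and "j \<in> null_homotopic R X Y" "k \<in> null_homotopic R X Y"
  then obtain h h' where j: "j \<in> chain_maps R X Y" and h: "\<And>n. lin R (part X n) (part Y (n - 1)) (h n)"
    "\<And>n. lin R (part X (n + 1)) (part Y n) (h (n + 1))"
    and jh: "\<And>n x. x \<in> carrier (part X n) \<Longrightarrow>
      j n x = diff Y (n - 1) (h n x) \<oplus>\<^bsub>part Y n\<^esub> h (n + 1) (diff X n x)"
    and k: "k \<in> chain_maps R X Y" and h': "\<And>n. lin R (part X n) (part Y (n - 1)) (h' n)"
    "\<And>n. lin R (part X (n + 1)) (part Y n) (h' (n + 1))"
    and kh: "\<And>n x. x \<in> carrier (part X n) \<Longrightarrow>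
      k n x = diff Y (n - 1) (h' n x) \<oplus>\<^bsub>part Y n\<^esub> h' (n + 1) (diff X n x)"
    by (elim nullE) (rule that)
  interpret Y: abelian_group "part Y n" for n by (rule rm_group[OF bcD(1)[OF Y]])
  show "rst X (\<lambda>n x. j n x \<oplus>\<^bsub>part Y n\<^esub> k n x) \<in> null_homotopic R X Y"
  proof (rule nullI[OF X cm_add[OF X Y j k] lin_sum[OF bcD(1)[OF X] bcD(1)[OF Y] h(1) h'(1)]])
    fix n x assume x: "x \<in> carrier (part X n)"
    note dx = lin_closed[OF bcD(4)[OF X] x]
    have cl: "h (n + 1) (diff X n x) \<in> carrier (part Y n)" "h' (n + 1) (diff X n x) \<in> carrier (part Y n)"
      "diff Y (n - 1) (h n x) \<in> carrier (part Y n)" "diff Y (n - 1) (h' n x) \<in> carrier (part Y n)"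
      using lin_closed[OF h(2) dx] lin_closed[OF h'(2) dx]
        lin_closed[OF bcD(5)[OF Y] lin_closed[OF h(1) x]] lin_closed[OF bcD(5)[OF Y] lin_closed[OF h'(1) x]] .
    show "rst X (\<lambda>n x. j n x \<oplus>\<^bsub>part Y n\<^esub> k n x) n x =
        diff Y (n - 1) (h n x \<oplus>\<^bsub>part Y (n - 1)\<^esub> h' n x) \<oplus>\<^bsub>part Y n\<^esub>
        (h (n + 1) (diff X n x) \<oplus>\<^bsub>part Y (n + 1 - 1)\<^esub> h' (n + 1) (diff X n x))"
      unfolding lin_add[OF bcD(5)[OF Y] lin_closed[OF h(1) x] lin_closed[OF h'(1) x]] rst_apply[OF x]
        jh[OF x] kh[OF x] using cl by (simp add: Y.a_ac)
  qed
next
  fix X Y Z :: "('a, 'u) cpx" and j g assume X: "X \<in> bounded_complexes R" and Y: "Y \<in> bounded_complexes R" and Z: "Z \<in> bounded_complexes R"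
    and "j \<in> null_homotopic R X Y" and g: "g \<in> chain_maps R Y Z"
  then obtain h where j: "j \<in> chain_maps R X Y" and h: "\<And>n. lin R (part X n) (part Y (n - 1)) (h n)"
    "\<And>n. lin R (part X (n + 1)) (part Y n) (h (n + 1))"
    and jh: "\<And>n x. x \<in> carrier (part X n) \<Longrightarrow>
      j n x = diff Y (n - 1) (h n x) \<oplus>\<^bsub>part Y n\<^esub> h (n + 1) (diff X n x)"
    by (elim nullE) (rule that)
  show "rst X (\<lambda>n x. g n (j n x)) \<in> null_homotopic R X Z"
  proof (rule nullI[OF X cm_comp[OF X j g] lin_comp[OF h(1) cmD(2)[OF g]]])
    fix n x assume x: "x \<in> carrier (part X n)"
    note dx = lin_closed[OF bcD(4)[OF X] x]
    show "rst X (\<lambda>n x. g n (j n x)) n x =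
        diff Z (n - 1) (g (n - 1) (h n x)) \<oplus>\<^bsub>part Z n\<^esub> g (n + 1 - 1) (h (n + 1) (diff X n x))"
      unfolding rst_apply[OF x] jh[OF x]
        lin_add[OF cmD(2)[OF g] lin_closed[OF bcD(5)[OF Y] lin_closed[OF h(1) x]] lin_closed[OF h(2) dx]]
        cmD(4)[OF g lin_closed[OF h(1) x]] by simp
  qed
next
  fix X Y Z :: "('a, 'u) cpx" and j f assume X: "X \<in> bounded_complexes R" and Y: "Y \<in> bounded_complexes R" and Z: "Z \<in> bounded_complexes R"
    and "j \<in> null_homotopic R Y Z" and f: "f \<in> chain_maps R X Y"
  then obtain h where j: "j \<in> chain_maps R Y Z" and h: "\<And>n. lin R (part Y n) (part Z (n - 1)) (h n)"
    and jh: "\<And>n x. x \<in> carrier (part Y n) \<Longrightarrow>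
      j n x = diff Z (n - 1) (h n x) \<oplus>\<^bsub>part Z n\<^esub> h (n + 1) (diff Y n x)"
    by (elim nullE) (rule that)
  show "rst X (\<lambda>n x. j n (f n x)) \<in> null_homotopic R X Z"
    by (rule nullI[OF X cm_comp[OF X f j] lin_comp[OF cmD(2)[OF f] h(1)]])
      (simp only: rst_apply jh lin_closed[OF cmD(2)[OF f]] cmD(3)[OF f])
qed


subsection \<open>Quasi-isomorphisms\<close>

lemma cocycles_submod:
  assumes X: "X \<in> bounded_complexes R"
  shows "submod R (part X n) (cocycles X n)"
  using submod_vimage[OF bcD(1)[OF X] bcD(1)[OF X] bcD(4)[OF X] submod_zero[OF bcD(1)[OF X]], of n]
  by (simp add: cocycles_def)

lemma coboundaries_submod:
  assumes X: "X \<in> bounded_complexes R"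
  shows "submod R (part X n) (coboundaries X n)"
  unfolding coboundaries_def by (rule submod_image[OF bcD(1)[OF X] bcD(1)[OF X] bcD(5)[OF X]])

lemma cocyclesD: "x \<in> cocycles X n \<Longrightarrow> x \<in> carrier (part X n)"
  "x \<in> cocycles X n \<Longrightarrow> diff X n x = \<zero>\<^bsub>part X (n + 1)\<^esub>"
  by (simp_all add: cocycles_def)

lemma coboundaries_cocycles: "X \<in> bounded_complexes R \<Longrightarrow> coboundaries X n \<subseteq> cocycles X n"
  by (auto simp: coboundaries_def cocycles_def bcD(7) lin_closed[OF bcD(5)])

lemma cm_cocycles:
  assumes "X \<in> bounded_complexes R" "Y \<in> bounded_complexes R" "f \<in> chain_maps R X Y" "x \<in> cocycles X n"
  shows "f n x \<in> cocycles Y n"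
proof -
  note x = cocyclesD[OF assms(4)]
  have "diff Y n (f n x) = f (n + 1) \<zero>\<^bsub>part X (n + 1)\<^esub>"
    using cmD(3)[OF assms(3) x(1)] x(2) by simp
  then show ?thesis
    using lin_zero[OF cmD(2)[OF assms(3)] bcD(1)[OF assms(1)] bcD(1)[OF assms(2)], of "n + 1"]
      lin_closed[OF cmD(2)[OF assms(3)] x(1)] by (simp add: cocycles_def)
qed

lemma cm_coboundaries:
  assumes "f \<in> chain_maps R X Y" "x \<in> coboundaries X n"
  shows "f n x \<in> coboundaries Y n"
proof -
  obtain w where w: "w \<in> carrier (part X (n - 1))" "x = diff X (n - 1) w"
    using assms(2) by (auto simp: coboundaries_def)
  show ?thesis
    unfolding w(2) cmD(4)[OF assms(1) w(1)] coboundaries_def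
    by (rule imageI[OF lin_closed[OF cmD(2)[OF assms(1)] w(1)]])
qed

lemma mem_coset: "y \<in> B +>\<^bsub>M\<^esub> x \<longleftrightarrow> (\<exists>b\<in>B. y = b \<oplus>\<^bsub>M\<^esub> x)"
  by (auto simp: a_r_coset_def r_coset_def)

lemma coset_eq_iff:
  assumes M: "right_module R M" and B: "submod R M B" and x: "x \<in> carrier M" and y: "y \<in> carrier M"
  shows "B +>\<^bsub>M\<^esub> x = B +>\<^bsub>M\<^esub> y \<longleftrightarrow> x \<ominus>\<^bsub>M\<^esub> y \<in> B"
proof -
  interpret M: right_module R M by fact
  have c: "B +>\<^bsub>M\<^esub> z = {b \<oplus>\<^bsub>M\<^esub> z | b. b \<in> B}" for z by (auto simp: a_r_coset_def r_coset_def)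
  have sub: "\<And>b. b \<in> B \<Longrightarrow> b \<in> carrier M" and add: "\<And>b c. \<lbrakk>b \<in> B; c \<in> B\<rbrakk> \<Longrightarrow> b \<oplus>\<^bsub>M\<^esub> c \<in> B"
    and zero: "\<zero>\<^bsub>M\<^esub> \<in> B" using B by (auto simp: submod_def)
  have neg: "\<And>b. b \<in> B \<Longrightarrow> \<ominus>\<^bsub>M\<^esub> b \<in> B" by (rule submod_neg[OF M B])
  have half: "B +>\<^bsub>M\<^esub> u \<subseteq> B +>\<^bsub>M\<^esub> v" if "u \<ominus>\<^bsub>M\<^esub> v \<in> B" "u \<in> carrier M" "v \<in> carrier M" for u v
  proof
    fix z assume "z \<in> B +>\<^bsub>M\<^esub> u"
    then obtain b where b: "b \<in> B" "z = b \<oplus>\<^bsub>M\<^esub> u" by (auto simp: c)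
    have "z = (b \<oplus>\<^bsub>M\<^esub> (u \<ominus>\<^bsub>M\<^esub> v)) \<oplus>\<^bsub>M\<^esub> v"
      using that b sub by (simp add: a_minus_def M.M.a_assoc M.M.l_neg)
    then show "z \<in> B +>\<^bsub>M\<^esub> v" using add[OF b(1) that(1)] by (auto simp: c)
  qed
  show ?thesis
  proof
    assume eq: "B +>\<^bsub>M\<^esub> x = B +>\<^bsub>M\<^esub> y"
    have "\<zero>\<^bsub>M\<^esub> \<oplus>\<^bsub>M\<^esub> x \<in> B +>\<^bsub>M\<^esub> x" using zero by (auto simp: c)
    then obtain b where b: "b \<in> B" "x = b \<oplus>\<^bsub>M\<^esub> y" using x unfolding eq by (auto simp: c)
    then show "x \<ominus>\<^bsub>M\<^esub> y \<in> B" using M.M.minus_eq_if_eq_add[OF b(2) sub[OF b(1)] y] by simp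
  next
    assume xy: "x \<ominus>\<^bsub>M\<^esub> y \<in> B"
    have "y \<ominus>\<^bsub>M\<^esub> x = \<ominus>\<^bsub>M\<^esub> (x \<ominus>\<^bsub>M\<^esub> y)"
      using x y by (simp add: a_minus_def M.M.minus_add M.M.a_comm)
    then have "y \<ominus>\<^bsub>M\<^esub> x \<in> B" using neg[OF xy] by simp
    then show "B +>\<^bsub>M\<^esub> x = B +>\<^bsub>M\<^esub> y" using half[OF xy x y] half[of y x] x y by blast
  qed
qed

lemma cohomology_eq: "cohomology X n = (\<lambda>x. coboundaries X n +>\<^bsub>part X n\<^esub> x) ` cocycles X n"
  by (auto simp: cohomology_def A_RCOSETS_def RCOSETS_def a_r_coset_def r_coset_def)

lemma cohomology_map_coset:
  assumes X: "X \<in> bounded_complexes R" and Y: "Y \<in> bounded_complexes R" and f: "f \<in> chain_maps R X Y"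
    and x: "x \<in> carrier (part X n)"
  shows "cohomology_map Y f n (coboundaries X n +>\<^bsub>part X n\<^esub> x) = coboundaries Y n +>\<^bsub>part Y n\<^esub> f n x"
proof -
  interpret X: right_module R "part X n" by (rule bcD(1)[OF X])
  interpret Y: right_module R "part Y n" by (rule bcD(1)[OF Y])
  note fl = cmD(2)[OF f]
  have "coboundaries Y n +>\<^bsub>part Y n\<^esub> f n y = coboundaries Y n +>\<^bsub>part Y n\<^esub> f n x"
    if y: "y \<in> coboundaries X n +>\<^bsub>part X n\<^esub> x" for y
  proof -
    obtain b where b: "b \<in> coboundaries X n" "y = b \<oplus>\<^bsub>part X n\<^esub> x"
      using y unfolding mem_coset by blast
    have bX: "b \<in> carrier (part X n)" using b(1) coboundaries_submod[OF X, of n] by (auto simp: submod_def)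
    have "f n y = f n b \<oplus>\<^bsub>part Y n\<^esub> f n x" unfolding b(2) by (rule lin_add[OF fl bX x])
    from Y.M.minus_eq_if_eq_add[OF this lin_closed[OF fl bX] lin_closed[OF fl x]]
    have "f n y \<ominus>\<^bsub>part Y n\<^esub> f n x \<in> coboundaries Y n" using cm_coboundaries[OF f b(1)] by simp
    moreover have "f n y \<in> carrier (part Y n)" unfolding b(2) by (intro lin_closed[OF fl] X.M.a_closed bX x)
    ultimately show ?thesis
      unfolding coset_eq_iff[OF bcD(1)[OF Y] coboundaries_submod[OF Y] \<open>f n y \<in> _\<close> lin_closed[OF fl x]] by simp
  qed
  moreover have "x \<in> coboundaries X n +>\<^bsub>part X n\<^esub> x"
  proof -
    have "\<zero>\<^bsub>part X n\<^esub> \<oplus>\<^bsub>part X n\<^esub> x \<in> coboundaries X n +>\<^bsub>part X n\<^esub> x"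
      using coboundaries_submod[OF X, of n] by (auto simp: submod_def a_r_coset_def r_coset_def)
    then show ?thesis using x by simp
  qed
  ultimately show ?thesis unfolding cohomology_map_def by blast
qed

text \<open>Injectivity and surjectivity on cohomology, expressed with cocycles and coboundaries.
  Later arguments about quasi-isomorphisms use this form and no longer mention cosets.\<close>

lemma qis_iff:
  assumes X: "X \<in> bounded_complexes R" and Y: "Y \<in> bounded_complexes R"
  shows "f \<in> quasi_isomorphisms R X Y \<longleftrightarrow> f \<in> chain_maps R X Y \<and>
    (\<forall>n. \<forall>x\<in>cocycles X n. f n x \<in> coboundaries Y n \<longrightarrow> x \<in> coboundaries X n) \<and>
    (\<forall>n. \<forall>y\<in>cocycles Y n. \<exists>x\<in>cocycles X n. y \<ominus>\<^bsub>part Y n\<^esub> f n x \<in> coboundaries Y n)"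
proof -
  have "bij_betw (cohomology_map Y f n) (cohomology X n) (cohomology Y n) \<longleftrightarrow>
      (\<forall>x\<in>cocycles X n. f n x \<in> coboundaries Y n \<longrightarrow> x \<in> coboundaries X n) \<and>
      (\<forall>y\<in>cocycles Y n. \<exists>x\<in>cocycles X n. y \<ominus>\<^bsub>part Y n\<^esub> f n x \<in> coboundaries Y n)"
    if f: "f \<in> chain_maps R X Y" for n
  proof -
    interpret X: right_module R "part X n" by (rule bcD(1)[OF X])
    interpret Y: right_module R "part Y n" by (rule bcD(1)[OF Y])
    note fl = cmD(2)[OF f]
    let ?cX = "\<lambda>x. coboundaries X n +>\<^bsub>part X n\<^esub> x" and ?cY = "\<lambda>x. coboundaries Y n +>\<^bsub>part Y n\<^esub> x"
    have map: "cohomology_map Y f n (?cX x) = ?cY (f n x)" if "x \<in> cocycles X n" for x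
      by (rule cohomology_map_coset[OF X Y f cocyclesD(1)[OF that]])
    have iX: "?cX x = ?cX y \<longleftrightarrow> x \<ominus>\<^bsub>part X n\<^esub> y \<in> coboundaries X n"
      if "x \<in> cocycles X n" "y \<in> cocycles X n" for x y
      by (rule coset_eq_iff[OF bcD(1)[OF X] coboundaries_submod[OF X] cocyclesD(1)[OF that(1)] cocyclesD(1)[OF that(2)]])
    have iY: "?cY x = ?cY y \<longleftrightarrow> x \<ominus>\<^bsub>part Y n\<^esub> y \<in> coboundaries Y n"
      if "x \<in> cocycles Y n" "y \<in> cocycles Y n" for x y
      by (rule coset_eq_iff[OF bcD(1)[OF Y] coboundaries_submod[OF Y] cocyclesD(1)[OF that(1)] cocyclesD(1)[OF that(2)]])
    have fc: "f n x \<in> cocycles Y n" if "x \<in> cocycles X n" for x by (rule cm_cocycles[OF X Y f that])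
    have minus: "x \<ominus>\<^bsub>part X n\<^esub> y \<in> cocycles X n" "f n (x \<ominus>\<^bsub>part X n\<^esub> y) = f n x \<ominus>\<^bsub>part Y n\<^esub> f n y"
      if "x \<in> cocycles X n" "y \<in> cocycles X n" for x y
    proof -
      have "\<ominus>\<^bsub>part X n\<^esub> y \<in> cocycles X n" by (rule submod_neg[OF bcD(1)[OF X] cocycles_submod[OF X] that(2)])
      then show "x \<ominus>\<^bsub>part X n\<^esub> y \<in> cocycles X n"
        using cocycles_submod[OF X, of n] that(1) by (simp add: submod_def a_minus_def)
      show "f n (x \<ominus>\<^bsub>part X n\<^esub> y) = f n x \<ominus>\<^bsub>part Y n\<^esub> f n y"
        by (rule lin_minus[OF fl bcD(1)[OF X] bcD(1)[OF Y] cocyclesD(1)[OF that(1)] cocyclesD(1)[OF that(2)]])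
    qed
    have zX: "\<zero>\<^bsub>part X n\<^esub> \<in> cocycles X n" using cocycles_submod[OF X, of n] by (simp add: submod_def)
    have f0: "f n \<zero>\<^bsub>part X n\<^esub> = \<zero>\<^bsub>part Y n\<^esub>" by (rule lin_zero[OF fl bcD(1)[OF X] bcD(1)[OF Y]])
    have inj: "inj_on (cohomology_map Y f n) (cohomology X n) \<longleftrightarrow>
        (\<forall>x\<in>cocycles X n. f n x \<in> coboundaries Y n \<longrightarrow> x \<in> coboundaries X n)"
    proof
      assume i: "inj_on (cohomology_map Y f n) (cohomology X n)"
      show "\<forall>x\<in>cocycles X n. f n x \<in> coboundaries Y n \<longrightarrow> x \<in> coboundaries X n"
      proof (intro ballI impI)
        fix x assume x: "x \<in> cocycles X n" "f n x \<in> coboundaries Y n"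
        have "f n x \<ominus>\<^bsub>part Y n\<^esub> f n \<zero>\<^bsub>part X n\<^esub> \<in> coboundaries Y n"
          unfolding f0 using x(2) Y.M.minus_zero_right[OF cocyclesD(1)[OF fc[OF x(1)]]] by simp
        then have "?cY (f n x) = ?cY (f n \<zero>\<^bsub>part X n\<^esub>)" unfolding iY[OF fc[OF x(1)] fc[OF zX]] .
        then have "cohomology_map Y f n (?cX x) = cohomology_map Y f n (?cX \<zero>\<^bsub>part X n\<^esub>)"
          unfolding map[OF x(1)] map[OF zX] .
        then have "?cX x = ?cX \<zero>\<^bsub>part X n\<^esub>"
          by (rule inj_onD[OF i]) (use x(1) zX in \<open>auto simp: cohomology_eq\<close>)
        then show "x \<in> coboundaries X n"
          unfolding iX[OF x(1) zX] using X.M.minus_zero_right[OF cocyclesD(1)[OF x(1)]] by simp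
      qed
    next
      assume i: "\<forall>x\<in>cocycles X n. f n x \<in> coboundaries Y n \<longrightarrow> x \<in> coboundaries X n"
      show "inj_on (cohomology_map Y f n) (cohomology X n)"
      proof (rule inj_onI)
        fix u v assume "u \<in> cohomology X n" "v \<in> cohomology X n"
          and eq: "cohomology_map Y f n u = cohomology_map Y f n v"
        then obtain x y where x: "x \<in> cocycles X n" "u = ?cX x" and y: "y \<in> cocycles X n" "v = ?cX y"
          by (auto simp: cohomology_eq)
        have "f n x \<ominus>\<^bsub>part Y n\<^esub> f n y \<in> coboundaries Y n"
          using eq unfolding x(2) y(2) map[OF x(1)] map[OF y(1)] iY[OF fc[OF x(1)] fc[OF y(1)]] .
        then have "x \<ominus>\<^bsub>part X n\<^esub> y \<in> coboundaries X n"
          using i minus[OF x(1) y(1)] by simp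
        then show "u = v" unfolding x(2) y(2) iX[OF x(1) y(1)] .
      qed
    qed
    have im: "cohomology_map Y f n ` cohomology X n = (\<lambda>x. ?cY (f n x)) ` cocycles X n"
      unfolding cohomology_eq image_image by (rule image_cong[OF refl map])
    have surj: "cohomology_map Y f n ` cohomology X n = cohomology Y n \<longleftrightarrow>
        (\<forall>y\<in>cocycles Y n. \<exists>x\<in>cocycles X n. y \<ominus>\<^bsub>part Y n\<^esub> f n x \<in> coboundaries Y n)"
    proof
      assume s: "cohomology_map Y f n ` cohomology X n = cohomology Y n"
      show "\<forall>y\<in>cocycles Y n. \<exists>x\<in>cocycles X n. y \<ominus>\<^bsub>part Y n\<^esub> f n x \<in> coboundaries Y n"
      proof
        fix y assume y: "y \<in> cocycles Y n"
        then have "?cY y \<in> cohomology Y n" unfolding cohomology_eq by (rule imageI)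
        then have "?cY y \<in> (\<lambda>x. ?cY (f n x)) ` cocycles X n" unfolding s[symmetric] im .
        then obtain x where x: "x \<in> cocycles X n" "?cY y = ?cY (f n x)" by blast
        then show "\<exists>x\<in>cocycles X n. y \<ominus>\<^bsub>part Y n\<^esub> f n x \<in> coboundaries Y n"
          using iY[OF y fc[OF x(1)]] by blast
      qed
    next
      assume s: "\<forall>y\<in>cocycles Y n. \<exists>x\<in>cocycles X n. y \<ominus>\<^bsub>part Y n\<^esub> f n x \<in> coboundaries Y n"
      show "cohomology_map Y f n ` cohomology X n = cohomology Y n"
        unfolding im unfolding cohomology_eq
      proof
        show "(\<lambda>x. ?cY (f n x)) ` cocycles X n \<subseteq> ?cY ` cocycles Y n" using fc by blast
        show "?cY ` cocycles Y n \<subseteq> (\<lambda>x. ?cY (f n x)) ` cocycles X n"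
        proof
          fix c assume "c \<in> ?cY ` cocycles Y n"
          then obtain y where y: "y \<in> cocycles Y n" "c = ?cY y" by blast
          then obtain x where x: "x \<in> cocycles X n" "y \<ominus>\<^bsub>part Y n\<^esub> f n x \<in> coboundaries Y n" using s by blast
          then have "c = ?cY (f n x)" using iY[OF y(1) fc[OF x(1)]] y(2) by simp
          then show "c \<in> (\<lambda>x. ?cY (f n x)) ` cocycles X n" using x(1) by blast
        qed
      qed
    qed
    show ?thesis unfolding bij_betw_def inj surj ..
  qed
  then show ?thesis unfolding quasi_isomorphisms_def by auto
qed

lemma qisD:
  assumes "X \<in> bounded_complexes R" "Y \<in> bounded_complexes R" "f \<in> quasi_isomorphisms R X Y"
  shows "f \<in> chain_maps R X Y"
    "\<lbrakk>x \<in> cocycles X n; f n x \<in> coboundaries Y n\<rbrakk> \<Longrightarrow> x \<in> coboundaries X n"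
    "y \<in> cocycles Y n \<Longrightarrow> \<exists>x\<in>cocycles X n. y \<ominus>\<^bsub>part Y n\<^esub> f n x \<in> coboundaries Y n"
  using assms(3) unfolding qis_iff[OF assms(1,2)] by blast+

lemma qisI:
  assumes "X \<in> bounded_complexes R" "Y \<in> bounded_complexes R" "f \<in> chain_maps R X Y"
    "\<And>n x. \<lbrakk>x \<in> cocycles X n; f n x \<in> coboundaries Y n\<rbrakk> \<Longrightarrow> x \<in> coboundaries X n"
    "\<And>n y. y \<in> cocycles Y n \<Longrightarrow> \<exists>x\<in>cocycles X n. y \<ominus>\<^bsub>part Y n\<^esub> f n x \<in> coboundaries Y n"
  shows "f \<in> quasi_isomorphisms R X Y"
  unfolding qis_iff[OF assms(1,2)] using assms(3-) by blast

lemma qis_id: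
  assumes X: "X \<in> bounded_complexes R"
  shows "rst X (\<lambda>n x. x) \<in> quasi_isomorphisms R X X"
proof (rule qisI[OF X X cm_id[OF X]])
  interpret X: right_module R "part X n" for n by (rule bcD(1)[OF X])
  fix n x assume x: "x \<in> cocycles X n"
  note xc = cocyclesD(1)[OF x]
  show "rst X (\<lambda>n x. x) n x \<in> coboundaries X n \<Longrightarrow> x \<in> coboundaries X n" using xc by (simp add: rst_apply)
  have "x \<ominus>\<^bsub>part X n\<^esub> rst X (\<lambda>n x. x) n x \<in> coboundaries X n"
    unfolding rst_apply[OF xc] X.M.minus_self[OF xc] using coboundaries_submod[OF X, of n] by (simp add: submod_def)
  then show "\<exists>z\<in>cocycles X n. x \<ominus>\<^bsub>part X n\<^esub> rst X (\<lambda>n x. x) n z \<in> coboundaries X n" using x by blast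
qed

lemma (in abelian_group) minus_split:
  "\<lbrakk>x \<in> carrier G; y \<in> carrier G; z \<in> carrier G\<rbrakk> \<Longrightarrow> (x \<ominus> y) \<oplus> (y \<ominus> z) = x \<ominus> z"
  by (simp add: minus_eq a_assoc r_neg1 r_neg2)

lemma qis_comp:
  assumes X: "X \<in> bounded_complexes R" and Y: "Y \<in> bounded_complexes R" and Z: "Z \<in> bounded_complexes R"
    and f: "f \<in> quasi_isomorphisms R X Y" and g: "g \<in> quasi_isomorphisms R Y Z"
  shows "rst X (\<lambda>n x. g n (f n x)) \<in> quasi_isomorphisms R X Z"
proof (rule qisI[OF X Z])
  note F = qisD[OF X Y f] and G = qisD[OF Y Z g]
  show "rst X (\<lambda>n x. g n (f n x)) \<in> chain_maps R X Z" by (rule cm_comp[OF X F(1) G(1)])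
  fix n
  interpret Z: right_module R "part Z n" by (rule bcD(1)[OF Z])
  {
    fix x assume x: "x \<in> cocycles X n" and b: "rst X (\<lambda>n x. g n (f n x)) n x \<in> coboundaries Z n"
    then have "g n (f n x) \<in> coboundaries Z n" by (simp add: rst_apply cocyclesD(1))
    then show "x \<in> coboundaries X n" by (rule F(2)[OF x G(2)[OF cm_cocycles[OF X Y F(1) x]]])
  }
  fix z assume z: "z \<in> cocycles Z n"
  obtain y where y: "y \<in> cocycles Y n" "z \<ominus>\<^bsub>part Z n\<^esub> g n y \<in> coboundaries Z n" using G(3)[OF z] by blast
  obtain x where x: "x \<in> cocycles X n" "y \<ominus>\<^bsub>part Y n\<^esub> f n x \<in> coboundaries Y n" using F(3)[OF y(1)] by blast
  note xc = cocyclesD(1)[OF x(1)] and yc = cocyclesD(1)[OF y(1)]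
  note fx = lin_closed[OF cmD(2)[OF F(1)] xc]
  have "g n y \<ominus>\<^bsub>part Z n\<^esub> g n (f n x) \<in> coboundaries Z n"
    using cm_coboundaries[OF G(1) x(2)]
    unfolding lin_minus[OF cmD(2)[OF G(1)] bcD(1)[OF Y] bcD(1)[OF Z] yc fx] .
  then have "(z \<ominus>\<^bsub>part Z n\<^esub> g n y) \<oplus>\<^bsub>part Z n\<^esub> (g n y \<ominus>\<^bsub>part Z n\<^esub> g n (f n x)) \<in> coboundaries Z n"
    using y(2) coboundaries_submod[OF Z, of n] by (simp add: submod_def)
  then have "z \<ominus>\<^bsub>part Z n\<^esub> rst X (\<lambda>n x. g n (f n x)) n x \<in> coboundaries Z n"
    unfolding rst_apply[OF xc]
      Z.M.minus_split[OF cocyclesD(1)[OF z] lin_closed[OF cmD(2)[OF G(1)] yc] lin_closed[OF cmD(2)[OF G(1)] fx]] .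
  then show "\<exists>x\<in>cocycles X n. z \<ominus>\<^bsub>part Z n\<^esub> rst X (\<lambda>n x. g n (f n x)) n x \<in> coboundaries Z n"
    using x(1) by blast
qed

text \<open>This is the acyclicity of the mapping cone of \<open>s\<close>.\<close>

lemma cone_exact:
  assumes A: "A \<in> bounded_complexes R" and Z: "Z \<in> bounded_complexes R" and s: "s \<in> quasi_isomorphisms R A Z"
    and u: "u \<in> carrier (part A (n + 1))" "diff A (n + 1) u = \<zero>\<^bsub>part A (n + 2)\<^esub>"
    and z: "z \<in> carrier (part Z n)" "s (n + 1) u = diff Z n z"
  shows "\<exists>y\<in>carrier (part A n). \<exists>w\<in>carrier (part Z (n - 1)).
    diff A n y = u \<and> s n y \<oplus>\<^bsub>part Z n\<^esub> diff Z (n - 1) w = z"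
proof -
  note S = qisD[OF A Z s]
  note sl = cmD(2)[OF S(1)]
  interpret A: right_module R "part A k" for k by (rule bcD(1)[OF A])
  interpret Z: right_module R "part Z k" for k by (rule bcD(1)[OF Z])
  have "u \<in> cocycles A (n + 1)" using u by (simp add: cocycles_def add.assoc)
  moreover have "s (n + 1) u \<in> coboundaries Z (n + 1)" using z by (simp add: coboundaries_def)
  ultimately have "u \<in> coboundaries A (n + 1)" by (rule S(2))
  then obtain y where y: "y \<in> carrier (part A n)" "diff A n y = u" by (auto simp: coboundaries_def)
  note sy = lin_closed[OF sl y(1)]
  \<comment> \<open>The preimage y of u found so far may be wrong by a cocycle. The defect z - s y
    is a cocycle of \<open>Z\<close>, so it is cohomologous to s x for some cocycle x of
    \<open>A\<close>, and y + x is the correct preimage.\<close>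
  have "diff Z n (z \<ominus>\<^bsub>part Z n\<^esub> s n y) = diff Z n z \<ominus>\<^bsub>part Z (n + 1)\<^esub> diff Z n z"
    unfolding lin_minus[OF bcD(4)[OF Z] bcD(1)[OF Z] bcD(1)[OF Z] z(1) sy] cmD(3)[OF S(1) y(1), symmetric] y(2) z(2) ..
  also have "\<dots> = \<zero>\<^bsub>part Z (n + 1)\<^esub>" by (rule Z.M.minus_self[OF lin_closed[OF bcD(4)[OF Z] z(1)]])
  finally have "z \<ominus>\<^bsub>part Z n\<^esub> s n y \<in> cocycles Z n"
    using z(1) sy by (simp add: cocycles_def)
  from S(3)[OF this] obtain x where x: "x \<in> cocycles A n"
    "z \<ominus>\<^bsub>part Z n\<^esub> s n y \<ominus>\<^bsub>part Z n\<^esub> s n x \<in> coboundaries Z n" by blast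
  then obtain w where w: "w \<in> carrier (part Z (n - 1))"
    "z \<ominus>\<^bsub>part Z n\<^esub> s n y \<ominus>\<^bsub>part Z n\<^esub> s n x = diff Z (n - 1) w" by (auto simp: coboundaries_def)
  note xc = cocyclesD[OF x(1)]
  note sx = lin_closed[OF sl xc(1)]
  have dw: "diff Z (n - 1) w \<in> carrier (part Z n)" by (rule lin_closed[OF bcD(5)[OF Z] w(1)])
  have "z \<ominus>\<^bsub>part Z n\<^esub> s n y = diff Z (n - 1) w \<oplus>\<^bsub>part Z n\<^esub> s n x"
    by (rule Z.M.eq_add_if_minus_eq[OF w(2) _ sx]) (simp add: z(1) sy)
  from Z.M.eq_add_if_minus_eq[OF this z(1) sy]
  have "s n (y \<oplus>\<^bsub>part A n\<^esub> x) \<oplus>\<^bsub>part Z n\<^esub> diff Z (n - 1) w = z"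
    unfolding lin_add[OF sl y(1) xc(1)] using dw sx sy by (simp add: Z.M.a_ac)
  moreover have "diff A n (y \<oplus>\<^bsub>part A n\<^esub> x) = u"
    unfolding lin_add[OF bcD(4)[OF A] y(1) xc(1)] y(2) xc(2) by (rule A.M.r_zero[OF u(1)])
  moreover have "y \<oplus>\<^bsub>part A n\<^esub> x \<in> carrier (part A n)" by (rule A.M.a_closed[OF y(1) xc(1)])
  ultimately show ?thesis using w(1) by blast
qed

text \<open>A linear family of cocycles of the mapping cone, parametrised by a projective module, is
  the boundary of a linear family: pointwise solvability is \<open>cone_exact\<close>, and
  \<open>fgp_lift_pair\<close> makes the choice linear.\<close>

lemma cone_lift:
  assumes M: "fgp R M" and A: "A \<in> bounded_complexes R" and Z: "Z \<in> bounded_complexes R"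
    and s: "s \<in> quasi_isomorphisms R A Z"
    and \<alpha>: "lin R M (part A (n + 1)) \<alpha>" and \<beta>: "lin R M (part Z n) \<beta>"
    and d: "\<And>x. x \<in> carrier M \<Longrightarrow> diff A (n + 1) (\<alpha> x) = \<zero>\<^bsub>part A (n + 2)\<^esub>"
    "\<And>x. x \<in> carrier M \<Longrightarrow> s (n + 1) (\<alpha> x) = diff Z n (\<beta> x)"
  obtains y w where "lin R M (part A n) y" "lin R M (part Z (n - 1)) w"
    "\<And>x. x \<in> carrier M \<Longrightarrow> diff A n (y x) = \<alpha> x"
    "\<And>x. x \<in> carrier M \<Longrightarrow> s n (y x) \<oplus>\<^bsub>part Z n\<^esub> diff Z (n - 1) (w x) = \<beta> x"
proof (rule fgp_lift_pair[OF M bcD(1)[OF A] bcD(1)[OF Z] bcD(1)[OF A] bcD(1)[OF Z]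
      bcD(4)[OF A] cmD(2)[OF qisD(1)[OF A Z s]] bcD(5)[OF Z] \<alpha> \<beta>])
  fix x assume x: "x \<in> carrier M"
  show "\<exists>a\<in>carrier (part A n). \<exists>c\<in>carrier (part Z (n - 1)).
      diff A n a = \<alpha> x \<and> s n a \<oplus>\<^bsub>part Z n\<^esub> diff Z (n - 1) c = \<beta> x"
    by (rule cone_exact[OF A Z s lin_closed[OF \<alpha> x] d(1)[OF x] lin_closed[OF \<beta> x] d(2)[OF x]])
qed (rule that)

subsection \<open>The homotopy category\<close>

abbreviation hcls ::
  "('a, 'r) ring_scheme \<Rightarrow> ('a, 'u) cpx \<Rightarrow> ('a, 'u) cpx \<Rightarrow> (int \<Rightarrow> 'u \<Rightarrow> 'u) \<Rightarrow> (int \<Rightarrow> 'u \<Rightarrow> 'u) set"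
where
  "hcls R \<equiv> hom_ideal.cls (complex_cat R) (null_homotopic R)"

lemma K_preadditive:
  fixes R :: "('a, 'r) ring_scheme"
  shows "preadditive (homotopy_cat R :: (('a, 'u) cpx, _) preadd_cat)"
  unfolding homotopy_cat_def by (rule hom_ideal.preadditive_Q[OF null_ideal])

lemma K_simps:
  fixes R :: "('a, 'r) ring_scheme" and X Y :: "('a, 'u) cpx"
  shows "Obj (homotopy_cat R) = (bounded_complexes R :: ('a, 'u) cpx set)"
    "Hom (homotopy_cat R) X Y = hcls R X Y ` chain_maps R X Y"
    "idn (homotopy_cat R) X = hcls R X X (rst X (\<lambda>n x. x))"
    "hzero (homotopy_cat R) X Y = hcls R X Y (rst X (\<lambda>n x. \<zero>\<^bsub>part Y n\<^esub>))"
  unfolding homotopy_cat_def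
  using hom_ideal.Obj_Q[OF null_ideal] hom_ideal.Hom_Q[OF null_ideal] hom_ideal.idn_Q[OF null_ideal]
    hom_ideal.hzero_Q[OF null_ideal] by simp_all

lemma K_cmp:
  assumes "X \<in> bounded_complexes R" "Y \<in> bounded_complexes R" "Z \<in> bounded_complexes R"
    "f \<in> chain_maps R X Y" "g \<in> chain_maps R Y Z"
  shows "cmp (homotopy_cat R) X Y Z (hcls R Y Z g) (hcls R X Y f) = hcls R X Z (rst X (\<lambda>n x. g n (f n x)))"
  unfolding homotopy_cat_def using hom_ideal.cmp_Q[OF null_ideal, of X R Y Z f g] assms by simp

lemma K_hadd:
  assumes "X \<in> bounded_complexes R" "Y \<in> bounded_complexes R"
    "f \<in> chain_maps R X Y" "g \<in> chain_maps R X Y"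
  shows "hadd (homotopy_cat R) X Y (hcls R X Y f) (hcls R X Y g) =
    hcls R X Y (rst X (\<lambda>n x. f n x \<oplus>\<^bsub>part Y n\<^esub> g n x))"
  unfolding homotopy_cat_def using hom_ideal.hadd_Q[OF null_ideal, of X R Y f g] assms by simp

definition hdiff where "hdiff X Y f g = rst X (\<lambda>n x. f n x \<ominus>\<^bsub>part Y n\<^esub> g n x)"

lemma hdiff_apply: "x \<in> carrier (part X n) \<Longrightarrow> hdiff X Y f g n x = f n x \<ominus>\<^bsub>part Y n\<^esub> g n x"
  by (simp add: hdiff_def rst_apply)

lemma cm_hdiff:
  assumes X: "X \<in> bounded_complexes R" and Y: "Y \<in> bounded_complexes R"
    and f: "f \<in> chain_maps R X Y" and g: "g \<in> chain_maps R X Y"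
  shows "hdiff X Y f g \<in> chain_maps R X Y"
  unfolding hdiff_def
  by (rule rst_cm[OF X lin_diff[OF bcD(1)[OF X] bcD(1)[OF Y] cmD(2)[OF f] cmD(2)[OF g]]])
    (simp only: cmD(3)[OF f] cmD(3)[OF g] lin_minus[OF bcD(4)[OF Y] bcD(1)[OF Y] bcD(1)[OF Y]
        lin_closed[OF cmD(2)[OF f]] lin_closed[OF cmD(2)[OF g]]])

lemma hcls_eq_iff:
  assumes X: "X \<in> bounded_complexes R" and Y: "Y \<in> bounded_complexes R"
    and f: "f \<in> chain_maps R X Y" and g: "g \<in> chain_maps R X Y"
  shows "hcls R X Y f = hcls R X Y g \<longleftrightarrow> hdiff X Y f g \<in> null_homotopic R X Y"
proof -
  note fc = lin_closed[OF cmD(2)[OF f]] and gc = lin_closed[OF cmD(2)[OF g]]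
  interpret Y: right_module R "part Y k" for k by (rule bcD(1)[OF Y])
  have "hcls R X Y f = hcls R X Y g \<longleftrightarrow> (f, g) \<in> ideal_rel (complex_cat R) (null_homotopic R) X Y"
    using hom_ideal.cls_eq_iff[OF null_ideal, of X R Y f g] assms by simp
  also have "\<dots> \<longleftrightarrow> (\<exists>j\<in>null_homotopic R X Y. f = rst X (\<lambda>n x. g n x \<oplus>\<^bsub>part Y n\<^esub> j n x))"
    using f g by (simp add: ideal_rel_def)
  also have "\<dots> \<longleftrightarrow> hdiff X Y f g \<in> null_homotopic R X Y"
  proof
    assume "\<exists>j\<in>null_homotopic R X Y. f = rst X (\<lambda>n x. g n x \<oplus>\<^bsub>part Y n\<^esub> j n x)"
    then obtain j where j: "j \<in> null_homotopic R X Y"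
      and eq: "f = rst X (\<lambda>n x. g n x \<oplus>\<^bsub>part Y n\<^esub> j n x)" by blast
    have jc: "j \<in> chain_maps R X Y" using j by (simp add: null_homotopic_def)
    note jcl = lin_closed[OF cmD(2)[OF jc]]
    have "hdiff X Y f g = j"
    proof (rule cm_eqI[OF cm_hdiff[OF X Y f g] jc])
      fix n x assume x: "x \<in> carrier (part X n)"
      have "f n x = g n x \<oplus>\<^bsub>part Y n\<^esub> j n x" by (subst eq) (rule rst_apply[OF x])
      then have "f n x = j n x \<oplus>\<^bsub>part Y n\<^esub> g n x" using Y.M.a_comm[OF gc[OF x] jcl[OF x]] by simp
      then show "hdiff X Y f g n x = j n x"
        unfolding hdiff_apply[OF x] by (rule Y.M.minus_eq_if_eq_add[OF _ jcl[OF x] gc[OF x]])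
    qed
    then show "hdiff X Y f g \<in> null_homotopic R X Y" using j by simp
  next
    assume d: "hdiff X Y f g \<in> null_homotopic R X Y"
    have "f = rst X (\<lambda>n x. g n x \<oplus>\<^bsub>part Y n\<^esub> hdiff X Y f g n x)"
    proof (rule cm_eqI[OF f cm_add[OF X Y g cm_hdiff[OF X Y f g]]])
      fix n x assume x: "x \<in> carrier (part X n)"
      show "f n x = rst X (\<lambda>n x. g n x \<oplus>\<^bsub>part Y n\<^esub> hdiff X Y f g n x) n x"
        unfolding rst_apply[OF x] hdiff_apply[OF x] by (rule Y.M.eq_add_minus[OF fc[OF x] gc[OF x]])
    qed
    then show "\<exists>j\<in>null_homotopic R X Y. f = rst X (\<lambda>n x. g n x \<oplus>\<^bsub>part Y n\<^esub> j n x)" using d by blast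
  qed
  finally show ?thesis .
qed

lemma hclsI:
  assumes X: "X \<in> bounded_complexes R" and Y: "Y \<in> bounded_complexes R"
    and f: "f \<in> chain_maps R X Y" and g: "g \<in> chain_maps R X Y"
    and h: "\<And>n. lin R (part X n) (part Y (n - 1)) (h n)"
    and eq: "\<And>n x. x \<in> carrier (part X n) \<Longrightarrow>
      f n x = g n x \<oplus>\<^bsub>part Y n\<^esub> (diff Y (n - 1) (h n x) \<oplus>\<^bsub>part Y n\<^esub> h (n + 1) (diff X n x))"
  shows "hcls R X Y f = hcls R X Y g"
  unfolding hcls_eq_iff[OF X Y f g]
proof (rule nullI[OF X cm_hdiff[OF X Y f g] h])
  interpret Y: right_module R "part Y k" for k by (rule bcD(1)[OF Y])
  fix n x assume x: "x \<in> carrier (part X n)"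
  let ?t = "diff Y (n - 1) (h n x) \<oplus>\<^bsub>part Y n\<^esub> h (n + 1) (diff X n x)"
  have "h (n + 1) (diff X n x) \<in> carrier (part Y n)"
    using lin_closed[OF h[of "n + 1"] lin_closed[OF bcD(4)[OF X] x]] by simp
  then have t: "?t \<in> carrier (part Y n)"
    by (intro Y.M.a_closed lin_closed[OF bcD(5)[OF Y] lin_closed[OF h x]])
  note gx = lin_closed[OF cmD(2)[OF g] x]
  have "f n x = ?t \<oplus>\<^bsub>part Y n\<^esub> g n x" unfolding eq[OF x] by (rule Y.M.a_comm[OF gx t])
  then show "hdiff X Y f g n x = ?t"
    unfolding hdiff_apply[OF x] by (rule Y.M.minus_eq_if_eq_add[OF _ t gx])
qed

definition qW :: "('a, 'r) ring_scheme \<Rightarrow> ('a, 'u) cpx \<Rightarrow> ('a, 'u) cpx \<Rightarrow> (int \<Rightarrow> 'u \<Rightarrow> 'u) set set" where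
  "qW R X Y = {\<phi> \<in> Hom (homotopy_cat R) X Y. \<exists>f\<in>\<phi>. f \<in> quasi_isomorphisms R X Y}"

lemma derived_cat_eq: "derived_cat R = localisation (homotopy_cat R) (qW R)"
  by (simp add: derived_cat_def qW_def[abs_def])

text \<open>On a cocycle the term of the homotopy that first applies the differential vanishes, so
  homotopic maps differ there by a coboundary and induce the same map on cohomology.\<close>

lemma qis_homotopic:
  assumes X: "X \<in> bounded_complexes R" and Y: "Y \<in> bounded_complexes R"
    and f: "f \<in> quasi_isomorphisms R X Y" and g: "g \<in> chain_maps R X Y"
    and eq: "hcls R X Y f = hcls R X Y g"
  shows "g \<in> quasi_isomorphisms R X Y"
proof -
  note F = qisD[OF X Y f]
  interpret X: right_module R "part X k" for k by (rule bcD(1)[OF X])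
  interpret Y: right_module R "part Y k" for k by (rule bcD(1)[OF Y])
  have null: "hdiff X Y f g \<in> null_homotopic R X Y" using eq unfolding hcls_eq_iff[OF X Y F(1) g] .
  obtain h where h: "\<And>n. lin R (part X n) (part Y (n - 1)) (h n)" "\<And>n. lin R (part X (n + 1)) (part Y n) (h (n + 1))"
    and dh: "\<And>n x. x \<in> carrier (part X n) \<Longrightarrow>
      hdiff X Y f g n x = diff Y (n - 1) (h n x) \<oplus>\<^bsub>part Y n\<^esub> h (n + 1) (diff X n x)"
    by (rule nullE[OF null], rule that)
  note fc = lin_closed[OF cmD(2)[OF F(1)]] and gc = lin_closed[OF cmD(2)[OF g]]
  have d: "f n x \<ominus>\<^bsub>part Y n\<^esub> g n x \<in> coboundaries Y n" if x: "x \<in> cocycles X n" for n x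
  proof -
    note xc = cocyclesD[OF x]
    have "f n x \<ominus>\<^bsub>part Y n\<^esub> g n x = diff Y (n - 1) (h n x) \<oplus>\<^bsub>part Y n\<^esub> \<zero>\<^bsub>part Y n\<^esub>"
      using dh[OF xc(1)] unfolding hdiff_apply[OF xc(1)] xc(2) lin_zero[OF h(2) bcD(1)[OF X] bcD(1)[OF Y]] .
    also have "\<dots> = diff Y (n - 1) (h n x)"
      by (rule Y.M.r_zero[OF lin_closed[OF bcD(5)[OF Y] lin_closed[OF h(1) xc(1)]]])
    finally show ?thesis unfolding coboundaries_def using lin_closed[OF h(1) xc(1)] by blast
  qed
  have Badd: "\<And>n x y. \<lbrakk>x \<in> coboundaries Y n; y \<in> coboundaries Y n\<rbrakk> \<Longrightarrow> x \<oplus>\<^bsub>part Y n\<^esub> y \<in> coboundaries Y n"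
    using coboundaries_submod[OF Y] by (simp add: submod_def)
  show ?thesis
  proof (rule qisI[OF X Y g])
    fix n x assume x: "x \<in> cocycles X n" and b: "g n x \<in> coboundaries Y n"
    note xc = cocyclesD(1)[OF x]
    have "f n x = (f n x \<ominus>\<^bsub>part Y n\<^esub> g n x) \<oplus>\<^bsub>part Y n\<^esub> g n x"
      by (rule Y.M.eq_add_if_minus_eq[OF refl fc[OF xc] gc[OF xc]])
    then have "f n x \<in> coboundaries Y n" using Badd[OF d[OF x] b] by simp
    then show "x \<in> coboundaries X n" by (rule F(2)[OF x])
  next
    fix n y assume y: "y \<in> cocycles Y n"
    obtain x where x: "x \<in> cocycles X n" "y \<ominus>\<^bsub>part Y n\<^esub> f n x \<in> coboundaries Y n" using F(3)[OF y] by blast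
    note xc = cocyclesD(1)[OF x(1)]
    have "y \<ominus>\<^bsub>part Y n\<^esub> g n x \<in> coboundaries Y n"
      using Badd[OF x(2) d[OF x(1)]] Y.M.minus_split[OF cocyclesD(1)[OF y] fc[OF xc] gc[OF xc]] by simp
    then show "\<exists>x\<in>cocycles X n. y \<ominus>\<^bsub>part Y n\<^esub> g n x \<in> coboundaries Y n" using x(1) by blast
  qed
qed

lemma hcls_qW:
  assumes X: "X \<in> bounded_complexes R" and Y: "Y \<in> bounded_complexes R" and f: "f \<in> chain_maps R X Y"
  shows "hcls R X Y f \<in> qW R X Y \<longleftrightarrow> f \<in> quasi_isomorphisms R X Y"
proof
  note cls = hom_ideal.mem_cls[OF null_ideal, of X R Y f, unfolded complex_cat_simps]
  assume "hcls R X Y f \<in> qW R X Y"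
  then obtain g where g: "g \<in> hcls R X Y f" "g \<in> quasi_isomorphisms R X Y" by (auto simp: qW_def)
  show "f \<in> quasi_isomorphisms R X Y" by (rule qis_homotopic[OF X Y g(2) f cls(2)[OF X Y f g(1)]])
next
  assume "f \<in> quasi_isomorphisms R X Y"
  moreover have "f \<in> hcls R X Y f"
    using hom_ideal.mem_cls_self[OF null_ideal, of X R Y f, unfolded complex_cat_simps] X Y f by blast
  ultimately show "hcls R X Y f \<in> qW R X Y" using f by (auto simp: qW_def K_simps(2))
qed

lemma qWE:
  assumes "\<phi> \<in> qW R X Y" "X \<in> bounded_complexes R" "Y \<in> bounded_complexes R"
  obtains f where "f \<in> quasi_isomorphisms R X Y" "f \<in> chain_maps R X Y" "\<phi> = hcls R X Y f"
proof -
  obtain f where f: "f \<in> chain_maps R X Y" "\<phi> = hcls R X Y f"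
    using assms(1) by (auto simp: qW_def K_simps(2))
  show thesis using hcls_qW[OF assms(2,3) f(1)] assms(1) f that by simp
qed

lemma K_localisation:
  fixes R :: "('a, 'r) ring_scheme"
  shows "resolved_localisation (homotopy_cat R :: (('a, 'u) cpx, _) preadd_cat) (qW R)"
proof (intro resolved_localisation.intro resolved_localisation_axioms.intro K_preadditive, unfold K_simps(1))
  fix X Y :: "('a, 'u) cpx" and s
  assume "s \<in> qW R X Y" then show "s \<in> Hom (homotopy_cat R) X Y" by (simp add: qW_def)
next
  fix X :: "('a, 'u) cpx"
  assume X: "X \<in> bounded_complexes R"
  show "idn (homotopy_cat R) X \<in> qW R X X"
    unfolding K_simps(3) hcls_qW[OF X X cm_id[OF X]] by (rule qis_id[OF X])
next
  fix X Y Z :: "('a, 'u) cpx" and s t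
  assume X: "X \<in> bounded_complexes R" and Y: "Y \<in> bounded_complexes R" and Z: "Z \<in> bounded_complexes R"
    and s: "s \<in> qW R X Y" and t: "t \<in> qW R Y Z"
  obtain f where f: "f \<in> quasi_isomorphisms R X Y" "f \<in> chain_maps R X Y" "s = hcls R X Y f"
    by (rule qWE[OF s X Y])
  obtain g where g: "g \<in> quasi_isomorphisms R Y Z" "g \<in> chain_maps R Y Z" "t = hcls R Y Z g"
    by (rule qWE[OF t Y Z])
  show "cmp (homotopy_cat R) X Y Z t s \<in> qW R X Z"
    unfolding f(3) g(3) K_cmp[OF X Y Z f(2) g(2)] hcls_qW[OF X Z cm_comp[OF X f(2) g(2)]]
    by (rule qis_comp[OF X Y Z f(1) g(1)])
qed

text \<open>The name is justified by \<open>tl_fgp\<close>: over a hereditary Noetherian domain the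
  parts are finitely generated projective, so these are bounded complexes of such modules.\<close>

definition perfect :: "('a, 'r) ring_scheme \<Rightarrow> ('a, 'u) cpx \<Rightarrow> bool" where
  "perfect R P \<longleftrightarrow> P \<in> bounded_complexes R \<and> (\<forall>n. tls R (part P n))"

section \<open>Maps from perfect complexes into quasi-isomorphic complexes\<close>

context hereditary_noetherian
begin

lemma perfect_retractions:
  assumes "perfect R P"
  obtains r where "\<And>n. lin R (part P n) (part P n) (r n)"
    "\<And>n x. x \<in> carrier (part P n) \<Longrightarrow> diff P n (r n x) = \<zero>\<^bsub>part P (n + 1)\<^esub>"
    "\<And>n x. \<lbrakk>x \<in> carrier (part P n); diff P n x = \<zero>\<^bsub>part P (n + 1)\<^esub>\<rbrakk> \<Longrightarrow> r n x = x"
proof -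
  have P: "P \<in> bounded_complexes R" and t: "\<And>n. tls R (part P n)" using assms by (simp_all add: perfect_def)
  have "\<exists>r. lin R (part P n) (part P n) r \<and>
    (\<forall>x\<in>carrier (part P n). diff P n (r x) = \<zero>\<^bsub>part P (n + 1)\<^esub>) \<and>
    (\<forall>x\<in>carrier (part P n). diff P n x = \<zero>\<^bsub>part P (n + 1)\<^esub> \<longrightarrow> r x = x)" for n
    by (rule kernel_retraction[OF bcD(1)[OF P, of n] t bcD(4)[OF P, of n]]) blast
  then obtain r where "\<forall>n. lin R (part P n) (part P n) (r n) \<and>
    (\<forall>x\<in>carrier (part P n). diff P n (r n x) = \<zero>\<^bsub>part P (n + 1)\<^esub>) \<and>
    (\<forall>x\<in>carrier (part P n). diff P n x = \<zero>\<^bsub>part P (n + 1)\<^esub> \<longrightarrow> r n x = x)" by metis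
  then show thesis by (intro that[of r]) simp_all
qed

text \<open>\<open>r n\<close> projects onto the cocycles of degree n, which are a summand because
  the next part is torsionless. The map x - \<open>r n x\<close> projects onto a complement, on
  which the differential is injective. Coboundaries are fixed by \<open>r\<close>.\<close>

lemma perfect_split:
  assumes "perfect R P"
  obtains r where "\<And>n. lin R (part P n) (part P n) (r n)"
    "\<And>n x. x \<in> carrier (part P n) \<Longrightarrow> diff P n (r n x) = \<zero>\<^bsub>part P (n + 1)\<^esub>"
    "\<And>n x. x \<in> carrier (part P n) \<Longrightarrow> r (n + 1) (diff P n x) = diff P n x"
    "\<And>n. lin R (part P n) (part P n) (\<lambda>x. x \<ominus>\<^bsub>part P n\<^esub> r n x)"
    "\<And>n x. x \<in> carrier (part P n) \<Longrightarrow> diff P n (x \<ominus>\<^bsub>part P n\<^esub> r n x) = diff P n x"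
    "\<And>n x. x \<in> carrier (part P n) \<Longrightarrow> r n (r n x) = r n x"
proof -
  have P: "P \<in> bounded_complexes R" using assms by (simp add: perfect_def)
  interpret P: right_module R "part P k" for k by (rule bcD(1)[OF P])
  note dl = bcD(4)[OF P]
  obtain r where r: "\<And>n. lin R (part P n) (part P n) (r n)"
    "\<And>n x. x \<in> carrier (part P n) \<Longrightarrow> diff P n (r n x) = \<zero>\<^bsub>part P (n + 1)\<^esub>"
    "\<And>n x. \<lbrakk>x \<in> carrier (part P n); diff P n x = \<zero>\<^bsub>part P (n + 1)\<^esub>\<rbrakk> \<Longrightarrow> r n x = x"
    by (rule perfect_retractions[OF assms], rule that)
  have rd: "r (n + 1) (diff P n x) = diff P n x" if x: "x \<in> carrier (part P n)" for n x
    by (rule r(3)[OF lin_closed[OF dl x]]) (simp add: bcD(6)[OF P x] add.assoc)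
  show thesis
  proof (rule that[OF r(1,2) rd lin_diff[OF bcD(1)[OF P] bcD(1)[OF P] lin_id r(1)]])
    fix n x assume x: "x \<in> carrier (part P n)"
    note dx = lin_closed[OF dl x]
    show "diff P n (x \<ominus>\<^bsub>part P n\<^esub> r n x) = diff P n x"
      unfolding lin_minus[OF dl bcD(1)[OF P] bcD(1)[OF P] x lin_closed[OF r(1) x]] r(2)[OF x]
      by (rule P.M.minus_zero_right[OF dx])
    show "r n (r n x) = r n x" by (rule r(3)[OF lin_closed[OF r(1) x] r(2)[OF x]])
  qed
qed

text \<open>The lift \<open>e\<close> and the homotopy \<open>h\<close> are built on cocycles and on
  the complement separately. The data on the complement in degree n refer only to the cocycle data
  in degree n + 1, so all degrees can be treated simultaneously.\<close>

lemma perfect_lift: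
  assumes P: "perfect R P" and A: "A \<in> bounded_complexes R" and Z: "Z \<in> bounded_complexes R"
    and s: "s \<in> quasi_isomorphisms R A Z" and g: "g \<in> chain_maps R P Z"
  shows "\<exists>e\<in>chain_maps R P A. hcls R P Z (rst P (\<lambda>n x. s n (e n x))) = hcls R P Z g"
proof -
  have Pc: "P \<in> bounded_complexes R" and t: "\<And>n. tls R (part P n)" using P by (simp_all add: perfect_def)
  note dP = bcD(4)[OF Pc] and dA = bcD(4)[OF A] and dZ = bcD(4)[OF Z]
  interpret P: right_module R "part P k" for k by (rule bcD(1)[OF Pc])
  interpret A: right_module R "part A k" for k by (rule bcD(1)[OF A])
  interpret Z: right_module R "part Z k" for k by (rule bcD(1)[OF Z])
  note S = qisD(1)[OF A Z s]
  note sl = cmD(2)[OF S] and gl = cmD(2)[OF g]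
  obtain r where r: "\<And>n. lin R (part P n) (part P n) (r n)"
    "\<And>n x. x \<in> carrier (part P n) \<Longrightarrow> diff P n (r n x) = \<zero>\<^bsub>part P (n + 1)\<^esub>"
    "\<And>n x. x \<in> carrier (part P n) \<Longrightarrow> r (n + 1) (diff P n x) = diff P n x"
    and q: "\<And>n. lin R (part P n) (part P n) (\<lambda>x. x \<ominus>\<^bsub>part P n\<^esub> r n x)"
    "\<And>n x. x \<in> carrier (part P n) \<Longrightarrow> diff P n (x \<ominus>\<^bsub>part P n\<^esub> r n x) = diff P n x"
    "\<And>n x. x \<in> carrier (part P n) \<Longrightarrow> r n (r n x) = r n x"
    by (rule perfect_split[OF P], rule that)
  \<comment> \<open>On cocycles: (0, g r x) is a cocycle of the cone of \<open>s\<close>, since g r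
    x is itself a cocycle. This yields a lift \<open>y\<close> into the cocycles of \<open>A\<close>
    and the corresponding part \<open>w\<close> of the homotopy.\<close>
  have "\<exists>y w. lin R (part P n) (part A n) y \<and> lin R (part P n) (part Z (n - 1)) w \<and>
    (\<forall>x\<in>carrier (part P n). diff A n (y x) = \<zero>\<^bsub>part A (n + 1)\<^esub>) \<and>
    (\<forall>x\<in>carrier (part P n). s n (y x) \<oplus>\<^bsub>part Z n\<^esub> diff Z (n - 1) (w x) = g n (r n x))" for n
  proof (rule cone_lift[OF tl_fgp[OF t] A Z s lin_const_zero[OF bcD(1)[OF A]] lin_comp[OF r(1) gl]])
    fix x assume x: "x \<in> carrier (part P n)"
    show "diff A (n + 1) \<zero>\<^bsub>part A (n + 1)\<^esub> = \<zero>\<^bsub>part A (n + 2)\<^esub>"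
      using lin_zero[OF dA bcD(1)[OF A] bcD(1)[OF A], of "n + 1"] by (simp add: add.assoc)
    show "s (n + 1) \<zero>\<^bsub>part A (n + 1)\<^esub> = diff Z n (g n (r n x))"
      unfolding cmD(3)[OF g lin_closed[OF r(1) x], symmetric] r(2)[OF x]
        lin_zero[OF sl bcD(1)[OF A] bcD(1)[OF Z]] lin_zero[OF gl bcD(1)[OF Pc] bcD(1)[OF Z]] ..
  qed blast
  then obtain y w where y: "\<And>n. lin R (part P n) (part A n) (y n)" and w: "\<And>n. lin R (part P n) (part Z (n - 1)) (w n)"
    and dy: "\<And>n x. x \<in> carrier (part P n) \<Longrightarrow> diff A n (y n x) = \<zero>\<^bsub>part A (n + 1)\<^esub>"
    and syw: "\<And>n x. x \<in> carrier (part P n) \<Longrightarrow> s n (y n x) \<oplus>\<^bsub>part Z n\<^esub> diff Z (n - 1) (w n x) = g n (r n x)"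
    by metis
  have w': "lin R (part P (n + 1)) (part Z n) (w (n + 1))" for n using w[of "n + 1"] by simp
  have syw': "s (n + 1) (y (n + 1) (diff P n x)) \<oplus>\<^bsub>part Z (n + 1)\<^esub> diff Z n (w (n + 1) (diff P n x)) = g (n + 1) (diff P n x)"
    if x: "x \<in> carrier (part P n)" for n x
    using syw[OF lin_closed[OF dP x]] by (simp add: r(3)[OF x])
  \<comment> \<open>On the complement the lift \<open>y2\<close> must satisfy d y2 = y d for
    \<open>e\<close> to be a chain map, and the homotopy already fixed on the coboundary d x has to
    be subtracted from g x. That this pair is again a cone cocycle is the first equation evaluated
    at d x.\<close>
  have "\<exists>y2 w2. lin R (part P n) (part A n) y2 \<and> lin R (part P n) (part Z (n - 1)) w2 \<and>
    (\<forall>x\<in>carrier (part P n). diff A n (y2 x) = y (n + 1) (diff P n x)) \<and>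
    (\<forall>x\<in>carrier (part P n). s n (y2 x) \<oplus>\<^bsub>part Z n\<^esub> diff Z (n - 1) (w2 x) =
        g n x \<ominus>\<^bsub>part Z n\<^esub> w (n + 1) (diff P n x))" for n
  proof (rule cone_lift[OF tl_fgp[OF t] A Z s lin_comp[OF dP y]
        lin_diff[OF bcD(1)[OF Pc] bcD(1)[OF Z] gl lin_comp[OF dP w']]])
    fix x assume x: "x \<in> carrier (part P n)"
    note dx = lin_closed[OF dP x]
    show "diff A (n + 1) (y (n + 1) (diff P n x)) = \<zero>\<^bsub>part A (n + 2)\<^esub>"
      using dy[OF dx] by (simp add: add.assoc)
    have 1: "diff Z n (g n x \<ominus>\<^bsub>part Z n\<^esub> w (n + 1) (diff P n x)) =
        g (n + 1) (diff P n x) \<ominus>\<^bsub>part Z (n + 1)\<^esub> diff Z n (w (n + 1) (diff P n x))"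
      unfolding lin_minus[OF dZ bcD(1)[OF Z] bcD(1)[OF Z] lin_closed[OF gl x] lin_closed[OF w' dx]]
        cmD(3)[OF g x] ..
    show "s (n + 1) (y (n + 1) (diff P n x)) = diff Z n (g n x \<ominus>\<^bsub>part Z n\<^esub> w (n + 1) (diff P n x))"
      unfolding 1 by (rule Z.M.minus_eq_if_eq_add[OF syw'[OF x, symmetric] lin_closed[OF sl lin_closed[OF y dx]]
            lin_closed[OF dZ lin_closed[OF w' dx]], symmetric])
  qed blast
  then obtain y2 w2 where y2: "\<And>n. lin R (part P n) (part A n) (y2 n)" and w2: "\<And>n. lin R (part P n) (part Z (n - 1)) (w2 n)"
    and dy2: "\<And>n x. x \<in> carrier (part P n) \<Longrightarrow> diff A n (y2 n x) = y (n + 1) (diff P n x)"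
    and syw2: "\<And>n x. x \<in> carrier (part P n) \<Longrightarrow> s n (y2 n x) \<oplus>\<^bsub>part Z n\<^esub> diff Z (n - 1) (w2 n x) =
        g n x \<ominus>\<^bsub>part Z n\<^esub> w (n + 1) (diff P n x)"
    by metis
  define e where "e n x = y n (r n x) \<oplus>\<^bsub>part A n\<^esub> y2 n (x \<ominus>\<^bsub>part P n\<^esub> r n x)" for n x
  define h where "h n x = w n (r n x) \<oplus>\<^bsub>part Z (n - 1)\<^esub> w2 n (x \<ominus>\<^bsub>part P n\<^esub> r n x)" for n x
  have el: "lin R (part P n) (part A n) (e n)" for n
    unfolding e_def by (rule lin_sum[OF bcD(1)[OF Pc] bcD(1)[OF A] lin_comp[OF r(1) y] lin_comp[OF q(1) y2]])
  have hl: "lin R (part P n) (part Z (n - 1)) (h n)" for n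
    unfolding h_def by (rule lin_sum[OF bcD(1)[OF Pc] bcD(1)[OF Z] lin_comp[OF r(1) w] lin_comp[OF q(1) w2]])
  \<comment> \<open>\<open>r\<close> fixes coboundaries, so the complement part of d x is zero and
    only the cocycle data contribute.\<close>
  have ed: "e (n + 1) (diff P n x) = y (n + 1) (diff P n x)" if x: "x \<in> carrier (part P n)" for n x
    unfolding e_def r(3)[OF x] P.M.minus_self[OF lin_closed[OF dP x]] lin_zero[OF y2 bcD(1)[OF Pc] bcD(1)[OF A]]
    by (rule A.M.r_zero[OF lin_closed[OF y lin_closed[OF dP x]]])
  have hd: "h (n + 1) (diff P n x) = w (n + 1) (diff P n x)" if x: "x \<in> carrier (part P n)" for n x
    unfolding h_def r(3)[OF x] P.M.minus_self[OF lin_closed[OF dP x]] lin_zero[OF w2 bcD(1)[OF Pc] bcD(1)[OF Z]]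
    by (rule Z.M.r_zero[OF lin_closed[OF w lin_closed[OF dP x]]])
  have ec: "rst P e \<in> chain_maps R P A"
  proof (rule rst_cm[OF Pc el])
    fix n x assume x: "x \<in> carrier (part P n)"
    note rx = lin_closed[OF r(1) x] and qx = lin_closed[OF q(1) x]
    show "e (n + 1) (diff P n x) = diff A n (e n x)"
      unfolding ed[OF x] unfolding e_def lin_add[OF dA lin_closed[OF y rx] lin_closed[OF y2 qx]]
        dy[OF rx] dy2[OF qx] q(2)[OF x]
      by (rule A.M.l_zero[OF lin_closed[OF y lin_closed[OF dP x]], symmetric])
  qed
  have "hcls R P Z g = hcls R P Z (rst P (\<lambda>n x. s n (rst P e n x)))"
  proof (rule hclsI[OF Pc Z g cm_comp[OF Pc ec S] hl])
    fix n x assume x: "x \<in> carrier (part P n)"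
    note rx = lin_closed[OF r(1) x] and qx = lin_closed[OF q(1) x] and dx = lin_closed[OF dP x]
    let ?q = "x \<ominus>\<^bsub>part P n\<^esub> r n x"
    let ?a = "s n (y n (r n x))" and ?b = "diff Z (n - 1) (w n (r n x))"
    let ?c = "s n (y2 n ?q)" and ?d = "diff Z (n - 1) (w2 n ?q)" and ?k = "w (n + 1) (diff P n x)"
    have cl: "?a \<in> carrier (part Z n)" "?b \<in> carrier (part Z n)" "?c \<in> carrier (part Z n)"
      "?d \<in> carrier (part Z n)" "?k \<in> carrier (part Z n)"
      by (rule lin_closed[OF sl lin_closed[OF y rx]] lin_closed[OF bcD(5)[OF Z] lin_closed[OF w rx]]
          lin_closed[OF sl lin_closed[OF y2 qx]] lin_closed[OF bcD(5)[OF Z] lin_closed[OF w2 qx]]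
          lin_closed[OF w' dx])+
    have 1: "g n (r n x) = ?a \<oplus>\<^bsub>part Z n\<^esub> ?b"
      using syw[OF rx] unfolding q(3)[OF x] by (rule sym)
    have 2: "g n ?q = ?c \<oplus>\<^bsub>part Z n\<^esub> ?d \<oplus>\<^bsub>part Z n\<^esub> ?k"
      by (rule Z.M.eq_add_if_minus_eq[OF syw2[OF qx, unfolded q(2)[OF x], symmetric] lin_closed[OF gl qx] cl(5)])
    have "x = r n x \<oplus>\<^bsub>part P n\<^esub> ?q" by (rule P.M.eq_add_minus[OF x rx])
    then have "g n x = g n (r n x) \<oplus>\<^bsub>part Z n\<^esub> g n ?q" using lin_add[OF gl rx qx] by simp
    also have "\<dots> = (?a \<oplus>\<^bsub>part Z n\<^esub> ?c) \<oplus>\<^bsub>part Z n\<^esub> ((?b \<oplus>\<^bsub>part Z n\<^esub> ?d) \<oplus>\<^bsub>part Z n\<^esub> ?k)"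
      unfolding 1 2 using cl by (simp add: Z.M.a_ac)
    also have "?a \<oplus>\<^bsub>part Z n\<^esub> ?c = rst P (\<lambda>n x. s n (rst P e n x)) n x"
      unfolding rst_apply[OF x] unfolding e_def by (rule lin_add[OF sl lin_closed[OF y rx] lin_closed[OF y2 qx], symmetric])
    also have "?b \<oplus>\<^bsub>part Z n\<^esub> ?d = diff Z (n - 1) (h n x)"
      unfolding h_def by (rule lin_add[OF bcD(5)[OF Z] lin_closed[OF w rx] lin_closed[OF w2 qx], symmetric])
    also have "?k = h (n + 1) (diff P n x)" by (rule hd[OF x, symmetric])
    finally show "g n x = rst P (\<lambda>n x. s n (rst P e n x)) n x \<oplus>\<^bsub>part Z n\<^esub>
        (diff Z (n - 1) (h n x) \<oplus>\<^bsub>part Z n\<^esub> h (n + 1) (diff P n x))" .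
  qed
  then show ?thesis using ec by (intro bexI[of _ "rst P e"]) simp_all
qed

text \<open>The same splitting with the cone shifted by one degree: a homotopy from s g to zero is
  corrected to come from a homotopy of g itself. The second entries \<open>w\<close> and
  \<open>w2\<close> record the homotopy between homotopies that the cone requires.\<close>

lemma perfect_null:
  assumes P: "perfect R P" and A: "A \<in> bounded_complexes R" and Z: "Z \<in> bounded_complexes R"
    and s: "s \<in> quasi_isomorphisms R A Z" and g: "g \<in> chain_maps R P A"
    and null: "rst P (\<lambda>n x. s n (g n x)) \<in> null_homotopic R P Z"
  shows "g \<in> null_homotopic R P A"
proof -
  have Pc: "P \<in> bounded_complexes R" and t: "\<And>n. tls R (part P n)" using P by (simp_all add: perfect_def)
  note dP = bcD(4)[OF Pc] and dA = bcD(4)[OF A] and dZ = bcD(4)[OF Z]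
    and dA' = bcD(5)[OF A] and dZ' = bcD(5)[OF Z]
  interpret P: right_module R "part P k" for k by (rule bcD(1)[OF Pc])
  interpret A: right_module R "part A k" for k by (rule bcD(1)[OF A])
  interpret Z: right_module R "part Z k" for k by (rule bcD(1)[OF Z])
  note S = qisD(1)[OF A Z s]
  note sl = cmD(2)[OF S] and gl = cmD(2)[OF g]
  obtain r where r: "\<And>n. lin R (part P n) (part P n) (r n)"
    "\<And>n x. x \<in> carrier (part P n) \<Longrightarrow> diff P n (r n x) = \<zero>\<^bsub>part P (n + 1)\<^esub>"
    "\<And>n x. x \<in> carrier (part P n) \<Longrightarrow> r (n + 1) (diff P n x) = diff P n x"
    and q: "\<And>n. lin R (part P n) (part P n) (\<lambda>x. x \<ominus>\<^bsub>part P n\<^esub> r n x)"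
    "\<And>n x. x \<in> carrier (part P n) \<Longrightarrow> diff P n (x \<ominus>\<^bsub>part P n\<^esub> r n x) = diff P n x"
    "\<And>n x. x \<in> carrier (part P n) \<Longrightarrow> r n (r n x) = r n x"
    by (rule perfect_split[OF P], rule that)
  obtain h where h: "\<And>n. lin R (part P n) (part Z (n - 1)) (h n)"
    "\<And>n. lin R (part P (n + 1)) (part Z n) (h (n + 1))"
    and dh: "\<And>n x. x \<in> carrier (part P n) \<Longrightarrow> s n (g n x) =
      diff Z (n - 1) (h n x) \<oplus>\<^bsub>part Z n\<^esub> h (n + 1) (diff P n x)"
  proof (rule nullE[OF null])
    fix h assume h: "\<And>n. lin R (part P n) (part Z (n - 1)) (h n)"
      "\<And>n. lin R (part P (n + 1)) (part Z n) (h (n + 1))"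
      and eq: "\<And>n x. x \<in> carrier (part P n) \<Longrightarrow> rst P (\<lambda>n x. s n (g n x)) n x =
        diff Z (n - 1) (h n x) \<oplus>\<^bsub>part Z n\<^esub> h (n + 1) (diff P n x)"
    show thesis by (rule that[OF h]) (simp only: eq[symmetric] rst_apply)
  qed
  have "\<exists>y w. lin R (part P n) (part A (n - 1)) y \<and> lin R (part P n) (part Z (n - 1 - 1)) w \<and>
    (\<forall>x\<in>carrier (part P n). diff A (n - 1) (y x) = g n (r n x)) \<and>
    (\<forall>x\<in>carrier (part P n). s (n - 1) (y x) \<oplus>\<^bsub>part Z (n - 1)\<^esub> diff Z (n - 1 - 1) (w x) = h n (r n x))" for n
  proof (rule cone_lift[OF tl_fgp[OF t] A Z s _ lin_comp[OF r(1) h(1)]])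
    show "lin R (part P n) (part A (n - 1 + 1)) (\<lambda>x. g n (r n x))" using lin_comp[OF r(1) gl, of n] by simp
    fix x assume x: "x \<in> carrier (part P n)"
    note rx = lin_closed[OF r(1) x]
    show "diff A (n - 1 + 1) (g n (r n x)) = \<zero>\<^bsub>part A (n - 1 + 2)\<^esub>"
      using cmD(3)[OF g rx] lin_zero[OF gl bcD(1)[OF Pc] bcD(1)[OF A], of "n + 1"]
      by (simp add: r(2)[OF x] algebra_simps)
    have "s n (g n (r n x)) = diff Z (n - 1) (h n (r n x))"
      unfolding dh[OF rx] r(2)[OF x] lin_zero[OF h(2) bcD(1)[OF Pc] bcD(1)[OF Z]]
      by (rule Z.M.r_zero[OF lin_closed[OF dZ' lin_closed[OF h(1) rx]]])
    then show "s (n - 1 + 1) (g n (r n x)) = diff Z (n - 1) (h n (r n x))" by simp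
  qed blast
  then obtain y w where y: "\<And>n. lin R (part P n) (part A (n - 1)) (y n)"
    and w: "\<And>n. lin R (part P n) (part Z (n - 1 - 1)) (w n)"
    and dy: "\<And>n x. x \<in> carrier (part P n) \<Longrightarrow> diff A (n - 1) (y n x) = g n (r n x)"
    and syw: "\<And>n x. x \<in> carrier (part P n) \<Longrightarrow>
      s (n - 1) (y n x) \<oplus>\<^bsub>part Z (n - 1)\<^esub> diff Z (n - 1 - 1) (w n x) = h n (r n x)"
    by metis
  have y': "lin R (part P (n + 1)) (part A n) (y (n + 1))" for n using y[of "n + 1"] by simp
  have w': "lin R (part P (n + 1)) (part Z (n - 1)) (w (n + 1))" for n using w[of "n + 1"] by simp
  have dy': "diff A n (y (n + 1) (diff P n x)) = diff A n (g n x)" if x: "x \<in> carrier (part P n)" for n x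
    using dy[OF lin_closed[OF dP x]] by (simp add: r(3)[OF x] cmD(3)[OF g x])
  have syw': "s n (y (n + 1) (diff P n x)) \<oplus>\<^bsub>part Z n\<^esub> diff Z (n - 1) (w (n + 1) (diff P n x)) = h (n + 1) (diff P n x)"
    if x: "x \<in> carrier (part P n)" for n x
    using syw[OF lin_closed[OF dP x]] by (simp add: r(3)[OF x])
  \<comment> \<open>On the complement the homotopy for g has to supply g - y d, what the cocycle
    part leaves over. Substituting s y + d w for h on coboundaries turns s g = d h + h d into s (g -
    y d) = d (h + w d), whence the plus sign in front of w.\<close>
  have "\<exists>y2 w2. lin R (part P n) (part A (n - 1)) y2 \<and> lin R (part P n) (part Z (n - 1 - 1)) w2 \<and>
    (\<forall>x\<in>carrier (part P n). diff A (n - 1) (y2 x) = g n x \<ominus>\<^bsub>part A n\<^esub> y (n + 1) (diff P n x)) \<and>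
    (\<forall>x\<in>carrier (part P n). s (n - 1) (y2 x) \<oplus>\<^bsub>part Z (n - 1)\<^esub> diff Z (n - 1 - 1) (w2 x) =
        h n x \<oplus>\<^bsub>part Z (n - 1)\<^esub> w (n + 1) (diff P n x))" for n
  proof (rule cone_lift[OF tl_fgp[OF t] A Z s _ lin_sum[OF bcD(1)[OF Pc] bcD(1)[OF Z] h(1) lin_comp[OF dP w']]])
    show "lin R (part P n) (part A (n - 1 + 1)) (\<lambda>x. g n x \<ominus>\<^bsub>part A n\<^esub> y (n + 1) (diff P n x))"
      using lin_diff[OF bcD(1)[OF Pc] bcD(1)[OF A] gl lin_comp[OF dP y'], of n] by simp
    fix x assume x: "x \<in> carrier (part P n)"
    note dx = lin_closed[OF dP x] and gx = lin_closed[OF gl x]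
    note ydx = lin_closed[OF y' dx] and wdx = lin_closed[OF w' dx]
    have "diff A n (g n x \<ominus>\<^bsub>part A n\<^esub> y (n + 1) (diff P n x)) = \<zero>\<^bsub>part A (n + 1)\<^esub>"
      unfolding lin_minus[OF dA bcD(1)[OF A] bcD(1)[OF A] gx ydx] dy'[OF x]
      by (rule A.M.minus_self[OF lin_closed[OF dA gx]])
    then show "diff A (n - 1 + 1) (g n x \<ominus>\<^bsub>part A n\<^esub> y (n + 1) (diff P n x)) = \<zero>\<^bsub>part A (n - 1 + 2)\<^esub>"
      by (simp add: algebra_simps)
    have cl: "s n (y (n + 1) (diff P n x)) \<in> carrier (part Z n)"
      "diff Z (n - 1) (w (n + 1) (diff P n x)) \<in> carrier (part Z n)"
      "diff Z (n - 1) (h n x) \<in> carrier (part Z n)"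
      by (rule lin_closed[OF sl ydx] lin_closed[OF dZ' wdx] lin_closed[OF dZ' lin_closed[OF h(1) x]])+
    have 1: "s n (g n x) = diff Z (n - 1) (h n x) \<oplus>\<^bsub>part Z n\<^esub> diff Z (n - 1) (w (n + 1) (diff P n x))
        \<oplus>\<^bsub>part Z n\<^esub> s n (y (n + 1) (diff P n x))"
      unfolding dh[OF x] syw'[OF x, symmetric] using cl by (simp add: Z.M.a_ac)
    have "s n (g n x \<ominus>\<^bsub>part A n\<^esub> y (n + 1) (diff P n x)) =
        diff Z (n - 1) (h n x) \<oplus>\<^bsub>part Z n\<^esub> diff Z (n - 1) (w (n + 1) (diff P n x))"
      unfolding lin_minus[OF sl bcD(1)[OF A] bcD(1)[OF Z] gx ydx]
      by (rule Z.M.minus_eq_if_eq_add[OF 1 _ cl(1)]) (rule Z.M.a_closed[OF cl(3,2)])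
    also have "\<dots> = diff Z (n - 1) (h n x \<oplus>\<^bsub>part Z (n - 1)\<^esub> w (n + 1) (diff P n x))"
      by (rule lin_add[OF dZ' lin_closed[OF h(1) x] wdx, symmetric])
    finally show "s (n - 1 + 1) (g n x \<ominus>\<^bsub>part A n\<^esub> y (n + 1) (diff P n x)) =
        diff Z (n - 1) (h n x \<oplus>\<^bsub>part Z (n - 1)\<^esub> w (n + 1) (diff P n x))" by simp
  qed blast
  then obtain y2 where y2: "\<And>n. lin R (part P n) (part A (n - 1)) (y2 n)"
    and dy2: "\<And>n x. x \<in> carrier (part P n) \<Longrightarrow>
      diff A (n - 1) (y2 n x) = g n x \<ominus>\<^bsub>part A n\<^esub> y (n + 1) (diff P n x)"
    by metis
  define H where "H n x = y n (r n x) \<oplus>\<^bsub>part A (n - 1)\<^esub> y2 n (x \<ominus>\<^bsub>part P n\<^esub> r n x)" for n x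
  have Hl: "lin R (part P n) (part A (n - 1)) (H n)" for n
    unfolding H_def by (rule lin_sum[OF bcD(1)[OF Pc] bcD(1)[OF A] lin_comp[OF r(1) y] lin_comp[OF q(1) y2]])
  have Hd: "H (n + 1) (diff P n x) = y (n + 1) (diff P n x)" if x: "x \<in> carrier (part P n)" for n x
    unfolding H_def r(3)[OF x] P.M.minus_self[OF lin_closed[OF dP x]] lin_zero[OF y2 bcD(1)[OF Pc] bcD(1)[OF A]]
    by (rule A.M.r_zero[OF lin_closed[OF y lin_closed[OF dP x]]])
  show ?thesis
  proof (rule nullI[OF Pc g Hl])
    fix n x assume x: "x \<in> carrier (part P n)"
    note rx = lin_closed[OF r(1) x] and qx = lin_closed[OF q(1) x] and dx = lin_closed[OF dP x]
    let ?q = "x \<ominus>\<^bsub>part P n\<^esub> r n x" and ?y = "y (n + 1) (diff P n x)"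
    have cl: "g n (r n x) \<in> carrier (part A n)" "g n ?q \<in> carrier (part A n)" "?y \<in> carrier (part A n)"
      by (rule lin_closed[OF gl rx] lin_closed[OF gl qx] lin_closed[OF y' dx])+
    have "x = r n x \<oplus>\<^bsub>part P n\<^esub> ?q" by (rule P.M.eq_add_minus[OF x rx])
    then have gx: "g n x = g n (r n x) \<oplus>\<^bsub>part A n\<^esub> g n ?q" using lin_add[OF gl rx qx] by simp
    have "diff A (n - 1) (H n x) = g n (r n x) \<oplus>\<^bsub>part A n\<^esub> (g n ?q \<ominus>\<^bsub>part A n\<^esub> ?y)"
      unfolding H_def lin_add[OF dA' lin_closed[OF y rx] lin_closed[OF y2 qx]] dy[OF rx] dy2[OF qx] q(2,3)[OF x] ..
    then show "g n x = diff A (n - 1) (H n x) \<oplus>\<^bsub>part A n\<^esub> H (n + 1) (diff P n x)"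
      unfolding Hd[OF x] gx using cl by (simp add: a_minus_def A.M.a_assoc A.M.l_neg)
  qed
qed

text \<open>Surjectivity of composition with a quasi-isomorphism is \<open>perfect_lift\<close>, and
  injectivity is \<open>perfect_null\<close> applied to a difference of two maps.\<close>

lemma perfect_res:
  fixes P X :: "('a, 'u) cpx"
  assumes P: "perfect R P" and X: "X \<in> bounded_complexes R" and p: "p \<in> quasi_isomorphisms R P X"
  shows "resolved_localisation.res (homotopy_cat R) (qW R) P (hcls R P X p) X"
  unfolding resolved_localisation.res_def[OF K_localisation] K_simps(1)
proof (intro conjI ballI)
  show Pc: "P \<in> bounded_complexes R" using P by (simp add: perfect_def)
  show "X \<in> bounded_complexes R" by (rule X)
  show "hcls R P X p \<in> qW R P X" unfolding hcls_qW[OF Pc X qisD(1)[OF Pc X p]] by (rule p)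
  fix A Z :: "('a, 'u) cpx" and \<sigma>
  assume A: "A \<in> bounded_complexes R" and Z: "Z \<in> bounded_complexes R" and "\<sigma> \<in> qW R A Z"
  obtain s where s: "s \<in> quasi_isomorphisms R A Z" "s \<in> chain_maps R A Z" "\<sigma> = hcls R A Z s"
    by (rule qWE[OF \<open>\<sigma> \<in> qW R A Z\<close> A Z])
  show "bij_betw (cmp (homotopy_cat R) P A Z \<sigma>) (Hom (homotopy_cat R) P A) (Hom (homotopy_cat R) P Z)"
    unfolding bij_betw_def
  proof
    show "inj_on (cmp (homotopy_cat R) P A Z \<sigma>) (Hom (homotopy_cat R) P A)"
    proof (rule inj_onI)
      fix \<phi> \<psi> assume "\<phi> \<in> Hom (homotopy_cat R) P A" "\<psi> \<in> Hom (homotopy_cat R) P A"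
        and eq: "cmp (homotopy_cat R) P A Z \<sigma> \<phi> = cmp (homotopy_cat R) P A Z \<sigma> \<psi>"
      then obtain f g where f: "f \<in> chain_maps R P A" "\<phi> = hcls R P A f"
        and g: "g \<in> chain_maps R P A" "\<psi> = hcls R P A g" by (auto simp: K_simps(2))
      note fs = cm_comp[OF Pc f(1) s(2)] and gs = cm_comp[OF Pc g(1) s(2)]
      have "hdiff P Z (rst P (\<lambda>n x. s n (f n x))) (rst P (\<lambda>n x. s n (g n x))) \<in> null_homotopic R P Z"
        using eq unfolding f(2) g(2) s(3) K_cmp[OF Pc A Z f(1) s(2)] K_cmp[OF Pc A Z g(1) s(2)]
          hcls_eq_iff[OF Pc Z fs gs] .
      moreover have "hdiff P Z (rst P (\<lambda>n x. s n (f n x))) (rst P (\<lambda>n x. s n (g n x))) =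
          rst P (\<lambda>n x. s n (hdiff P A f g n x))"
      proof (rule cm_eqI[OF cm_hdiff[OF Pc Z fs gs] cm_comp[OF Pc cm_hdiff[OF Pc A f(1) g(1)] s(2)]])
        fix n x assume x: "x \<in> carrier (part P n)"
        show "hdiff P Z (rst P (\<lambda>n x. s n (f n x))) (rst P (\<lambda>n x. s n (g n x))) n x =
            rst P (\<lambda>n x. s n (hdiff P A f g n x)) n x"
          unfolding rst_apply[OF x] hdiff_apply[OF x]
          by (rule lin_minus[OF cmD(2)[OF s(2)] bcD(1)[OF A] bcD(1)[OF Z] lin_closed[OF cmD(2)[OF f(1)] x]
                lin_closed[OF cmD(2)[OF g(1)] x], symmetric])
      qed
      ultimately have "rst P (\<lambda>n x. s n (hdiff P A f g n x)) \<in> null_homotopic R P Z" by simp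
      then have "hdiff P A f g \<in> null_homotopic R P A"
        by (rule perfect_null[OF P A Z s(1) cm_hdiff[OF Pc A f(1) g(1)]])
      then show "\<phi> = \<psi>" unfolding f(2) g(2) hcls_eq_iff[OF Pc A f(1) g(1)] .
    qed
    show "cmp (homotopy_cat R) P A Z \<sigma> ` Hom (homotopy_cat R) P A = Hom (homotopy_cat R) P Z"
    proof
      show "cmp (homotopy_cat R) P A Z \<sigma> ` Hom (homotopy_cat R) P A \<subseteq> Hom (homotopy_cat R) P Z"
        unfolding K_simps(2) s(3) using K_cmp[OF Pc A Z _ s(2)] cm_comp[OF Pc _ s(2)] by auto
      show "Hom (homotopy_cat R) P Z \<subseteq> cmp (homotopy_cat R) P A Z \<sigma> ` Hom (homotopy_cat R) P A"
      proof
        fix \<phi> assume "\<phi> \<in> Hom (homotopy_cat R) P Z"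
        then obtain g where g: "g \<in> chain_maps R P Z" "\<phi> = hcls R P Z g" by (auto simp: K_simps(2))
        obtain e where e: "e \<in> chain_maps R P A" "hcls R P Z (rst P (\<lambda>n x. s n (e n x))) = hcls R P Z g"
          using perfect_lift[OF P A Z s(1) g(1)] by blast
        have "\<phi> = cmp (homotopy_cat R) P A Z \<sigma> (hcls R P A e)"
          unfolding g(2) s(3) K_cmp[OF Pc A Z e(1) s(2)] e(2) ..
        then show "\<phi> \<in> cmp (homotopy_cat R) P A Z \<sigma> ` Hom (homotopy_cat R) P A"
          using e(1) by (simp add: K_simps(2))
      qed
    qed
  qed
qed

end

subsection \<open>Projective resolutions\<close>

lemma free_empty_eq: "\<lbrakk>v \<in> carrier (free_module R {}); w \<in> carrier (free_module R {})\<rbrakk> \<Longrightarrow> v = w"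
  by simp

context hereditary_noetherian
begin

text \<open>Covers and direct sums are made of functions and pairs, while a complex needs its
  elements in \<open>'u\<close>. A torsionless module is finitely generated, hence has an isomorphic
  copy there.\<close>

lemma tls_transport:
  fixes M :: "('a, 'w, 'c) module_scheme"
  assumes M: "tls R M" and U: "large_universe R TYPE('u)"
  obtains B :: "('a, 'u) module" and \<phi> \<psi> where "B \<in> fg_modules R" "tls R B" "lin R M B \<phi>" "lin R B M \<psi>"
    "\<And>x. x \<in> carrier M \<Longrightarrow> \<psi> (\<phi> x) = x" "\<And>y. y \<in> carrier B \<Longrightarrow> \<phi> (\<psi> y) = y"
proof -
  note mM = tl_module[OF M]
  obtain B :: "('a, 'u) module" and \<phi> where B: "B \<in> fg_modules R" and \<phi>: "\<phi> \<in> mod_hom R M B"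
    and bij: "bij_betw \<phi> (carrier M) (carrier B)"
    using fin_gen_in_large_universe[OF mM tl_fin_gen[OF M] U] by blast
  have mB: "right_module R B" using B by (simp add: fg_modules_def)
  note \<phi>l = mod_hom_lin[OF \<phi>]
  obtain \<psi> where \<psi>: "lin R B M \<psi>" and inv: "\<And>x. x \<in> carrier M \<Longrightarrow> \<psi> (\<phi> x) = x"
    and inv': "\<And>y. y \<in> carrier B \<Longrightarrow> \<phi> (\<psi> y) = y"
    by (rule lin_inverse[OF mM \<phi>l bij]) blast
  have "tls R B"
  proof (rule tl_inj[OF mB \<psi> M])
    fix y assume y: "y \<in> carrier B" and "\<psi> y = \<zero>\<^bsub>M\<^esub>"
    then show "y = \<zero>\<^bsub>B\<^esub>" using inv'[OF y] lin_zero[OF \<phi>l mM mB] by simp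
  qed
  then show thesis using that[OF B _ \<phi>l \<psi> inv inv'] by blast
qed

text \<open>Let \<open>F n\<close> be projective over the cocycles of degree n, and
  \<open>K n\<close> the part of it lying over the coboundaries, again projective as a submodule.
  Then \<open>P\<close> in degree n is the sum of \<open>F n\<close> and \<open>K (n + 1)\<close>
  with differential (f, k) -> (k, 0), so its cohomology is \<open>F n\<close> modulo
  \<open>K n\<close>, which is that of \<open>X\<close>. The map to \<open>X\<close> is (f, k) -> q
  f + l k, where l lifts q on \<open>K (n + 1)\<close> through the differential of
  \<open>X\<close>.\<close>

lemma resolution_exists:
  fixes X :: "('a, 'u) cpx"
  assumes U: "large_universe R TYPE('u)" and X: "X \<in> bounded_complexes R"
  shows "\<exists>P p. perfect R P \<and> p \<in> quasi_isomorphisms R P X"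
proof -
  interpret X: right_module R "part X k" for k by (rule bcD(1)[OF X])
  note dX = bcD(4)[OF X]
  define cover where "cover n A q \<longleftrightarrow> finite A \<and> (carrier (part X n) = {\<zero>\<^bsub>part X n\<^esub>} \<longrightarrow> A = {}) \<and>
    tls R (free_module R A\<lparr>carrier := {v \<in> carrier (free_module R A). q v \<in> cocycles X n}\<rparr>) \<and>
    lin R (free_module R A) (part X n) q \<and>
    q ` {v \<in> carrier (free_module R A). q v \<in> cocycles X n} = cocycles X n"
    for n and A :: "'u set" and q
  have "\<exists>A q. cover n A q" for n
    unfolding cover_def
    by (rule submod_cover[OF bcD(1)[OF X] bcD(2)[OF X] cocycles_submod[OF X]]) (intro exI conjI impI, assumption+)
  then obtain A q where "\<And>n. cover n (A n) (q n)" by metis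
  then have A: "\<And>n. finite (A n)" "\<And>n. carrier (part X n) = {\<zero>\<^bsub>part X n\<^esub>} \<Longrightarrow> A n = {}"
    and tF: "\<And>n. tls R (free_module R (A n)\<lparr>carrier := {v \<in> carrier (free_module R (A n)). q n v \<in> cocycles X n}\<rparr>)"
    and q: "\<And>n. lin R (free_module R (A n)) (part X n) (q n)"
    and qZ: "\<And>n. q n ` {v \<in> carrier (free_module R (A n)). q n v \<in> cocycles X n} = cocycles X n"
    unfolding cover_def by blast+
  define F where "F n = free_module R (A n)\<lparr>carrier := {v \<in> carrier (free_module R (A n)). q n v \<in> cocycles X n}\<rparr>" for n
  define K where "K n = free_module R (A n)\<lparr>carrier := {v \<in> carrier (free_module R (A n)). q n v \<in> coboundaries X n}\<rparr>" for n
  note FM = free_module_module[OF ring_R]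
  have sF: "submod R (free_module R (A n)) {v \<in> carrier (free_module R (A n)). q n v \<in> cocycles X n}" for n
    by (rule submod_vimage[OF FM bcD(1)[OF X] q cocycles_submod[OF X]])
  have sK: "submod R (free_module R (A n)) {v \<in> carrier (free_module R (A n)). q n v \<in> coboundaries X n}" for n
    by (rule submod_vimage[OF FM bcD(1)[OF X] q coboundaries_submod[OF X]])
  have tF: "tls R (F n)" for n unfolding F_def by (rule tF)
  have tK: "tls R (K n)" for n unfolding K_def by (rule tl_sub[OF tl_free[OF ring_R A(1)] sK])
  have cF: "carrier (F n) = {v \<in> carrier (free_module R (A n)). q n v \<in> cocycles X n}" for n
    unfolding F_def by (rule sub_carrier)
  have cK: "carrier (K n) = {v \<in> carrier (free_module R (A n)). q n v \<in> coboundaries X n}" for n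
    unfolding K_def by (rule sub_carrier)
  have KF: "lin R (K n) (F n) (\<lambda>x. x)" for n
  proof (rule linI)
    fix x assume "x \<in> carrier (K n)"
    then show "x \<in> carrier (F n)" unfolding cF cK using coboundaries_cocycles[OF X] by blast
  qed (simp_all add: F_def K_def)
  have qF: "lin R (F n) (part X n) (q n)" for n unfolding F_def by (rule lin_sub[OF q sF])
  have qK: "lin R (K n) (part X n) (q n)" for n unfolding K_def by (rule lin_sub[OF q sK])
  have zFK: "\<zero>\<^bsub>F n\<^esub> = \<zero>\<^bsub>K n\<^esub>" for n by (simp add: F_def K_def)
  \<comment> \<open>Elements of \<open>K (n + 1)\<close> are mapped by q to coboundaries; preimages
    under the differential of \<open>X\<close> can be chosen linearly because
    \<open>K (n + 1)\<close> is projective.\<close>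
  have "\<exists>l. lin R (K (n + 1)) (part X n) l \<and> (\<forall>k\<in>carrier (K (n + 1)). diff X n (l k) = q (n + 1) k)" for n
  proof (rule fgp_lift[OF tl_fgp[OF tK] bcD(1)[OF X] bcD(1)[OF X] dX qK])
    fix k assume "k \<in> carrier (K (n + 1))"
    then have "q (n + 1) k \<in> coboundaries X (n + 1)" unfolding cK by blast
    then show "\<exists>y\<in>carrier (part X n). diff X n y = q (n + 1) k" unfolding coboundaries_def by auto
  qed blast
  then obtain l where l: "\<And>n. lin R (K (n + 1)) (part X n) (l n)"
    and dl: "\<And>n k. k \<in> carrier (K (n + 1)) \<Longrightarrow> diff X n (l n k) = q (n + 1) k" by metis
  define P0 where "P0 n = prod_module (F n) (K (n + 1))" for n
  have tP0: "tls R (P0 n)" for n unfolding P0_def by (rule tl_prod[OF tF tK])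
  note P0m = tl_module[OF tP0]
  interpret P0: right_module R "P0 k" for k by (rule P0m)
  interpret F: right_module R "F k" for k by (rule tl_module[OF tF])
  interpret K: right_module R "K k" for k by (rule tl_module[OF tK])
  have "\<exists>N \<phi> \<psi>. N \<in> (fg_modules R :: ('a, 'u) module set) \<and> tls R N \<and> lin R (P0 n) N \<phi> \<and> lin R N (P0 n) \<psi> \<and>
      (\<forall>x\<in>carrier (P0 n). \<psi> (\<phi> x) = x) \<and> (\<forall>y\<in>carrier N. \<phi> (\<psi> y) = y)" for n
    by (rule tls_transport[OF tP0 U, of n]) blast
  then obtain N :: "int \<Rightarrow> ('a, 'u) module" and \<phi> \<psi> where N: "\<And>n. N n \<in> fg_modules R" "\<And>n. tls R (N n)"
    and \<phi>: "\<And>n. lin R (P0 n) (N n) (\<phi> n)" and \<psi>: "\<And>n. lin R (N n) (P0 n) (\<psi> n)"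
    and \<psi>\<phi>: "\<And>n x. x \<in> carrier (P0 n) \<Longrightarrow> \<psi> n (\<phi> n x) = x" and \<phi>\<psi>: "\<And>n y. y \<in> carrier (N n) \<Longrightarrow> \<phi> n (\<psi> n y) = y"
    by metis
  note Nm = tl_module[OF N(2)]
  interpret N: right_module R "N k" for k by (rule Nm)
  have \<psi>1: "lin R (N n) (F n) (\<lambda>x. fst (\<psi> n x))" for n by (rule lin_comp[OF \<psi>[unfolded P0_def] lin_fst])
  have \<psi>2: "lin R (N n) (K (n + 1)) (\<lambda>x. snd (\<psi> n x))" for n by (rule lin_comp[OF \<psi>[unfolded P0_def] lin_snd])
  have mem: "(f, k) \<in> carrier (P0 n)" if "f \<in> carrier (F n)" "k \<in> carrier (K (n + 1))" for n f k
    unfolding P0_def prod_module_simps using that by blast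
  have mem': "\<phi> n (f, k) \<in> carrier (N n)" if "f \<in> carrier (F n)" "k \<in> carrier (K (n + 1))" for n f k
    by (rule lin_closed[OF \<phi> mem[OF that]])
  have zP0: "\<zero>\<^bsub>P0 n\<^esub> = (\<zero>\<^bsub>F n\<^esub>, \<zero>\<^bsub>K (n + 1)\<^esub>)" for n unfolding P0_def prod_module_simps ..
  have \<phi>0: "\<phi> n (\<zero>\<^bsub>F n\<^esub>, \<zero>\<^bsub>K (n + 1)\<^esub>) = \<zero>\<^bsub>N n\<^esub>" for n
    unfolding zP0[symmetric] by (rule lin_zero[OF \<phi> P0m Nm])
  note \<phi>0' = \<phi>0[unfolded zFK]
  \<comment> \<open>The differential (f, k) -> (k, 0), read through the isomorphisms
    \<open>\<phi>\<close> and \<open>\<psi>\<close> with the copies in \<open>'u\<close>;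
    \<open>K (n + 1)\<close> is included in \<open>F (n + 1)\<close>.\<close>
  define D where "D n x = \<phi> (n + 1) (snd (\<psi> n x), \<zero>\<^bsub>K (n + 1 + 1)\<^esub>)" for n x
  define P :: "('a, 'u) cpx" where "P = \<lparr>part = N, diff = \<lambda>n. restrict (D n) (carrier (N n))\<rparr>"
  have pP: "part P n = N n" for n by (simp add: P_def)
  have dP: "diff P n x = D n x" if "x \<in> carrier (N n)" for n x using that by (simp add: P_def)
  have Dl: "lin R (N n) (N (n + 1)) (D n)" for n
  proof -
    have "lin R (N n) (P0 (n + 1)) (\<lambda>x. (snd (\<psi> n x), \<zero>\<^bsub>K (n + 1 + 1)\<^esub>))"
      unfolding P0_def by (rule lin_pair[OF lin_comp[OF \<psi>2 KF] lin_const_zero[OF tl_module[OF tK]]])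
    then show ?thesis unfolding D_def by (rule lin_comp[OF _ \<phi>])
  qed
  have \<psi>D: "\<psi> (n + 1) (D n x) = (snd (\<psi> n x), \<zero>\<^bsub>K (n + 1 + 1)\<^esub>)" if "x \<in> carrier (N n)" for n x
    unfolding D_def by (rule \<psi>\<phi>[OF mem[OF lin_closed[OF KF lin_closed[OF \<psi>2 that]] K.M.zero_closed]])
  obtain b where b: "\<And>n. \<bar>n\<bar> > b \<Longrightarrow> carrier (part X n) = {\<zero>\<^bsub>part X n\<^esub>}" by (rule bc_bound[OF X], rule that)
  have Pbc: "P \<in> bounded_complexes R"
    unfolding bounded_complexes_def
  proof (intro CollectI conjI allI ballI exI[of _ "b + 1"] impI)
    fix n
    show "part P n \<in> fg_modules R" unfolding pP by (rule N(1))
    show "diff P n \<in> mod_hom R (part P n) (part P (n + 1))"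
      unfolding pP using lin_restrict[OF Dl Nm, of n] by (simp add: P_def)
    {
      fix x assume x: "x \<in> carrier (part P n)"
      then have x: "x \<in> carrier (N n)" unfolding pP .
      have "D (n + 1) (D n x) = \<zero>\<^bsub>N (n + 1 + 1)\<^esub>"
        unfolding D_def[of "n + 1"] \<psi>D[OF x] snd_conv by (rule \<phi>0')
      then show "diff P (n + 1) (diff P n x) = \<zero>\<^bsub>part P (n + 2)\<^esub>"
        unfolding dP[OF x] dP[OF lin_closed[OF Dl x]] pP by (simp add: add.assoc)
    }
    \<comment> \<open>Degree n of \<open>P\<close> uses the covers of degrees n and n + 1, hence the
      bound b + 1 instead of b.\<close>
    assume n: "b + 1 < \<bar>n\<bar>"
    have A0: "A n = {}" "A (n + 1) = {}" using A(2) b[of n] b[of "n + 1"] n by auto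
    have "y = \<zero>\<^bsub>N n\<^esub>" if y: "y \<in> carrier (N n)" for y
    proof -
      have "fst (\<psi> n y) \<in> carrier (free_module R {})" "\<zero>\<^bsub>F n\<^esub> \<in> carrier (free_module R {})"
        using lin_closed[OF \<psi>1 y] F.M.zero_closed[of n] unfolding cF A0 by blast+
      then have 1: "fst (\<psi> n y) = \<zero>\<^bsub>F n\<^esub>" by (rule free_empty_eq)
      have "snd (\<psi> n y) \<in> carrier (free_module R {})" "\<zero>\<^bsub>K (n + 1)\<^esub> \<in> carrier (free_module R {})"
        using lin_closed[OF \<psi>2 y] K.M.zero_closed[of "n + 1"] unfolding cK A0 by blast+
      then have 2: "snd (\<psi> n y) = \<zero>\<^bsub>K (n + 1)\<^esub>" by (rule free_empty_eq)
      have "y = \<phi> n (fst (\<psi> n y), snd (\<psi> n y))" using \<phi>\<psi>[OF y] by simp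
      then show ?thesis unfolding 1 2 \<phi>0 .
    qed
    then show "carrier (part P n) = {\<zero>\<^bsub>part P n\<^esub>}" unfolding pP using N.M.zero_closed[of n] by blast
  qed
  have perf: "perfect R P" unfolding perfect_def pP using Pbc N(2) by blast
  define p where "p n x = q n (fst (\<psi> n x)) \<oplus>\<^bsub>part X n\<^esub> l n (snd (\<psi> n x))" for n x
  have p1: "lin R (N n) (part X n) (\<lambda>x. q n (fst (\<psi> n x)))" for n by (rule lin_comp[OF \<psi>1 qF])
  have p2: "lin R (N n) (part X n) (\<lambda>x. l n (snd (\<psi> n x)))" for n by (rule lin_comp[OF \<psi>2 l])
  have pl: "lin R (N n) (part X n) (p n)" for n unfolding p_def by (rule lin_sum[OF Nm bcD(1)[OF X] p1 p2])
  have l0: "l n \<zero>\<^bsub>K (n + 1)\<^esub> = \<zero>\<^bsub>part X n\<^esub>" for n by (rule lin_zero[OF l tl_module[OF tK] bcD(1)[OF X]])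
  have pf: "p n (\<phi> n (f, \<zero>\<^bsub>K (n + 1)\<^esub>)) = q n f" if f: "f \<in> carrier (F n)" for n f
    unfolding p_def \<psi>\<phi>[OF mem[OF f K.M.zero_closed]] fst_conv snd_conv l0
    by (rule X.M.r_zero[OF lin_closed[OF qF f]])
  have pc: "rst P p \<in> chain_maps R P X"
  proof (rule rst_cm[OF Pbc], unfold pP)
    show "lin R (N n) (part X n) (p n)" for n by (rule pl)
    fix n x assume x: "x \<in> carrier (N n)"
    have k: "snd (\<psi> n x) \<in> carrier (K (n + 1))" by (rule lin_closed[OF \<psi>2 x])
    have "q n (fst (\<psi> n x)) \<in> cocycles X n" using lin_closed[OF \<psi>1 x] unfolding cF by blast
    then have z: "diff X n (q n (fst (\<psi> n x))) = \<zero>\<^bsub>part X (n + 1)\<^esub>" by (rule cocyclesD(2))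
    have "p (n + 1) (diff P n x) = q (n + 1) (snd (\<psi> n x))"
      unfolding dP[OF x] D_def by (rule pf[OF lin_closed[OF KF k]])
    also have "\<dots> = diff X n (p n x)"
      unfolding p_def lin_add[OF dX lin_closed[OF p1 x] lin_closed[OF p2 x]] z dl[OF k]
      by (rule X.M.l_zero[OF lin_closed[OF qK k], symmetric])
    finally show "p (n + 1) (diff P n x) = diff X n (p n x)" .
  qed
  have "rst P p \<in> quasi_isomorphisms R P X"
  proof (rule qisI[OF Pbc X pc])
    fix n x assume x: "x \<in> cocycles P n" and c: "rst P p n x \<in> coboundaries X n"
    have xN: "x \<in> carrier (N n)" using cocyclesD(1)[OF x] unfolding pP .
    have "D n x = \<zero>\<^bsub>N (n + 1)\<^esub>" using cocyclesD(2)[OF x] unfolding dP[OF xN] pP .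
    then have "\<psi> (n + 1) (D n x) = (\<zero>\<^bsub>F (n + 1)\<^esub>, \<zero>\<^bsub>K (n + 1 + 1)\<^esub>)"
      using lin_zero[OF \<psi> Nm P0m] by (simp add: zP0)
    then have s0: "snd (\<psi> n x) = \<zero>\<^bsub>K (n + 1)\<^esub>" unfolding \<psi>D[OF xN] zFK by simp
    let ?f = "fst (\<psi> n x)"
    have fF: "?f \<in> carrier (F n)" by (rule lin_closed[OF \<psi>1 xN])
    have x_eq: "x = \<phi> n (?f, \<zero>\<^bsub>K (n + 1)\<^esub>)" using \<phi>\<psi>[OF xN] unfolding s0[symmetric] by simp
    have "rst P p n x = p n x" by (rule rst_apply) (simp add: pP xN)
    also have "\<dots> = q n ?f" by (subst x_eq) (rule pf[OF fF])
    finally have "q n ?f \<in> coboundaries X n" using c by simp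
    then have fK: "?f \<in> carrier (K n)" using fF unfolding cF cK by blast
    \<comment> \<open>A cocycle of \<open>P\<close> has the form (f, 0). If its image q f is a
      coboundary then f lies in \<open>K n\<close>, and (0, f) in degree n - 1 is mapped to (f,
      0).\<close>
    let ?y = "\<phi> (n - 1) (\<zero>\<^bsub>F (n - 1)\<^esub>, ?f)"
    have fK': "?f \<in> carrier (K (n - 1 + 1))" using fK by simp
    have y: "?y \<in> carrier (N (n - 1))" by (rule mem'[OF F.M.zero_closed fK'])
    have "D (n - 1) ?y = x"
      unfolding D_def \<psi>\<phi>[OF mem[OF F.M.zero_closed fK']] snd_conv using x_eq by simp
    then have "x = diff P (n - 1) ?y" unfolding dP[OF y] by (rule sym)
    then show "x \<in> coboundaries P n" unfolding coboundaries_def pP using y by blast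
  next
    fix n y assume y: "y \<in> cocycles X n"
    then have "y \<in> q n ` {v \<in> carrier (free_module R (A n)). q n v \<in> cocycles X n}" unfolding qZ .
    then obtain f where f: "f \<in> carrier (F n)" "y = q n f" unfolding cF by blast
    let ?x = "\<phi> n (f, \<zero>\<^bsub>K (n + 1)\<^esub>)"
    have x: "?x \<in> carrier (N n)" by (rule mem'[OF f(1) K.M.zero_closed])
    have "D n ?x = \<zero>\<^bsub>N (n + 1)\<^esub>"
      unfolding D_def \<psi>\<phi>[OF mem[OF f(1) K.M.zero_closed]] snd_conv by (rule \<phi>0')
    then have "?x \<in> cocycles P n" unfolding cocycles_def pP using x dP[OF x] by simp
    moreover have "rst P p n ?x = y" unfolding f(2) using rst_apply[of ?x P n p] x pf[OF f(1)] by (simp add: pP)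
    moreover have "y \<ominus>\<^bsub>part X n\<^esub> y \<in> coboundaries X n"
      unfolding X.M.minus_self[OF cocyclesD(1)[OF y]] using coboundaries_submod[OF X, of n] by (simp add: submod_def)
    ultimately show "\<exists>x\<in>cocycles P n. y \<ominus>\<^bsub>part X n\<^esub> rst P p n x \<in> coboundaries X n"
      by (intro bexI[of _ ?x]) simp_all
  qed
  with perf show ?thesis by blast
qed

end


subsection \<open>The shift\<close>

text \<open>Multiplication by (-1)^k inside a module. With \<open>eps_eps\<close> and
  \<open>lin_eps\<close>, parity cases reduce to arithmetic on the exponents.\<close>

definition eps :: "int \<Rightarrow> ('a, 'b, 'c) module_scheme \<Rightarrow> 'b \<Rightarrow> 'b" where
  "eps k M x = (if even k then x else \<ominus>\<^bsub>M\<^esub> x)"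

lemma eps_lin: "right_module R M \<Longrightarrow> lin R M M (eps k M)"
  unfolding eps_def by (cases "even k") (simp_all add: lin_id lin_uminus)

lemma lin_eps:
  assumes "lin R M N f" "right_module R M" "right_module R N" "x \<in> carrier M"
  shows "f (eps k M x) = eps k N (f x)"
  using lin_neg[OF assms] by (simp add: eps_def)

lemma eps_eps:
  assumes "right_module R M" "x \<in> carrier M"
  shows "eps j M (eps k M x) = eps (j + k) M x"
proof -
  interpret M: abelian_group M by (rule rm_group[OF assms(1)])
  show ?thesis using assms(2) by (auto simp: eps_def)
qed

lemma eps_even: "even k \<Longrightarrow> eps k M x = x"
  by (simp add: eps_def)

lemma part_shift [simp]: "part (shift k X) n = part X (n + k)"
  by (simp add: shift_def)

lemma diff_shift:
  assumes "X \<in> bounded_complexes R"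
  shows "diff (shift k X) n = restrict (\<lambda>x. eps k (part X (n + 1 + k)) (diff X (n + k) x)) (carrier (part X (n + k)))"
proof -
  have "diff X (n + k) \<in> extensional (carrier (part X (n + k)))"
    using bcD(3)[OF assms] by (simp add: mod_hom_iff)
  moreover have "part X (n + k + 1) = part X (n + 1 + k)" by (simp add: algebra_simps)
  ultimately show ?thesis by (cases "even k") (simp_all add: shift_def eps_def extensional_restrict)
qed

lemma diff_shift_apply:
  "\<lbrakk>X \<in> bounded_complexes R; x \<in> carrier (part X (n + k))\<rbrakk> \<Longrightarrow>
    diff (shift k X) n x = eps k (part X (n + 1 + k)) (diff X (n + k) x)"
  by (simp only: diff_shift restrict_apply if_True)

lemma bcD_shift:
  assumes "X \<in> bounded_complexes R"
  shows "lin R (part X (n + k)) (part X (n + 1 + k)) (diff X (n + k))"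
    "lin R (part X (n - 1 + k)) (part X (n + k)) (diff X (n - 1 + k))"
  using bcD(4)[OF assms, of "n + k"] bcD(4)[OF assms, of "n - 1 + k"] by (simp_all add: algebra_simps)

lemma shift_bc:
  assumes X: "X \<in> bounded_complexes R"
  shows "shift k X \<in> bounded_complexes R"
  unfolding bounded_complexes_def
proof (intro CollectI conjI allI ballI)
  interpret X: right_module R "part X j" for j by (rule bcD(1)[OF X])
  fix n
  show "part (shift k X) n \<in> fg_modules R" using bcD(1,2)[OF X, of "n + k"] by (simp add: fg_modules_def)
  show "diff (shift k X) n \<in> mod_hom R (part (shift k X) n) (part (shift k X) (n + 1))"
    unfolding diff_shift[OF X] part_shift
    by (rule lin_restrict[OF lin_comp[OF bcD_shift(1)[OF X] eps_lin[OF bcD(1)[OF X]]] bcD(1)[OF X]])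
  fix x assume x: "x \<in> carrier (part (shift k X) n)"
  then have x: "x \<in> carrier (part X (n + k))" by simp
  note dx = lin_closed[OF bcD_shift(1)[OF X] x]
  note edx = lin_closed[OF eps_lin[OF bcD(1)[OF X]] dx, of k]
  have "diff (shift k X) (n + 1) (diff (shift k X) n x) =
      eps k (part X (n + 1 + 1 + k)) (diff X (n + 1 + k) (eps k (part X (n + 1 + k)) (diff X (n + k) x)))"
    unfolding diff_shift_apply[OF X x] by (rule diff_shift_apply[OF X edx])
  also have "\<dots> = eps k (part X (n + 1 + 1 + k)) (eps k (part X (n + 1 + 1 + k)) (diff X (n + 1 + k) (diff X (n + k) x)))"
    unfolding lin_eps[OF bcD_shift(1)[OF X] bcD(1)[OF X] bcD(1)[OF X] dx] ..
  also have "diff X (n + 1 + k) (diff X (n + k) x) = \<zero>\<^bsub>part X (n + 1 + 1 + k)\<^esub>"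
    using bcD(6)[OF X x] by (simp add: algebra_simps)
  finally show "diff (shift k X) (n + 1) (diff (shift k X) n x) = \<zero>\<^bsub>part (shift k X) (n + 2)\<^esub>"
    by (simp add: eps_def algebra_simps)
next
  obtain b where b: "\<And>n. \<bar>n\<bar> > b \<Longrightarrow> carrier (part X n) = {\<zero>\<^bsub>part X n\<^esub>}" by (rule bc_bound[OF X], rule that)
  have "\<forall>n. b + \<bar>k\<bar> < \<bar>n\<bar> \<longrightarrow> carrier (part (shift k X) n) = {\<zero>\<^bsub>part (shift k X) n\<^esub>}"
    using b by simp
  then show "\<exists>N. \<forall>n. N < \<bar>n\<bar> \<longrightarrow> carrier (part (shift k X) n) = {\<zero>\<^bsub>part (shift k X) n\<^esub>}" by blast
qed

text \<open>An equality of complexes, not merely an isomorphism: the shift by i of a morphism into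
  \<open>Z[k]\<close> then has target \<open>Z[i + k]\<close> on the nose, as composition in the
  orbit category demands. Differentials are extensional, so they are compared off the carrier as
  well.\<close>

lemma shift_shift:
  fixes X :: "('a, 'u) cpx"
  assumes X: "X \<in> bounded_complexes R"
  shows "shift i (shift j X) = shift (i + j) X"
proof -
  have p: "n + i + j = n + (i + j)" "n + 1 + i + j = n + 1 + (i + j)" "n + i + 1 + j = n + 1 + (i + j)" for n by simp_all
  have "diff (shift i (shift j X)) n x = diff (shift (i + j) X) n x" for n x
  proof (cases "x \<in> carrier (part X (n + (i + j)))")
    case True
    then have x1: "x \<in> carrier (part (shift j X) (n + i))" and x2: "x \<in> carrier (part X (n + i + j))" by (simp_all add: p)
    have dx: "diff X (n + i + j) x \<in> carrier (part X (n + 1 + (i + j)))"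
      using lin_closed[OF bcD_shift(1)[OF X] True] by (simp add: p)
    show ?thesis
      unfolding diff_shift_apply[OF shift_bc[OF X] x1] diff_shift_apply[OF X x2] part_shift p
        diff_shift_apply[OF X True] using eps_eps[OF bcD(1)[OF X] dx, of i j] by (simp only: p)
  next
    case False
    then show ?thesis unfolding diff_shift[OF shift_bc[OF X]] diff_shift[OF X] by (simp add: p)
  qed
  moreover have "part (shift i (shift j X)) = part (shift (i + j) X)" by (rule ext) (simp add: p)
  ultimately show ?thesis by (intro cpx.equality) (auto intro!: ext)
qed

lemma shift_zero:
  assumes X: "X \<in> bounded_complexes R"
  shows "shift 0 X = X"
  by (intro cpx.equality) (simp_all add: shift_def)

lemma shift_inverse:
  assumes "X \<in> bounded_complexes R"
  shows "shift k (shift (- k) X) = X" "shift (- k) (shift k X) = X"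
  using shift_shift[OF assms, of k "- k"] shift_shift[OF assms, of "- k" k] shift_zero[OF assms] by simp_all

lemma shift_map_shift_map [simp]: "shift_map i (shift_map j f) = shift_map (i + j) f" "shift_map 0 f = f"
  by (simp_all add: shift_map_def algebra_simps)

lemma shift_map_rst: "shift_map k (rst X F) = rst (shift k X) (shift_map k F)"
  by (rule ext) (simp add: shift_map_def rst_def restrict_def)

lemma shift_map_cm:
  assumes X: "X \<in> bounded_complexes R" and Y: "Y \<in> bounded_complexes R" and f: "f \<in> chain_maps R X Y"
  shows "shift_map k f \<in> chain_maps R (shift k X) (shift k Y)"
  unfolding chain_maps_def
proof (intro CollectI conjI allI ballI)
  fix n show "shift_map k f n \<in> mod_hom R (part (shift k X) n) (part (shift k Y) n)"
    using cmD(1)[OF f] by (simp add: shift_map_def)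
  fix x assume "x \<in> carrier (part (shift k X) n)"
  then have x: "x \<in> carrier (part X (n + k))" by simp
  note fx = lin_closed[OF cmD(2)[OF f] x]
  have c: "f (n + 1 + k) (diff X (n + k) x) = diff Y (n + k) (f (n + k) x)"
    using cmD(3)[OF f x] by (simp add: algebra_simps)
  show "shift_map k f (n + 1) (diff (shift k X) n x) = diff (shift k Y) n (shift_map k f n x)"
    unfolding shift_map_def diff_shift_apply[OF X x] diff_shift_apply[OF Y fx]
      lin_eps[OF cmD(2)[OF f] bcD(1)[OF X] bcD(1)[OF Y] lin_closed[OF bcD_shift(1)[OF X] x]] c ..
qed

lemma cocycles_shift:
  assumes X: "X \<in> bounded_complexes R"
  shows "cocycles (shift k X) n = cocycles X (n + k)"
proof -
  interpret X: right_module R "part X j" for j by (rule bcD(1)[OF X])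
  have "diff (shift k X) n x = \<zero>\<^bsub>part X (n + 1 + k)\<^esub> \<longleftrightarrow> diff X (n + k) x = \<zero>\<^bsub>part X (n + 1 + k)\<^esub>"
    if x: "x \<in> carrier (part X (n + k))" for x
    unfolding diff_shift_apply[OF X x] using lin_closed[OF bcD_shift(1)[OF X] x] by (simp add: eps_def)
  moreover have i: "n + k + 1 = n + 1 + k" by simp
  ultimately show ?thesis unfolding cocycles_def part_shift i by auto
qed

lemma coboundaries_shift:
  assumes X: "X \<in> bounded_complexes R"
  shows "coboundaries (shift k X) n = coboundaries X (n + k)"
proof -
  interpret X: right_module R "part X j" for j by (rule bcD(1)[OF X])
  have i: "n - 1 + 1 + k = n + k" "n + k - 1 = n - 1 + k" by simp_all
  note d = bcD_shift(2)[OF X, of n k]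
  have 1: "diff (shift k X) (n - 1) x = diff X (n - 1 + k) (eps k (part X (n - 1 + k)) x)"
    if x: "x \<in> carrier (part X (n - 1 + k))" for x
    unfolding diff_shift_apply[OF X x] i by (rule lin_eps[OF d bcD(1)[OF X] bcD(1)[OF X] x, symmetric])
  have 2: "eps k (part X (n - 1 + k)) ` carrier (part X (n - 1 + k)) = carrier (part X (n - 1 + k))"
  proof
    show "eps k (part X (n - 1 + k)) ` carrier (part X (n - 1 + k)) \<subseteq> carrier (part X (n - 1 + k))"
      using lin_closed[OF eps_lin[OF bcD(1)[OF X]]] by blast
    show "carrier (part X (n - 1 + k)) \<subseteq> eps k (part X (n - 1 + k)) ` carrier (part X (n - 1 + k))"
    proof
      fix x assume x: "x \<in> carrier (part X (n - 1 + k))"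
      have "x = eps k (part X (n - 1 + k)) (eps k (part X (n - 1 + k)) x)"
        unfolding eps_eps[OF bcD(1)[OF X] x] by (simp add: eps_even)
      then show "x \<in> eps k (part X (n - 1 + k)) ` carrier (part X (n - 1 + k))"
        using lin_closed[OF eps_lin[OF bcD(1)[OF X]] x] by (rule image_eqI)
    qed
  qed
  have "coboundaries (shift k X) n =
      (\<lambda>x. diff X (n - 1 + k) (eps k (part X (n - 1 + k)) x)) ` carrier (part X (n - 1 + k))"
    unfolding coboundaries_def part_shift by (rule image_cong[OF refl 1])
  also have "\<dots> = diff X (n - 1 + k) ` eps k (part X (n - 1 + k)) ` carrier (part X (n - 1 + k))"
    by (rule image_image[symmetric])
  also have "\<dots> = diff X (n - 1 + k) ` carrier (part X (n - 1 + k))" unfolding 2 ..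
  finally show ?thesis unfolding coboundaries_def i .
qed

lemma shift_map_qis:
  assumes X: "X \<in> bounded_complexes R" and Y: "Y \<in> bounded_complexes R" and f: "f \<in> quasi_isomorphisms R X Y"
  shows "shift_map k f \<in> quasi_isomorphisms R (shift k X) (shift k Y)"
  by (rule qisI[OF shift_bc[OF X] shift_bc[OF Y] shift_map_cm[OF X Y qisD(1)[OF X Y f]]],
      unfold cocycles_shift[OF X] cocycles_shift[OF Y] coboundaries_shift[OF X] coboundaries_shift[OF Y]
        part_shift shift_map_def)
    (rule qisD(2,3)[OF X Y f], assumption+)+

lemma shift_map_null:
  assumes X: "X \<in> bounded_complexes R" and Y: "Y \<in> bounded_complexes R" and f: "f \<in> null_homotopic R X Y"
  shows "shift_map k f \<in> null_homotopic R (shift k X) (shift k Y)"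
proof (rule nullE[OF f])
  fix h assume fc: "f \<in> chain_maps R X Y" and h: "\<And>n. lin R (part X n) (part Y (n - 1)) (h n)"
    "\<And>n. lin R (part X (n + 1)) (part Y n) (h (n + 1))"
    and eq: "\<And>n x. x \<in> carrier (part X n) \<Longrightarrow>
      f n x = diff Y (n - 1) (h n x) \<oplus>\<^bsub>part Y n\<^esub> h (n + 1) (diff X n x)"
  have i: "n + k - 1 = n - 1 + k" "n + k + 1 = n + 1 + k" "n - 1 + 1 + k = n + k" "n + 1 - 1 + k = n + k" for n by simp_all
  have h': "lin R (part X (n + k)) (part Y (n - 1 + k)) (h (n + k))"
    "lin R (part X (n + 1 + k)) (part Y (n + k)) (h (n + 1 + k))" for n
    using h(1)[of "n + k"] h(2)[of "n + k"] unfolding i .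
  \<comment> \<open>The homotopy must carry the sign (-1)^k too, so that it cancels the sign of the
    shifted differential in both terms.\<close>
  let ?h = "\<lambda>n x. eps k (part Y (n - 1 + k)) (h (n + k) x)"
  show ?thesis
  proof (rule nullI[OF shift_bc[OF X] shift_map_cm[OF X Y fc], where h = ?h], unfold part_shift)
    show "lin R (part X (n + k)) (part Y (n - 1 + k)) (?h n)" for n
      by (rule lin_comp[OF h'(1) eps_lin[OF bcD(1)[OF Y]]])
    fix n x assume x: "x \<in> carrier (part X (n + k))"
    note hx = lin_closed[OF h'(1) x] and dx = lin_closed[OF bcD_shift(1)[OF X] x]
    have hdx: "h (n + 1 + k) (diff X (n + k) x) \<in> carrier (part Y (n + k))" by (rule lin_closed[OF h'(2) dx])
    have dhx: "diff Y (n - 1 + k) (h (n + k) x) \<in> carrier (part Y (n + k))"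
      by (rule lin_closed[OF bcD_shift(2)[OF Y] hx])
    have 1: "diff (shift k Y) (n - 1) (?h n x) = diff Y (n - 1 + k) (h (n + k) x)"
    proof -
      have "diff (shift k Y) (n - 1) (?h n x) =
          eps k (part Y (n - 1 + 1 + k)) (diff Y (n - 1 + k) (eps k (part Y (n - 1 + k)) (h (n + k) x)))"
        by (rule diff_shift_apply[OF Y lin_closed[OF eps_lin[OF bcD(1)[OF Y]] hx]])
      also have "\<dots> = eps k (part Y (n + k)) (eps k (part Y (n + k)) (diff Y (n - 1 + k) (h (n + k) x)))"
        unfolding lin_eps[OF bcD_shift(2)[OF Y] bcD(1)[OF Y] bcD(1)[OF Y] hx] i ..
      also have "\<dots> = diff Y (n - 1 + k) (h (n + k) x)"
        unfolding eps_eps[OF bcD(1)[OF Y] dhx] by (simp add: eps_even)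
      finally show ?thesis .
    qed
    have 2: "?h (n + 1) (diff (shift k X) n x) = h (n + 1 + k) (diff X (n + k) x)"
    proof -
      have "?h (n + 1) (diff (shift k X) n x) =
          eps k (part Y (n + k)) (h (n + 1 + k) (eps k (part X (n + 1 + k)) (diff X (n + k) x)))"
        unfolding diff_shift_apply[OF X x] i ..
      also have "\<dots> = eps k (part Y (n + k)) (eps k (part Y (n + k)) (h (n + 1 + k) (diff X (n + k) x)))"
        unfolding lin_eps[OF h'(2) bcD(1)[OF X] bcD(1)[OF Y] dx] ..
      also have "\<dots> = h (n + 1 + k) (diff X (n + k) x)"
        unfolding eps_eps[OF bcD(1)[OF Y] hdx] by (simp add: eps_even)
      finally show ?thesis .
    qed
    show "shift_map k f n x = diff (shift k Y) (n - 1) (?h n x) \<oplus>\<^bsub>part Y (n + k)\<^esub> ?h (n + 1) (diff (shift k X) n x)"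
      unfolding 1 2 shift_map_def using eq[OF x] by (simp only: i)
  qed
qed

lemma shift_map_hdiff: "shift_map k (hdiff X Y f g) = hdiff (shift k X) (shift k Y) (shift_map k f) (shift_map k g)"
  by (simp add: hdiff_def shift_map_rst) (simp add: shift_map_def)

lemma mem_hcls:
  assumes X: "X \<in> bounded_complexes R" and Y: "Y \<in> bounded_complexes R" and f: "f \<in> chain_maps R X Y"
  shows "g \<in> hcls R X Y f \<longleftrightarrow> g \<in> chain_maps R X Y \<and> hdiff X Y f g \<in> null_homotopic R X Y"
proof
  note cls = hom_ideal.mem_cls[OF null_ideal, of X R Y f g, unfolded complex_cat_simps]
  assume g: "g \<in> hcls R X Y f"
  note gc = cls(1)[OF X Y f g]
  have "hdiff X Y f g \<in> null_homotopic R X Y"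
    using cls(2)[OF X Y f g, symmetric] unfolding hcls_eq_iff[OF X Y f gc] .
  with gc show "g \<in> chain_maps R X Y \<and> hdiff X Y f g \<in> null_homotopic R X Y" ..
next
  assume g: "g \<in> chain_maps R X Y \<and> hdiff X Y f g \<in> null_homotopic R X Y"
  then have "hcls R X Y f = hcls R X Y g" using hcls_eq_iff[OF X Y f, of g] by simp
  moreover have "g \<in> hcls R X Y g"
    by (rule hom_ideal.mem_cls_self[OF null_ideal, of X R Y g, unfolded complex_cat_simps, OF X Y])
      (rule conjunct1[OF g])
  ultimately show "g \<in> hcls R X Y f" by simp
qed

lemma shift_hcls:
  assumes X: "X \<in> bounded_complexes R" and Y: "Y \<in> bounded_complexes R" and f: "f \<in> chain_maps R X Y"
  shows "shift_map k ` hcls R X Y f = hcls R (shift k X) (shift k Y) (shift_map k f)"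
proof
  note SX = shift_bc[OF X] and SY = shift_bc[OF Y] and Sf = shift_map_cm[OF X Y f]
  show "shift_map k ` hcls R X Y f \<subseteq> hcls R (shift k X) (shift k Y) (shift_map k f)"
  proof
    fix g' assume "g' \<in> shift_map k ` hcls R X Y f"
    then obtain g where g: "g' = shift_map k g" "g \<in> chain_maps R X Y" "hdiff X Y f g \<in> null_homotopic R X Y"
      using mem_hcls[OF X Y f] by blast
    show "g' \<in> hcls R (shift k X) (shift k Y) (shift_map k f)"
      unfolding mem_hcls[OF SX SY Sf] g(1)
      using shift_map_cm[OF X Y g(2)] shift_map_null[OF X Y g(3), of k] by (simp add: shift_map_hdiff)
  qed
  show "hcls R (shift k X) (shift k Y) (shift_map k f) \<subseteq> shift_map k ` hcls R X Y f"
  proof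
    fix g' assume "g' \<in> hcls R (shift k X) (shift k Y) (shift_map k f)"
    then have g': "g' \<in> chain_maps R (shift k X) (shift k Y)"
      "hdiff (shift k X) (shift k Y) (shift_map k f) g' \<in> null_homotopic R (shift k X) (shift k Y)"
      unfolding mem_hcls[OF SX SY Sf] by blast+
    have "shift_map (- k) g' \<in> hcls R X Y f"
      unfolding mem_hcls[OF X Y f]
      using shift_map_cm[OF SX SY g'(1), of "- k"] shift_map_null[OF SX SY g'(2), of "- k"]
      by (simp add: shift_map_hdiff shift_inverse[OF X] shift_inverse[OF Y])
    then have "shift_map k (shift_map (- k) g') \<in> shift_map k ` hcls R X Y f" by (rule imageI)
    then show "g' \<in> shift_map k ` hcls R X Y f" by simp
  qed
qed

lemma shift_perfect: "perfect R P \<Longrightarrow> perfect R (shift k P)"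
  by (simp add: perfect_def shift_bc)

section \<open>Modules over the dual numbers\<close>

text \<open>What the proof uses of the dual numbers: a copy of \<open>R\<close>, an element
  \<open>e\<close> of square zero commuting with that copy, and unique coordinates
  \<open>p0\<close>, \<open>p1\<close> with respect to 1 and \<open>e\<close>. Since
  \<open>R\<close> may be noncommutative, \<open>e_comm\<close> is a genuine condition.\<close>

locale dual_structure =
  fixes R :: "('a, 'r) ring_scheme" and D :: "('d, 's) ring_scheme"
    and \<iota> :: "'a \<Rightarrow> 'd" and e :: 'd and p0 p1 :: "'d \<Rightarrow> 'a"
  assumes ringR: "ring R" and ringD: "ring D"
    and i_closed: "a \<in> carrier R \<Longrightarrow> \<iota> a \<in> carrier D"
    and i_add: "\<lbrakk>a \<in> carrier R; b \<in> carrier R\<rbrakk> \<Longrightarrow> \<iota> (a \<oplus>\<^bsub>R\<^esub> b) = \<iota> a \<oplus>\<^bsub>D\<^esub> \<iota> b"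
    and i_mult: "\<lbrakk>a \<in> carrier R; b \<in> carrier R\<rbrakk> \<Longrightarrow> \<iota> (a \<otimes>\<^bsub>R\<^esub> b) = \<iota> a \<otimes>\<^bsub>D\<^esub> \<iota> b"
    and i_one: "\<iota> \<one>\<^bsub>R\<^esub> = \<one>\<^bsub>D\<^esub>"
    and e_closed: "e \<in> carrier D" and e_e: "e \<otimes>\<^bsub>D\<^esub> e = \<zero>\<^bsub>D\<^esub>"
    and e_comm: "a \<in> carrier R \<Longrightarrow> e \<otimes>\<^bsub>D\<^esub> \<iota> a = \<iota> a \<otimes>\<^bsub>D\<^esub> e"
    and p_closed: "d \<in> carrier D \<Longrightarrow> p0 d \<in> carrier R" "d \<in> carrier D \<Longrightarrow> p1 d \<in> carrier R"
    and decomp: "d \<in> carrier D \<Longrightarrow> \<iota> (p0 d) \<oplus>\<^bsub>D\<^esub> \<iota> (p1 d) \<otimes>\<^bsub>D\<^esub> e = d"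
    and p_eq: "\<lbrakk>a \<in> carrier R; b \<in> carrier R\<rbrakk> \<Longrightarrow> p0 (\<iota> a \<oplus>\<^bsub>D\<^esub> \<iota> b \<otimes>\<^bsub>D\<^esub> e) = a"
      "\<lbrakk>a \<in> carrier R; b \<in> carrier R\<rbrakk> \<Longrightarrow> p1 (\<iota> a \<oplus>\<^bsub>D\<^esub> \<iota> b \<otimes>\<^bsub>D\<^esub> e) = b"

text \<open>The class of T plays the role of \<open>e\<close>, and the coordinates of a class are
  the coefficients of degree 0 and 1 of a representative.\<close>

lemma dual_numbers_structure:
  fixes R :: "('a, 'r) ring_scheme"
  assumes "ring R"
  shows "\<exists>\<iota> e p0 p1. dual_structure R (dual_numbers R) \<iota> e p0 p1"
proof -
  interpret R: ring R by fact
  interpret U: UP_ring R "UP R" by unfold_locales simp_all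
  let ?P = "UP R"
  let ?x2 = "monom ?P \<one>\<^bsub>R\<^esub> 2"
  define I where "I = Idl\<^bsub>?P\<^esub> {?x2}"
  have x2: "?x2 \<in> carrier ?P" by simp
  have "ideal I ?P" unfolding I_def by (rule U.P.genideal_ideal) (simp add: x2)
  then interpret I: ideal I ?P .
  have x2I: "?x2 \<in> I" unfolding I_def by (rule U.P.genideal_self') (rule x2)
  have D: "dual_numbers R = ?P Quot I" unfolding dual_numbers_def I_def ..
  let ?D = "?P Quot I"
  define \<pi> where "\<pi> p = I +>\<^bsub>?P\<^esub> p" for p
  have hom: "\<pi> \<in> ring_hom ?P ?D" unfolding \<pi>_def[abs_def] by (rule I.rcos_ring_hom)
  have ringD: "ring ?D" by (rule I.quotient_is_ring)
  have zD: "\<zero>\<^bsub>?D\<^esub> = I" by (simp add: FactRing_def)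
  have \<pi>I: "\<pi> p = \<zero>\<^bsub>?D\<^esub>" if "p \<in> I" for p unfolding \<pi>_def zD by (rule I.a_rcos_const[OF that])
  have surj: "\<exists>p\<in>carrier ?P. d = \<pi> p" if "d \<in> carrier ?D" for d
    using that unfolding \<pi>_def by (auto simp: FactRing_def A_RCOSETS_def')
  have c0: "coeff ?P (p \<otimes>\<^bsub>?P\<^esub> q) 0 = coeff ?P p 0 \<otimes>\<^bsub>R\<^esub> coeff ?P q 0"
    if "p \<in> carrier ?P" "q \<in> carrier ?P" for p q
    using that by simp
  have c1: "coeff ?P (p \<otimes>\<^bsub>?P\<^esub> q) 1 = coeff ?P p 1 \<otimes>\<^bsub>R\<^esub> coeff ?P q 0 \<oplus>\<^bsub>R\<^esub> coeff ?P p 0 \<otimes>\<^bsub>R\<^esub> coeff ?P q 1"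
    if "p \<in> carrier ?P" "q \<in> carrier ?P" for p q
    using that by simp
  \<comment> \<open>The polynomials without terms of degree 0 and 1 form a two-sided ideal
    containing the square of T. It contains \<open>I\<close>, which makes those two coefficients
    well defined modulo \<open>I\<close>.\<close>
  let ?J = "{p \<in> carrier ?P. coeff ?P p 0 = \<zero>\<^bsub>R\<^esub> \<and> coeff ?P p 1 = \<zero>\<^bsub>R\<^esub>}"
  have "ideal ?J ?P"
  proof (rule idealI[OF U.UP_ring])
    show "subgroup ?J (add_monoid ?P)"
      by (rule U.P.add.subgroupI) (auto simp: a_inv_def[symmetric] intro!: exI[of _ "\<zero>\<^bsub>?P\<^esub>"])
    show "\<And>a x. \<lbrakk>a \<in> ?J; x \<in> carrier ?P\<rbrakk> \<Longrightarrow> x \<otimes>\<^bsub>?P\<^esub> a \<in> ?J"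
      using c0 c1 by (simp del: U.coeff_mult One_nat_def)
    show "\<And>a x. \<lbrakk>a \<in> ?J; x \<in> carrier ?P\<rbrakk> \<Longrightarrow> a \<otimes>\<^bsub>?P\<^esub> x \<in> ?J"
      using c0 c1 by (simp del: U.coeff_mult One_nat_def)
  qed
  then have "I \<subseteq> ?J" unfolding I_def by (rule U.P.genideal_minimal) simp
  then have IJ: "coeff ?P j 0 = \<zero>\<^bsub>R\<^esub>" "coeff ?P j 1 = \<zero>\<^bsub>R\<^esub>" "j \<in> carrier ?P" if "j \<in> I" for j
    using that by blast+
  \<comment> \<open>\<open>p0\<close> and \<open>p1\<close> are defined through an arbitrarily
    chosen element of the coset; any two elements differ by one of \<open>I\<close>, whose
    coefficients of degree 0 and 1 vanish.\<close>
  have rep: "coeff ?P (SOME q. q \<in> \<pi> p) n = coeff ?P p n" if p: "p \<in> carrier ?P" and n: "n = 0 \<or> n = 1" for p n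
  proof -
    have "p \<in> \<pi> p" unfolding \<pi>_def by (rule I.a_rcos_self[OF p])
    then have "(SOME q. q \<in> \<pi> p) \<in> \<pi> p" by (rule someI[of "\<lambda>q. q \<in> \<pi> p"])
    then obtain j where j: "j \<in> I" "(SOME q. q \<in> \<pi> p) = j \<oplus>\<^bsub>?P\<^esub> p"
      unfolding \<pi>_def mem_coset by blast
    show ?thesis unfolding j(2) using IJ[OF j(1)] p n by auto
  qed
  define \<iota> where "\<iota> a = \<pi> (monom ?P a 0)" for a
  define e where "e = \<pi> (monom ?P \<one>\<^bsub>R\<^esub> 1)"
  define p0 where "p0 d = coeff ?P (SOME q. q \<in> d) 0" for d
  define p1 where "p1 d = coeff ?P (SOME q. q \<in> d) 1" for d
  have p0: "p0 (\<pi> p) = coeff ?P p 0" and p1: "p1 (\<pi> p) = coeff ?P p 1" if "p \<in> carrier ?P" for p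
    unfolding p0_def p1_def using rep[OF that] by blast+
  have lin_form: "\<iota> a \<oplus>\<^bsub>?D\<^esub> \<iota> b \<otimes>\<^bsub>?D\<^esub> e = \<pi> (monom ?P a 0 \<oplus>\<^bsub>?P\<^esub> monom ?P b 1)"
    if a: "a \<in> carrier R" and b: "b \<in> carrier R" for a b
  proof -
    have "monom ?P b 1 = monom ?P b 0 \<otimes>\<^bsub>?P\<^esub> monom ?P \<one>\<^bsub>R\<^esub> 1"
      using U.monom_mult[of b "\<one>\<^bsub>R\<^esub>" 0 1] b by simp
    then show ?thesis
      unfolding \<iota>_def e_def using a b by (simp add: ring_hom_add[OF hom] ring_hom_mult[OF hom])
  qed
  \<comment> \<open>Modulo \<open>I\<close> a polynomial equals its truncation after degree 1. The
    property is additive and holds for monomials, those of degree at least 2 being multiples of the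
    square of T; every polynomial is a finite sum of monomials.\<close>
  have dec: "\<pi> p = \<pi> (monom ?P (coeff ?P p 0) 0 \<oplus>\<^bsub>?P\<^esub> monom ?P (coeff ?P p 1) 1)" (is "?Q p")
    if p: "p \<in> carrier ?P" for p
  proof -
    have add: "?Q (p \<oplus>\<^bsub>?P\<^esub> q)" if "?Q p" "?Q q" "p \<in> carrier ?P" "q \<in> carrier ?P" for p q
    proof -
      interpret D: ring ?D by (rule ringD)
      let ?t = "\<lambda>p. monom ?P (coeff ?P p 0) 0 \<oplus>\<^bsub>?P\<^esub> monom ?P (coeff ?P p 1) 1"
      have t: "?t r \<in> carrier ?P" if "r \<in> carrier ?P" for r using that by simp
      have "?t (p \<oplus>\<^bsub>?P\<^esub> q) = ?t p \<oplus>\<^bsub>?P\<^esub> ?t q"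
        using that(3,4) by (simp add: U.P.a_ac)
      then have "\<pi> (?t (p \<oplus>\<^bsub>?P\<^esub> q)) = \<pi> (?t p) \<oplus>\<^bsub>?D\<^esub> \<pi> (?t q)"
        using ring_hom_add[OF hom t[OF that(3)] t[OF that(4)]] by simp
      also have "\<dots> = \<pi> p \<oplus>\<^bsub>?D\<^esub> \<pi> q" using that(1,2) by simp
      also have "\<dots> = \<pi> (p \<oplus>\<^bsub>?P\<^esub> q)" by (rule ring_hom_add[OF hom that(3,4), symmetric])
      finally show ?thesis by (rule sym)
    qed
    have mon: "?Q (monom ?P c i)" if c: "c \<in> carrier R" for c i
    proof -
      consider "i = 0" | "i = 1" | k where "i = k + 2" by (metis add.commute add_2_eq_Suc' not0_implies_Suc One_nat_def)
      then show ?thesis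
      proof cases
        case 3
        have "monom ?P c i = monom ?P c k \<otimes>\<^bsub>?P\<^esub> ?x2"
          using U.monom_mult[of c "\<one>\<^bsub>R\<^esub>" k 2] c 3 by simp
        then have "monom ?P c i \<in> I" using I.I_l_closed[OF x2I, of "monom ?P c k"] c by simp
        then have "\<pi> (monom ?P c i) = \<zero>\<^bsub>?D\<^esub>" by (rule \<pi>I)
        moreover have "\<pi> \<zero>\<^bsub>?P\<^esub> = \<zero>\<^bsub>?D\<^esub>" by (rule \<pi>I) simp
        ultimately show ?thesis using 3 c by simp
      qed (use c in simp_all)
    qed
    have fin: "?Q (\<Oplus>\<^bsub>?P\<^esub>i\<in>{..n}. monom ?P (coeff ?P p i) i)" for n
    proof (induction n)
      case 0
      show ?case using mon[of "coeff ?P p 0" 0] p by simp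
    next
      case (Suc n)
      have "(\<Oplus>\<^bsub>?P\<^esub>i\<in>{..Suc n}. monom ?P (coeff ?P p i) i) =
          monom ?P (coeff ?P p (Suc n)) (Suc n) \<oplus>\<^bsub>?P\<^esub> (\<Oplus>\<^bsub>?P\<^esub>i\<in>{..n}. monom ?P (coeff ?P p i) i)"
        by (rule U.P.finsum_Suc) (use p in simp)
      moreover have "(\<Oplus>\<^bsub>?P\<^esub>i\<in>{..n}. monom ?P (coeff ?P p i) i) \<in> carrier ?P"
        by (rule U.P.finsum_closed) (use p in simp)
      ultimately show ?case using add[OF mon Suc.IH] p by simp
    qed
    show ?thesis using fin[of "deg R p"] unfolding U.up_repr[OF p] .
  qed
  have "dual_structure R ?D \<iota> e p0 p1"
  proof (rule dual_structure.intro[OF assms ringD])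
    fix a b assume a: "a \<in> carrier R" and b: "b \<in> carrier R"
    show "\<iota> (a \<oplus>\<^bsub>R\<^esub> b) = \<iota> a \<oplus>\<^bsub>?D\<^esub> \<iota> b"
      unfolding \<iota>_def U.monom_add[OF a b] using a b by (simp add: ring_hom_add[OF hom])
    have "monom ?P (a \<otimes>\<^bsub>R\<^esub> b) 0 = monom ?P a 0 \<otimes>\<^bsub>?P\<^esub> monom ?P b 0"
      using U.monom_mult[OF a b, of 0 0] by simp
    then show "\<iota> (a \<otimes>\<^bsub>R\<^esub> b) = \<iota> a \<otimes>\<^bsub>?D\<^esub> \<iota> b"
      unfolding \<iota>_def using a b by (simp add: ring_hom_mult[OF hom])
    show "p0 (\<iota> a \<oplus>\<^bsub>?D\<^esub> \<iota> b \<otimes>\<^bsub>?D\<^esub> e) = a" "p1 (\<iota> a \<oplus>\<^bsub>?D\<^esub> \<iota> b \<otimes>\<^bsub>?D\<^esub> e) = b"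
      unfolding lin_form[OF a b] using a b by (simp_all add: p0 p1)
  next
    fix a assume a: "a \<in> carrier R"
    show "\<iota> a \<in> carrier ?D" unfolding \<iota>_def using a by (simp add: ring_hom_closed[OF hom])
    have "monom ?P \<one>\<^bsub>R\<^esub> 1 \<otimes>\<^bsub>?P\<^esub> monom ?P a 0 = monom ?P a 0 \<otimes>\<^bsub>?P\<^esub> monom ?P \<one>\<^bsub>R\<^esub> 1"
      using U.monom_mult[of "\<one>\<^bsub>R\<^esub>" a 1 0] U.monom_mult[of a "\<one>\<^bsub>R\<^esub>" 0 1] a by simp
    then show "e \<otimes>\<^bsub>?D\<^esub> \<iota> a = \<iota> a \<otimes>\<^bsub>?D\<^esub> e"
      unfolding \<iota>_def e_def using a ring_hom_mult[OF hom, of "monom ?P \<one>\<^bsub>R\<^esub> 1" "monom ?P a 0"]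
        ring_hom_mult[OF hom, of "monom ?P a 0" "monom ?P \<one>\<^bsub>R\<^esub> 1"] by simp
  next
    show "\<iota> \<one>\<^bsub>R\<^esub> = \<one>\<^bsub>?D\<^esub>" unfolding \<iota>_def using ring_hom_one[OF hom] by simp
    show "e \<in> carrier ?D" unfolding e_def by (simp add: ring_hom_closed[OF hom])
    have "monom ?P \<one>\<^bsub>R\<^esub> 1 \<otimes>\<^bsub>?P\<^esub> monom ?P \<one>\<^bsub>R\<^esub> 1 = ?x2"
      using U.monom_mult[of "\<one>\<^bsub>R\<^esub>" "\<one>\<^bsub>R\<^esub>" 1 1] by (simp add: numeral_2_eq_2)
    then show "e \<otimes>\<^bsub>?D\<^esub> e = \<zero>\<^bsub>?D\<^esub>"
      unfolding e_def using ring_hom_mult[OF hom, of "monom ?P \<one>\<^bsub>R\<^esub> 1" "monom ?P \<one>\<^bsub>R\<^esub> 1"] \<pi>I[OF x2I] by simp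
  next
    fix d assume "d \<in> carrier ?D"
    then obtain p where p: "p \<in> carrier ?P" "d = \<pi> p" using surj by blast
    show "p0 d \<in> carrier R" "p1 d \<in> carrier R" unfolding p(2) p0[OF p(1)] p1[OF p(1)] using p(1) by simp_all
    show "\<iota> (p0 d) \<oplus>\<^bsub>?D\<^esub> \<iota> (p1 d) \<otimes>\<^bsub>?D\<^esub> e = d"
      unfolding p(2) p0[OF p(1)] p1[OF p(1)] using p(1) by (subst lin_form) (simp_all add: dec[symmetric] del: One_nat_def)
  qed
  then show ?thesis unfolding D by blast
qed

section \<open>Restriction of scalars and modules with a square-zero endomorphism\<close>

definition resm :: "('a \<Rightarrow> 'd) \<Rightarrow> ('d, 'v, 'c) module_scheme \<Rightarrow> ('a, 'v) module" where
  "resm \<iota> M = \<lparr>carrier = carrier M, mult = undefined, one = undefined, zero = \<zero>\<^bsub>M\<^esub>,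
     add = add M, smult = (\<lambda>a x. \<iota> a \<odot>\<^bsub>M\<^esub> x)\<rparr>"

lemma resm_simps [simp]:
  "carrier (resm \<iota> M) = carrier M" "\<zero>\<^bsub>resm \<iota> M\<^esub> = \<zero>\<^bsub>M\<^esub>" "x \<oplus>\<^bsub>resm \<iota> M\<^esub> y = x \<oplus>\<^bsub>M\<^esub> y"
  "a \<odot>\<^bsub>resm \<iota> M\<^esub> x = \<iota> a \<odot>\<^bsub>M\<^esub> x"
  by (simp_all add: resm_def)

lemma resm_neg [simp]: "\<ominus>\<^bsub>resm \<iota> M\<^esub> x = \<ominus>\<^bsub>M\<^esub> x"
  by (simp add: a_inv_def m_inv_def resm_def)

context dual_structure
begin

abbreviation base :: "('d, 'v, 'c) module_scheme \<Rightarrow> ('a, 'v) module" where "base \<equiv> resm \<iota>"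

interpretation R: ring R by (rule ringR)
interpretation D: ring D by (rule ringD)

lemma i_zero: "\<iota> \<zero>\<^bsub>R\<^esub> = \<zero>\<^bsub>D\<^esub>"
  using i_add[of "\<zero>\<^bsub>R\<^esub>" "\<zero>\<^bsub>R\<^esub>"] D.add_eq_self_zero[of "\<iota> \<zero>\<^bsub>R\<^esub>" "\<iota> \<zero>\<^bsub>R\<^esub>"] i_closed by (metis R.l_zero R.zero_closed)

lemma p_eqI:
  assumes "d = \<iota> a \<oplus>\<^bsub>D\<^esub> \<iota> b \<otimes>\<^bsub>D\<^esub> e" "a \<in> carrier R" "b \<in> carrier R"
  shows "p0 d = a" "p1 d = b"
  using assms p_eq by simp_all

lemma p_i: "a \<in> carrier R \<Longrightarrow> p0 (\<iota> a) = a" "a \<in> carrier R \<Longrightarrow> p1 (\<iota> a) = \<zero>\<^bsub>R\<^esub>"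
  using p_eqI[of "\<iota> a" a "\<zero>\<^bsub>R\<^esub>"] by (simp_all add: i_zero i_closed e_closed)

lemma p_one: "p0 \<one>\<^bsub>D\<^esub> = \<one>\<^bsub>R\<^esub>" "p1 \<one>\<^bsub>D\<^esub> = \<zero>\<^bsub>R\<^esub>"
  using p_i[of "\<one>\<^bsub>R\<^esub>"] by (simp_all add: i_one)

lemma p_e: "p0 e = \<zero>\<^bsub>R\<^esub>" "p1 e = \<one>\<^bsub>R\<^esub>"
  using p_eqI[of e "\<zero>\<^bsub>R\<^esub>" "\<one>\<^bsub>R\<^esub>"] by (simp_all add: i_zero i_one e_closed)

lemma p_add:
  assumes "d \<in> carrier D" "d' \<in> carrier D"
  shows "p0 (d \<oplus>\<^bsub>D\<^esub> d') = p0 d \<oplus>\<^bsub>R\<^esub> p0 d'" "p1 (d \<oplus>\<^bsub>D\<^esub> d') = p1 d \<oplus>\<^bsub>R\<^esub> p1 d'"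
proof -
  note c = p_closed[OF assms(1)] p_closed[OF assms(2)]
  note ic = i_closed[OF c(1)] i_closed[OF c(2)] i_closed[OF c(3)] i_closed[OF c(4)]
  have "d \<oplus>\<^bsub>D\<^esub> d' = (\<iota> (p0 d) \<oplus>\<^bsub>D\<^esub> \<iota> (p1 d) \<otimes>\<^bsub>D\<^esub> e) \<oplus>\<^bsub>D\<^esub> (\<iota> (p0 d') \<oplus>\<^bsub>D\<^esub> \<iota> (p1 d') \<otimes>\<^bsub>D\<^esub> e)"
    using decomp assms by simp
  also have "\<dots> = \<iota> (p0 d \<oplus>\<^bsub>R\<^esub> p0 d') \<oplus>\<^bsub>D\<^esub> \<iota> (p1 d \<oplus>\<^bsub>R\<^esub> p1 d') \<otimes>\<^bsub>D\<^esub> e"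
    using c ic e_closed by (simp add: i_add D.l_distr D.a_ac)
  finally show "p0 (d \<oplus>\<^bsub>D\<^esub> d') = p0 d \<oplus>\<^bsub>R\<^esub> p0 d'" "p1 (d \<oplus>\<^bsub>D\<^esub> d') = p1 d \<oplus>\<^bsub>R\<^esub> p1 d'"
    using p_eqI c by (meson R.a_closed)+
qed

text \<open>Expanding (a + b e)(a' + b' e), the term b e b' e vanishes because \<open>e\<close>
  commutes with the image of \<open>R\<close> and squares to zero.\<close>

lemma p_mult:
  assumes "d \<in> carrier D" "d' \<in> carrier D"
  shows "p0 (d \<otimes>\<^bsub>D\<^esub> d') = p0 d \<otimes>\<^bsub>R\<^esub> p0 d'"
    "p1 (d \<otimes>\<^bsub>D\<^esub> d') = p0 d \<otimes>\<^bsub>R\<^esub> p1 d' \<oplus>\<^bsub>R\<^esub> p1 d \<otimes>\<^bsub>R\<^esub> p0 d'"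
proof -
  note c = p_closed[OF assms(1)] p_closed[OF assms(2)]
  note ic = i_closed[OF c(1)] i_closed[OF c(2)] i_closed[OF c(3)] i_closed[OF c(4)]
  have e1: "e \<otimes>\<^bsub>D\<^esub> (\<iota> (p1 d') \<otimes>\<^bsub>D\<^esub> e) = \<zero>\<^bsub>D\<^esub>"
  proof -
    have "e \<otimes>\<^bsub>D\<^esub> (\<iota> (p1 d') \<otimes>\<^bsub>D\<^esub> e) = \<iota> (p1 d') \<otimes>\<^bsub>D\<^esub> (e \<otimes>\<^bsub>D\<^esub> e)"
      using ic e_closed e_comm[OF c(4)] by (simp add: D.m_assoc[symmetric])
    then show ?thesis using ic by (simp add: e_e)
  qed
  have "d \<otimes>\<^bsub>D\<^esub> d' = (\<iota> (p0 d) \<oplus>\<^bsub>D\<^esub> \<iota> (p1 d) \<otimes>\<^bsub>D\<^esub> e) \<otimes>\<^bsub>D\<^esub> (\<iota> (p0 d') \<oplus>\<^bsub>D\<^esub> \<iota> (p1 d') \<otimes>\<^bsub>D\<^esub> e)"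
    using decomp assms by simp
  also have "\<dots> = \<iota> (p0 d) \<otimes>\<^bsub>D\<^esub> \<iota> (p0 d') \<oplus>\<^bsub>D\<^esub> (\<iota> (p0 d) \<otimes>\<^bsub>D\<^esub> \<iota> (p1 d') \<oplus>\<^bsub>D\<^esub> \<iota> (p1 d) \<otimes>\<^bsub>D\<^esub> \<iota> (p0 d')) \<otimes>\<^bsub>D\<^esub> e"
    using ic e_closed e1 e_comm[OF c(3)] by (simp add: D.l_distr D.r_distr D.m_assoc D.a_ac)
  also have "\<dots> = \<iota> (p0 d \<otimes>\<^bsub>R\<^esub> p0 d') \<oplus>\<^bsub>D\<^esub> \<iota> (p0 d \<otimes>\<^bsub>R\<^esub> p1 d' \<oplus>\<^bsub>R\<^esub> p1 d \<otimes>\<^bsub>R\<^esub> p0 d') \<otimes>\<^bsub>D\<^esub> e"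
    using c by (simp add: i_add i_mult)
  finally show "p0 (d \<otimes>\<^bsub>D\<^esub> d') = p0 d \<otimes>\<^bsub>R\<^esub> p0 d'"
    "p1 (d \<otimes>\<^bsub>D\<^esub> d') = p0 d \<otimes>\<^bsub>R\<^esub> p1 d' \<oplus>\<^bsub>R\<^esub> p1 d \<otimes>\<^bsub>R\<^esub> p0 d'"
    using p_eqI c by (meson R.a_closed R.m_closed)+
qed

lemma resm_module:
  assumes "right_module D M"
  shows "right_module R (base M)"
proof -
  interpret M: right_module D M by fact
  have "abelian_group (base M)"
  proof (rule abelian_groupI)
    fix x assume "x \<in> carrier (base M)"
    then show "\<exists>y\<in>carrier (base M). y \<oplus>\<^bsub>base M\<^esub> x = \<zero>\<^bsub>base M\<^esub>"
      by (intro bexI[of _ "\<ominus>\<^bsub>M\<^esub> x"]) (simp_all add: M.M.l_neg)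
  qed (simp_all add: M.M.a_ac)
  then show ?thesis
    by (intro right_module.intro right_module_axioms.intro ringR)
      (simp_all add: i_closed i_add i_mult i_one M.smult_closed M.smult_scalar_distr M.smult_vector_distr
        M.smult_assoc M.smult_one)
qed

abbreviation em :: "('d, 'v, 'c) module_scheme \<Rightarrow> 'v \<Rightarrow> 'v" where "em M x \<equiv> e \<odot>\<^bsub>M\<^esub> x"

lemma em_lin:
  assumes "right_module D M"
  shows "lin R (base M) (base M) (em M)"
proof -
  interpret M: right_module D M by fact
  show ?thesis
    by (rule linI)
      (simp_all add: e_closed i_closed M.smult_closed M.smult_vector_distr M.smult_assoc[symmetric] e_comm)
qed

lemma em_em:
  assumes "right_module D M" "x \<in> carrier M"
  shows "em M (em M x) = \<zero>\<^bsub>M\<^esub>"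
proof -
  interpret M: right_module D M by fact
  show ?thesis using assms(2) by (simp add: e_closed M.smult_assoc[symmetric] e_e M.smult_l_null)
qed

lemma smult_D:
  assumes "right_module D M" "d \<in> carrier D" "x \<in> carrier M"
  shows "d \<odot>\<^bsub>M\<^esub> x = \<iota> (p0 d) \<odot>\<^bsub>M\<^esub> x \<oplus>\<^bsub>M\<^esub> em M (\<iota> (p1 d) \<odot>\<^bsub>M\<^esub> x)"
proof -
  interpret M: right_module D M by fact
  have "d \<odot>\<^bsub>M\<^esub> x = (\<iota> (p0 d) \<oplus>\<^bsub>D\<^esub> \<iota> (p1 d) \<otimes>\<^bsub>D\<^esub> e) \<odot>\<^bsub>M\<^esub> x" using decomp[OF assms(2)] by simp
  also have "\<dots> = \<iota> (p0 d) \<odot>\<^bsub>M\<^esub> x \<oplus>\<^bsub>M\<^esub> em M (\<iota> (p1 d) \<odot>\<^bsub>M\<^esub> x)"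
    using assms(3) p_closed[OF assms(2)] by (simp add: i_closed e_closed M.smult_scalar_distr M.smult_assoc)
  finally show ?thesis .
qed

text \<open>Every scalar has the form a + b e with a and b from \<open>R\<close>, so compatibility
  with \<open>R\<close> and with \<open>e\<close> is enough.\<close>

lemma lin_D_iff:
  assumes M: "right_module D M" and N: "right_module D N"
  shows "lin D M N f \<longleftrightarrow> lin R (base M) (base N) f \<and> (\<forall>x\<in>carrier M. f (em M x) = em N (f x))"
proof
  assume f: "lin D M N f"
  then show "lin R (base M) (base N) f \<and> (\<forall>x\<in>carrier M. f (em M x) = em N (f x))"
    by (simp add: lin_def i_closed e_closed)
next
  interpret M: right_module D M by fact
  interpret N: right_module D N by fact
  assume "lin R (base M) (base N) f \<and> (\<forall>x\<in>carrier M. f (em M x) = em N (f x))"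
  then have f: "lin R (base M) (base N) f" and fe: "\<And>x. x \<in> carrier M \<Longrightarrow> f (em M x) = em N (f x)" by blast+
  note fs = lin_closed[OF f, simplified] lin_add[OF f, simplified] lin_smult[OF f, simplified]
  show "lin D M N f"
  proof (rule linI)
    fix d x assume d: "d \<in> carrier D" and x: "x \<in> carrier M"
    note p = p_closed[OF d]
    have ix: "\<iota> (p0 d) \<odot>\<^bsub>M\<^esub> x \<in> carrier M" "\<iota> (p1 d) \<odot>\<^bsub>M\<^esub> x \<in> carrier M"
      using p x by (simp_all add: i_closed M.smult_closed)
    show "f (d \<odot>\<^bsub>M\<^esub> x) = d \<odot>\<^bsub>N\<^esub> f x"
      unfolding smult_D[OF M d x] smult_D[OF N d fs(1)[OF x]]
      using ix p x by (simp add: fs(2,3) fe M.smult_closed e_closed)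
  qed (simp_all add: fs)
qed

text \<open>The inverse of restriction of scalars: \<open>\<delta>\<close> becomes the action of
  \<open>e\<close>. For a linear \<open>\<delta>\<close> of square zero this is a module over
  \<open>D\<close>, by \<open>mkD_module\<close>.\<close>

definition mkD :: "('a, 'b) module \<Rightarrow> ('b \<Rightarrow> 'b) \<Rightarrow> ('d, 'b) module" where
  "mkD M \<delta> = \<lparr>carrier = carrier M, mult = undefined, one = undefined, zero = \<zero>\<^bsub>M\<^esub>, add = add M,
     smult = (\<lambda>d x. p0 d \<odot>\<^bsub>M\<^esub> x \<oplus>\<^bsub>M\<^esub> \<delta> (p1 d \<odot>\<^bsub>M\<^esub> x))\<rparr>"

lemma mkD_simps [simp]:
  "carrier (mkD M \<delta>) = carrier M" "\<zero>\<^bsub>mkD M \<delta>\<^esub> = \<zero>\<^bsub>M\<^esub>" "x \<oplus>\<^bsub>mkD M \<delta>\<^esub> y = x \<oplus>\<^bsub>M\<^esub> y"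
  "d \<odot>\<^bsub>mkD M \<delta>\<^esub> x = p0 d \<odot>\<^bsub>M\<^esub> x \<oplus>\<^bsub>M\<^esub> \<delta> (p1 d \<odot>\<^bsub>M\<^esub> x)"
  by (simp_all add: mkD_def)

lemma mkD_module:
  assumes M: "right_module R M" and \<delta>: "lin R M M \<delta>" and \<delta>\<delta>: "\<And>x. x \<in> carrier M \<Longrightarrow> \<delta> (\<delta> x) = \<zero>\<^bsub>M\<^esub>"
  shows "right_module D (mkD M \<delta>)"
proof -
  interpret M: right_module R M by fact
  have "abelian_group (mkD M \<delta>)"
  proof (rule abelian_groupI)
    fix x assume "x \<in> carrier (mkD M \<delta>)"
    then show "\<exists>y\<in>carrier (mkD M \<delta>). y \<oplus>\<^bsub>mkD M \<delta>\<^esub> x = \<zero>\<^bsub>mkD M \<delta>\<^esub>"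
      by (intro bexI[of _ "\<ominus>\<^bsub>M\<^esub> x"]) (simp_all add: M.M.l_neg)
  qed (simp_all add: M.M.a_ac)
  then show ?thesis
  proof (intro right_module.intro right_module_axioms.intro ringD)
    note dc = lin_closed[OF \<delta>] and da = lin_add[OF \<delta>] and ds = lin_smult[OF \<delta>]
    note sc = M.smult_closed
    fix a b x y assume a: "a \<in> carrier D"
    note pa = p_closed[OF a]
    {
      assume x: "x \<in> carrier (mkD M \<delta>)"
      then show "a \<odot>\<^bsub>mkD M \<delta>\<^esub> x \<in> carrier (mkD M \<delta>)" using pa by (simp add: dc sc)
    }
    {
      assume b: "b \<in> carrier D" and "x \<in> carrier (mkD M \<delta>)"
      then have x: "x \<in> carrier M" by simp
      note pb = p_closed[OF b]
      show "(a \<oplus>\<^bsub>D\<^esub> b) \<odot>\<^bsub>mkD M \<delta>\<^esub> x = a \<odot>\<^bsub>mkD M \<delta>\<^esub> x \<oplus>\<^bsub>mkD M \<delta>\<^esub> b \<odot>\<^bsub>mkD M \<delta>\<^esub> x"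
        using pa pb x by (simp add: p_add[OF a b] M.smult_scalar_distr da dc sc M.M.a_ac)
      show "(a \<otimes>\<^bsub>D\<^esub> b) \<odot>\<^bsub>mkD M \<delta>\<^esub> x = b \<odot>\<^bsub>mkD M \<delta>\<^esub> (a \<odot>\<^bsub>mkD M \<delta>\<^esub> x)"
        using pa pb x by (simp add: p_mult[OF a b] M.smult_scalar_distr M.smult_vector_distr M.smult_assoc
            da dc sc ds[symmetric] \<delta>\<delta> M.M.a_ac)
    }
    {
      assume "x \<in> carrier (mkD M \<delta>)" "y \<in> carrier (mkD M \<delta>)"
      then show "a \<odot>\<^bsub>mkD M \<delta>\<^esub> (x \<oplus>\<^bsub>mkD M \<delta>\<^esub> y) = a \<odot>\<^bsub>mkD M \<delta>\<^esub> x \<oplus>\<^bsub>mkD M \<delta>\<^esub> a \<odot>\<^bsub>mkD M \<delta>\<^esub> y"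
        using pa by (simp add: M.smult_vector_distr da dc sc M.M.a_ac)
    }
  next
    fix x assume "x \<in> carrier (mkD M \<delta>)"
    then show "\<one>\<^bsub>D\<^esub> \<odot>\<^bsub>mkD M \<delta>\<^esub> x = x"
      using lin_zero[OF \<delta> M M] by (simp add: p_one M.smult_one M.smult_l_null)
  qed
qed

lemma mkD_em:
  assumes M: "right_module R M" and \<delta>: "lin R M M \<delta>" and x: "x \<in> carrier M"
  shows "em (mkD M \<delta>) x = \<delta> x"
proof -
  interpret M: right_module R M by fact
  show ?thesis using x lin_closed[OF \<delta>] by (simp add: p_e M.smult_one M.smult_l_null)
qed

lemma mkD_resm:
  assumes M: "right_module R M" and \<delta>: "lin R M M \<delta>" and x: "x \<in> carrier M" and a: "a \<in> carrier R"
  shows "a \<odot>\<^bsub>base (mkD M \<delta>)\<^esub> x = a \<odot>\<^bsub>M\<^esub> x"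
proof -
  interpret M: right_module R M by fact
  show ?thesis using x a lin_zero[OF \<delta> M M] by (simp add: p_i M.smult_l_null M.smult_closed)
qed

end

subsection \<open>Categories of modules\<close>

lemma module_cat_simps [simp]:
  "Obj (module_cat S \<M>) = \<M>"
  "Hom (module_cat S \<M>) M N = mod_hom S M N"
  "idn (module_cat S \<M>) M = restrict (\<lambda>x. x) (carrier M)"
  "cmp (module_cat S \<M>) L M N g f = restrict (\<lambda>x. g (f x)) (carrier L)"
  "hadd (module_cat S \<M>) M N f g = restrict (\<lambda>x. f x \<oplus>\<^bsub>N\<^esub> g x) (carrier M)"
  "hzero (module_cat S \<M>) M N = restrict (\<lambda>x. \<zero>\<^bsub>N\<^esub>) (carrier M)"
  by (simp_all add: module_cat_def compose_def)

lemma mh_comp: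
  "\<lbrakk>right_module S L; f \<in> mod_hom S L M; g \<in> mod_hom S M N\<rbrakk> \<Longrightarrow> restrict (\<lambda>x. g (f x)) (carrier L) \<in> mod_hom S L N"
  by (intro lin_restrict lin_comp[of S L M f N g] mod_hom_lin)

lemma mh_add:
  "\<lbrakk>right_module S M; right_module S N; f \<in> mod_hom S M N; g \<in> mod_hom S M N\<rbrakk> \<Longrightarrow>
    restrict (\<lambda>x. f x \<oplus>\<^bsub>N\<^esub> g x) (carrier M) \<in> mod_hom S M N"
  by (intro lin_restrict lin_sum mod_hom_lin)

lemma mh_zero:
  "\<lbrakk>right_module S M; right_module S N\<rbrakk> \<Longrightarrow> restrict (\<lambda>x. \<zero>\<^bsub>N\<^esub>) (carrier M) \<in> mod_hom S M N"
  by (intro lin_restrict lin_const_zero)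

lemma mh_id: "right_module S M \<Longrightarrow> restrict (\<lambda>x. x) (carrier M) \<in> mod_hom S M M"
  by (intro lin_restrict lin_id)

lemma mh_neg:
  "\<lbrakk>right_module S M; right_module S N; f \<in> mod_hom S M N\<rbrakk> \<Longrightarrow>
    restrict (\<lambda>x. \<ominus>\<^bsub>N\<^esub> f x) (carrier M) \<in> mod_hom S M N"
  by (intro lin_restrict lin_uminus mod_hom_lin)

lemma mh_closed: "\<lbrakk>f \<in> mod_hom S M N; x \<in> carrier M\<rbrakk> \<Longrightarrow> f x \<in> carrier N"
  by (rule lin_closed[OF mod_hom_lin])

lemma module_cat_preadditive:
  fixes \<M> :: "('d, 'v) module set"
  assumes mods: "\<And>M. M \<in> \<M> \<Longrightarrow> right_module S M"
  shows "preadditive (module_cat S \<M>)"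
proof (intro preadditive.intro category.intro preadditive_axioms.intro,
    unfold is_category_def module_cat_simps, intro conjI ballI)
  fix M assume "M \<in> \<M>"
  then show "restrict (\<lambda>x. x) (carrier M) \<in> mod_hom S M M" by (intro mh_id mods)
next
  fix L M N f g assume "L \<in> \<M>" "f \<in> mod_hom S L M" "g \<in> mod_hom S M N"
  then show "restrict (\<lambda>x. g (f x)) (carrier L) \<in> mod_hom S L N" by (intro mh_comp[of S L f M g N] mods)
next
  fix M N f assume M: "M \<in> \<M>" "N \<in> \<M>" and f: "f \<in> mod_hom S M N"
  show "restrict (\<lambda>x. f (restrict (\<lambda>x. x) (carrier M) x)) (carrier M) = f"
    by (rule mod_hom_eqI[OF mh_comp[OF mods[OF M(1)] mh_id[OF mods[OF M(1)]] f] f]) simp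
  show "restrict (\<lambda>x. restrict (\<lambda>x. x) (carrier N) (f x)) (carrier M) = f"
    by (rule mod_hom_eqI[OF mh_comp[OF mods[OF M(1)] f mh_id[OF mods[OF M(2)]]] f]) (simp add: mh_closed[OF f])
next
  fix K L M N f g h assume M: "K \<in> \<M>" "L \<in> \<M>" "M \<in> \<M>" "N \<in> \<M>"
    and f: "f \<in> mod_hom S K L" and g: "g \<in> mod_hom S L M" and h: "h \<in> mod_hom S M N"
  show "restrict (\<lambda>x. restrict (\<lambda>x. h (g x)) (carrier L) (f x)) (carrier K) =
      restrict (\<lambda>x. h (restrict (\<lambda>x. g (f x)) (carrier K) x)) (carrier K)"
    by (rule mod_hom_eqI[OF mh_comp[OF mods[OF M(1)] f mh_comp[OF mods[OF M(2)] g h]]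
          mh_comp[OF mods[OF M(1)] mh_comp[OF mods[OF M(1)] f g] h]]) (simp add: mh_closed[OF f])
next
  fix M N assume "M \<in> \<M>" "N \<in> \<M>"
  then have M: "right_module S M" and N: "right_module S N" by (simp_all add: mods)
  interpret N: right_module S N by (rule N)
  show "comm_group (hom_group (module_cat S \<M>) M N)"
  proof (rule comm_groupI, unfold hom_group_def module_cat_simps partial_object.simps monoid.simps)
    fix f g assume f: "f \<in> mod_hom S M N" and g: "g \<in> mod_hom S M N"
    note c = mh_closed[OF f] mh_closed[OF g]
    show "restrict (\<lambda>x. f x \<oplus>\<^bsub>N\<^esub> g x) (carrier M) \<in> mod_hom S M N" by (rule mh_add[OF M N f g])
    show "restrict (\<lambda>x. f x \<oplus>\<^bsub>N\<^esub> g x) (carrier M) = restrict (\<lambda>x. g x \<oplus>\<^bsub>N\<^esub> f x) (carrier M)"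
      by (rule restrict_ext) (simp add: c N.M.a_comm)
    fix h assume h: "h \<in> mod_hom S M N"
    show "restrict (\<lambda>x. restrict (\<lambda>x. f x \<oplus>\<^bsub>N\<^esub> g x) (carrier M) x \<oplus>\<^bsub>N\<^esub> h x) (carrier M) =
        restrict (\<lambda>x. f x \<oplus>\<^bsub>N\<^esub> restrict (\<lambda>x. g x \<oplus>\<^bsub>N\<^esub> h x) (carrier M) x) (carrier M)"
      by (rule restrict_ext) (simp add: c mh_closed[OF h] N.M.a_assoc)
  next
    show "restrict (\<lambda>x. \<zero>\<^bsub>N\<^esub>) (carrier M) \<in> mod_hom S M N" by (rule mh_zero[OF M N])
  next
    fix f assume f: "f \<in> mod_hom S M N"
    show "restrict (\<lambda>x. restrict (\<lambda>x. \<zero>\<^bsub>N\<^esub>) (carrier M) x \<oplus>\<^bsub>N\<^esub> f x) (carrier M) = f"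
      by (rule mod_hom_eqI[OF mh_add[OF M N mh_zero[OF M N] f] f]) (simp add: mh_closed[OF f])
    have "restrict (\<lambda>x. restrict (\<lambda>x. \<ominus>\<^bsub>N\<^esub> f x) (carrier M) x \<oplus>\<^bsub>N\<^esub> f x) (carrier M) = restrict (\<lambda>x. \<zero>\<^bsub>N\<^esub>) (carrier M)"
      by (rule restrict_ext) (simp add: mh_closed[OF f] N.M.l_neg)
    then show "\<exists>g\<in>mod_hom S M N. restrict (\<lambda>x. g x \<oplus>\<^bsub>N\<^esub> f x) (carrier M) = restrict (\<lambda>x. \<zero>\<^bsub>N\<^esub>) (carrier M)"
      using mh_neg[OF M N f] by blast
  qed
next
  fix L M N f g h assume M: "L \<in> \<M>" "M \<in> \<M>" "N \<in> \<M>"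
    and f: "f \<in> mod_hom S L M" and g: "g \<in> mod_hom S L M" and h: "h \<in> mod_hom S M N"
  show "restrict (\<lambda>x. h (restrict (\<lambda>x. f x \<oplus>\<^bsub>M\<^esub> g x) (carrier L) x)) (carrier L) =
      restrict (\<lambda>x. restrict (\<lambda>x. h (f x)) (carrier L) x \<oplus>\<^bsub>N\<^esub> restrict (\<lambda>x. h (g x)) (carrier L) x) (carrier L)"
    by (rule restrict_ext) (simp add: mh_closed[OF f] mh_closed[OF g] lin_add[OF mod_hom_lin[OF h]])
next
  fix L M N f g h assume M: "L \<in> \<M>" "M \<in> \<M>" "N \<in> \<M>"
    and f: "f \<in> mod_hom S L M" and g: "g \<in> mod_hom S M N" and h: "h \<in> mod_hom S M N"
  show "restrict (\<lambda>x. restrict (\<lambda>x. g x \<oplus>\<^bsub>N\<^esub> h x) (carrier M) (f x)) (carrier L) =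
      restrict (\<lambda>x. restrict (\<lambda>x. g (f x)) (carrier L) x \<oplus>\<^bsub>N\<^esub> restrict (\<lambda>x. h (f x)) (carrier L) x) (carrier L)"
    by (rule restrict_ext) (simp add: mh_closed[OF f])
qed


subsection \<open>Torsionless modules over the dual numbers\<close>

lemma lin_free:
  assumes I: "finite I" and c: "\<And>k. k \<in> I \<Longrightarrow> lin S M (reg S) (c k)"
  shows "lin S M (free_module S I) (\<lambda>x. \<lambda>k\<in>I. c k x)"
proof (rule linI)
  note cc = lin_closed[OF c, simplified] lin_add[OF c, simplified] lin_smult[OF c, simplified]
  fix x assume x: "x \<in> carrier M"
  show "(\<lambda>k\<in>I. c k x) \<in> carrier (free_module S I)" using I cc(1)[OF _ x] by simp
  show "(\<lambda>k\<in>I. c k (x \<oplus>\<^bsub>M\<^esub> y)) = (\<lambda>k\<in>I. c k x) \<oplus>\<^bsub>free_module S I\<^esub> (\<lambda>k\<in>I. c k y)" if "y \<in> carrier M" for y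
    unfolding free_module_simps by (rule restrict_ext) (simp add: cc x that)
  show "(\<lambda>k\<in>I. c k (a \<odot>\<^bsub>M\<^esub> x)) = a \<odot>\<^bsub>free_module S I\<^esub> (\<lambda>k\<in>I. c k x)" if "a \<in> carrier S" for a
    unfolding free_module_simps by (rule restrict_ext) (simp add: cc x that)
qed

lemma free_dual_basis:
  assumes S: "ring S" and I: "finite I"
  shows "dual_basis S (free_module S I) I (free_unit S I) (\<lambda>k v. v k)"
  unfolding dual_basis_def
proof (intro conjI ballI)
  show "right_module S (free_module S I)" by (rule free_module_module[OF S])
  show "finite I" by (rule I)
  fix k assume "k \<in> I"
  then show "free_unit S I k \<in> carrier (free_module S I)" "lin S (free_module S I) (reg S) (\<lambda>v. v k)"
    by (rule free_unit_closed[OF S], rule free_coord_lin)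
next
  fix v assume v: "v \<in> carrier (free_module S I)"
  show "(\<Oplus>\<^bsub>free_module S I\<^esub>k\<in>I. v k \<odot>\<^bsub>free_module S I\<^esub> free_unit S I k) = v"
    by (rule free_expand[OF S v I subset_refl]) simp
qed

text \<open>\<open>projective\<close> requires a basis consisting of elements of the type of
  \<open>N\<close>, whereas the free module is indexed by naturals. An injection of the naturals
  into the infinite type \<open>'v\<close> renames the basis.\<close>

lemma free_iso_projective:
  fixes N :: "('d, 'v) module"
  assumes S: "ring S" and inf: "infinite (UNIV :: 'v set)" and N: "right_module S N"
    and \<phi>: "\<phi> \<in> mod_hom S (free_module S {..<n::nat}) N"
    and bij: "bij_betw \<phi> (carrier (free_module S {..<n})) (carrier N)"
  shows "projective S N"
proof -
  let ?F = "free_module S {..<n}"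
  obtain g :: "nat \<Rightarrow> 'v" where g: "inj g" using inf by (auto simp: infinite_iff_countable_subset)
  let ?I = "g ` {..<n}"
  note F = free_module_module[OF S]
  obtain \<psi> where \<psi>: "lin S N ?F \<psi>" and \<phi>\<psi>: "\<And>y. y \<in> carrier N \<Longrightarrow> \<phi> (\<psi> y) = y"
    by (rule lin_inverse[OF F mod_hom_lin[OF \<phi>] bij]) blast
  define i where "i y = (\<lambda>j\<in>?I. \<psi> y (inv_into UNIV g j))" for y
  define p where "p v = \<phi> (\<lambda>k\<in>{..<n}. v (g k))" for v
  have i: "lin S N (free_module S ?I) i"
    unfolding i_def
  proof (rule lin_free)
    fix j assume "j \<in> ?I"
    then have "inv_into UNIV g j \<in> {..<n}" using g by (auto simp: inv_f_f)
    then show "lin S N (reg S) (\<lambda>y. \<psi> y (inv_into UNIV g j))" by (rule lin_comp[OF \<psi> free_coord_lin])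
  qed simp
  have p: "lin S (free_module S ?I) N p"
    unfolding p_def
  proof (rule lin_comp[OF lin_free mod_hom_lin[OF \<phi>]])
    fix k assume "k \<in> {..<n}"
    then have "g k \<in> ?I" by (rule imageI)
    then show "lin S (free_module S ?I) (reg S) (\<lambda>v. v (g k))" by (rule free_coord_lin)
  qed simp
  have pi: "p (i y) = y" if y: "y \<in> carrier N" for y
  proof -
    have "\<psi> y \<in> extensional {..<n}" using lin_closed[OF \<psi> y] by (simp add: PiE_def)
    then have "(\<lambda>k\<in>{..<n}. i y (g k)) = \<psi> y"
      by (intro extensionalityI[of _ "{..<n}"]) (simp_all add: i_def inv_f_f[OF g])
    then show ?thesis unfolding p_def using \<phi>\<psi>[OF y] by simp
  qed
  show ?thesis
    unfolding projective_def
  proof (intro conjI N exI[of _ ?I] bexI ballI)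
    fix x assume x: "x \<in> carrier N"
    then show "restrict p (carrier (free_module S ?I)) (restrict i (carrier N) x) = x"
      using lin_closed[OF i x] pi[OF x] by (simp del: free_module_simps)
  qed (rule lin_restrict[OF p F] lin_restrict[OF i N])+
qed

locale hereditary_dual = hereditary_noetherian R + dual_structure R D \<iota> e p0 p1
  for R :: "('a, 'r) ring_scheme" and D :: "('d, 's) ring_scheme" and \<iota> e p0 p1
begin

interpretation R: ring R by (rule ringR)
interpretation D: ring D by (rule ringD)

lemma finsum_resm: "finsum (base M) f S = finsum M f S"
  by (simp add: finsum_def finprod_def resm_def)

lemma lin_res: "\<lbrakk>right_module D M; right_module D N; lin D M N f\<rbrakk> \<Longrightarrow> lin R (base M) (base N) f"
  by (simp add: lin_D_iff)

lemma lin_em_comm: "\<lbrakk>lin D M N f; x \<in> carrier M\<rbrakk> \<Longrightarrow> f (em M x) = em N (f x)"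
  by (rule lin_smult[OF _ e_closed])

lemma p_lin: "lin R (base (reg D)) (reg R) p0" "lin R (base (reg D)) (reg R) p1"
  by (rule linI; simp add: p_closed p_add p_mult i_closed p_i)+

lemma p_zero_iff: "d \<in> carrier D \<Longrightarrow> p0 d = \<zero>\<^bsub>R\<^esub> \<Longrightarrow> p1 d = \<zero>\<^bsub>R\<^esub> \<Longrightarrow> d = \<zero>\<^bsub>D\<^esub>"
  using decomp[of d] by (simp add: i_zero e_closed)

text \<open>The Frobenius isomorphism between R-linear functionals on \<open>M\<close> and D-linear
  maps from \<open>M\<close> to \<open>D\<close>: this is the unique D-linear map whose coordinate
  \<open>p1\<close> is \<open>f\<close>. Linearity over \<open>e\<close> forces the coordinate
  \<open>p0\<close> to be \<open>f (em M x)\<close>.\<close>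

definition cofunctional :: "('d, 'v, 'c) module_scheme \<Rightarrow> ('v \<Rightarrow> 'a) \<Rightarrow> 'v \<Rightarrow> 'd" where
  "cofunctional M f x = \<iota> (f (em M x)) \<oplus>\<^bsub>D\<^esub> \<iota> (f x) \<otimes>\<^bsub>D\<^esub> e"

lemma cofunctional_lin:
  assumes M: "right_module D M" and f: "lin R (base M) (reg R) f"
  shows "lin D M (reg D) (cofunctional M f)"
proof -
  interpret M: right_module D M by fact
  note fs = lin_closed[OF f, simplified] lin_add[OF f, simplified] lin_smult[OF f, simplified]
  note el = lin_closed[OF em_lin[OF M], simplified] lin_add[OF em_lin[OF M], simplified] lin_smult[OF em_lin[OF M], simplified]
  have f0: "f \<zero>\<^bsub>M\<^esub> = \<zero>\<^bsub>R\<^esub>" using lin_zero[OF f resm_module[OF M] reg_module[OF ringR]] by simp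
  have "lin R (base M) (base (reg D)) (cofunctional M f)"
  proof (rule linI)
    fix a x assume a: "a \<in> carrier R" and "x \<in> carrier (base M)"
    then have x: "x \<in> carrier M" by simp
    show "cofunctional M f (a \<odot>\<^bsub>base M\<^esub> x) = a \<odot>\<^bsub>base (reg D)\<^esub> cofunctional M f x"
      unfolding cofunctional_def using a x
      by (simp add: fs el i_mult i_closed e_closed e_comm D.l_distr D.m_assoc)
  qed (simp_all add: cofunctional_def fs el i_add i_closed e_closed D.l_distr D.a_ac)
  moreover have "cofunctional M f (em M x) = em (reg D) (cofunctional M f x)" if x: "x \<in> carrier M" for x
    unfolding cofunctional_def using x
    by (simp add: em_em[OF M] f0 i_zero fs el i_closed e_closed D.l_distr D.m_assoc e_e)
  ultimately show ?thesis by (simp add: lin_D_iff[OF M reg_module[OF ringD]])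
qed

lemma tls_fin_gen_D:
  assumes M: "right_module D M" and fg: "fin_gen R (base M)"
  shows "fin_gen D M"
proof -
  obtain A where A: "finite A" "A \<subseteq> carrier (base M)"
    "\<And>S. submod R (base M) S \<Longrightarrow> A \<subseteq> S \<Longrightarrow> carrier (base M) \<subseteq> S"
    using fg unfolding fin_gen_iff[OF resm_module[OF M]] by blast
  have "carrier M \<subseteq> S" if S: "submod D M S" "A \<subseteq> S" for S
  proof -
    have "submod R (base M) S" using S(1) by (simp add: submod_def i_closed)
    from A(3)[OF this S(2)] show ?thesis by simp
  qed
  then have "finite A \<and> A \<subseteq> carrier M \<and> (\<forall>S. submod D M S \<longrightarrow> A \<subseteq> S \<longrightarrow> carrier M \<subseteq> S)"
    using A(1,2) by simp
  then show ?thesis unfolding fin_gen_iff[OF M] by (rule exI)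
qed

text \<open>Each coordinate in \<open>D\<close> consists of two coordinates in \<open>R\<close>,
  which gives one direction. Conversely a torsionless R-module has a dual basis; its functionals
  lift to D-linear maps by \<open>cofunctional\<close>, and \<open>p1\<close> recovers the original
  values, which determine x.\<close>

lemma torsionless_iff:
  assumes M: "right_module D M"
  shows "torsionless D M \<longleftrightarrow> tls R (base M)"
proof
  interpret M: right_module D M by fact
  assume "torsionless D M"
  then obtain n :: nat and f where f: "f \<in> mod_hom D M (free_module D {..<n})" and inj: "inj_on f (carrier M)"
    unfolding torsionless_def by blast
  note fl = mod_hom_lin[OF f]
  let ?J = "{..<n} <+> {..<n}"
  define g where "g = case_sum (\<lambda>k x. p0 (f x k)) (\<lambda>k x. p1 (f x k))"
  have c: "lin R (base M) (base (reg D)) (\<lambda>x. f x k)" if "k < n" for k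
    using that by (intro lin_res[OF M reg_module[OF ringD]] lin_comp[OF fl free_coord_lin]) simp
  show "tls R (base M)"
  proof (rule tlI[OF resm_module[OF M], of ?J g])
    fix k assume "k \<in> ?J"
    then show "lin R (base M) (reg R) (g k)"
      using lin_comp[OF c p_lin(1)] lin_comp[OF c p_lin(2)] by (auto simp: g_def)
  next
    fix x assume "x \<in> carrier (base M)" and z: "\<And>k. k \<in> ?J \<Longrightarrow> g k x = \<zero>\<^bsub>R\<^esub>"
    then have x: "x \<in> carrier M" by simp
    have fx: "f x \<in> carrier (free_module D {..<n})" by (rule lin_closed[OF fl x])
    have "f x k = \<zero>\<^bsub>D\<^esub>" if k: "k < n" for k
    proof (rule p_zero_iff)
      show "f x k \<in> carrier D" using lin_closed[OF c[OF k], of x] x by simp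
      show "p0 (f x k) = \<zero>\<^bsub>R\<^esub>" "p1 (f x k) = \<zero>\<^bsub>R\<^esub>" using z[OF InlI] z[OF InrI] k by (simp_all add: g_def)
    qed
    moreover have "f x \<in> extensional {..<n}" using fx by (simp add: PiE_def)
    ultimately have "f x = \<zero>\<^bsub>free_module D {..<n}\<^esub>" by (intro extensionalityI[of _ "{..<n}"]) simp_all
    also have "\<dots> = f \<zero>\<^bsub>M\<^esub>" by (rule lin_zero[OF fl M free_module_module[OF ringD], symmetric])
    finally have "x = \<zero>\<^bsub>M\<^esub>" using inj_onD[OF inj] x by simp
    then show "x = \<zero>\<^bsub>base M\<^esub>" by simp
  qed simp
next
  assume t: "tls R (base M)"
  then obtain n b f where db: "dual_basis R (base M) {..<n::nat} b f"
    using tl_fgp[OF t] by (auto simp: fgp_def)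
  define i where "i x = (\<lambda>k\<in>{..<n}. cofunctional M (f k) x)" for x
  have i: "lin D M (free_module D {..<n}) i"
    unfolding i_def by (rule lin_free[OF _ cofunctional_lin[OF M dual_basisD(3)[OF db]]]) simp_all
  have "x = y" if x: "x \<in> carrier M" and y: "y \<in> carrier M" and eq: "i x = i y" for x y
  proof -
    interpret M: right_module D M by fact
    interpret RM: right_module R "base M" by (rule resm_module[OF M])
    have ex: "em M x \<in> carrier (base M)" "em M y \<in> carrier (base M)"
      using x y by (simp_all add: M.smult_closed e_closed)
    have f: "f k x = f k y" if k: "k \<in> {..<n}" for k
    proof -
      have "cofunctional M (f k) x = cofunctional M (f k) y"
        using fun_cong[OF eq, of k] k by (simp add: i_def)
      then have "p1 (cofunctional M (f k) x) = p1 (cofunctional M (f k) y)" by simp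
      then show ?thesis
        unfolding cofunctional_def using dual_basisD(4)[OF db k] x y ex by (simp add: p_eq)
    qed
    have "x = (\<Oplus>\<^bsub>base M\<^esub>k\<in>{..<n}. f k x \<odot>\<^bsub>base M\<^esub> b k)"
      using dual_basisD(5)[OF db, of x] x by simp
    also have "\<dots> = (\<Oplus>\<^bsub>base M\<^esub>k\<in>{..<n}. f k y \<odot>\<^bsub>base M\<^esub> b k)"
      by (rule RM.M.finsum_cong') (use f dual_basisD(2,4)[OF db] y RM.smult_closed in \<open>simp_all del: resm_simps(4)\<close>)
    also have "\<dots> = y" using dual_basisD(5)[OF db, of y] y by simp
    finally show ?thesis .
  qed
  then have "inj_on (restrict i (carrier M)) (carrier M)" by (intro inj_onI) simp
  then show "torsionless D M" unfolding torsionless_def using lin_restrict[OF i M] by blast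
qed

text \<open>The ungraded counterpart of \<open>null_homotopic\<close>, with \<open>e\<close> acting
  as the differential. \<open>factoring_iff\<close> identifies it with the maps that vanish in the
  stable category.\<close>

definition dnull :: "('d, 'v) module \<Rightarrow> ('d, 'v) module \<Rightarrow> ('v \<Rightarrow> 'v) set" where
  "dnull M N = {j \<in> mod_hom D M N. \<exists>h. lin R (base M) (base N) h \<and>
     (\<forall>x\<in>carrier M. j x = h (em M x) \<oplus>\<^bsub>N\<^esub> em N (h x))}"

text \<open>On a free module the identity is itself of the required form, with the homotopy
  \<open>t\<close> below. Composing with linear maps on both sides, which commute with
  \<open>e\<close>, transfers this to every map through a retract of a free module.\<close>

lemma factoring_null:
  fixes M N :: "('d, 'v) module"
  assumes M: "right_module D M" and N: "right_module D N"
    and j: "j \<in> factoring_through (module_cat D (fg_modules D)) {P \<in> fg_modules D. projective D P} M N"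
  shows "j \<in> dnull M N"
proof -
  obtain P :: "('d, 'v) module" and h k where P: "P \<in> fg_modules D" "projective D P" and h: "h \<in> mod_hom D M P" and k: "k \<in> mod_hom D P N"
    and jj: "j = restrict (\<lambda>x. k (h x)) (carrier M)"
    using j unfolding factoring_through_def by auto
  obtain I :: "'v set" and i p where Pm: "right_module D P" and i: "i \<in> mod_hom D P (free_module D I)"
    and p: "p \<in> mod_hom D (free_module D I) P" and pi: "\<And>x. x \<in> carrier P \<Longrightarrow> p (i x) = x"
    using P(2) unfolding projective_def by blast
  let ?F = "free_module D I"
  note F = free_module_module[OF ringD, of I]
  interpret F: right_module D ?F by (rule F)
  note hl = mod_hom_lin[OF h] and kl = mod_hom_lin[OF k] and il = mod_hom_lin[OF i] and pl = mod_hom_lin[OF p]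
  \<comment> \<open>\<open>t\<close> takes a + b e to b in each coordinate. Applied to (a + b e) e
    it gives a, while t(a + b e) e is b e; the two add up to the identity.\<close>
  define t where "t v = (\<lambda>l\<in>I. \<iota> (p1 (v l)))" for v
  have vD: "v l \<in> carrier D" if "v \<in> carrier ?F" "l \<in> I" for v l
    using lin_closed[OF free_coord_lin[OF that(2)] that(1)] by simp
  have p10: "p1 \<zero>\<^bsub>D\<^esub> = \<zero>\<^bsub>R\<^esub>" using p_i(2)[of "\<zero>\<^bsub>R\<^esub>"] by (simp add: i_zero)
  have tF: "t v \<in> carrier ?F" if v: "v \<in> carrier ?F" for v
  proof -
    have "{l \<in> I. t v l \<noteq> \<zero>\<^bsub>D\<^esub>} \<subseteq> {l \<in> I. v l \<noteq> \<zero>\<^bsub>D\<^esub>}" by (auto simp: t_def p10 i_zero)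
    moreover have "finite {l \<in> I. v l \<noteq> \<zero>\<^bsub>D\<^esub>}" using v by simp
    ultimately have "finite {l \<in> I. t v l \<noteq> \<zero>\<^bsub>D\<^esub>}" by (rule finite_subset)
    moreover have "t v \<in> I \<rightarrow>\<^sub>E carrier D" unfolding t_def using vD[OF v] by (simp add: i_closed p_closed)
    ultimately show ?thesis by simp
  qed
  have tl: "lin R (base ?F) (base ?F) t"
  proof (rule linI, unfold resm_simps)
    show "t v \<in> carrier ?F" if "v \<in> carrier ?F" for v by (rule tF[OF that])
    show "t (v \<oplus>\<^bsub>?F\<^esub> w) = t v \<oplus>\<^bsub>?F\<^esub> t w" if "v \<in> carrier ?F" "w \<in> carrier ?F" for v w
      unfolding t_def free_module_simps
      by (rule restrict_ext) (simp add: vD[OF that(1)] vD[OF that(2)] p_add i_add p_closed)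
    show "t (\<iota> a \<odot>\<^bsub>?F\<^esub> v) = \<iota> a \<odot>\<^bsub>?F\<^esub> t v" if "a \<in> carrier R" "v \<in> carrier ?F" for a v
      unfolding t_def free_module_simps
      by (rule restrict_ext) (simp add: vD[OF that(2)] that(1) p_mult i_closed p_i p_closed i_mult)
  qed
  have tt: "t (em ?F v) \<oplus>\<^bsub>?F\<^esub> em ?F (t v) = v" if v: "v \<in> carrier ?F" for v
  proof (rule extensionalityI[of _ I])
    show "v \<in> extensional I" using v by (simp add: PiE_def)
    show "t (em ?F v) \<oplus>\<^bsub>?F\<^esub> em ?F (t v) \<in> extensional I" by simp
    fix l assume l: "l \<in> I"
    show "(t (em ?F v) \<oplus>\<^bsub>?F\<^esub> em ?F (t v)) l = v l"
      using l vD[OF v l] decomp[OF vD[OF v l]] by (simp add: t_def p_mult e_closed p_e p_closed)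
  qed
  have ihl: "lin D M ?F (\<lambda>x. i (h x))" and kpl: "lin D ?F N (\<lambda>v. k (p v))"
    by (rule lin_comp[OF hl il], rule lin_comp[OF pl kl])
  define s where "s x = k (p (t (i (h x))))" for x
  have sl: "lin R (base M) (base N) s"
    unfolding s_def by (rule lin_comp[OF lin_comp[OF lin_res[OF M F ihl] tl] lin_res[OF F N kpl]])
  have "j x = s (em M x) \<oplus>\<^bsub>N\<^esub> em N (s x)" if x: "x \<in> carrier M" for x
  proof -
    let ?v = "i (h x)"
    have v: "?v \<in> carrier ?F" by (rule lin_closed[OF ihl x])
    have ev: "em ?F ?v \<in> carrier ?F" by (rule F.smult_closed[OF e_closed v])
    have "s (em M x) \<oplus>\<^bsub>N\<^esub> em N (s x) = k (p (t (em ?F ?v))) \<oplus>\<^bsub>N\<^esub> k (p (em ?F (t ?v)))"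
      unfolding s_def lin_em_comm[OF ihl x] lin_em_comm[OF kpl tF[OF v]] ..
    also have "\<dots> = k (p (t (em ?F ?v) \<oplus>\<^bsub>?F\<^esub> em ?F (t ?v)))"
      by (rule lin_add[OF kpl tF[OF ev] F.smult_closed[OF e_closed tF[OF v]], symmetric])
    also have "\<dots> = k (p ?v)" unfolding tt[OF v] ..
    also have "\<dots> = j x" unfolding jj using pi[OF lin_closed[OF hl x]] x by simp
    finally show ?thesis by (rule sym)
  qed
  moreover have "j \<in> mod_hom D M N" unfolding jj by (rule mh_comp[OF M h k])
  ultimately show ?thesis unfolding dnull_def using sl by blast
qed

text \<open>The projective is a copy of \<open>D^n\<close>, where n is the length of an R-dual basis
  (b, f) of \<open>M\<close>. The first map has the cofunctionals of the \<open>f k\<close> as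
  coordinates, and the second sends the k-th unit vector to \<open>h (b k)\<close>. Their composite
  sends x to the sum of the terms f_k(x e) h(b_k) and (f_k(x) h(b_k)) e, which is h(x e) + h(x)
  e.\<close>

lemma null_factoring:
  fixes M N :: "('d, 'v) module"
  assumes U: "large_universe D TYPE('v)" and M: "right_module D M" and N: "right_module D N"
    and t: "tls R (base M)" and j: "j \<in> dnull M N"
  shows "j \<in> factoring_through (module_cat D (fg_modules D)) {P \<in> fg_modules D. projective D P} M N"
proof -
  obtain n b f where db: "dual_basis R (base M) {..<n::nat} b f"
    using tl_fgp[OF t] by (auto simp: fgp_def)
  obtain h where jm: "j \<in> mod_hom D M N" and h: "lin R (base M) (base N) h"
    and jh: "\<And>x. x \<in> carrier M \<Longrightarrow> j x = h (em M x) \<oplus>\<^bsub>N\<^esub> em N (h x)"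
    using j unfolding dnull_def by blast
  interpret M: right_module D M by fact
  interpret N: right_module D N by fact
  let ?I = "{..<n}"
  let ?F = "free_module D ?I"
  note F = free_module_module[OF ringD, of ?I]
  note dbF = free_dual_basis[OF ringD finite_lessThan[of n]]
  obtain P :: "('d, 'v) module" and \<phi> where P: "P \<in> fg_modules D" and \<phi>: "\<phi> \<in> mod_hom D ?F P"
    and bij: "bij_betw \<phi> (carrier ?F) (carrier P)"
    using fin_gen_in_large_universe[OF F fgp_fin_gen[OF fgpI[OF dbF]] U] by blast
  have Pm: "right_module D P" using P by (simp add: fg_modules_def)
  have inf: "infinite (UNIV :: 'v set)" using U by (simp add: large_universe_def)
  have proj: "projective D P" by (rule free_iso_projective[OF ringD inf Pm \<phi> bij])
  obtain \<psi> where \<psi>: "lin D P ?F \<psi>" and \<psi>\<phi>: "\<And>v. v \<in> carrier ?F \<Longrightarrow> \<psi> (\<phi> v) = v"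
    by (rule lin_inverse[OF F mod_hom_lin[OF \<phi>] bij]) blast
  define i where "i x = (\<lambda>k\<in>?I. cofunctional M (f k) x)" for x
  have i: "lin D M ?F i"
    unfolding i_def by (rule lin_free[OF _ cofunctional_lin[OF M dual_basisD(3)[OF db]]]) simp_all
  have bM: "b k \<in> carrier M" if "k \<in> ?I" for k using dual_basisD(2)[OF db that] by simp
  have hb: "h (b k) \<in> carrier N" if "k \<in> ?I" for k using lin_closed[OF h, of "b k"] bM[OF that] by simp
  define \<kappa> where "\<kappa> v = (\<Oplus>\<^bsub>N\<^esub>k\<in>?I. v k \<odot>\<^bsub>N\<^esub> h (b k))" for v
  have \<kappa>: "lin D ?F N \<kappa>" unfolding \<kappa>_def by (rule dual_basis_extend(1)[OF dbF N hb])
  have sum: "(\<Oplus>\<^bsub>N\<^esub>k\<in>?I. \<iota> (f k x) \<odot>\<^bsub>N\<^esub> h (b k)) = h x" if x: "x \<in> carrier M" for x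
  proof -
    have "(\<Oplus>\<^bsub>base N\<^esub>k\<in>?I. f k x \<odot>\<^bsub>base N\<^esub> h (b k)) = h x"
    proof (rule dual_basis_extend(2)[OF db resm_module[OF N] _ _ resm_module[OF N] lin_id h])
      show "h (b k) \<in> carrier (base N)" if "k \<in> ?I" for k using hb[OF that] by simp
      show "x \<in> carrier (base M)" using x by simp
    qed simp
    then show ?thesis by (simp add: finsum_resm)
  qed
  have \<kappa>i: "\<kappa> (i x) = j x" if x: "x \<in> carrier M" for x
  proof -
    have ex: "em M x \<in> carrier M" by (rule M.smult_closed[OF e_closed x])
    have fR: "f k x \<in> carrier R" "f k (em M x) \<in> carrier R" if "k \<in> ?I" for k
      using dual_basisD(4)[OF db that] x ex by simp_all
    have cl: "\<iota> (f k x) \<odot>\<^bsub>N\<^esub> h (b k) \<in> carrier N" "\<iota> (f k (em M x)) \<odot>\<^bsub>N\<^esub> h (b k) \<in> carrier N" if "k \<in> ?I" for k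
      using fR[OF that] hb[OF that] by (simp_all add: N.smult_closed i_closed)
    have "\<kappa> (i x) = (\<Oplus>\<^bsub>N\<^esub>k\<in>?I. \<iota> (f k (em M x)) \<odot>\<^bsub>N\<^esub> h (b k) \<oplus>\<^bsub>N\<^esub> em N (\<iota> (f k x) \<odot>\<^bsub>N\<^esub> h (b k)))"
      unfolding \<kappa>_def
    proof (rule N.M.finsum_cong'[OF refl])
      show "(\<lambda>k. \<iota> (f k (em M x)) \<odot>\<^bsub>N\<^esub> h (b k) \<oplus>\<^bsub>N\<^esub> em N (\<iota> (f k x) \<odot>\<^bsub>N\<^esub> h (b k))) \<in> ?I \<rightarrow> carrier N"
        using cl by (simp add: N.smult_closed e_closed)
      fix k assume k: "k \<in> ?I"
      show "i x k \<odot>\<^bsub>N\<^esub> h (b k) = \<iota> (f k (em M x)) \<odot>\<^bsub>N\<^esub> h (b k) \<oplus>\<^bsub>N\<^esub> em N (\<iota> (f k x) \<odot>\<^bsub>N\<^esub> h (b k))"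
        using k fR[OF k] hb[OF k]
        by (simp add: i_def cofunctional_def N.smult_scalar_distr N.smult_assoc i_closed e_closed)
    qed
    also have "\<dots> = (\<Oplus>\<^bsub>N\<^esub>k\<in>?I. \<iota> (f k (em M x)) \<odot>\<^bsub>N\<^esub> h (b k)) \<oplus>\<^bsub>N\<^esub> (\<Oplus>\<^bsub>N\<^esub>k\<in>?I. em N (\<iota> (f k x) \<odot>\<^bsub>N\<^esub> h (b k)))"
      by (rule N.M.finsum_addf) (use cl in \<open>simp_all add: N.smult_closed e_closed\<close>)
    also have "(\<Oplus>\<^bsub>N\<^esub>k\<in>?I. em N (\<iota> (f k x) \<odot>\<^bsub>N\<^esub> h (b k))) = em N (\<Oplus>\<^bsub>N\<^esub>k\<in>?I. \<iota> (f k x) \<odot>\<^bsub>N\<^esub> h (b k))"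
      by (rule N.smult_finsum[OF e_closed _ cl(1), symmetric]) simp_all
    also have "(\<Oplus>\<^bsub>N\<^esub>k\<in>?I. \<iota> (f k (em M x)) \<odot>\<^bsub>N\<^esub> h (b k)) \<oplus>\<^bsub>N\<^esub> em N (\<Oplus>\<^bsub>N\<^esub>k\<in>?I. \<iota> (f k x) \<odot>\<^bsub>N\<^esub> h (b k)) = j x"
      unfolding sum[OF x] sum[OF ex] jh[OF x] ..
    finally show ?thesis .
  qed
  define h1 where "h1 = restrict (\<lambda>x. \<phi> (i x)) (carrier M)"
  define k1 where "k1 = restrict (\<lambda>y. \<kappa> (\<psi> y)) (carrier P)"
  have h1: "h1 \<in> mod_hom D M P" unfolding h1_def by (rule lin_restrict[OF lin_comp[OF i mod_hom_lin[OF \<phi>]] M])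
  have k1: "k1 \<in> mod_hom D P N" unfolding k1_def by (rule lin_restrict[OF lin_comp[OF \<psi> \<kappa>] Pm])
  have "j = restrict (\<lambda>x. k1 (h1 x)) (carrier M)"
  proof (rule mod_hom_eqI[OF jm mh_comp[OF M h1 k1]])
    fix x assume x: "x \<in> carrier M"
    have ix: "i x \<in> carrier ?F" by (rule lin_closed[OF i x])
    show "j x = restrict (\<lambda>x. k1 (h1 x)) (carrier M) x"
      using x lin_closed[OF mod_hom_lin[OF \<phi>] ix] \<psi>\<phi>[OF ix] \<kappa>i[OF x] by (simp add: h1_def k1_def)
  qed
  then show ?thesis
    unfolding factoring_through_def module_cat_simps using P proj h1 k1 by blast
qed

lemma dnullI:
  "\<lbrakk>j \<in> mod_hom D M N; lin R (base M) (base N) h;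
    \<And>x. x \<in> carrier M \<Longrightarrow> j x = h (em M x) \<oplus>\<^bsub>N\<^esub> em N (h x)\<rbrakk> \<Longrightarrow> j \<in> dnull M N"
  unfolding dnull_def by blast

lemma dnullE:
  assumes "j \<in> dnull M N"
  obtains h where "j \<in> mod_hom D M N" "lin R (base M) (base N) h"
    "\<And>x. x \<in> carrier M \<Longrightarrow> j x = h (em M x) \<oplus>\<^bsub>N\<^esub> em N (h x)"
  using assms unfolding dnull_def by blast

lemma dnull_zero:
  assumes M: "right_module D M" and N: "right_module D N"
  shows "restrict (\<lambda>x. \<zero>\<^bsub>N\<^esub>) (carrier M) \<in> dnull M N"
proof (rule dnullI[OF mh_zero[OF M N], of "\<lambda>x. \<zero>\<^bsub>N\<^esub>"])
  interpret N: right_module D N by fact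
  show "lin R (base M) (base N) (\<lambda>x. \<zero>\<^bsub>N\<^esub>)"
    using lin_const_zero[OF resm_module[OF N]] by simp
  show "restrict (\<lambda>x. \<zero>\<^bsub>N\<^esub>) (carrier M) x = \<zero>\<^bsub>N\<^esub> \<oplus>\<^bsub>N\<^esub> em N \<zero>\<^bsub>N\<^esub>" if "x \<in> carrier M" for x
    using that by (simp add: N.smult_r_null e_closed)
qed

lemma dnull_add:
  assumes M: "right_module D M" and N: "right_module D N" and j: "j \<in> dnull M N" and k: "k \<in> dnull M N"
  shows "restrict (\<lambda>x. j x \<oplus>\<^bsub>N\<^esub> k x) (carrier M) \<in> dnull M N"
proof -
  obtain a where jm: "j \<in> mod_hom D M N" and a: "lin R (base M) (base N) a"
    and ja: "\<And>x. x \<in> carrier M \<Longrightarrow> j x = a (em M x) \<oplus>\<^bsub>N\<^esub> em N (a x)" by (rule dnullE[OF j]) blast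
  obtain b where km: "k \<in> mod_hom D M N" and b: "lin R (base M) (base N) b"
    and kb: "\<And>x. x \<in> carrier M \<Longrightarrow> k x = b (em M x) \<oplus>\<^bsub>N\<^esub> em N (b x)" by (rule dnullE[OF k]) blast
  interpret M: right_module D M by fact
  interpret N: right_module D N by fact
  show ?thesis
  proof (rule dnullI[OF mh_add[OF M N jm km]])
    show "lin R (base M) (base N) (\<lambda>x. a x \<oplus>\<^bsub>base N\<^esub> b x)"
      by (rule lin_sum[OF resm_module[OF M] resm_module[OF N] a b])
    fix x assume x: "x \<in> carrier M"
    have ab: "a y \<in> carrier N" "b y \<in> carrier N" if "y \<in> carrier M" for y
      using lin_closed[OF a, of y] lin_closed[OF b, of y] that by simp_all
    have ex: "em M x \<in> carrier M" by (rule M.smult_closed[OF e_closed x])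
    show "restrict (\<lambda>x. j x \<oplus>\<^bsub>N\<^esub> k x) (carrier M) x =
        (a (em M x) \<oplus>\<^bsub>base N\<^esub> b (em M x)) \<oplus>\<^bsub>N\<^esub> em N (a x \<oplus>\<^bsub>base N\<^esub> b x)"
      using x ex ab by (simp add: ja kb N.smult_vector_distr N.smult_closed e_closed N.M.a_ac)
  qed
qed

lemma dnull_left:
  assumes M: "right_module D M" and N: "right_module D N" and L: "right_module D L"
    and j: "j \<in> dnull M N" and g: "g \<in> mod_hom D N L"
  shows "restrict (\<lambda>x. g (j x)) (carrier M) \<in> dnull M L"
proof -
  obtain a where jm: "j \<in> mod_hom D M N" and a: "lin R (base M) (base N) a"
    and ja: "\<And>x. x \<in> carrier M \<Longrightarrow> j x = a (em M x) \<oplus>\<^bsub>N\<^esub> em N (a x)" by (rule dnullE[OF j]) blast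
  interpret M: right_module D M by fact
  interpret N: right_module D N by fact
  note gl = mod_hom_lin[OF g]
  show ?thesis
  proof (rule dnullI[OF mh_comp[OF M jm g] lin_comp[OF a lin_res[OF N L gl]]])
    fix x assume x: "x \<in> carrier M"
    have ex: "em M x \<in> carrier M" by (rule M.smult_closed[OF e_closed x])
    have c: "a x \<in> carrier N" "a (em M x) \<in> carrier N"
      using lin_closed[OF a, of x] lin_closed[OF a, of "em M x"] x ex by simp_all
    show "restrict (\<lambda>x. g (j x)) (carrier M) x = g (a (em M x)) \<oplus>\<^bsub>L\<^esub> em L (g (a x))"
      using x c by (simp add: ja lin_add[OF gl] N.smult_closed e_closed lin_em_comm[OF gl])
  qed
qed

lemma dnull_right:
  assumes M: "right_module D M" and N: "right_module D N" and L: "right_module D L"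
    and f: "f \<in> mod_hom D M N" and j: "j \<in> dnull N L"
  shows "restrict (\<lambda>x. j (f x)) (carrier M) \<in> dnull M L"
proof -
  obtain a where jm: "j \<in> mod_hom D N L" and a: "lin R (base N) (base L) a"
    and ja: "\<And>x. x \<in> carrier N \<Longrightarrow> j x = a (em N x) \<oplus>\<^bsub>L\<^esub> em L (a x)" by (rule dnullE[OF j]) blast
  note fl = mod_hom_lin[OF f]
  show ?thesis
  proof (rule dnullI[OF mh_comp[OF M f jm] lin_comp[OF lin_res[OF M N fl] a]])
    fix x assume x: "x \<in> carrier M"
    show "restrict (\<lambda>x. j (f x)) (carrier M) x = a (f (em M x)) \<oplus>\<^bsub>L\<^esub> em L (a (f x))"
      using x by (simp add: ja mh_closed[OF f] lin_em_comm[OF fl])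
  qed
qed

abbreviation proj_fg :: "('d, 'v) module \<Rightarrow> ('d, 'v) module \<Rightarrow> ('v \<Rightarrow> 'v) set" where
  "proj_fg \<equiv> factoring_through (module_cat D (fg_modules D)) {P \<in> fg_modules D. projective D P}"

lemma torsionless_obj:
  assumes "M \<in> {M \<in> fg_modules D. torsionless D M}"
  shows "right_module D M" "tls R (base M)" "fin_gen D M"
  using assms torsionless_iff[of M] by (simp_all add: fg_modules_def)

lemma factoring_iff:
  fixes M N :: "('d, 'v) module"
  assumes U: "large_universe D TYPE('v)"
    and M: "M \<in> {M \<in> fg_modules D. torsionless D M}" and N: "N \<in> {M \<in> fg_modules D. torsionless D M}"
  shows "proj_fg M N = dnull M N"
proof (rule subset_antisym; rule subsetI)
  fix j
  show "j \<in> proj_fg M N \<Longrightarrow> j \<in> dnull M N"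
    by (rule factoring_null[OF torsionless_obj(1)[OF M] torsionless_obj(1)[OF N]])
  show "j \<in> dnull M N \<Longrightarrow> j \<in> proj_fg M N"
    by (rule null_factoring[OF U torsionless_obj(1)[OF M] torsionless_obj(1)[OF N] torsionless_obj(2)[OF M]])
qed

text \<open>Adding two maps that factor through projectives would call for a direct sum of the two
  modules inside the universe. In the description by \<open>dnull\<close> one simply adds the
  homotopies.\<close>

lemma stable_hom_ideal:
  assumes U: "large_universe D TYPE('v)"
  shows "hom_ideal (torsionless_cat D :: (('d, 'v) module, _) preadd_cat) proj_fg"
proof (intro hom_ideal.intro hom_ideal_axioms.intro, unfold torsionless_cat_def module_cat_simps)
  show "preadditive (module_cat D {M :: ('d, 'v) module. M \<in> fg_modules D \<and> torsionless D M})"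
    by (rule module_cat_preadditive) (simp add: fg_modules_def)
next
  fix X Y :: "('d, 'v) module" and j
  assume X: "X \<in> {M \<in> fg_modules D. torsionless D M}" and Y: "Y \<in> {M \<in> fg_modules D. torsionless D M}"
  note mX = torsionless_obj(1)[OF X] and mY = torsionless_obj(1)[OF Y]
  note f = factoring_iff[OF U X Y]
  show "restrict (\<lambda>x. \<zero>\<^bsub>Y\<^esub>) (carrier X) \<in> proj_fg X Y" unfolding f by (rule dnull_zero[OF mX mY])
  assume j: "j \<in> proj_fg X Y"
  then show "j \<in> mod_hom D X Y" unfolding f dnull_def by blast
  show "restrict (\<lambda>x. j x \<oplus>\<^bsub>Y\<^esub> k x) (carrier X) \<in> proj_fg X Y" if k: "k \<in> proj_fg X Y" for k
    using dnull_add[OF mX mY] j k unfolding f by blast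
next
  fix X Y Z :: "('d, 'v) module" and j g
  assume X: "X \<in> {M \<in> fg_modules D. torsionless D M}" and Y: "Y \<in> {M \<in> fg_modules D. torsionless D M}"
    and Z: "Z \<in> {M \<in> fg_modules D. torsionless D M}" and j: "j \<in> proj_fg X Y" and g: "g \<in> mod_hom D Y Z"
  show "restrict (\<lambda>x. g (j x)) (carrier X) \<in> proj_fg X Z"
    unfolding factoring_iff[OF U X Z]
    by (rule dnull_left[OF torsionless_obj(1)[OF X] torsionless_obj(1)[OF Y] torsionless_obj(1)[OF Z]
          j[unfolded factoring_iff[OF U X Y]] g])
next
  fix X Y Z :: "('d, 'v) module" and j f
  assume X: "X \<in> {M \<in> fg_modules D. torsionless D M}" and Y: "Y \<in> {M \<in> fg_modules D. torsionless D M}"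
    and Z: "Z \<in> {M \<in> fg_modules D. torsionless D M}" and j: "j \<in> proj_fg Y Z" and f: "f \<in> mod_hom D X Y"
  show "restrict (\<lambda>x. j (f x)) (carrier X) \<in> proj_fg X Z"
    unfolding factoring_iff[OF U X Z]
    by (rule dnull_right[OF torsionless_obj(1)[OF X] torsionless_obj(1)[OF Y] torsionless_obj(1)[OF Z]
          f j[unfolded factoring_iff[OF U Y Z]]])
qed

end

subsection \<open>Morphisms in the derived category\<close>

context hereditary_noetherian
begin

definition resolution :: "('a, 'u) cpx \<Rightarrow> (int \<Rightarrow> 'u \<Rightarrow> 'u) \<Rightarrow> ('a, 'u) cpx \<Rightarrow> bool" where
  "resolution P p X \<longleftrightarrow> perfect R P \<and> X \<in> bounded_complexes R \<and> p \<in> quasi_isomorphisms R P X"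

lemma resolutionD:
  assumes "resolution P p X"
  shows "perfect R P" "P \<in> bounded_complexes R" "X \<in> bounded_complexes R" "p \<in> quasi_isomorphisms R P X"
    "p \<in> chain_maps R P X" "resolved_localisation.res (homotopy_cat R) (qW R) P (hcls R P X p) X"
    "resolution (shift i P) (shift_map i p) (shift i X)"
proof -
  show 1: "perfect R P" "X \<in> bounded_complexes R" "p \<in> quasi_isomorphisms R P X"
    using assms by (simp_all add: resolution_def)
  then show 2: "P \<in> bounded_complexes R" "p \<in> chain_maps R P X"
    by (simp_all add: perfect_def quasi_isomorphisms_def)
  show "resolved_localisation.res (homotopy_cat R) (qW R) P (hcls R P X p) X" by (rule perfect_res[OF 1])
  show "resolution (shift i P) (shift_map i p) (shift i X)"
    unfolding resolution_def using shift_perfect[OF 1(1)] shift_bc[OF 1(2)] shift_map_qis[OF 2(1) 1(2,3)] by blast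
qed

abbreviation "lam \<equiv> resolved_localisation.lam (homotopy_cat R) (qW R)"

text \<open>\<open>rho i X P p Y q g\<close> is the morphism \<open>q[i] \<circ> g \<circ> p\<^sup>-\<^sup>1 : X \<rightarrow> Y[i]\<close>.\<close>

definition rho ::
  "int \<Rightarrow> ('a, 'u) cpx \<Rightarrow> ('a, 'u) cpx \<Rightarrow> (int \<Rightarrow> 'u \<Rightarrow> 'u) \<Rightarrow> ('a, 'u) cpx \<Rightarrow> (int \<Rightarrow> 'u \<Rightarrow> 'u) \<Rightarrow> (int \<Rightarrow> 'u \<Rightarrow> 'u) \<Rightarrow>
    (('a, 'u) cpx \<times> (int \<Rightarrow> 'u \<Rightarrow> 'u) set \<times> (int \<Rightarrow> 'u \<Rightarrow> 'u) set) set"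
where
  "rho i X P p Y q g =
     lam X (shift i Y) P (hcls R P X p) (hcls R P (shift i Y) (rst P (\<lambda>n x. shift_map i q n (g n x))))"

lemma hcls_Hom: "f \<in> chain_maps R X Y \<Longrightarrow> hcls R X Y f \<in> Hom (homotopy_cat R) X Y"
  unfolding K_simps by (rule imageI)

text \<open>Two reductions: the localisation replaces morphisms out of \<open>X\<close> by homotopy
  classes of maps from \<open>P\<close> to \<open>Y[i]\<close>, and \<open>perfect_lift\<close>
  along the quasi-isomorphism \<open>q[i]\<close> replaces the target by
  \<open>Q[i]\<close>.\<close>

lemma rho_Hom:
  assumes P: "resolution P p X" and Q: "resolution Q q Y"
  shows "Hom (derived_cat R) X (shift i Y) = rho i X P p Y q ` chain_maps R P (shift i Q)"
proof -
  note PD = resolutionD[OF P] and QD = resolutionD[OF resolutionD(7)[OF Q, of i]]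
  note H = resolved_localisation.Hom_L[OF K_localisation PD(6), unfolded K_simps, OF QD(3)]
  have "hcls R P (shift i Y) ` chain_maps R P (shift i Y) =
      (\<lambda>g. hcls R P (shift i Y) (rst P (\<lambda>n x. shift_map i q n (g n x)))) ` chain_maps R P (shift i Q)"
  proof (rule Set.equalityI; rule subsetI)
    fix \<phi> assume "\<phi> \<in> hcls R P (shift i Y) ` chain_maps R P (shift i Y)"
    then obtain u where u: "\<phi> = hcls R P (shift i Y) u" "u \<in> chain_maps R P (shift i Y)" by (rule imageE)
    obtain g where "g \<in> chain_maps R P (shift i Q)"
      "hcls R P (shift i Y) (rst P (\<lambda>n x. shift_map i q n (g n x))) = hcls R P (shift i Y) u"
      using perfect_lift[OF PD(1) QD(2-4) u(2)] by blast
    then show "\<phi> \<in> (\<lambda>g. hcls R P (shift i Y) (rst P (\<lambda>n x. shift_map i q n (g n x)))) ` chain_maps R P (shift i Q)"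
      unfolding u(1) by (intro image_eqI[of _ _ g]) simp_all
  next
    fix \<phi> assume "\<phi> \<in> (\<lambda>g. hcls R P (shift i Y) (rst P (\<lambda>n x. shift_map i q n (g n x)))) ` chain_maps R P (shift i Q)"
    then obtain g where g: "\<phi> = hcls R P (shift i Y) (rst P (\<lambda>n x. shift_map i q n (g n x)))"
      "g \<in> chain_maps R P (shift i Q)" by (rule imageE)
    show "\<phi> \<in> hcls R P (shift i Y) ` chain_maps R P (shift i Y)"
      unfolding g(1) by (rule imageI[OF cm_comp[OF PD(2) g(2) QD(5)]])
  qed
  then show ?thesis unfolding derived_cat_eq H rho_def by (simp only: image_image)
qed

text \<open>Fractions over \<open>p\<close> are equal iff their numerators are homotopic, and the
  quasi-isomorphism \<open>q[i]\<close> can be cancelled on the left up to homotopy by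
  \<open>perfect_null\<close>.\<close>

lemma rho_inject:
  assumes P: "resolution P p X" and Q: "resolution Q q Y"
    and g: "g \<in> chain_maps R P (shift i Q)" and h: "h \<in> chain_maps R P (shift i Q)"
  shows "rho i X P p Y q g = rho i X P p Y q h \<longleftrightarrow> hdiff P (shift i Q) g h \<in> null_homotopic R P (shift i Q)"
proof -
  note PD = resolutionD[OF P] and QD = resolutionD[OF resolutionD(7)[OF Q, of i]]
  let ?c = "\<lambda>g. rst P (\<lambda>n x. shift_map i q n (g n x))"
  note c = cm_comp[OF PD(2) g QD(5)] cm_comp[OF PD(2) h QD(5)]
  have "rho i X P p Y q g = rho i X P p Y q h \<longleftrightarrow> hcls R P (shift i Y) (?c g) = hcls R P (shift i Y) (?c h)"
    unfolding rho_def
    by (rule resolved_localisation.lam_inject[OF K_localisation PD(6) _ hcls_Hom hcls_Hom]) (simp_all add: K_simps QD(3) c)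
  also have "\<dots> \<longleftrightarrow> hdiff P (shift i Q) g h \<in> null_homotopic R P (shift i Q)"
  proof
    assume "hdiff P (shift i Q) g h \<in> null_homotopic R P (shift i Q)"
    then have "hcls R P (shift i Q) g = hcls R P (shift i Q) h" using hcls_eq_iff[OF PD(2) QD(2) g h] by simp
    then show "hcls R P (shift i Y) (?c g) = hcls R P (shift i Y) (?c h)"
      using K_cmp[OF PD(2) QD(2,3) g QD(5)] K_cmp[OF PD(2) QD(2,3) h QD(5)] by simp
  next
    assume "hcls R P (shift i Y) (?c g) = hcls R P (shift i Y) (?c h)"
    then have n: "hdiff P (shift i Y) (?c g) (?c h) \<in> null_homotopic R P (shift i Y)"
      using hcls_eq_iff[OF PD(2) QD(3) c] by simp
    have "hdiff P (shift i Y) (?c g) (?c h) = ?c (hdiff P (shift i Q) g h)"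
    proof (rule cm_eqI[OF cm_hdiff[OF PD(2) QD(3) c] cm_comp[OF PD(2) cm_hdiff[OF PD(2) QD(2) g h] QD(5)]])
      fix n x assume x: "x \<in> carrier (part P n)"
      show "hdiff P (shift i Y) (?c g) (?c h) n x = ?c (hdiff P (shift i Q) g h) n x"
        unfolding hdiff_apply[OF x] rst_apply[OF x]
        by (rule lin_minus[OF cmD(2)[OF QD(5)] bcD(1)[OF QD(2)] bcD(1)[OF QD(3)]
              lin_closed[OF cmD(2)[OF g] x] lin_closed[OF cmD(2)[OF h] x], symmetric])
    qed
    then show "hdiff P (shift i Q) g h \<in> null_homotopic R P (shift i Q)"
      using perfect_null[OF PD(1) QD(2-4) cm_hdiff[OF PD(2) QD(2) g h]] n by simp
  qed
  finally show ?thesis .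
qed

lemma rho_zero:
  assumes P: "resolution P p X" and Q: "resolution Q q Y"
  shows "hzero (derived_cat R) X (shift i Y) = rho i X P p Y q (rst P (\<lambda>n x. \<zero>\<^bsub>part (shift i Q) n\<^esub>))"
proof -
  note PD = resolutionD[OF P] and QD = resolutionD[OF resolutionD(7)[OF Q, of i]]
  have "rst P (\<lambda>n x. shift_map i q n (rst P (\<lambda>n x. \<zero>\<^bsub>part (shift i Q) n\<^esub>) n x)) = rst P (\<lambda>n x. \<zero>\<^bsub>part (shift i Y) n\<^esub>)"
    unfolding rst_def
    by (rule ext, rule restrict_ext) (simp only: restrict_apply if_True lin_zero[OF cmD(2)[OF QD(5)] bcD(1)[OF QD(2)] bcD(1)[OF QD(3)]])
  then show ?thesis
    unfolding derived_cat_eq rho_def using resolved_localisation.lam_hzero[OF K_localisation PD(6), of "shift i Y"] QD(3)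
    by (simp only: K_simps)
qed

lemma rho_id:
  assumes P: "resolution P p X"
  shows "idn (derived_cat R) X = rho 0 X P p X p (rst P (\<lambda>n x. x))"
proof -
  note PD = resolutionD[OF P]
  have "rst P (\<lambda>n x. shift_map 0 p n (rst P (\<lambda>n x. x) n x)) = rst P p"
    unfolding rst_def shift_map_shift_map by (rule ext, rule restrict_ext) simp
  then have "rho 0 X P p X p (rst P (\<lambda>n x. x)) = lam X X P (hcls R P X p) (hcls R P X p)"
    unfolding rho_def shift_zero[OF PD(3)] cm_rst[OF PD(5)] by simp
  then show ?thesis
    unfolding derived_cat_eq using resolved_localisation.lam_idn[OF K_localisation PD(6)] by simp
qed

lemma shift_image_cmp:
  assumes "A \<in> bounded_complexes R" "B \<in> bounded_complexes R" "C \<in> bounded_complexes R"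
    "f \<in> chain_maps R A B" "g \<in> chain_maps R B C"
  shows "shift_map i ` cmp (homotopy_cat R) A B C (hcls R B C g) (hcls R A B f) =
    cmp (homotopy_cat R) (shift i A) (shift i B) (shift i C) (shift_map i ` hcls R B C g) (shift_map i ` hcls R A B f)"
proof -
  have e: "shift_map i (rst A (\<lambda>n x. g n (f n x))) = rst (shift i A) (\<lambda>n x. shift_map i g n (shift_map i f n x))"
    unfolding shift_map_rst by (rule arg_cong[of _ _ "rst (shift i A)"]) (simp add: shift_map_def)
  show ?thesis
    unfolding K_cmp[OF assms] shift_hcls[OF assms(1,2,4)] shift_hcls[OF assms(2,3,5)]
      shift_hcls[OF assms(1,3) cm_comp[OF assms(1,4,5)]] e
    by (rule K_cmp[OF shift_bc[OF assms(1)] shift_bc[OF assms(2)] shift_bc[OF assms(3)]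
          shift_map_cm[OF assms(1,2,4)] shift_map_cm[OF assms(2,3,5)], symmetric])
qed

text \<open>\<open>derived_shift_map\<close> shifts all roofs of a class at once. Since the shift by
  -i is a strict inverse, \<open>lam_image\<close> says that the result is again a full class, the
  one over the shifted resolution.\<close>

lemma shift_lam:
  fixes P X Y :: "('a, 'u) cpx"
  assumes P: "resolution P p X" and Y: "Y \<in> bounded_complexes R" and g: "g \<in> chain_maps R P Y"
  shows "derived_shift_map i (lam X Y P (hcls R P X p) (hcls R P Y g)) =
    lam (shift i X) (shift i Y) (shift i P) (hcls R (shift i P) (shift i X) (shift_map i p))
      (hcls R (shift i P) (shift i Y) (shift_map i g))"
proof -
  note PD = resolutionD[OF P] and SP = resolutionD[OF resolutionD(7)[OF P, of i]]
  have H: "shift_map j ` f \<in> Hom (homotopy_cat R) (shift j A) (shift j B)"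
    if A: "A \<in> bounded_complexes R" "B \<in> bounded_complexes R" and f: "f \<in> Hom (homotopy_cat R) A B"
    for A B :: "('a, 'u) cpx" and f j
  proof -
    obtain f0 where f0: "f = hcls R A B f0" "f0 \<in> chain_maps R A B" using f unfolding K_simps by (rule imageE)
    show ?thesis unfolding f0(1) shift_hcls[OF A f0(2)] by (rule hcls_Hom[OF shift_map_cm[OF A f0(2)]])
  qed
  have W: "shift_map j ` f \<in> qW R (shift j A) (shift j B)"
    if A: "A \<in> bounded_complexes R" "B \<in> bounded_complexes R" and f: "f \<in> qW R A B" for A B :: "('a, 'u) cpx" and f j
  proof -
    obtain f0 where f0: "f0 \<in> quasi_isomorphisms R A B" "f0 \<in> chain_maps R A B" "f = hcls R A B f0" by (rule qWE[OF f A]) blast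
    show ?thesis
      unfolding f0(3) shift_hcls[OF A f0(2)] hcls_qW[OF shift_bc[OF A(1)] shift_bc[OF A(2)] shift_map_cm[OF A f0(2)]]
      by (rule shift_map_qis[OF A f0(1)])
  qed
  have C: "shift_map j ` cmp (homotopy_cat R) A B C g f =
      cmp (homotopy_cat R) (shift j A) (shift j B) (shift j C) (shift_map j ` g) (shift_map j ` f)"
    if A: "A \<in> bounded_complexes R" "B \<in> bounded_complexes R" "C \<in> bounded_complexes R"
      and f: "f \<in> Hom (homotopy_cat R) A B" and g: "g \<in> Hom (homotopy_cat R) B C" for A B C :: "('a, 'u) cpx" and f g j
  proof -
    obtain f0 where f0: "f = hcls R A B f0" "f0 \<in> chain_maps R A B" using f unfolding K_simps by (rule imageE)
    obtain g0 where g0: "g = hcls R B C g0" "g0 \<in> chain_maps R B C" using g unfolding K_simps by (rule imageE)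
    show ?thesis unfolding f0(1) g0(1) by (rule shift_image_cmp[OF A f0(2) g0(2)])
  qed
  have sp: "shift_map i ` hcls R P X p = hcls R (shift i P) (shift i X) (shift_map i p)"
    by (rule shift_hcls[OF PD(2,3,5)])
  have inv: "shift_map (i :: int) ` (shift_map (- i) ` f) = f" "shift_map (- i) ` (shift_map i ` f) = f"
    for f :: "(int \<Rightarrow> 'u \<Rightarrow> 'u) set" and i
    by (simp_all add: image_image)
  show ?thesis
    unfolding derived_shift_map_def sp[symmetric] shift_hcls[OF PD(2) Y g, symmetric]
    by (rule resolved_localisation.lam_image[OF K_localisation PD(6) _ _ _ hcls_Hom[OF g],
          where ?T0.0 = "shift (- i)" and ?T1.0 = "image (shift_map (- i))", unfolded K_simps(1)])
      (rule SP(6)[folded sp] Y shift_bc[OF Y] shift_bc shift_inverse inv H W C; assumption?)+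
qed

text \<open>The shifted second factor is t[i + k] g[i] followed into from the inverse of
  \<open>q[i]\<close>, and the first ends in \<open>q[i]\<close>; the two cancel by
  \<open>lam_cmp\<close> and leave t[i + k] g[i] f after the inverse of \<open>p\<close>.\<close>

lemma rho_cmp:
  assumes P: "resolution P p X" and Q: "resolution Q q Y" and T: "resolution T t Z"
    and f: "f \<in> chain_maps R P (shift i Q)" and g: "g \<in> chain_maps R Q (shift k T)"
  shows "cmp (derived_cat R) X (shift i Y) (shift (i + k) Z) (derived_shift_map i (rho k Y Q q Z t g)) (rho i X P p Y q f) =
    rho (i + k) X P p Z t (rst P (\<lambda>n x. shift_map i g n (f n x)))"
proof -
  note PD = resolutionD[OF P] and QD = resolutionD[OF Q] and TD = resolutionD[OF T]
  note Qi = resolutionD[OF resolutionD(7)[OF Q, of i]] and Tk = resolutionD[OF resolutionD(7)[OF T, of k]]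
  note Ti = resolutionD[OF resolutionD(7)[OF T, of "i + k"]]
  have tg: "rst Q (\<lambda>n x. shift_map k t n (g n x)) \<in> chain_maps R Q (shift k Z)" by (rule cm_comp[OF QD(2) g Tk(5)])
  let ?d = "rst (shift i Q) (\<lambda>n x. shift_map (i + k) t n (shift_map i g n x))"
  have d: "shift_map i (rst Q (\<lambda>n x. shift_map k t n (g n x))) = ?d"
    unfolding shift_map_rst by (rule arg_cong[of _ _ "rst (shift i Q)"]) (simp add: shift_map_def fun_eq_iff algebra_simps)
  have dc: "?d \<in> chain_maps R (shift i Q) (shift (i + k) Z)"
    using shift_map_cm[OF QD(2) Tk(3) tg, of i] unfolding d shift_shift[OF TD(3)] .
  have e: "rst P (\<lambda>n x. ?d n (f n x)) = rst P (\<lambda>n x. shift_map (i + k) t n (rst P (\<lambda>n x. shift_map i g n (f n x)) n x))"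
    unfolding rst_def by (rule ext, rule restrict_ext) (use lin_closed[OF cmD(2)[OF f]] in simp)
  show ?thesis
    unfolding rho_def[of k] shift_lam[OF Q Tk(3) tg] d shift_shift[OF TD(3)] rho_def[of i]
      K_cmp[OF PD(2) Qi(2,3) f Qi(5), symmetric] derived_cat_eq
    unfolding rho_def[of "i + k"] e[symmetric] K_cmp[OF PD(2) Qi(2) Ti(3) f dc, symmetric]
    by (rule resolved_localisation.lam_cmp[OF K_localisation PD(6) Qi(6) _ hcls_Hom[OF f] hcls_Hom[OF dc]])
      (simp add: K_simps Ti(3))
qed

lemma cm_finsum:
  assumes X: "X \<in> bounded_complexes R" and Y: "Y \<in> bounded_complexes R" and S: "finite S"
    and g: "\<And>i. i \<in> S \<Longrightarrow> g i \<in> chain_maps R X Y"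
  shows "rst X (\<lambda>n x. \<Oplus>\<^bsub>part Y n\<^esub>i\<in>S. g i n x) \<in> chain_maps R X Y"
    "finprod (hom_group (homotopy_cat R) X Y) (\<lambda>i. hcls R X Y (g i)) S =
      hcls R X Y (rst X (\<lambda>n x. \<Oplus>\<^bsub>part Y n\<^esub>i\<in>S. g i n x))"
proof -
  interpret Y: right_module R "part Y n" for n by (rule bcD(1)[OF Y])
  interpret G: comm_group "hom_group (homotopy_cat R) X Y"
    by (rule preadditive.hom_comm_group[OF K_preadditive]) (simp_all add: K_simps X Y)
  have "rst X (\<lambda>n x. \<Oplus>\<^bsub>part Y n\<^esub>i\<in>S. g i n x) \<in> chain_maps R X Y \<and>
      finprod (hom_group (homotopy_cat R) X Y) (\<lambda>i. hcls R X Y (g i)) S =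
        hcls R X Y (rst X (\<lambda>n x. \<Oplus>\<^bsub>part Y n\<^esub>i\<in>S. g i n x))"
    using S g
  proof (induction S)
    case empty
    show ?case using cm_zero[OF X Y] by simp (simp add: hom_group_def K_simps)
  next
    case (insert j S)
    have gj: "g j \<in> chain_maps R X Y" and gS: "\<And>i. i \<in> S \<Longrightarrow> g i \<in> chain_maps R X Y" using insert.prems by simp_all
    let ?s = "rst X (\<lambda>n x. \<Oplus>\<^bsub>part Y n\<^esub>i\<in>S. g i n x)"
    have s: "?s \<in> chain_maps R X Y" and p: "finprod (hom_group (homotopy_cat R) X Y) (\<lambda>i. hcls R X Y (g i)) S = hcls R X Y ?s"
      using insert.IH[OF gS] by blast+
    have e: "rst X (\<lambda>n x. \<Oplus>\<^bsub>part Y n\<^esub>i\<in>insert j S. g i n x) = rst X (\<lambda>n x. g j n x \<oplus>\<^bsub>part Y n\<^esub> ?s n x)"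
      unfolding rst_def
    proof (rule ext, rule restrict_ext)
      fix n x assume x: "x \<in> carrier (part X n)"
      show "(\<Oplus>\<^bsub>part Y n\<^esub>i\<in>insert j S. g i n x) =
          g j n x \<oplus>\<^bsub>part Y n\<^esub> restrict (\<lambda>x. \<Oplus>\<^bsub>part Y n\<^esub>i\<in>S. g i n x) (carrier (part X n)) x"
        using x Y.M.finsum_insert[OF insert.hyps, of "\<lambda>i. g i n x" n] lin_closed[OF cmD(2)[OF gj] x] lin_closed[OF cmD(2)[OF gS] x]
        by (simp add: Pi_iff)
    qed
    have "finprod (hom_group (homotopy_cat R) X Y) (\<lambda>i. hcls R X Y (g i)) (insert j S) =
        hcls R X Y (g j) \<otimes>\<^bsub>hom_group (homotopy_cat R) X Y\<^esub> hcls R X Y ?s"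
      unfolding p[symmetric] by (rule G.finprod_insert[OF insert.hyps])
        (use hcls_Hom[OF gS] hcls_Hom[OF gj] in \<open>simp_all add: hom_group_def\<close>)
    also have "\<dots> = hcls R X Y (rst X (\<lambda>n x. g j n x \<oplus>\<^bsub>part Y n\<^esub> ?s n x))"
      using K_hadd[OF X Y gj s] by (simp add: hom_group_def)
    finally show ?case unfolding e using cm_add[OF X Y gj s] by blast
  qed
  then show "rst X (\<lambda>n x. \<Oplus>\<^bsub>part Y n\<^esub>i\<in>S. g i n x) \<in> chain_maps R X Y"
    "finprod (hom_group (homotopy_cat R) X Y) (\<lambda>i. hcls R X Y (g i)) S =
      hcls R X Y (rst X (\<lambda>n x. \<Oplus>\<^bsub>part Y n\<^esub>i\<in>S. g i n x))"
    by blast+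
qed

lemma rho_sum:
  assumes P: "resolution P p X" and Q: "resolution Q q Y" and S: "finite S"
    and g: "\<And>j. j \<in> S \<Longrightarrow> g j \<in> chain_maps R P (shift i Q)"
  shows "finprod (hom_group (derived_cat R) X (shift i Y)) (\<lambda>j. rho i X P p Y q (g j)) S =
    rho i X P p Y q (rst P (\<lambda>n x. \<Oplus>\<^bsub>part (shift i Q) n\<^esub>j\<in>S. g j n x))"
proof -
  note PD = resolutionD[OF P] and QD = resolutionD[OF resolutionD(7)[OF Q, of i]]
  have c: "rst P (\<lambda>n x. shift_map i q n (g j n x)) \<in> chain_maps R P (shift i Y)" if "j \<in> S" for j
    by (rule cm_comp[OF PD(2) g[OF that] QD(5)])
  have e: "rst P (\<lambda>n x. \<Oplus>\<^bsub>part (shift i Y) n\<^esub>j\<in>S. rst P (\<lambda>n x. shift_map i q n (g j n x)) n x) =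
      rst P (\<lambda>n x. shift_map i q n (rst P (\<lambda>n x. \<Oplus>\<^bsub>part (shift i Q) n\<^esub>j\<in>S. g j n x) n x))"
    unfolding rst_def
  proof (rule ext, rule restrict_ext)
    fix n x assume x: "x \<in> carrier (part P n)"
    have "shift_map i q n (\<Oplus>\<^bsub>part (shift i Q) n\<^esub>j\<in>S. g j n x) = (\<Oplus>\<^bsub>part (shift i Y) n\<^esub>j\<in>S. shift_map i q n (g j n x))"
      by (rule lin_finsum[OF bcD(1)[OF QD(2)] bcD(1)[OF QD(3)] cmD(2)[OF QD(5)] S lin_closed[OF cmD(2)[OF g] x]])
    then show "(\<Oplus>\<^bsub>part (shift i Y) n\<^esub>j\<in>S. restrict (\<lambda>x. shift_map i q n (g j n x)) (carrier (part P n)) x) =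
        shift_map i q n (restrict (\<lambda>x. \<Oplus>\<^bsub>part (shift i Q) n\<^esub>j\<in>S. g j n x) (carrier (part P n)) x)"
      using x by simp
  qed
  have "finprod (hom_group (derived_cat R) X (shift i Y)) (\<lambda>j. rho i X P p Y q (g j)) S =
      lam X (shift i Y) P (hcls R P X p) (finprod (hom_group (homotopy_cat R) P (shift i Y))
        (\<lambda>j. hcls R P (shift i Y) (rst P (\<lambda>n x. shift_map i q n (g j n x)))) S)"
    unfolding rho_def derived_cat_eq
    by (rule resolved_localisation.lam_finprod[OF K_localisation PD(6) _ S hcls_Hom[OF c]]) (simp_all add: K_simps QD(3))
  also have "finprod (hom_group (homotopy_cat R) P (shift i Y))
        (\<lambda>j. hcls R P (shift i Y) (rst P (\<lambda>n x. shift_map i q n (g j n x)))) S =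
      hcls R P (shift i Y) (rst P (\<lambda>n x. \<Oplus>\<^bsub>part (shift i Y) n\<^esub>j\<in>S. rst P (\<lambda>n x. shift_map i q n (g j n x)) n x))"
    by (rule cm_finsum(2)[OF PD(2) QD(3) S c])
  finally show ?thesis unfolding e unfolding rho_def .
qed

end

subsection \<open>Total modules\<close>

context hereditary_dual
begin

text \<open>A total module is specified by its projections rather than constructed, since it must be
  movable into the type \<open>'v\<close> and also recognisable in a given module. The two
  conditions on families make \<open>N\<close> the product of the parts of \<open>P\<close>, which
  is their sum as \<open>P\<close> is bounded. The sign is \<open>eps n\<close> on the part of
  degree n.\<close>

definition is_tot :: "('a, 'u) cpx \<Rightarrow> ('d, 'v) module \<Rightarrow> (int \<Rightarrow> 'v \<Rightarrow> 'u) \<Rightarrow> bool" where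
  "is_tot P N pr \<longleftrightarrow> P \<in> bounded_complexes R \<and> right_module D N \<and> (\<forall>n. lin R (base N) (part P n) (pr n)) \<and>
     (\<forall>x\<in>carrier N. \<forall>y\<in>carrier N. (\<forall>n. pr n x = pr n y) \<longrightarrow> x = y) \<and>
     (\<forall>y. (\<forall>n. y n \<in> carrier (part P n)) \<longrightarrow> (\<exists>x\<in>carrier N. \<forall>n. pr n x = y n)) \<and>
     (\<forall>n. \<forall>x\<in>carrier N. pr (n + 1) (em N x) = eps n (part P (n + 1)) (diff P n (pr n x)))"

definition assemble :: "('d, 'v) module \<Rightarrow> (int \<Rightarrow> 'v \<Rightarrow> 'u) \<Rightarrow> (int \<Rightarrow> 'u) \<Rightarrow> 'v" where
  "assemble N pr y = (SOME x. x \<in> carrier N \<and> (\<forall>n. pr n x = y n))"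

definition emb :: "('a, 'u) cpx \<Rightarrow> ('d, 'v) module \<Rightarrow> (int \<Rightarrow> 'v \<Rightarrow> 'u) \<Rightarrow> int \<Rightarrow> 'u \<Rightarrow> 'v" where
  "emb P N pr n y = assemble N pr (\<lambda>m. if m = n then y else \<zero>\<^bsub>part P m\<^esub>)"

definition cpx_range :: "('a, 'u) cpx \<Rightarrow> int set" where
  "cpx_range P = {n. carrier (part P n) \<noteq> {\<zero>\<^bsub>part P n\<^esub>}}"

lemma cpx_range_finite:
  assumes "P \<in> bounded_complexes R"
  shows "finite (cpx_range P)"
proof -
  obtain N where "\<And>n. \<bar>n\<bar> > N \<Longrightarrow> carrier (part P n) = {\<zero>\<^bsub>part P n\<^esub>}" by (rule bc_bound[OF assms], rule that)
  then have "cpx_range P \<subseteq> {- N..N}" unfolding cpx_range_def by (auto simp: abs_le_iff not_less[symmetric])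
  then show ?thesis by (rule finite_subset) simp
qed

lemma cpx_range_zero: "\<lbrakk>n \<notin> cpx_range P; x \<in> carrier (part P n)\<rbrakk> \<Longrightarrow> x = \<zero>\<^bsub>part P n\<^esub>"
  unfolding cpx_range_def by simp

context
  fixes P :: "('a, 'u) cpx" and N :: "('d, 'v) module" and pr :: "int \<Rightarrow> 'v \<Rightarrow> 'u"
  assumes tot: "is_tot P N pr"
begin

lemma tot_bc: "P \<in> bounded_complexes R"
  and tot_module: "right_module D N"
  and tot_pr: "lin R (base N) (part P n) (pr n)"
  and tot_em: "x \<in> carrier N \<Longrightarrow> pr (n + 1) (em N x) = eps n (part P (n + 1)) (diff P n (pr n x))"
  using tot by (simp_all add: is_tot_def)

lemma tot_eqI: "\<lbrakk>x \<in> carrier N; y \<in> carrier N; \<And>n. pr n x = pr n y\<rbrakk> \<Longrightarrow> x = y"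
  using tot unfolding is_tot_def by blast

lemma tot_pr_closed: "x \<in> carrier N \<Longrightarrow> pr n x \<in> carrier (part P n)"
  using lin_closed[OF tot_pr, of x] by simp

lemma assemble:
  assumes "\<And>n. y n \<in> carrier (part P n)"
  shows "assemble N pr y \<in> carrier N" "pr n (assemble N pr y) = y n"
proof -
  have "\<exists>x. x \<in> carrier N \<and> (\<forall>n. pr n x = y n)" using tot assms unfolding is_tot_def by blast
  from someI_ex[OF this] show "assemble N pr y \<in> carrier N" "pr n (assemble N pr y) = y n"
    unfolding assemble_def by blast+
qed

lemma tot_zero: "pr n \<zero>\<^bsub>N\<^esub> = \<zero>\<^bsub>part P n\<^esub>"
  using lin_zero[OF tot_pr resm_module[OF tot_module] bcD(1)[OF tot_bc]] by simp

lemma tot_add: "\<lbrakk>x \<in> carrier N; y \<in> carrier N\<rbrakk> \<Longrightarrow> pr n (x \<oplus>\<^bsub>N\<^esub> y) = pr n x \<oplus>\<^bsub>part P n\<^esub> pr n y"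
  using lin_add[OF tot_pr, of x y] by simp

lemma tot_smult: "\<lbrakk>a \<in> carrier R; x \<in> carrier N\<rbrakk> \<Longrightarrow> pr n (\<iota> a \<odot>\<^bsub>N\<^esub> x) = a \<odot>\<^bsub>part P n\<^esub> pr n x"
  using lin_smult[OF tot_pr, of a x] by simp

lemma emb:
  assumes y: "y \<in> carrier (part P n)"
  shows "emb P N pr n y \<in> carrier N" "pr m (emb P N pr n y) = (if m = n then y else \<zero>\<^bsub>part P m\<^esub>)"
proof -
  interpret P: right_module R "part P m" for m by (rule bcD(1)[OF tot_bc])
  have "(if m = n then y else \<zero>\<^bsub>part P m\<^esub>) \<in> carrier (part P m)" for m using y by simp
  from assemble[OF this] show "emb P N pr n y \<in> carrier N" "pr m (emb P N pr n y) = (if m = n then y else \<zero>\<^bsub>part P m\<^esub>)"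
    unfolding emb_def by blast+
qed

lemma tot_linI:
  assumes M: "right_module R M" and c: "\<And>x. x \<in> carrier M \<Longrightarrow> f x \<in> carrier N"
    and l: "\<And>n. lin R M (part P n) (\<lambda>x. pr n (f x))"
  shows "lin R M (base N) f"
proof -
  interpret M: right_module R M by (rule M)
  interpret N: right_module D N by (rule tot_module)
  show ?thesis
  proof (rule linI, unfold resm_simps)
    show "f x \<in> carrier N" if "x \<in> carrier M" for x by (rule c[OF that])
    show "f (x \<oplus>\<^bsub>M\<^esub> y) = f x \<oplus>\<^bsub>N\<^esub> f y" if "x \<in> carrier M" "y \<in> carrier M" for x y
      by (rule tot_eqI) (use that in \<open>simp_all add: c tot_add lin_add[OF l]\<close>)
    show "f (a \<odot>\<^bsub>M\<^esub> x) = \<iota> a \<odot>\<^bsub>N\<^esub> f x" if "a \<in> carrier R" "x \<in> carrier M" for a x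
      by (rule tot_eqI) (use that in \<open>simp_all add: c tot_smult M.smult_closed N.smult_closed i_closed lin_smult[OF l]\<close>)
  qed
qed

lemma emb_lin: "lin R (part P n) (base N) (emb P N pr n)"
proof (rule tot_linI[OF bcD(1)[OF tot_bc] emb(1)], assumption)
  fix m
  show "lin R (part P n) (part P m) (\<lambda>x. pr m (emb P N pr n x))"
  proof (cases "m = n")
    case True
    show ?thesis by (rule lin_cong[OF _ bcD(1)[OF tot_bc], of _ _ "\<lambda>x. x"]) (simp_all add: True lin_id emb(2))
  next
    case False
    show ?thesis
      by (rule lin_cong[OF lin_const_zero[OF bcD(1)[OF tot_bc]] bcD(1)[OF tot_bc]]) (simp add: False emb(2))
  qed
qed

lemma em_emb:
  assumes y: "y \<in> carrier (part P n)"
  shows "em N (emb P N pr n y) = emb P N pr (n + 1) (eps n (part P (n + 1)) (diff P n y))"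
proof (rule tot_eqI)
  interpret N: right_module D N by (rule tot_module)
  interpret P: right_module R "part P m" for m by (rule bcD(1)[OF tot_bc])
  have d: "eps n (part P (n + 1)) (diff P n y) \<in> carrier (part P (n + 1))"
    by (rule lin_closed[OF eps_lin[OF bcD(1)[OF tot_bc]] lin_closed[OF bcD(4)[OF tot_bc] y]])
  show "em N (emb P N pr n y) \<in> carrier N" by (rule N.smult_closed[OF e_closed emb(1)[OF y]])
  show "emb P N pr (n + 1) (eps n (part P (n + 1)) (diff P n y)) \<in> carrier N" by (rule emb(1)[OF d])
  fix m
  have "pr m (em N (emb P N pr n y)) = eps (m - 1) (part P m) (diff P (m - 1) (pr (m - 1) (emb P N pr n y)))"
    using tot_em[OF emb(1)[OF y], of "m - 1"] by simp
  also have "\<dots> = (if m = n + 1 then eps n (part P (n + 1)) (diff P n y) else \<zero>\<^bsub>part P m\<^esub>)"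
    using lin_zero[OF bcD(5)[OF tot_bc] bcD(1)[OF tot_bc] bcD(1)[OF tot_bc], of m] by (auto simp: emb(2)[OF y] eps_def)
  finally show "pr m (em N (emb P N pr n y)) = pr m (emb P N pr (n + 1) (eps n (part P (n + 1)) (diff P n y)))"
    unfolding emb(2)[OF d] .
qed

text \<open>\<open>T\<close> may exceed the range of \<open>P\<close>: in the proof of the
  composition formula the sum is taken over a translate of a set of degrees.\<close>

lemma tot_expand:
  assumes x: "x \<in> carrier N" and T: "finite T" "cpx_range P \<subseteq> T"
  shows "x = (\<Oplus>\<^bsub>base N\<^esub>n\<in>T. emb P N pr n (pr n x))"
proof (rule tot_eqI[OF x])
  interpret N: right_module R "base N" by (rule resm_module[OF tot_module])
  interpret P: right_module R "part P m" for m by (rule bcD(1)[OF tot_bc])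
  have c: "emb P N pr n (pr n x) \<in> carrier (base N)" for n using emb(1)[OF tot_pr_closed[OF x]] by simp
  show "(\<Oplus>\<^bsub>base N\<^esub>n\<in>T. emb P N pr n (pr n x)) \<in> carrier N"
    using N.M.finsum_closed[of "\<lambda>n. emb P N pr n (pr n x)" T] c by (simp add: Pi_iff)
  fix m
  have "pr m (\<Oplus>\<^bsub>base N\<^esub>n\<in>T. emb P N pr n (pr n x)) = (\<Oplus>\<^bsub>part P m\<^esub>n\<in>T. pr m (emb P N pr n (pr n x)))"
    by (rule lin_finsum[OF resm_module[OF tot_module] bcD(1)[OF tot_bc] tot_pr T(1) c])
  also have "\<dots> = (\<Oplus>\<^bsub>part P m\<^esub>n\<in>T. if m = n then pr m x else \<zero>\<^bsub>part P m\<^esub>)"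
    by (rule P.M.finsum_cong') (auto simp: emb(2)[OF tot_pr_closed[OF x]] tot_pr_closed[OF x])
  also have "\<dots> = pr m x"
  proof (cases "m \<in> T")
    case True
    then show ?thesis by (intro P.M.add.finprod_singleton T(1)) (simp_all add: tot_pr_closed[OF x])
  next
    case False
    then have "pr m x = \<zero>\<^bsub>part P m\<^esub>" using T(2) by (intro cpx_range_zero[OF _ tot_pr_closed[OF x]]) blast
    then have "(if m = n then pr m x else \<zero>\<^bsub>part P m\<^esub>) = \<zero>\<^bsub>part P m\<^esub>" for n by auto
    then show ?thesis using \<open>pr m x = \<zero>\<^bsub>part P m\<^esub>\<close> by simp
  qed
  finally show "pr m x = pr m (\<Oplus>\<^bsub>base N\<^esub>n\<in>T. emb P N pr n (pr n x))" by simp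
qed

lemma tot_ext:
  assumes M: "right_module R M" and f: "lin R (base N) M f" and g: "lin R (base N) M g"
    and eq: "\<And>n y. y \<in> carrier (part P n) \<Longrightarrow> f (emb P N pr n y) = g (emb P N pr n y)" and x: "x \<in> carrier N"
  shows "f x = g x"
proof -
  interpret M: right_module R M by (rule M)
  note T = cpx_range_finite[OF tot_bc]
  have c: "emb P N pr n (pr n x) \<in> carrier (base N)" for n using emb(1)[OF tot_pr_closed[OF x]] by simp
  have "f x = (\<Oplus>\<^bsub>M\<^esub>n\<in>cpx_range P. f (emb P N pr n (pr n x)))"
    by (subst tot_expand[OF x T subset_refl]) (rule lin_finsum[OF resm_module[OF tot_module] M f T c])
  also have "\<dots> = (\<Oplus>\<^bsub>M\<^esub>n\<in>cpx_range P. g (emb P N pr n (pr n x)))"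
    unfolding eq[OF tot_pr_closed[OF x]] ..
  also have "\<dots> = g x"
    by (subst (2) tot_expand[OF x T subset_refl]) (rule lin_finsum[OF resm_module[OF tot_module] M g T c, symmetric])
  finally show ?thesis .
qed

text \<open>The functionals are those of the finitely many nonzero parts, composed with the
  projections; jointly they detect every projection and hence the element.\<close>

lemma tot_tls:
  assumes P: "perfect R P"
  shows "tls R (base N)"
proof -
  have "\<forall>n. \<exists>k::nat. \<exists>g. (\<forall>j<k. lin R (part P n) (reg R) (g j)) \<and>
      (\<forall>x\<in>carrier (part P n). (\<forall>j<k. g j x = \<zero>\<^bsub>R\<^esub>) \<longrightarrow> x = \<zero>\<^bsub>part P n\<^esub>)"
    using P unfolding perfect_def tls_def by blast
  then obtain k :: "int \<Rightarrow> nat" and g where g: "\<And>n j. j < k n \<Longrightarrow> lin R (part P n) (reg R) (g n j)"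
    "\<And>n x. \<lbrakk>x \<in> carrier (part P n); \<And>j. j < k n \<Longrightarrow> g n j x = \<zero>\<^bsub>R\<^esub>\<rbrakk> \<Longrightarrow> x = \<zero>\<^bsub>part P n\<^esub>"
    by metis
  let ?J = "Sigma (cpx_range P) (\<lambda>n. {..<k n})"
  show ?thesis
  proof (rule tlI[OF resm_module[OF tot_module], of ?J "\<lambda>(n, j) x. g n j (pr n x)"])
    show "finite ?J" using cpx_range_finite[OF tot_bc] by simp
    show "lin R (base N) (reg R) ((\<lambda>(n, j) x. g n j (pr n x)) l)" if "l \<in> ?J" for l
      using that lin_comp[OF tot_pr g(1)] by auto
    fix x assume "x \<in> carrier (base N)" and z: "\<And>l. l \<in> ?J \<Longrightarrow> (\<lambda>(n, j) x. g n j (pr n x)) l x = \<zero>\<^bsub>R\<^esub>"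
    then have x: "x \<in> carrier N" by simp
    interpret N: right_module D N by (rule tot_module)
    have "pr n x = \<zero>\<^bsub>part P n\<^esub>" for n
    proof (cases "n \<in> cpx_range P")
      case True
      show ?thesis by (rule g(2)[OF tot_pr_closed[OF x]]) (use z True in auto)
    next
      case False
      then show ?thesis by (rule cpx_range_zero[OF _ tot_pr_closed[OF x]])
    qed
    then have "x = \<zero>\<^bsub>N\<^esub>" by (intro tot_eqI) (simp_all add: x tot_zero)
    then show "x = \<zero>\<^bsub>base N\<^esub>" by simp
  qed
qed

end

section \<open>Matrices and components of maps between total modules\<close>

definition matrix_map ::
  "('a, 'u) cpx \<Rightarrow> (int \<Rightarrow> 'v \<Rightarrow> 'u) \<Rightarrow> ('a, 'u) cpx \<Rightarrow> ('d, 'v) module \<Rightarrow> (int \<Rightarrow> 'v \<Rightarrow> 'u) \<Rightarrow>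
    (int \<Rightarrow> int \<Rightarrow> 'u \<Rightarrow> 'u) \<Rightarrow> 'v \<Rightarrow> 'v" where
  "matrix_map P pr Q N' pr' a x = assemble N' pr' (\<lambda>m. \<Oplus>\<^bsub>part Q m\<^esub>n\<in>cpx_range P. a n m (pr n x))"

text \<open>The diagonal of offset \<open>i\<close> in the matrix of \<open>f\<close>: in degree n,
  the entry from the part of degree n to the part of degree n + i.\<close>

definition component ::
  "('a, 'u) cpx \<Rightarrow> ('d, 'v) module \<Rightarrow> (int \<Rightarrow> 'v \<Rightarrow> 'u) \<Rightarrow> (int \<Rightarrow> 'v \<Rightarrow> 'u) \<Rightarrow> ('v \<Rightarrow> 'v) \<Rightarrow> int \<Rightarrow> int \<Rightarrow> 'u \<Rightarrow> 'u" where
  "component P N pr pr' f i = rst P (\<lambda>n y. pr' (n + i) (f (emb P N pr n y)))"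

context
  fixes P Q :: "('a, 'u) cpx" and N N' :: "('d, 'v) module" and pr pr' :: "int \<Rightarrow> 'v \<Rightarrow> 'u"
  assumes N: "is_tot P N pr" and N': "is_tot Q N' pr'"
begin

lemma matrix_map:
  assumes a: "\<And>n m. lin R (part P n) (part Q m) (a n m)"
  shows "lin R (base N) (base N') (matrix_map P pr Q N' pr' a)"
    "y \<in> carrier (part P n) \<Longrightarrow> pr' m (matrix_map P pr Q N' pr' a (emb P N pr n y)) = a n m y"
proof -
  interpret P: right_module R "part P m" for m by (rule bcD(1)[OF tot_bc[OF N]])
  interpret Q: right_module R "part Q m" for m by (rule bcD(1)[OF tot_bc[OF N']])
  note T = cpx_range_finite[OF tot_bc[OF N]]
  have al: "lin R (base N) (part Q m) (\<lambda>x. a n m (pr n x))" for n m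
    by (rule lin_comp[OF tot_pr[OF N] a])
  have sl: "lin R (base N) (part Q m) (\<lambda>x. \<Oplus>\<^bsub>part Q m\<^esub>n\<in>cpx_range P. a n m (pr n x))" for m
    by (rule lin_family_sum[OF resm_module[OF tot_module[OF N]] Q.right_module_axioms T al])
  have c: "(\<Oplus>\<^bsub>part Q m\<^esub>n\<in>cpx_range P. a n m (pr n x)) \<in> carrier (part Q m)" if "x \<in> carrier N" for x m
    using lin_closed[OF sl, of x m] that by simp
  have A: "matrix_map P pr Q N' pr' a x \<in> carrier N'"
    "pr' m (matrix_map P pr Q N' pr' a x) = (\<Oplus>\<^bsub>part Q m\<^esub>n\<in>cpx_range P. a n m (pr n x))" if "x \<in> carrier N" for x m
    unfolding matrix_map_def by (rule assemble[OF N' c[OF that]])+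
  show "lin R (base N) (base N') (matrix_map P pr Q N' pr' a)"
  proof (rule tot_linI[OF N' resm_module[OF tot_module[OF N]]])
    show "matrix_map P pr Q N' pr' a x \<in> carrier N'" if "x \<in> carrier (base N)" for x using A(1) that by simp
    show "lin R (base N) (part Q m) (\<lambda>x. pr' m (matrix_map P pr Q N' pr' a x))" for m
      by (rule lin_cong[OF sl resm_module[OF tot_module[OF N]]]) (simp add: A(2))
  qed
  assume y: "y \<in> carrier (part P n)"
  have z: "a k m \<zero>\<^bsub>part P k\<^esub> = \<zero>\<^bsub>part Q m\<^esub>" for k by (rule lin_zero[OF a bcD(1)[OF tot_bc[OF N]] bcD(1)[OF tot_bc[OF N']]])
  have "pr' m (matrix_map P pr Q N' pr' a (emb P N pr n y)) = (\<Oplus>\<^bsub>part Q m\<^esub>k\<in>cpx_range P. a k m (pr k (emb P N pr n y)))"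
    by (rule A(2)[OF emb(1)[OF N y]])
  also have "\<dots> = (\<Oplus>\<^bsub>part Q m\<^esub>k\<in>cpx_range P. if n = k then a n m y else \<zero>\<^bsub>part Q m\<^esub>)"
    by (rule Q.M.finsum_cong') (auto simp: emb(2)[OF N y] z lin_closed[OF a y])
  also have "\<dots> = a n m y"
  proof (cases "n \<in> cpx_range P")
    case True
    then show ?thesis by (intro Q.M.add.finprod_singleton T) (simp_all add: lin_closed[OF a y])
  next
    case False
    then show ?thesis using cpx_range_zero[OF False y] z by (simp cong: if_cong)
  qed
  finally show "pr' m (matrix_map P pr Q N' pr' a (emb P N pr n y)) = a n m y" .
qed

lemma component_apply: "y \<in> carrier (part P n) \<Longrightarrow> component P N pr pr' f i n y = pr' (n + i) (f (emb P N pr n y))"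
  unfolding component_def by (rule rst_apply)

text \<open>Commutation with \<open>e\<close> reads (-1)^n f d = (-1)^(n+i) d f on the entry of
  offset i in degree n. Cancelling (-1)^n leaves the factor (-1)^i, the sign in the differential of
  the shifted complex.\<close>

lemma component_cm:
  assumes f: "f \<in> mod_hom D N N'"
  shows "component P N pr pr' f i \<in> chain_maps R P (shift i Q)"
  unfolding component_def
proof (rule rst_cm[OF tot_bc[OF N]], unfold part_shift)
  note PB = tot_bc[OF N] and QB = tot_bc[OF N']
  note fD = mod_hom_lin[OF f]
  note fl = lin_res[OF tot_module[OF N] tot_module[OF N'] fD]
  show cl: "lin R (part P n) (part Q (n + i)) (\<lambda>y. pr' (n + i) (f (emb P N pr n y)))" for n
    by (rule lin_comp[OF lin_comp[OF emb_lin[OF N] fl] tot_pr[OF N']])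
  have cl1: "lin R (part P (n + 1)) (part Q (n + i + 1)) (\<lambda>y. pr' (n + i + 1) (f (emb P N pr (n + 1) y)))" for n
    by (rule lin_comp[OF lin_comp[OF emb_lin[OF N] fl] tot_pr[OF N']])
  fix n y assume y: "y \<in> carrier (part P n)"
  note dy = lin_closed[OF bcD(4)[OF PB] y]
  have fe: "f (emb P N pr n y) \<in> carrier N'" by (rule lin_closed[OF fD emb(1)[OF N y]])
  have ix: "n + 1 + i = n + i + 1" by simp
  let ?z = "pr' (n + i) (f (emb P N pr n y))"
  have dz: "diff Q (n + i) ?z \<in> carrier (part Q (n + i + 1))" by (rule lin_closed[OF bcD(4)[OF QB] tot_pr_closed[OF N' fe]])
  have c: "pr' (n + i + 1) (f (emb P N pr (n + 1) (diff P n y))) \<in> carrier (part Q (n + i + 1))" by (rule lin_closed[OF cl1 dy])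
  have "eps n (part Q (n + i + 1)) (pr' (n + i + 1) (f (emb P N pr (n + 1) (diff P n y)))) =
      pr' (n + i + 1) (f (emb P N pr (n + 1) (eps n (part P (n + 1)) (diff P n y))))"
    by (rule lin_eps[OF cl1 bcD(1)[OF PB] bcD(1)[OF QB] dy, symmetric])
  also have "\<dots> = pr' (n + i + 1) (em N' (f (emb P N pr n y)))"
    unfolding em_emb[OF N y, symmetric] lin_em_comm[OF fD emb(1)[OF N y]] ..
  also have "\<dots> = eps (n + i) (part Q (n + i + 1)) (diff Q (n + i) ?z)" by (rule tot_em[OF N' fe])
  finally have "eps n (part Q (n + i + 1)) (eps n (part Q (n + i + 1)) (pr' (n + i + 1) (f (emb P N pr (n + 1) (diff P n y))))) =
      eps n (part Q (n + i + 1)) (eps (n + i) (part Q (n + i + 1)) (diff Q (n + i) ?z))" by simp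
  then have "pr' (n + i + 1) (f (emb P N pr (n + 1) (diff P n y))) = eps i (part Q (n + i + 1)) (diff Q (n + i) ?z)"
    unfolding eps_eps[OF bcD(1)[OF QB] c] eps_eps[OF bcD(1)[OF QB] dz] by (simp add: eps_def)
  then show "pr' (n + 1 + i) (f (emb P N pr (n + 1) (diff P n y))) = diff (shift i Q) n ?z"
    unfolding diff_shift_apply[OF QB tot_pr_closed[OF N' fe]] ix .
qed

text \<open>The entry from degree n to degree m is taken from \<open>g (m - n)\<close>. For a fixed
  target degree only the finitely many nonzero parts of \<open>P\<close> contribute, so the matrix
  defines an R-linear map for any family of chain maps.\<close>

lemma component_surj:
  assumes g: "\<And>i. g i \<in> chain_maps R P (shift i Q)"
  shows "\<exists>f\<in>mod_hom D N N'. \<forall>i. component P N pr pr' f i = g i"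
proof -
  note PB = tot_bc[OF N] and QB = tot_bc[OF N']
  note mN = tot_module[OF N] and mN' = tot_module[OF N']
  interpret N': right_module D N' by (rule mN')
  define a where "a n m = g (m - n) n" for n m
  have gl: "lin R (part P n) (part Q (n + i)) (g i n)" for n i using cmD(2)[OF g[of i], of n] by simp
  have al: "lin R (part P n) (part Q m) (a n m)" for n m using gl[of n "m - n"] by (simp add: a_def)
  let ?f = "matrix_map P pr Q N' pr' a"
  note F = matrix_map[OF al]
  have Fc: "?f x \<in> carrier N'" if "x \<in> carrier N" for x using lin_closed[OF F(1), of x] that by simp
  have "?f (em N (emb P N pr n y)) = em N' (?f (emb P N pr n y))" if y: "y \<in> carrier (part P n)" for n y
  proof (rule tot_eqI[OF N'])
    note dy = lin_closed[OF bcD(4)[OF PB] y] and ey = emb(1)[OF N y]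
    note edy = lin_closed[OF eps_lin[OF bcD(1)[OF PB]] dy, of n]
    show "?f (em N (emb P N pr n y)) \<in> carrier N'" unfolding em_emb[OF N y] by (rule Fc[OF emb(1)[OF N edy]])
    show "em N' (?f (emb P N pr n y)) \<in> carrier N'" by (rule N'.smult_closed[OF e_closed Fc[OF ey]])
    fix m0 :: int
    define m where "m = m0 - 1"
    have m0: "m0 = m + 1" by (simp add: m_def)
    have ay: "a n m y \<in> carrier (part Q m)" by (rule lin_closed[OF al y])
    have day: "diff Q m (a n m y) \<in> carrier (part Q (m + 1))" by (rule lin_closed[OF bcD(4)[OF QB] ay])
    \<comment> \<open>The chain map condition for \<open>g (m - n)\<close>, in which the shifted
      differential contributes (-1)^(m-n). Together with the sign (-1)^n of the source it becomes
      (-1)^m, the sign of the target.\<close>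
    have ch: "a (n + 1) (m + 1) (diff P n y) = eps (m - n) (part Q (m + 1)) (diff Q m (a n m y))"
    proof -
      have z: "g (m - n) n y \<in> carrier (part Q (n + (m - n)))" by (rule lin_closed[OF gl y])
      have "g (m - n) (n + 1) (diff P n y) = eps (m - n) (part Q (n + 1 + (m - n))) (diff Q (n + (m - n)) (g (m - n) n y))"
        unfolding cmD(3)[OF g y] by (rule diff_shift_apply[OF QB z])
      then show ?thesis by (simp add: a_def algebra_simps)
    qed
    have "pr' (m + 1) (?f (em N (emb P N pr n y))) = a (n + 1) (m + 1) (eps n (part P (n + 1)) (diff P n y))"
      unfolding em_emb[OF N y] by (rule F(2)[OF edy])
    also have "\<dots> = eps n (part Q (m + 1)) (eps (m - n) (part Q (m + 1)) (diff Q m (a n m y)))"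
      unfolding lin_eps[OF al bcD(1)[OF PB] bcD(1)[OF QB] dy] ch ..
    also have "\<dots> = eps m (part Q (m + 1)) (diff Q m (a n m y))"
      unfolding eps_eps[OF bcD(1)[OF QB] day] by simp
    also have "\<dots> = pr' (m + 1) (em N' (?f (emb P N pr n y)))"
      unfolding tot_em[OF N' Fc[OF ey]] F(2)[OF y] ..
    finally show "pr' m0 (?f (em N (emb P N pr n y))) = pr' m0 (em N' (?f (emb P N pr n y)))" unfolding m0 .
  qed
  then have "?f (em N x) = em N' (?f x)" if "x \<in> carrier N" for x
    using tot_ext[OF N resm_module[OF mN'] lin_comp[OF em_lin[OF mN] F(1)] lin_comp[OF F(1) em_lin[OF mN']] _ that] by blast
  then have "lin D N N' ?f" unfolding lin_D_iff[OF mN mN'] using F(1) by blast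
  note f = lin_restrict[OF this mN]
  have "component P N pr pr' (restrict ?f (carrier N)) i = g i" for i
  proof (rule cm_eqI[OF component_cm[OF f] g])
    fix n y assume y: "y \<in> carrier (part P n)"
    show "component P N pr pr' (restrict ?f (carrier N)) i n y = g i n y"
    proof -
      have "a n (n + i) y = g i n y" by (simp add: a_def)
      then show ?thesis unfolding component_apply[OF y] using emb(1)[OF N y] F(2)[OF y, of "n + i"] by simp
    qed
  qed
  then show ?thesis using f by blast
qed

text \<open>The entries of offset i - 1 of an R-linear \<open>h\<close>, with their signs adjusted,
  form a homotopy for the component of offset i, and conversely such homotopies assemble to an
  \<open>h\<close>.\<close>

lemma component_null:
  assumes j: "j \<in> mod_hom D N N'"
  shows "j \<in> dnull N N' \<longleftrightarrow> (\<forall>i. component P N pr pr' j i \<in> null_homotopic R P (shift i Q))"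
proof
  note PB = tot_bc[OF N] and QB = tot_bc[OF N']
  note mN = tot_module[OF N] and mN' = tot_module[OF N']
  interpret N: right_module D N by (rule mN)
  interpret N': right_module D N' by (rule mN')
  interpret Q: right_module R "part Q m" for m by (rule bcD(1)[OF QB])
  {
    assume "j \<in> dnull N N'"
    then obtain h where h: "lin R (base N) (base N') h"
      and jh: "\<And>x. x \<in> carrier N \<Longrightarrow> j x = h (em N x) \<oplus>\<^bsub>N'\<^esub> em N' (h x)" by (rule dnullE) blast
    have hc: "h x \<in> carrier N'" if "x \<in> carrier N" for x using lin_closed[OF h, of x] that by simp
    show "\<forall>i. component P N pr pr' j i \<in> null_homotopic R P (shift i Q)"
    proof
      fix i
      have cl: "lin R (part P n) (part Q m) (\<lambda>y. pr' m (h (emb P N pr n y)))" for n m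
        by (rule lin_comp[OF lin_comp[OF emb_lin[OF N] h] tot_pr[OF N']])
      \<comment> \<open>The twist by (-1)^(n-1) turns the sign (-1)^(n-1+i), with which
        \<open>e\<close> acts after \<open>h\<close>, into the sign (-1)^i of the shifted
        differential. In the other term the twist in degree n + 1 is (-1)^n and cancels the sign of
        \<open>e\<close> before \<open>h\<close>.\<close>
      let ?k = "\<lambda>n y. eps (n - 1) (part Q (n - 1 + i)) (pr' (n - 1 + i) (h (emb P N pr n y)))"
      show "component P N pr pr' j i \<in> null_homotopic R P (shift i Q)"
      proof (rule nullI[OF PB component_cm[OF j], where h = ?k], unfold part_shift)
        show "lin R (part P n) (part Q (n - 1 + i)) (?k n)" for n
          by (rule lin_comp[OF cl eps_lin[OF bcD(1)[OF QB]]])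
        fix n y assume y: "y \<in> carrier (part P n)"
        note ey = emb(1)[OF N y] and dy = lin_closed[OF bcD(4)[OF PB] y]
        note edy = lin_closed[OF eps_lin[OF bcD(1)[OF PB]] dy, of n]
        let ?w = "pr' (n - 1 + i) (h (emb P N pr n y))"
        have w: "?w \<in> carrier (part Q (n - 1 + i))" by (rule lin_closed[OF cl y])
        have ix: "n - 1 + 1 + i = n + i" "n - 1 + i + 1 = n + i" "n + 1 - 1 + i = n + i" "n + 1 - 1 = n" by simp_all
        have dQ: "lin R (part Q (n - 1 + i)) (part Q (n + i)) (diff Q (n - 1 + i))" using bcD(4)[OF QB, of "n - 1 + i"] ix by simp
        note dw = lin_closed[OF dQ w]
        have ekw: "eps (n - 1) (part Q (n - 1 + i)) ?w \<in> carrier (part Q (n - 1 + i))" by (rule lin_closed[OF eps_lin[OF bcD(1)[OF QB]] w])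
        have "diff (shift i Q) (n - 1) (?k n y) = eps i (part Q (n - 1 + 1 + i)) (diff Q (n - 1 + i) (?k n y))"
          by (rule diff_shift_apply[OF QB ekw])
        also have "\<dots> = eps (i + (n - 1)) (part Q (n + i)) (diff Q (n - 1 + i) ?w)"
          unfolding ix lin_eps[OF dQ bcD(1)[OF QB] bcD(1)[OF QB] w] eps_eps[OF bcD(1)[OF QB] dw] ..
        also have "\<dots> = pr' (n + i) (em N' (h (emb P N pr n y)))"
          using tot_em[OF N' hc[OF ey], of "n - 1 + i"] unfolding ix by (simp add: algebra_simps)
        finally have 1: "diff (shift i Q) (n - 1) (?k n y) = pr' (n + i) (em N' (h (emb P N pr n y)))" .
        have "?k (n + 1) (diff P n y) = pr' (n + i) (h (em N (emb P N pr n y)))"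
          unfolding ix em_emb[OF N y] by (rule lin_eps[OF cl bcD(1)[OF PB] bcD(1)[OF QB] dy, symmetric])
        moreover have "em N (emb P N pr n y) \<in> carrier N" by (rule N.smult_closed[OF e_closed ey])
        moreover have "em N' (h (emb P N pr n y)) \<in> carrier N'" by (rule N'.smult_closed[OF e_closed hc[OF ey]])
        ultimately show "component P N pr pr' j i n y =
            diff (shift i Q) (n - 1) (?k n y) \<oplus>\<^bsub>part Q (n + i)\<^esub> ?k (n + 1) (diff P n y)"
          unfolding component_apply[OF y] jh[OF ey] 1 by (simp add: tot_add[OF N'] hc tot_pr_closed[OF N'] Q.M.a_comm)
      qed
    qed
  }
  {
    assume null: "\<forall>i. component P N pr pr' j i \<in> null_homotopic R P (shift i Q)"
    have "\<exists>k. (\<forall>n. lin R (part P n) (part Q (n - 1 + i)) (k n)) \<and>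
        (\<forall>n. \<forall>y\<in>carrier (part P n). component P N pr pr' j i n y =
          diff (shift i Q) (n - 1) (k n y) \<oplus>\<^bsub>part Q (n + i)\<^esub> k (n + 1) (diff P n y))" for i
      by (rule nullE[OF null[rule_format, of i]], unfold part_shift) blast
    then obtain k where k: "\<And>i n. lin R (part P n) (part Q (n - 1 + i)) (k i n)"
      and ck: "\<And>i n y. y \<in> carrier (part P n) \<Longrightarrow> component P N pr pr' j i n y =
          diff (shift i Q) (n - 1) (k i n y) \<oplus>\<^bsub>part Q (n + i)\<^esub> k i (n + 1) (diff P n y)"
      by metis
    \<comment> \<open>The inverse of the previous twist. The homotopy of offset i sends degree n to
      degree n - 1 + i, so the entry ending in degree m comes from i = m + 1 - n.\<close>
    define a where "a n m y = eps (n - 1) (part Q m) (k (m + 1 - n) n y)" for n m y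
    have al: "lin R (part P n) (part Q m) (a n m)" for n m
      using lin_comp[OF k[of n "m + 1 - n"] eps_lin[OF bcD(1)[OF QB]], of "n - 1"] by (simp add: a_def[abs_def])
    let ?h = "matrix_map P pr Q N' pr' a"
    note H = matrix_map[OF al]
    have Hc: "?h x \<in> carrier N'" if "x \<in> carrier N" for x using lin_closed[OF H(1), of x] that by simp
    note mR = resm_module[OF mN] and mR' = resm_module[OF mN']
    have rl: "lin R (base N) (base N') (\<lambda>x. ?h (em N x) \<oplus>\<^bsub>N'\<^esub> em N' (?h x))"
      using lin_sum[OF mR mR' lin_comp[OF em_lin[OF mN] H(1)] lin_comp[OF H(1) em_lin[OF mN']]] by simp
    have "j (emb P N pr n y) = ?h (em N (emb P N pr n y)) \<oplus>\<^bsub>N'\<^esub> em N' (?h (emb P N pr n y))"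
      if y: "y \<in> carrier (part P n)" for n y
    proof (rule tot_eqI[OF N'])
      note ey = emb(1)[OF N y] and dy = lin_closed[OF bcD(4)[OF PB] y]
      note edy = lin_closed[OF eps_lin[OF bcD(1)[OF PB]] dy, of n]
      have c1: "?h (em N (emb P N pr n y)) \<in> carrier N'" unfolding em_emb[OF N y] by (rule Hc[OF emb(1)[OF N edy]])
      have c2: "em N' (?h (emb P N pr n y)) \<in> carrier N'" by (rule N'.smult_closed[OF e_closed Hc[OF ey]])
      show "j (emb P N pr n y) \<in> carrier N'" by (rule mh_closed[OF j ey])
      show "?h (em N (emb P N pr n y)) \<oplus>\<^bsub>N'\<^esub> em N' (?h (emb P N pr n y)) \<in> carrier N'" using c1 c2 by simp
      fix m
      define i where "i = m - n"
      have m: "m = n + i" by (simp add: i_def)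
      have ix: "n - 1 + 1 + i = n + i" "n + i + 1 - (n + 1) = i" "n + 1 - 1 = n" "n - 1 + i + 1 = n + i"
        "n + i - n = i" by simp_all
      have kl: "lin R (part P (n + 1)) (part Q (n + i)) (k i (n + 1))" using k[of "n + 1" i] by (simp add: algebra_simps)
      have w: "k i n y \<in> carrier (part Q (n - 1 + i))" by (rule lin_closed[OF k y])
      have dQ: "lin R (part Q (n - 1 + i)) (part Q (n + i)) (diff Q (n - 1 + i))" using bcD(4)[OF QB, of "n - 1 + i"] ix by simp
      note dw = lin_closed[OF dQ w] and kdy = lin_closed[OF kl dy]
      have 1: "pr' (n + i) (?h (em N (emb P N pr n y))) = k i (n + 1) (diff P n y)"
      proof -
        have "pr' (n + i) (?h (em N (emb P N pr n y))) = a (n + 1) (n + i) (eps n (part P (n + 1)) (diff P n y))"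
          unfolding em_emb[OF N y] by (rule H(2)[OF edy])
        also have "\<dots> = eps n (part Q (n + i)) (eps n (part Q (n + i)) (k i (n + 1) (diff P n y)))"
          unfolding a_def ix lin_eps[OF kl bcD(1)[OF PB] bcD(1)[OF QB] dy] ..
        also have "\<dots> = k i (n + 1) (diff P n y)" unfolding eps_eps[OF bcD(1)[OF QB] kdy] by (simp add: eps_def)
        finally show ?thesis .
      qed
      have 2: "pr' (n + i) (em N' (?h (emb P N pr n y))) = diff (shift i Q) (n - 1) (k i n y)"
      proof -
        have "pr' (n + i) (em N' (?h (emb P N pr n y))) =
            eps (n - 1 + i) (part Q (n + i)) (diff Q (n - 1 + i) (a n (n - 1 + i) y))"
          using tot_em[OF N' Hc[OF ey], of "n - 1 + i"] unfolding ix H(2)[OF y] .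
        also have "\<dots> = eps (n - 1 + i + (n - 1)) (part Q (n + i)) (diff Q (n - 1 + i) (k i n y))"
          unfolding a_def ix lin_eps[OF dQ bcD(1)[OF QB] bcD(1)[OF QB] w] eps_eps[OF bcD(1)[OF QB] dw] ..
        also have "\<dots> = eps i (part Q (n - 1 + 1 + i)) (diff Q (n - 1 + i) (k i n y))" unfolding ix by (simp add: eps_def)
        also have "\<dots> = diff (shift i Q) (n - 1) (k i n y)" by (rule diff_shift_apply[OF QB w, symmetric])
        finally show ?thesis .
      qed
      have c: "diff (shift i Q) (n - 1) (k i n y) \<in> carrier (part Q (n + i))"
        unfolding 2[symmetric] by (rule tot_pr_closed[OF N' c2])
      show "pr' m (j (emb P N pr n y)) = pr' m (?h (em N (emb P N pr n y)) \<oplus>\<^bsub>N'\<^esub> em N' (?h (emb P N pr n y)))"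
        using ck[OF y, of i] unfolding m tot_add[OF N' c1 c2] 1 2 component_apply[OF y]
        by (simp add: Q.M.a_comm c kdy)
    qed
    then have "j x = ?h (em N x) \<oplus>\<^bsub>N'\<^esub> em N' (?h x)" if "x \<in> carrier N" for x
      using tot_ext[OF N mR' lin_res[OF mN mN' mod_hom_lin[OF j]] rl _ that] by blast
    then show "j \<in> dnull N N'" by (rule dnullI[OF j H(1)])
  }
qed

end

section \<open>Existence and uniqueness of total modules\<close>

definition family_module :: "('a, 'u) cpx \<Rightarrow> ('a, int \<Rightarrow> 'u) module" where
  "family_module P = \<lparr>carrier = {x. \<forall>n. x n \<in> carrier (part P n)}, mult = undefined, one = undefined,
     zero = (\<lambda>n. \<zero>\<^bsub>part P n\<^esub>), add = (\<lambda>x y n. x n \<oplus>\<^bsub>part P n\<^esub> y n), smult = (\<lambda>a x n. a \<odot>\<^bsub>part P n\<^esub> x n)\<rparr>"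

text \<open>Full families of elements serve as a model: for a bounded complex product and sum
  coincide, so no support condition is imposed. The component of degree n of the image under
  \<open>e\<close> comes from degree n - 1, hence the sign (-1)^(n-1).\<close>

lemma family_module_tot:
  assumes P: "P \<in> bounded_complexes R"
  shows "is_tot P (mkD (family_module P) (\<lambda>x n. eps (n - 1) (part P n) (diff P (n - 1) (x (n - 1))))) (\<lambda>n x. x n)"
proof -
  interpret P: right_module R "part P m" for m by (rule bcD(1)[OF P])
  let ?M = "family_module P"
  let ?d = "\<lambda>x n. eps (n - 1) (part P n) (diff P (n - 1) (x (n - 1)))"
  note Ms = family_module_def partial_object.simps ring.simps monoid.simps module.simps mem_Collect_eq
  note dl = lin_comp[OF bcD(5)[OF P] eps_lin[OF bcD(1)[OF P]]]
  have "abelian_group ?M"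
  proof (rule abelian_groupI; unfold Ms)
    fix x assume x: "\<forall>n. x n \<in> carrier (part P n)"
    show "\<exists>y\<in>{x. \<forall>n. x n \<in> carrier (part P n)}. (\<lambda>n. y n \<oplus>\<^bsub>part P n\<^esub> x n) = (\<lambda>n. \<zero>\<^bsub>part P n\<^esub>)"
      by (rule bexI[of _ "\<lambda>n. \<ominus>\<^bsub>part P n\<^esub> x n"]) (simp_all add: x P.M.l_neg)
  qed (simp_all add: P.M.a_ac)
  then have M: "right_module R ?M"
    by (intro right_module.intro right_module_axioms.intro ring_R; unfold Ms)
      (simp_all add: P.smult_closed P.smult_scalar_distr P.smult_vector_distr P.smult_assoc P.smult_one)
  have d: "lin R ?M ?M ?d"
    by (rule linI; unfold Ms) (simp_all add: lin_closed[OF dl] lin_add[OF dl] lin_smult[OF dl])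
  have dd: "?d (?d x) = \<zero>\<^bsub>?M\<^esub>" if "x \<in> carrier ?M" for x
  proof -
    have x: "x n \<in> carrier (part P n)" for n using that by (simp add: family_module_def)
    have "?d (?d x) n = \<zero>\<^bsub>part P n\<^esub>" for n
    proof -
      let ?y = "diff P (n - 2) (x (n - 2))"
      have dx: "?y \<in> carrier (part P (n - 1))" using lin_closed[OF bcD(4)[OF P] x, of "n - 2"] by simp
      have ddx: "diff P (n - 1) ?y = \<zero>\<^bsub>part P n\<^esub>" using bcD(6)[OF P x, of "n - 2"] by simp
      have "?d (?d x) n = eps (n - 1) (part P n) (diff P (n - 1) (eps (n - 2) (part P (n - 1)) ?y))" by simp
      also have "\<dots> = \<zero>\<^bsub>part P n\<^esub>"
        unfolding lin_eps[OF bcD(5)[OF P] bcD(1)[OF P] bcD(1)[OF P] dx] ddx by (simp add: eps_def)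
      finally show ?thesis .
    qed
    then show ?thesis unfolding Ms by (rule ext)
  qed
  show ?thesis
    unfolding is_tot_def mkD_simps(1)
  proof (intro conjI allI ballI impI P mkD_module[OF M d dd])
    show "lin R (base (mkD ?M ?d)) (part P n) (\<lambda>x. x n)" for n
    proof (rule linI)
      fix a x assume a: "a \<in> carrier R" and "x \<in> carrier (base (mkD ?M ?d))"
      then have x: "x \<in> carrier ?M" by simp
      show "(a \<odot>\<^bsub>base (mkD ?M ?d)\<^esub> x) n = a \<odot>\<^bsub>part P n\<^esub> x n"
        unfolding mkD_resm[OF M d x a] by (simp add: family_module_def)
    qed (simp_all add: family_module_def)
    show "\<exists>x\<in>carrier ?M. \<forall>n. x n = y n" if "\<forall>n. y n \<in> carrier (part P n)" for y
      using that by (intro bexI[of _ y]) (simp_all add: family_module_def)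
    show "em (mkD ?M ?d) x (n + 1) = eps n (part P (n + 1)) (diff P n (x n))" if "x \<in> carrier ?M" for x n
      unfolding mkD_em[OF M d that] by simp
  qed auto
qed

lemma tot_transport:
  assumes t: "is_tot P N pr" and N': "right_module D N'" and \<phi>: "lin D N N' \<phi>"
    and bij: "bij_betw \<phi> (carrier N) (carrier N')"
  shows "\<exists>pr'. is_tot P N' pr'"
proof -
  note N = tot_module[OF t]
  obtain \<psi> where \<psi>: "lin D N' N \<psi>" and inv: "\<And>x. x \<in> carrier N \<Longrightarrow> \<psi> (\<phi> x) = x"
    and inv': "\<And>y. y \<in> carrier N' \<Longrightarrow> \<phi> (\<psi> y) = y"
    by (rule lin_inverse[OF N \<phi> bij]) blast
  have "is_tot P N' (\<lambda>n x. pr n (\<psi> x))"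
    unfolding is_tot_def
  proof (intro conjI allI ballI impI tot_bc[OF t] N')
    show "lin R (base N') (part P n) (\<lambda>x. pr n (\<psi> x))" for n
      by (rule lin_comp[OF lin_res[OF N' N \<psi>] tot_pr[OF t]])
    show "x = y" if x: "x \<in> carrier N'" and y: "y \<in> carrier N'" and eq: "\<forall>n. pr n (\<psi> x) = pr n (\<psi> y)" for x y
    proof -
      have "\<psi> x = \<psi> y" by (rule tot_eqI[OF t lin_closed[OF \<psi> x] lin_closed[OF \<psi> y]]) (simp add: eq)
      then have "\<phi> (\<psi> x) = \<phi> (\<psi> y)" by simp
      then show ?thesis unfolding inv'[OF x] inv'[OF y] .
    qed
    show "\<exists>x\<in>carrier N'. \<forall>n. pr n (\<psi> x) = y n" if y: "\<forall>n. y n \<in> carrier (part P n)" for y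
    proof -
      have yc: "\<And>n. y n \<in> carrier (part P n)" using y by blast
      note A = assemble[OF t yc]
      show ?thesis
        by (rule bexI[of _ "\<phi> (assemble N pr y)"]) (simp_all add: inv[OF A(1)] A(2) lin_closed[OF \<phi> A(1)])
    qed
    show "pr (n + 1) (\<psi> (em N' x)) = eps n (part P (n + 1)) (diff P n (pr n (\<psi> x)))" if x: "x \<in> carrier N'" for n x
      unfolding lin_em_comm[OF \<psi> x] by (rule tot_em[OF t lin_closed[OF \<psi> x]])
  qed
  then show ?thesis by blast
qed

lemma tot_obj:
  assumes t: "is_tot P N pr" and P: "perfect R P"
  shows "fin_gen D N" "torsionless D N"
  using tls_fin_gen_D[OF tot_module[OF t] tl_fin_gen[OF tot_tls[OF t P]]] torsionless_iff[OF tot_module[OF t]] tot_tls[OF t P]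
  by simp_all

lemma tot_exists:
  assumes U: "large_universe D TYPE('v)" and P: "perfect R P"
  shows "\<exists>N :: ('d, 'v) module. \<exists>pr. is_tot P N pr \<and> N \<in> {M \<in> fg_modules D. torsionless D M}"
proof -
  have PB: "P \<in> bounded_complexes R" using P by (simp add: perfect_def)
  note t = family_module_tot[OF PB]
  obtain N :: "('d, 'v) module" and \<phi> where N: "N \<in> fg_modules D"
    and \<phi>: "\<phi> \<in> mod_hom D (mkD (family_module P) (\<lambda>x n. eps (n - 1) (part P n) (diff P (n - 1) (x (n - 1))))) N"
    and bij: "bij_betw \<phi> (carrier (mkD (family_module P) (\<lambda>x n. eps (n - 1) (part P n) (diff P (n - 1) (x (n - 1)))))) (carrier N)"
    using fin_gen_in_large_universe[OF tot_module[OF t] tot_obj(1)[OF t P] U] by blast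
  have mN: "right_module D N" using N by (simp add: fg_modules_def)
  obtain pr' where t': "is_tot P N pr'" using tot_transport[OF t mN mod_hom_lin[OF \<phi>] bij] by blast
  show ?thesis using t' N tot_obj(2)[OF t' P] by blast
qed

text \<open>The projections of x form an admissible family for \<open>N'\<close>, so they assemble
  to an element there. Compatibility with \<open>e\<close> holds because both projections satisfy
  the same formula.\<close>

lemma tot_iso:
  assumes t: "is_tot P N pr" and t': "is_tot P N' pr'"
  shows "\<exists>f\<in>mod_hom D N N'. \<forall>x\<in>carrier N. \<forall>n. pr' n (f x) = pr n x"
proof -
  note mN = tot_module[OF t] and mN' = tot_module[OF t']
  interpret N: right_module D N by (rule mN)
  interpret N': right_module D N' by (rule mN')
  define f where "f x = assemble N' pr' (\<lambda>n. pr n x)" for x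
  have f: "f x \<in> carrier N'" "pr' n (f x) = pr n x" if "x \<in> carrier N" for x n
    unfolding f_def by (rule assemble[OF t' tot_pr_closed[OF t that]])+
  have "lin R (base N) (base N') f"
  proof (rule tot_linI[OF t' resm_module[OF mN]])
    show "f x \<in> carrier N'" if "x \<in> carrier (base N)" for x using f(1) that by simp
    show "lin R (base N) (part P n) (\<lambda>x. pr' n (f x))" for n
      by (rule lin_cong[OF tot_pr[OF t] resm_module[OF mN]]) (simp add: f(2))
  qed
  moreover have "f (em N x) = em N' (f x)" if x: "x \<in> carrier N" for x
  proof (rule tot_eqI[OF t'])
    have ex: "em N x \<in> carrier N" by (rule N.smult_closed[OF e_closed x])
    show "f (em N x) \<in> carrier N'" by (rule f(1)[OF ex])
    show "em N' (f x) \<in> carrier N'" by (rule N'.smult_closed[OF e_closed f(1)[OF x]])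
    fix n
    show "pr' n (f (em N x)) = pr' n (em N' (f x))"
      using tot_em[OF t x, of "n - 1"] tot_em[OF t' f(1)[OF x], of "n - 1"] by (simp add: f(2)[OF ex] f(2)[OF x])
  qed
  ultimately have "lin D N N' f" unfolding lin_D_iff[OF mN mN'] by blast
  from lin_restrict[OF this mN] show ?thesis by (rule bexI[rotated]) (simp add: f(2))
qed

lemma tot_is_isomorphism:
  assumes t: "is_tot P N pr" and t': "is_tot P N' pr'"
  shows "\<exists>f. is_isomorphism (torsionless_cat D) N N' f"
proof -
  obtain f where f: "f \<in> mod_hom D N N'" "\<And>x n. x \<in> carrier N \<Longrightarrow> pr' n (f x) = pr n x" using tot_iso[OF t t'] by blast
  obtain g where g: "g \<in> mod_hom D N' N" "\<And>x n. x \<in> carrier N' \<Longrightarrow> pr n (g x) = pr' n x" using tot_iso[OF t' t] by blast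
  note fc = mh_closed[OF f(1)] and gc = mh_closed[OF g(1)]
  have "g (f x) = x" if x: "x \<in> carrier N" for x
    by (rule tot_eqI[OF t gc[OF fc[OF x]] x]) (simp add: g(2)[OF fc[OF x]] f(2)[OF x])
  moreover have "f (g x) = x" if x: "x \<in> carrier N'" for x
    by (rule tot_eqI[OF t' fc[OF gc[OF x]] x]) (simp add: f(2)[OF gc[OF x]] g(2)[OF x])
  ultimately have "is_isomorphism (torsionless_cat D) N N' f"
    unfolding is_isomorphism_def torsionless_cat_def module_cat_simps
    by (intro conjI bexI[of _ g] restrict_ext f(1) g(1))
  then show ?thesis by blast
qed

text \<open>A torsionless module \<open>M\<close> is the total module of the complex \<open>im \<epsilon> \<rightarrow> ker \<epsilon>\<close> in degrees \<open>0\<close> and \<open>1\<close>: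
  since \<open>im \<epsilon>\<close> is projective over \<open>R\<close>, \<open>M\<close> splits over \<open>R\<close> as \<open>im \<epsilon> \<oplus> ker \<epsilon>\<close>.\<close>

lemma tot_surj:
  fixes M :: "('d, 'v) module"
  assumes U: "large_universe R TYPE('u)" and M: "M \<in> {M \<in> fg_modules D. torsionless D M}"
  shows "\<exists>X :: ('a, 'u) cpx. \<exists>pr. perfect R X \<and> is_tot X M pr"
proof -
  note mM = torsionless_obj(1)[OF M] and tM = torsionless_obj(2)[OF M]
  note mR = resm_module[OF mM] and el = em_lin[OF mM]
  interpret M: right_module D M by (rule mM)
  let ?B = "em M ` carrier (base M)" and ?Z = "{x \<in> carrier (base M). em M x \<in> {\<zero>\<^bsub>base M\<^esub>}}"
  have sB: "submod R (base M) ?B" by (rule submod_image[OF mR mR el])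
  have sZ: "submod R (base M) ?Z" by (rule submod_vimage[OF mR mR el submod_zero[OF mR]])
  let ?MB = "(base M)\<lparr>carrier := ?B\<rparr>" and ?MZ = "(base M)\<lparr>carrier := ?Z\<rparr>"
  obtain \<tau> where \<tau>: "lin R ?MB (base M) \<tau>" and e\<tau>: "\<And>y. y \<in> ?B \<Longrightarrow> em M (\<tau> y) = y"
    by (rule image_section[OF mR tM el]) blast
  obtain B :: "('a, 'u) module" and \<phi> \<psi> where B: "B \<in> fg_modules R" "tls R B" and \<phi>: "lin R ?MB B \<phi>" and \<psi>: "lin R B ?MB \<psi>"
    and \<psi>\<phi>: "\<And>x. x \<in> carrier ?MB \<Longrightarrow> \<psi> (\<phi> x) = x" and \<phi>\<psi>: "\<And>y. y \<in> carrier B \<Longrightarrow> \<phi> (\<psi> y) = y"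
    by (rule tls_transport[OF tl_sub[OF tM sB] U]) (rule that; assumption)
  obtain Z :: "('a, 'u) module" and \<phi>' \<psi>' where Z: "Z \<in> fg_modules R" "tls R Z" and \<phi>': "lin R ?MZ Z \<phi>'" and \<psi>': "lin R Z ?MZ \<psi>'"
    and \<psi>\<phi>': "\<And>x. x \<in> carrier ?MZ \<Longrightarrow> \<psi>' (\<phi>' x) = x" and \<phi>\<psi>': "\<And>y. y \<in> carrier Z \<Longrightarrow> \<phi>' (\<psi>' y) = y"
    by (rule tls_transport[OF tl_sub[OF tM sZ] U]) (rule that; assumption)
  have mB: "right_module R B" and mZ: "right_module R Z" using B Z by (simp_all add: fg_modules_def)
  note mMB = submod_module[OF mR sB]
  have sO: "submod R B {\<zero>\<^bsub>B\<^esub>}" by (rule submod_zero[OF mB])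
  \<comment> \<open>A zero module with elements in \<open>'u\<close>, needed to fill all degrees
    other than 0 and 1.\<close>
  define O' where "O' = B\<lparr>carrier := {\<zero>\<^bsub>B\<^esub>}\<rparr>"
  have O': "right_module R O'" "tls R O'" "carrier O' = {\<zero>\<^bsub>O'\<^esub>}"
    unfolding O'_def by (rule submod_module[OF mB sO], rule tl_sub[OF B(2) sO]) simp
  define p where "p n = (if n = (0 :: int) then B else if n = 1 then Z else O')" for n
  have pm: "right_module R (p n)" and pt: "tls R (p n)" for n using mB mZ O' B(2) Z(2) by (simp_all add: p_def)
  interpret p: right_module R "p n" for n by (rule pm)
  have p0: "p 0 = B" and p1: "p 1 = Z" and pO: "\<And>n. n \<noteq> 0 \<Longrightarrow> n \<noteq> 1 \<Longrightarrow> p n = O'" by (simp_all add: p_def)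
  have BZ: "lin R ?MB ?MZ (\<lambda>x. x)"
    by (rule linI) (auto simp: em_em[OF mM] M.smult_closed e_closed)
  \<comment> \<open>The only nonzero differential is the inclusion of the image of \<open>e\<close>
    into its kernel. It starts in degree 0, where \<open>eps\<close> is trivial, so no sign has to
    be inserted.\<close>
  define \<delta> where "\<delta> n x = (if n = (0 :: int) then \<phi>' (\<psi> x) else \<zero>\<^bsub>p (n + 1)\<^esub>)" for n x
  have \<delta>: "lin R (p n) (p (n + 1)) (\<delta> n)" for n
  proof (cases "n = 0")
    case True
    have "lin R B Z (\<lambda>x. \<phi>' (\<psi> x))" by (rule lin_comp[OF lin_comp[OF \<psi> BZ] \<phi>'])
    then show ?thesis unfolding True \<delta>_def[abs_def] using p0 p1 by simp
  next
    case False
    then show ?thesis unfolding \<delta>_def[abs_def] using lin_const_zero[OF pm] by simp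
  qed
  define X :: "('a, 'u) cpx" where "X = \<lparr>part = p, diff = (\<lambda>n. restrict (\<delta> n) (carrier (p n)))\<rparr>"
  have Xs: "part X = p" "diff X n = restrict (\<delta> n) (carrier (p n))" for n by (simp_all add: X_def)
  have XB: "X \<in> bounded_complexes R"
    unfolding bounded_complexes_def mem_Collect_eq Xs
  proof (intro conjI allI ballI)
    fix n
    show "p n \<in> fg_modules R" using pm tl_fin_gen[OF pt] by (simp add: fg_modules_def)
    show "restrict (\<delta> n) (carrier (p n)) \<in> mod_hom R (p n) (p (n + 1))" by (rule lin_restrict[OF \<delta> pm])
    fix x assume x: "x \<in> carrier (p n)"
    note dx = lin_closed[OF \<delta> x]
    have "\<delta> (n + 1) (\<delta> n x) = \<zero>\<^bsub>p (n + 2)\<^esub>"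
    proof (cases "n + 1 = 0")
      case True
      then have "\<delta> n x = \<zero>\<^bsub>p (n + 1)\<^esub>" by (simp add: \<delta>_def)
      then show ?thesis using lin_zero[OF \<delta> pm pm, of "n + 1"] by (simp add: add.commute)
    next
      case False
      then show ?thesis by (simp add: \<delta>_def add.commute)
    qed
    then show "restrict (\<delta> (n + 1)) (carrier (p (n + 1))) (restrict (\<delta> n) (carrier (p n)) x) = \<zero>\<^bsub>p (n + 2)\<^esub>"
      using x dx by simp
  next
    show "\<exists>N. \<forall>n. N < \<bar>n\<bar> \<longrightarrow> carrier (p n) = {\<zero>\<^bsub>p n\<^esub>}"
      using O'(3) by (intro exI[of _ 1]) (auto simp: p_def)
  qed
  then have perf: "perfect R X" using pt by (simp add: perfect_def Xs)
  have eB: "em M x \<in> ?B" if "x \<in> carrier M" for x using that by simp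
  have \<tau>c: "\<tau> y \<in> carrier M" if "y \<in> ?B" for y using lin_closed[OF \<tau>, of y] that by simp
  have eml: "lin R (base M) ?MB (em M)" by (rule lin_corestrict[OF el]) (rule imageI)
  note ec = M.smult_closed[OF e_closed]
  note ead = M.smult_vector_distr[OF e_closed]
  have zc: "x \<ominus>\<^bsub>base M\<^esub> \<tau> (em M x) \<in> ?Z" if x: "x \<in> carrier M" for x
  proof -
    have "em M (x \<ominus>\<^bsub>base M\<^esub> \<tau> (em M x)) = em M x \<ominus>\<^bsub>base M\<^esub> em M (\<tau> (em M x))"
      by (rule lin_minus[OF el mR mR]) (simp_all add: x \<tau>c)
    also have "\<dots> = \<zero>\<^bsub>M\<^esub>" unfolding e\<tau>[OF eB[OF x]] by (simp add: a_minus_def M.M.r_neg ec[OF x])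
    finally show ?thesis using x \<tau>c[OF eB[OF x]] by (simp add: a_minus_def)
  qed
  have zl: "lin R (base M) ?MZ (\<lambda>x. x \<ominus>\<^bsub>base M\<^esub> \<tau> (em M x))"
    by (rule lin_corestrict[OF lin_diff[OF mR mR lin_id lin_comp[OF eml \<tau>]] zc]) simp
  \<comment> \<open>The two coordinates of the splitting: x e in the image of \<open>e\<close>, and
    x minus the section applied to x e, which lies in the kernel of \<open>e\<close>.\<close>
  define q where "q n x = (if n = (0 :: int) then \<phi> (em M x) else if n = 1 then \<phi>' (x \<ominus>\<^bsub>base M\<^esub> \<tau> (em M x)) else \<zero>\<^bsub>p n\<^esub>)" for n x
  have ql: "lin R (base M) (p n) (q n)" for n
  proof -
    consider "n = 0" | "n = 1" | "n \<noteq> 0" "n \<noteq> 1" by blast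
    then show ?thesis
    proof cases
      case 1 then show ?thesis unfolding q_def[abs_def] using lin_comp[OF eml \<phi>] by (simp add: p0)
    next
      case 2 then show ?thesis unfolding q_def[abs_def] using lin_comp[OF zl \<phi>'] by (simp add: p1)
    next
      case 3 then show ?thesis unfolding q_def[abs_def] using lin_const_zero[OF pm] by simp
    qed
  qed
  have "is_tot X M q"
    unfolding is_tot_def Xs
  proof (intro conjI allI ballI impI XB mM ql)
    show "x = y" if x: "x \<in> carrier M" and y: "y \<in> carrier M" and eq: "\<forall>n. q n x = q n y" for x y
    proof -
      have "\<phi> (em M x) = \<phi> (em M y)" using eq[rule_format, of 0] by (simp add: q_def)
      then have "\<psi> (\<phi> (em M x)) = \<psi> (\<phi> (em M y))" by simp
      then have ee: "em M x = em M y" using \<psi>\<phi> eB[OF x] eB[OF y] by simp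
      have "\<phi>' (x \<ominus>\<^bsub>base M\<^esub> \<tau> (em M x)) = \<phi>' (y \<ominus>\<^bsub>base M\<^esub> \<tau> (em M y))" using eq[rule_format, of 1] by (simp add: q_def)
      then have "\<psi>' (\<phi>' (x \<ominus>\<^bsub>base M\<^esub> \<tau> (em M x))) = \<psi>' (\<phi>' (y \<ominus>\<^bsub>base M\<^esub> \<tau> (em M y)))" by simp
      then have "x \<ominus>\<^bsub>base M\<^esub> \<tau> (em M x) = y \<ominus>\<^bsub>base M\<^esub> \<tau> (em M y)"
        using \<psi>\<phi>'[unfolded sub_carrier, OF zc[OF x]] \<psi>\<phi>'[unfolded sub_carrier, OF zc[OF y]] by simp
      then show ?thesis unfolding ee using x y \<tau>c[OF eB[OF y]] by (simp add: a_minus_def)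
    qed
    show "\<exists>x\<in>carrier M. \<forall>n. q n x = y n" if y: "\<forall>n. y n \<in> carrier (p n)" for y
    proof -
      have y0: "y 0 \<in> carrier B" and y1: "y 1 \<in> carrier Z" using y[rule_format, of 0] y[rule_format, of 1] by (simp_all add: p0 p1)
      have b: "\<psi> (y 0) \<in> ?B" and z: "\<psi>' (y 1) \<in> ?Z" using lin_closed[OF \<psi> y0] lin_closed[OF \<psi>' y1] by (simp_all only: sub_carrier)
      note t = \<tau>c[OF b]
      have zM: "\<psi>' (y 1) \<in> carrier M" "em M (\<psi>' (y 1)) = \<zero>\<^bsub>M\<^esub>" using z by simp_all
      \<comment> \<open>The element with prescribed coordinates b in the image and z in the kernel
        is z plus the section of b: applying \<open>e\<close> kills z and returns b.\<close>
      let ?x = "\<psi>' (y 1) \<oplus>\<^bsub>M\<^esub> \<tau> (\<psi> (y 0))"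
      have x: "?x \<in> carrier M" using zM t by simp
      have ex: "em M ?x = \<psi> (y 0)" unfolding ead[OF zM(1) t] zM(2) e\<tau>[OF b] using ec[OF t] e\<tau>[OF b] by simp
      have xz: "?x \<ominus>\<^bsub>base M\<^esub> \<tau> (em M ?x) = \<psi>' (y 1)" unfolding ex using zM(1) t by (simp add: a_minus_def M.M.a_assoc M.M.r_neg)
      have "q n ?x = y n" for n
      proof -
        consider "n = 0" | "n = 1" | "n \<noteq> 0" "n \<noteq> 1" by blast
        then show ?thesis
        proof cases
          case 1 then show ?thesis unfolding q_def ex using \<phi>\<psi>[OF y0] by simp
        next
          case 2 then show ?thesis unfolding q_def xz using \<phi>\<psi>'[OF y1] by simp
        next
          case 3
          then have "y n = \<zero>\<^bsub>p n\<^esub>" using y[rule_format, of n] O'(3) by (simp add: pO)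
          then show ?thesis unfolding q_def using 3 by simp
        qed
      qed
      then show ?thesis using x by blast
    qed
    show "q (n + 1) (em M x) = eps n (p (n + 1)) (restrict (\<delta> n) (carrier (p n)) (q n x))" if x: "x \<in> carrier M" for n x
    proof -
      have qc: "q n x \<in> carrier (p n)" using lin_closed[OF ql, of x n] x by simp
      have ee: "em M (em M x) = \<zero>\<^bsub>M\<^esub>" by (rule em_em[OF mM x])
      have \<tau>0: "\<tau> \<zero>\<^bsub>M\<^esub> = \<zero>\<^bsub>M\<^esub>" using lin_zero[OF \<tau> mMB mR] by simp
      have n0: "\<ominus>\<^bsub>p n\<^esub> \<zero>\<^bsub>p n\<^esub> = \<zero>\<^bsub>p n\<^esub>" for n by simp
      have B0: "\<ominus>\<^bsub>B\<^esub> \<zero>\<^bsub>B\<^esub> = \<zero>\<^bsub>B\<^esub>" using n0[of 0] unfolding p0 .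
      \<comment> \<open>Compatibility with \<open>e\<close> has content in two degrees. For n = 0, x
        e lies in the kernel of \<open>e\<close>, so its degree 1 coordinate is x e itself. For n =
        -1 the degree 0 coordinate of x e is (x e) e, which is zero.\<close>
      consider "n = 0" | "n = - 1" | "n \<noteq> 0" "n \<noteq> - 1" by blast
      then show ?thesis
      proof cases
        case 1
        have "em M x \<ominus>\<^bsub>base M\<^esub> \<tau> (em M (em M x)) = em M x" unfolding ee \<tau>0 using ec[OF x] by (simp add: a_minus_def)
        moreover have "\<psi> (\<phi> (em M x)) = em M x" using \<psi>\<phi> eB[OF x] by simp
        ultimately show ?thesis using qc unfolding 1 by (simp add: q_def \<delta>_def eps_def)
      next
        case 2
        have "\<phi> \<zero>\<^bsub>M\<^esub> = \<zero>\<^bsub>B\<^esub>" using lin_zero[OF \<phi> mMB mB] by simp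
        then show ?thesis using qc B0 unfolding 2 by (simp add: q_def \<delta>_def eps_def ee p0)
      next
        case 3
        then show ?thesis using qc zc[OF x] lin_closed[OF \<phi>', unfolded sub_carrier, OF zc[OF x]] by (auto simp: q_def \<delta>_def eps_def p1 n0)
      qed
    qed
  qed
  then show ?thesis using perf by blast
qed


subsection \<open>The equivalence\<close>

text \<open>The offsets i for which a nonzero map from \<open>P\<close> to \<open>Q[i]\<close> can
  exist. The set is finite, which accounts for the finite supports in the orbit category.\<close>

definition degrees :: "('a, 'u) cpx \<Rightarrow> ('a, 'u) cpx \<Rightarrow> int set" where
  "degrees P Q = (\<lambda>(n, m). m - n) ` (cpx_range P \<times> cpx_range Q)"

lemma degrees_finite: "\<lbrakk>P \<in> bounded_complexes R; Q \<in> bounded_complexes R\<rbrakk> \<Longrightarrow> finite (degrees P Q)"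
  unfolding degrees_def using cpx_range_finite by blast

lemma chain_map_zero:
  assumes P: "P \<in> bounded_complexes R" and Q: "Q \<in> bounded_complexes R"
    and f: "f \<in> chain_maps R P (shift i Q)" and i: "i \<notin> degrees P Q"
  shows "f = rst P (\<lambda>n x. \<zero>\<^bsub>part (shift i Q) n\<^esub>)"
proof (rule cm_eqI[OF f cm_zero[OF P shift_bc[OF Q]]])
  fix n x assume x: "x \<in> carrier (part P n)"
  have fx: "f n x \<in> carrier (part Q (n + i))" using lin_closed[OF cmD(2)[OF f] x] by simp
  have "f n x = \<zero>\<^bsub>part Q (n + i)\<^esub>"
  proof (cases "n \<in> cpx_range P")
    case True
    have "n + i \<notin> cpx_range Q"
    proof
      assume "n + i \<in> cpx_range Q"
      with True have "(\<lambda>(n, m). m - n) (n, n + i) \<in> degrees P Q" unfolding degrees_def by (intro imageI) simp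
      with i show False by simp
    qed
    then show ?thesis by (rule cpx_range_zero[OF _ fx])
  next
    case False
    then have "x = \<zero>\<^bsub>part P n\<^esub>" by (rule cpx_range_zero[OF _ x])
    then show ?thesis using lin_zero[OF cmD(2)[OF f] bcD(1)[OF P] bcD(1)[OF shift_bc[OF Q]]] by simp
  qed
  then show "f n x = rst P (\<lambda>n x. \<zero>\<^bsub>part (shift i Q) n\<^esub>) n x" unfolding rst_apply[OF x] by simp
qed

lemma component_id:
  assumes t: "is_tot P N pr"
  shows "component P N pr pr (restrict (\<lambda>x. x) (carrier N)) i =
    (if i = 0 then rst P (\<lambda>n x. x) else rst P (\<lambda>n x. \<zero>\<^bsub>part (shift i P) n\<^esub>))"
proof -
  have "component P N pr pr (restrict (\<lambda>x. x) (carrier N)) i =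
      rst P (\<lambda>n y. if i = 0 then y else \<zero>\<^bsub>part P (n + i)\<^esub>)"
    unfolding component_def rst_def by (rule ext, rule restrict_ext) (simp add: emb[OF t])
  then show ?thesis by simp
qed

lemma component_minus:
  assumes t: "is_tot P N pr" and t': "is_tot Q N' pr'" and f: "f \<in> mod_hom D N N'" and g: "g \<in> mod_hom D N N'"
  shows "component P N pr pr' (restrict (\<lambda>x. f x \<ominus>\<^bsub>N'\<^esub> g x) (carrier N)) i =
    hdiff P (shift i Q) (component P N pr pr' f i) (component P N pr pr' g i)"
  unfolding hdiff_def component_def[of _ _ _ _ "restrict _ _"] rst_def
proof (rule ext, rule restrict_ext)
  fix n y assume y: "y \<in> carrier (part P n)"
  note ey = emb(1)[OF t y]
  show "pr' (n + i) (restrict (\<lambda>x. f x \<ominus>\<^bsub>N'\<^esub> g x) (carrier N) (emb P N pr n y)) =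
      component P N pr pr' f i n y \<ominus>\<^bsub>part (shift i Q) n\<^esub> component P N pr pr' g i n y"
    unfolding component_apply[OF t t' y] part_shift
    using lin_minus[OF tot_pr[OF t'] resm_module[OF tot_module[OF t']] bcD(1)[OF tot_bc[OF t']], of "f (emb P N pr n y)" "g (emb P N pr n y)" "n + i"]
      ey mh_closed[OF f ey] mh_closed[OF g ey] by (simp add: a_minus_def)
qed

text \<open>Matrix multiplication arranged by diagonals: the diagonal of offset n of a product is
  the sum over i of the diagonals of offsets i and n - i. It suffices to let i run over
  \<open>degrees P Q\<close>, where \<open>f\<close> can have entries.\<close>

lemma component_comp:
  assumes t: "is_tot P N pr" and t': "is_tot Q N' pr'" and t'': "is_tot T N'' pr''"
    and f: "f \<in> mod_hom D N N'" and g: "g \<in> mod_hom D N' N''"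
  shows "component P N pr pr'' (restrict (\<lambda>x. g (f x)) (carrier N)) n =
    rst P (\<lambda>l x. \<Oplus>\<^bsub>part (shift n T) l\<^esub>i\<in>degrees P Q.
      rst P (\<lambda>l x. shift_map i (component Q N' pr' pr'' g (n - i)) l (component P N pr pr' f i l x)) l x)"
proof -
  note PB = tot_bc[OF t] and QB = tot_bc[OF t'] and TB = tot_bc[OF t'']
  note mN' = tot_module[OF t'] and mN'' = tot_module[OF t'']
  note S = degrees_finite[OF PB QB]
  interpret T: right_module R "part T m" for m by (rule bcD(1)[OF TB])
  let ?gf = "restrict (\<lambda>x. g (f x)) (carrier N)"
  have gf: "?gf \<in> mod_hom D N N''" by (rule mh_comp[OF tot_module[OF t] f g])
  note gr = lin_res[OF mN' mN'' mod_hom_lin[OF g]]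
  have c: "rst P (\<lambda>l x. shift_map i (component Q N' pr' pr'' g (n - i)) l (component P N pr pr' f i l x))
      \<in> chain_maps R P (shift n T)" for i
    using cm_comp[OF PB component_cm[OF t t' f, of i] shift_map_cm[OF QB shift_bc[OF TB] component_cm[OF t' t'' g, of "n - i"], of i]]
    unfolding shift_shift[OF TB] by simp
  show ?thesis
  proof (rule cm_eqI[OF component_cm[OF t t'' gf] cm_finsum(1)[OF PB shift_bc[OF TB] S c]], unfold part_shift)
    fix l x assume x: "x \<in> carrier (part P l)"
    note ex = emb(1)[OF t x]
    let ?z = "f (emb P N pr l x)"
    have z: "?z \<in> carrier N'" by (rule mh_closed[OF f ex])
    have gl: "lin R (part Q m) (part T (l + n)) (\<lambda>y. pr'' (l + n) (g (emb Q N' pr' m y)))" for m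
      by (rule lin_comp[OF lin_comp[OF emb_lin[OF t'] gr] tot_pr[OF t'']])
    have trm: "rst P (\<lambda>l x. shift_map i (component Q N' pr' pr'' g (n - i)) l (component P N pr pr' f i l x)) l x =
        pr'' (l + n) (g (emb Q N' pr' (l + i) (pr' (l + i) ?z)))" for i
      unfolding rst_apply[OF x] component_apply[OF t t' x] shift_map_def
        component_apply[OF t' t'' tot_pr_closed[OF t' z]] by simp
    have "pr'' (l + n) (g ?z) = (\<Oplus>\<^bsub>part T (l + n)\<^esub>i\<in>degrees P Q. pr'' (l + n) (g (emb Q N' pr' (l + i) (pr' (l + i) ?z))))"
    proof (cases "l \<in> cpx_range P")
      case True
      \<comment> \<open>For a fixed degree l in the range of \<open>P\<close>, the offsets i
        correspond to the degrees l + i, and these cover the whole range of \<open>Q\<close>; so the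
        element f(x) is the sum of its parts in these degrees.\<close>
      let ?T = "(\<lambda>i. l + i) ` degrees P Q"
      have T: "finite ?T" using S by simp
      have "cpx_range Q \<subseteq> ?T"
      proof
        fix m assume "m \<in> cpx_range Q"
        with True have "(\<lambda>(n, m). m - n) (l, m) \<in> degrees P Q" unfolding degrees_def by (intro imageI) simp
        then show "m \<in> ?T" by (intro image_eqI[of _ _ "m - l"]) simp_all
      qed
      note e = tot_expand[OF t' z T this]
      have cl: "emb Q N' pr' m (pr' m ?z) \<in> carrier (base N')" for m using emb(1)[OF t' tot_pr_closed[OF t' z]] by simp
      have "pr'' (l + n) (g ?z) = (\<Oplus>\<^bsub>part T (l + n)\<^esub>m\<in>?T. pr'' (l + n) (g (emb Q N' pr' m (pr' m ?z))))"
        by (subst e) (rule lin_finsum[OF resm_module[OF mN'] T.right_module_axioms lin_comp[OF gr tot_pr[OF t'']] T cl])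
      also have "\<dots> = (\<Oplus>\<^bsub>part T (l + n)\<^esub>i\<in>degrees P Q. pr'' (l + n) (g (emb Q N' pr' (l + i) (pr' (l + i) ?z))))"
        by (rule T.M.finsum_reindex) (use lin_closed[OF gl tot_pr_closed[OF t' z]] in \<open>auto intro: inj_onI\<close>)
      finally show ?thesis .
    next
      \<comment> \<open>If the part of degree l is zero, the degrees l + i might miss part of the
        range of \<open>Q\<close>, but then x is zero and all terms vanish.\<close>
      case False
      then have "x = \<zero>\<^bsub>part P l\<^esub>" by (rule cpx_range_zero[OF _ x])
      then have "emb P N pr l x = \<zero>\<^bsub>N\<^esub>"
        using lin_zero[OF emb_lin[OF t] bcD(1)[OF PB] resm_module[OF tot_module[OF t]]] by simp
      then have z0: "?z = \<zero>\<^bsub>N'\<^esub>" using lin_zero[OF mod_hom_lin[OF f] tot_module[OF t] mN'] by simp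
      have "g \<zero>\<^bsub>N'\<^esub> = \<zero>\<^bsub>N''\<^esub>" by (rule lin_zero[OF mod_hom_lin[OF g] mN' mN''])
      moreover have "pr'' (l + n) (g (emb Q N' pr' m \<zero>\<^bsub>part Q m\<^esub>)) = \<zero>\<^bsub>part T (l + n)\<^esub>" for m
        by (rule lin_zero[OF gl bcD(1)[OF QB] bcD(1)[OF TB]])
      ultimately show ?thesis unfolding z0 by (simp add: tot_zero[OF t'] tot_zero[OF t''])
    qed
    then show "component P N pr pr'' ?gf n l x = rst P (\<lambda>l x. \<Oplus>\<^bsub>part T (l + n)\<^esub>i\<in>degrees P Q.
        rst P (\<lambda>l x. shift_map i (component Q N' pr' pr'' g (n - i)) l (component P N pr pr' f i l x)) l x) l x"
      unfolding component_apply[OF t t'' x] rst_apply[OF x] trm[unfolded rst_apply[OF x]] using ex by simp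
  qed
qed

text \<open>The functor sends \<open>X\<close> to a total module of a chosen resolution.
  \<open>component_surj\<close> and \<open>rho_Hom\<close> make \<open>H\<close> surjective,
  \<open>rho_inject\<close>, \<open>component_null\<close> and \<open>factoring_iff\<close>
  determine its kernel, and \<open>tot_surj\<close> gives essential surjectivity.\<close>

theorem derived_orbit_stable:
  assumes UR: "large_universe R TYPE('u)" and UD: "large_universe D TYPE('v)"
  shows "equivalent_categories (derived_orbit_cat R :: (('a, 'u) cpx, _) cat)
    (stable_torsionless_cat D :: (('d, 'v) module, _) preadd_cat)"
proof -
  let ?C = "torsionless_cat D :: (('d, 'v) module, _) preadd_cat"
  let ?O = "derived_orbit_cat R :: (('a, 'u) cpx, _) cat"
  let ?B = "bounded_complexes R :: ('a, 'u) cpx set"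
  let ?M = "{M \<in> fg_modules D. torsionless D M} :: ('d, 'v) module set"
  \<comment> \<open>A perfect complex is required to be its own resolution: \<open>tot_surj\<close>
    presents \<open>M\<close> as the total module of a perfect \<open>X\<close>, and the module
    chosen for \<open>X\<close> has to be a total module of the same complex to be isomorphic to
    \<open>M\<close>.\<close>
  have "\<exists>P p N pr. resolution P p X \<and> (perfect R X \<longrightarrow> P = X) \<and> is_tot P N pr \<and> N \<in> ?M" if X: "X \<in> ?B" for X
  proof -
    have "\<exists>P p. resolution P p X \<and> (perfect R X \<longrightarrow> P = X)"
    proof (cases "perfect R X")
      case True
      then have "resolution X (rst X (\<lambda>n x. x)) X" unfolding resolution_def using X qis_id[OF X] by blast
      then show ?thesis by blast
    next
      case False
      then show ?thesis using resolution_exists[OF UR X] X unfolding resolution_def by blast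
    qed
    then obtain P p where P: "resolution P p X" "perfect R X \<longrightarrow> P = X" by blast
    then show ?thesis using tot_exists[OF UD resolutionD(1)[OF P(1)]] by blast
  qed
  then have "\<forall>X\<in>?B. \<exists>t. resolution (fst t) (fst (snd t)) X \<and> (perfect R X \<longrightarrow> fst t = X) \<and>
      is_tot (fst t) (fst (snd (snd t))) (snd (snd (snd t))) \<and> fst (snd (snd t)) \<in> ?M"
    by (simp only: split_paired_Ex fst_conv snd_conv) blast
  from bchoice[OF this] obtain F where F: "\<forall>X\<in>?B. resolution (fst (F X)) (fst (snd (F X))) X \<and> (perfect R X \<longrightarrow> fst (F X) = X) \<and>
      is_tot (fst (F X)) (fst (snd (snd (F X)))) (snd (snd (snd (F X)))) \<and> fst (snd (snd (F X))) \<in> ?M"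
    by (elim exE)
  define RP where "RP X = fst (F X)" for X
  define rp where "rp X = fst (snd (F X))" for X
  define NT where "NT X = fst (snd (snd (F X)))" for X
  define pt where "pt X = snd (snd (snd (F X)))" for X
  note F' = bspec[OF F, folded RP_def rp_def NT_def pt_def]
  have res: "resolution (RP X) (rp X) X" and self: "perfect R X \<Longrightarrow> RP X = X"
    and tot: "is_tot (RP X) (NT X) (pt X)" and obj: "NT X \<in> ?M" if "X \<in> ?B" for X
    using F'[OF that] by (blast, blast, blast, blast)
  define cp where "cp X Y = component (RP X) (NT X) (pt X) (pt Y)" for X Y
  \<comment> \<open>The family of derived morphisms attached to a linear map: its component of
    offset i, read as a morphism from \<open>X\<close> to \<open>Y[i]\<close> through the two
    resolutions.\<close>
  define H where "H X Y f i = rho i X (RP X) (rp X) Y (rp Y) (cp X Y f i)" for X Y f i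
  have O: "Obj ?O = ?B"
    unfolding derived_orbit_cat_def orbit_cat_def derived_cat_eq localisation_def by (simp add: K_simps)
  have OH: "Hom ?O X Y = {\<phi>. (\<forall>i. \<phi> i \<in> Hom (derived_cat R) X (shift i Y)) \<and>
      finite (orbit_support (derived_cat R) shift X Y \<phi>)}" for X Y
    unfolding derived_orbit_cat_def orbit_cat_def by simp
  have Oid: "idn ?O X = (\<lambda>i. if i = 0 then idn (derived_cat R) X else hzero (derived_cat R) X (shift i X))" for X
    unfolding derived_orbit_cat_def orbit_cat_def by simp
  have Ocmp: "cmp ?O X Y Z \<psi> \<phi> = (\<lambda>n. finprod (hom_group (derived_cat R) X (shift n Z))
      (\<lambda>i. cmp (derived_cat R) X (shift i Y) (shift n Z) (derived_shift_map i (\<psi> (n - i))) (\<phi> i))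
      (orbit_support (derived_cat R) shift X Y \<phi>))" for X Y Z \<psi> \<phi>
    unfolding derived_orbit_cat_def orbit_cat_def by simp
  have cpc: "cp X Y f i \<in> chain_maps R (RP X) (shift i (RP Y))"
    if "X \<in> ?B" "Y \<in> ?B" "f \<in> mod_hom D (NT X) (NT Y)" for X Y f i
    unfolding cp_def by (rule component_cm[OF tot[OF that(1)] tot[OF that(2)] that(3)])
  note RB = tot_bc[OF tot]
  have supp: "orbit_support (derived_cat R) shift X Y (H X Y f) \<subseteq> degrees (RP X) (RP Y)"
    if X: "X \<in> ?B" and Y: "Y \<in> ?B" and f: "f \<in> mod_hom D (NT X) (NT Y)" for X Y f
  proof
    fix i assume i: "i \<in> orbit_support (derived_cat R) shift X Y (H X Y f)"
    show "i \<in> degrees (RP X) (RP Y)"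
    proof (rule ccontr)
      assume "i \<notin> degrees (RP X) (RP Y)"
      from chain_map_zero[OF RB[OF X] RB[OF Y] cpc[OF X Y f] this]
      have "H X Y f i = hzero (derived_cat R) X (shift i Y)"
        unfolding H_def rho_zero[OF res[OF X] res[OF Y]] by (rule arg_cong)
      with i show False unfolding orbit_support_def by simp
    qed
  qed
  show ?thesis
    unfolding stable_torsionless_cat_def
  proof (rule hom_ideal.equivalent_to_quotientI[OF stable_hom_ideal[OF UD], where ?F0.0 = NT and H = H];
      unfold O torsionless_cat_def module_cat_simps)
    show "NT X \<in> ?M" if "X \<in> ?B" for X by (rule obj[OF that])
  next
    fix X Y assume X: "X \<in> ?B" and Y: "Y \<in> ?B"
    show "H X Y ` mod_hom D (NT X) (NT Y) = Hom ?O X Y"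
    proof (rule Set.equalityI; rule subsetI)
      fix \<phi> assume "\<phi> \<in> H X Y ` mod_hom D (NT X) (NT Y)"
      then obtain f where f: "\<phi> = H X Y f" "f \<in> mod_hom D (NT X) (NT Y)" by (rule imageE)
      have "H X Y f i \<in> Hom (derived_cat R) X (shift i Y)" for i
        unfolding H_def rho_Hom[OF res[OF X] res[OF Y]] by (rule imageI[OF cpc[OF X Y f(2)]])
      then show "\<phi> \<in> Hom ?O X Y"
        unfolding OH f(1) using finite_subset[OF supp[OF X Y f(2)] degrees_finite[OF RB[OF X] RB[OF Y]]] by blast
    next
      fix \<phi> assume "\<phi> \<in> Hom ?O X Y"
      then have "\<forall>i. \<exists>g. g \<in> chain_maps R (RP X) (shift i (RP Y)) \<and> \<phi> i = rho i X (RP X) (rp X) Y (rp Y) g"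
        unfolding OH rho_Hom[OF res[OF X] res[OF Y]] by blast
      then obtain g where g: "\<And>i. g i \<in> chain_maps R (RP X) (shift i (RP Y))"
        and \<phi>: "\<And>i. \<phi> i = rho i X (RP X) (rp X) Y (rp Y) (g i)" by metis
      obtain f where f: "f \<in> mod_hom D (NT X) (NT Y)" and "\<forall>i. cp X Y f i = g i"
        unfolding cp_def using component_surj[OF tot[OF X] tot[OF Y], of g, OF g] by blast
      then have "\<phi> = H X Y f" by (intro ext) (simp add: H_def \<phi>)
      then show "\<phi> \<in> H X Y ` mod_hom D (NT X) (NT Y)" using f by (rule image_eqI)
    qed
  next
    fix X Y f g assume X: "X \<in> ?B" and Y: "Y \<in> ?B" and f: "f \<in> mod_hom D (NT X) (NT Y)" and g: "g \<in> mod_hom D (NT X) (NT Y)"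
    note mX = tot_module[OF tot[OF X]] and mY = tot_module[OF tot[OF Y]]
    interpret NY: right_module D "NT Y" by (rule mY)
    \<comment> \<open>Both sides of the kernel condition are statements about the difference f - g:
      all its components are null-homotopic, respectively it factors through a projective.\<close>
    let ?j = "restrict (\<lambda>x. f x \<ominus>\<^bsub>NT Y\<^esub> g x) (carrier (NT X))"
    have j: "?j \<in> mod_hom D (NT X) (NT Y)"
      by (rule lin_restrict[OF lin_diff[OF mX mY mod_hom_lin[OF f] mod_hom_lin[OF g]] mX])
    have "H X Y f = H X Y g \<longleftrightarrow> (\<forall>i. H X Y f i = H X Y g i)" by (rule fun_eq_iff)
    also have "\<dots> \<longleftrightarrow> (\<forall>i. cp X Y ?j i \<in> null_homotopic R (RP X) (shift i (RP Y)))"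
      unfolding H_def rho_inject[OF res[OF X] res[OF Y] cpc[OF X Y f] cpc[OF X Y g]]
      unfolding cp_def component_minus[OF tot[OF X] tot[OF Y] f g] ..
    also have "\<dots> \<longleftrightarrow> ?j \<in> dnull (NT X) (NT Y)"
      unfolding cp_def component_null[OF tot[OF X] tot[OF Y] j] ..
    also have "\<dots> \<longleftrightarrow> (f, g) \<in> ideal_rel (module_cat D ?M) proj_fg (NT X) (NT Y)"
    proof
      have "f = restrict (\<lambda>x. g x \<oplus>\<^bsub>NT Y\<^esub> ?j x) (carrier (NT X))"
        by (rule mod_hom_eqI[OF f mh_add[OF mX mY g j]])
          (simp add: NY.M.eq_add_minus mh_closed[OF f] mh_closed[OF g])
      moreover assume "?j \<in> dnull (NT X) (NT Y)"
      ultimately show "(f, g) \<in> ideal_rel (module_cat D ?M) proj_fg (NT X) (NT Y)"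
        unfolding ideal_rel_def module_cat_simps using f g factoring_iff[OF UD obj[OF X] obj[OF Y]] by blast
    next
      assume "(f, g) \<in> ideal_rel (module_cat D ?M) proj_fg (NT X) (NT Y)"
      then obtain k where k: "k \<in> dnull (NT X) (NT Y)" and fk: "f = restrict (\<lambda>x. g x \<oplus>\<^bsub>NT Y\<^esub> k x) (carrier (NT X))"
        unfolding ideal_rel_def module_cat_simps factoring_iff[OF UD obj[OF X] obj[OF Y]] by blast
      have km: "k \<in> mod_hom D (NT X) (NT Y)" using k unfolding dnull_def by blast
      have "?j = k"
      proof (rule mod_hom_eqI[OF j km])
        fix x assume x: "x \<in> carrier (NT X)"
        have "f x = k x \<oplus>\<^bsub>NT Y\<^esub> g x"
          using fun_cong[OF fk, of x] x NY.M.a_comm[OF mh_closed[OF g x] mh_closed[OF km x]] by simp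
        from NY.M.minus_eq_if_eq_add[OF this mh_closed[OF km x] mh_closed[OF g x]] show "?j x = k x" using x by simp
      qed
      then show "?j \<in> dnull (NT X) (NT Y)" using k by simp
    qed
    finally show "H X Y f = H X Y g \<longleftrightarrow> (f, g) \<in> ideal_rel (module_cat D ?M) proj_fg (NT X) (NT Y)" .
  next
    fix X assume X: "X \<in> ?B"
    show "H X X (restrict (\<lambda>x. x) (carrier (NT X))) = idn ?O X"
    proof (rule ext)
      fix i
      show "H X X (restrict (\<lambda>x. x) (carrier (NT X))) i = idn ?O X i"
        unfolding H_def cp_def component_id[OF tot[OF X]] Oid rho_id[OF res[OF X]] rho_zero[OF res[OF X] res[OF X]]
        by simp
    qed
  next
    fix X Y Z f g assume X: "X \<in> ?B" and Y: "Y \<in> ?B" and Z: "Z \<in> ?B"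
      and f: "f \<in> mod_hom D (NT X) (NT Y)" and g: "g \<in> mod_hom D (NT Y) (NT Z)"
    let ?gf = "restrict (\<lambda>x. g (f x)) (carrier (NT X))"
    let ?S = "degrees (RP X) (RP Y)"
    note S = degrees_finite[OF RB[OF X] RB[OF Y]]
    show "H X Z ?gf = cmp ?O X Y Z (H Y Z g) (H X Y f)"
    proof (rule ext)
      fix n
      let ?G = "hom_group (derived_cat R) X (shift n Z)"
      let ?c = "\<lambda>i. cmp (derived_cat R) X (shift i Y) (shift n Z) (derived_shift_map i (H Y Z g (n - i))) (H X Y f i)"
      let ?k = "\<lambda>i u. rst (RP X) (\<lambda>l x. shift_map i (cp Y Z g (n - i)) l (u l x))"
      interpret G: comm_group ?G
        unfolding derived_cat_eq by (rule resolved_localisation.L_comm_group[OF K_localisation resolutionD(6)[OF res[OF X]]])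
          (simp add: K_simps shift_bc[OF Z])
      have kc: "?k i u \<in> chain_maps R (RP X) (shift n (RP Z))" if u: "u \<in> chain_maps R (RP X) (shift i (RP Y))" for i u
        using cm_comp[OF RB[OF X] u shift_map_cm[OF RB[OF Y] shift_bc[OF RB[OF Z]] cpc[OF Y Z g, of "n - i"], of i]]
        unfolding shift_shift[OF RB[OF Z]] by simp
      have ck: "cmp (derived_cat R) X (shift i Y) (shift n Z) (derived_shift_map i (H Y Z g (n - i)))
            (rho i X (RP X) (rp X) Y (rp Y) u) = rho n X (RP X) (rp X) Z (rp Z) (?k i u)"
        if u: "u \<in> chain_maps R (RP X) (shift i (RP Y))" for i u
        using rho_cmp[OF res[OF X] res[OF Y] res[OF Z] u cpc[OF Y Z g, of "n - i"]] unfolding H_def by simp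
      have c: "?c i = rho n X (RP X) (rp X) Z (rp Z) (?k i (cp X Y f i))" for i
        unfolding H_def[of X Y] by (rule ck[OF cpc[OF X Y f]])
      have cG: "?c i \<in> carrier ?G" for i
        unfolding c hom_group_def partial_object.simps rho_Hom[OF res[OF X] res[OF Z]]
        by (rule imageI[OF kc[OF cpc[OF X Y f]]])
      \<comment> \<open>The orbit category sums over the support of the first factor, which can be
        smaller than \<open>degrees\<close>: a nonzero component may be null-homotopic. Such a
        component equals \<open>rho\<close> of the zero map, so its contribution to the composite is
        the neutral element and the sum may be extended to all of \<open>degrees\<close>.\<close>
      have one: "?c i = \<one>\<^bsub>?G\<^esub>" if "i \<notin> orbit_support (derived_cat R) shift X Y (H X Y f)" for i
      proof -
        let ?o = "rst (RP X) (\<lambda>n x. \<zero>\<^bsub>part (shift i (RP Y)) n\<^esub>)"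
        have "H X Y f i = rho i X (RP X) (rp X) Y (rp Y) ?o"
          using that unfolding orbit_support_def rho_zero[OF res[OF X] res[OF Y], symmetric] by simp
        then have "?c i = rho n X (RP X) (rp X) Z (rp Z) (?k i ?o)"
          using ck[OF cm_zero[OF RB[OF X] shift_bc[OF RB[OF Y]]]] by simp
        also have "?k i ?o = rst (RP X) (\<lambda>l x. \<zero>\<^bsub>part (shift n (RP Z)) l\<^esub>)"
          unfolding rst_def
        proof (rule ext, rule restrict_ext)
          fix l x assume x: "x \<in> carrier (part (RP X) l)"
          have "shift_map i (cp Y Z g (n - i)) l \<zero>\<^bsub>part (shift i (RP Y)) l\<^esub> = \<zero>\<^bsub>part (shift i (shift (n - i) (RP Z))) l\<^esub>"
            by (rule lin_zero[OF cmD(2)[OF shift_map_cm[OF RB[OF Y] shift_bc[OF RB[OF Z]] cpc[OF Y Z g]]]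
                  bcD(1)[OF shift_bc[OF RB[OF Y]]] bcD(1)[OF shift_bc[OF shift_bc[OF RB[OF Z]]]]])
          then show "shift_map i (cp Y Z g (n - i)) l (restrict (\<lambda>x. \<zero>\<^bsub>part (shift i (RP Y)) l\<^esub>) (carrier (part (RP X) l)) x) =
              \<zero>\<^bsub>part (shift n (RP Z)) l\<^esub>"
            using x unfolding shift_shift[OF RB[OF Z]] by simp
        qed
        finally show ?thesis unfolding rho_zero[OF res[OF X] res[OF Z], symmetric] by (simp add: hom_group_def)
      qed
      have "cmp ?O X Y Z (H Y Z g) (H X Y f) n = finprod ?G ?c (orbit_support (derived_cat R) shift X Y (H X Y f))"
        unfolding Ocmp ..
      also have "\<dots> = finprod ?G ?c ?S"
        by (rule G.finprod_mono_neutral_cong_left[OF S supp[OF X Y f]]) (use one cG in auto)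
      also have "\<dots> = rho n X (RP X) (rp X) Z (rp Z) (rst (RP X) (\<lambda>l x. \<Oplus>\<^bsub>part (shift n (RP Z)) l\<^esub>i\<in>?S. ?k i (cp X Y f i) l x))"
        unfolding c by (rule rho_sum[OF res[OF X] res[OF Z] S kc[OF cpc[OF X Y f]]])
      also have "\<dots> = H X Z ?gf n"
        unfolding H_def cp_def component_comp[OF tot[OF X] tot[OF Y] tot[OF Z] f g] ..
      finally show "H X Z ?gf n = cmp ?O X Y Z (H Y Z g) (H X Y f) n" by (rule sym)
    qed
  next
    fix M assume M: "M \<in> ?M"
    obtain X :: "('a, 'u) cpx" and pr where X: "perfect R X" "is_tot X M pr" using tot_surj[OF UR M] by blast
    have XB: "X \<in> ?B" by (rule tot_bc[OF X(2)])
    have "is_tot X (NT X) (pt X)" using tot[OF XB] unfolding self[OF XB X(1)] .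
    from tot_is_isomorphism[OF this X(2)]
    show "\<exists>X\<in>?B. \<exists>f. is_isomorphism (module_cat D ?M) (NT X) M f"
      using XB unfolding torsionless_cat_def by blast
  qed
qed

end

text \<open>It remains to recognise \<open>dual_numbers R\<close> as a
  \<open>dual_structure\<close>. The universes \<open>'u\<close> for complexes and \<open>'v\<close>
  for modules over the dual numbers are independent of each other.\<close>

theorem theorem4p2p1:
  fixes R :: "('a, 'r) ring_scheme"
  assumes "hereditary_noetherian_domain R"
    and "large_universe R TYPE('u)"
    and "large_universe R TYPE('v)"
  shows "equivalent_categories
    (derived_orbit_cat R :: (('a, 'u) cpx, _) cat)
    (stable_torsionless_cat (dual_numbers R) :: (((nat \<Rightarrow> 'a) set, 'v) module, _) preadd_cat)"
proof -
  interpret hereditary_noetherian R by (rule hereditary_noetherian.intro[OF assms(1)])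
  obtain \<iota> e p0 p1 where ds: "dual_structure R (dual_numbers R) \<iota> e p0 p1"
    using dual_numbers_structure[OF ring_R] by (elim exE)
  interpret hereditary_dual R "dual_numbers R" \<iota> e p0 p1
    by (rule hereditary_dual.intro[OF hereditary_noetherian_axioms ds])
  show ?thesis by (rule derived_orbit_stable[OF assms(2) large_universe_dual_numbers[OF assms(3)]])
qed

end
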